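(* Let $U=U^{0}+U^{\bullet}$ be the potential function on $\mathbb{R}^p$ of a posterior distribution $\pi$, with $U^0$ the negative log-prior and $U^{\bullet}$ the negative log-likelihood, and let $\widetilde{\pi}(d\xi,d\theta)=\pi(d\xi)\otimes\upsilon(d\theta)$, where $\upsilon$ is the uniform measure on $\{-1,1\}^p$. Let $\mu_i$ $(i=1,\dots,p)$ be probability measures such that $\widehat{\partial}_i U^{\bullet}(\xi,a)$, $a\sim\mu_i$, is an unbiased estimator of the $i$-th partial derivative $\partial_i U^{\bullet}(\xi)$ of the negative log-likelihood function. Let $$m_i^{\bullet}(t,a)=\{\theta_i\,\widehat{\partial}_iU^{\bullet}(\xi+t\theta,a)\}^{+}$$ and let $M_i^{\bullet}(t)$ be such that $m_i^{\bullet}(t,a)\le M_i^{\bullet}(t)$ for all $a$ and all $t\ge0$. Similarly, let $$m_i^{0}(t)=\{\theta_i\,\partial_iU^{0}(\xi+t\theta)\}^{+}$$ and let $M_i^{0}(t)$ be such that $m_i^0(t)\le M_i^0(t)$ for all $t\ge 0$. Then the zig-zag process generated by the zig-zag algorithm with generalized sub-sampling (given in the context) preserves the target measure $\widetilde{\pi}$, and the effective bouncing rate of the generated zig-zag process is of the form $\lambda_i(\xi,\theta)=\lambda_i^{0}(\xi,\theta)+\lambda_i^{\bullet}(\xi,\theta)$, with $$\lambda_i^{0}(\xi,\theta)=\{\theta_i\,\partial_iU^{0}(\xi)\}^{+}\quad\text{and}\quad \lambda_i^{\bullet}(\xi,\theta)=E_{a\sim\mu_i}\left[\{\theta_i\,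\widehat{\partial}_iU^{\bullet}(\xi,a)\}^{+}\right].$$
   Context: Notation: $(x)^+=\max\{0,x\}$; $\partial_i$ is the $i$-th partial derivative with respect to $\xi$; $F_i:\{-1,1\}^p\to\{-1,1\}^p$ flips the sign of the $i$-th component and leaves the others unchanged. For data $(y^1,x^1),\dots,(y^n,x^n)$ and a prior density $p_0$ on $\mathbb{R}^p$, $U^0(\xi)=-\log p_0(\xi)$ and $U^{\bullet}(\xi)=\sum_{j=1}^n U^j(\xi)$ with $U^j(\xi)=-\log p(y^j\mid x^j,\xi)$ (the main application being logistic regression); the posterior $\pi$ has density proportional to $e^{-U}$. In the definitions of $m_i^\bullet$ and $m_i^0$, $(\xi,\theta)\in\mathbb{R}^p\times\{-1,1\}^p$ is the current state of the process, and the bounds $M_i^\bullet,M_i^0$ are associated with that state. Zig-zag process with bouncing rates $\lambda_1,\dots,\lambda_p$: the continuous-time process $\{\xi(t),\theta(t)\}_{t\ge0}$ on $\mathbb{R}^p\times\{-1,1\}^p$ which, from a state $(\xi,\theta)$, evolves deterministically as $\xi(t)=\xi+\theta t$, $\theta(t)=\theta$ until the random time $\tau=\min_i\tau_i$, where $\tau_1,\dots,\tau_p$ are the first arrival times of independent Poisson processes with intensities $t\mapsto\lambda_i(\xi+t\theta,\theta)$; at time $\tau$ the velocity is replaced by $F_{i_0}(\theta)$ with $i_0=\arg\min_i\tau_i$, and the construction is repeated from the new state. "Preserves $\widetilde\pi$" means that $\widetilde\pi$ is an invariant measure of the process. Zig-zag algorithm with generalized sub-sampling. Input: starting point $\xi^{(0)}\in\mathbb{R}^p$,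 initial velocity $\theta^{(0)}\in\{-1,1\}^p$, maximum number of bouncing attempts. Set $t^{(0)}=0$. At each attempt, given the current state $(\xi^{(k)},\theta^{(k)})$ at time $t^{(k)}$: 1. Draw $\widetilde\tau_i,\widehat\tau_i$ ($i=1,\dots,p$) such that $P(\widetilde\tau_i\ge t)=\exp\{-\int_0^tM_i^{\bullet}(s)\,ds\}$ and $P(\widehat\tau_i\ge t)=\exp\{-\int_0^tM_i^{0}(s)\,ds\}$. 2. Let $i_0=\arg\min_i\widetilde\tau_i$, $j_0=\arg\min_i\widehat\tau_i$, and set $\tau=\min\{\widetilde\tau_{i_0},\widehat\tau_{j_0}\}$. 3. Set $t^{(k+1)}=t^{(k)}+\tau$ and $\xi^{(k+1)}=\xi^{(k)}+\theta^{(k)}\tau$. 4. If $\widehat\tau_{j_0}<\widetilde\tau_{i_0}$, set $\theta^{(k+1)}=F_{j_0}(\theta^{(k)})$. Otherwise, draw $B\sim\mu_{i_0}$ and $u\sim\mathrm{Uniform}(0,1)$; if $u<m_{i_0}^{\bullet}(\tau,B)/M_{i_0}^{\bullet}(\tau)$ set $\theta^{(k+1)}=F_{i_0}(\theta^{(k)})$, else set $\theta^{(k+1)}=\theta^{(k)}$. Output: the path of the process specified by the skeleton points $(\xi^{(k)},\theta^{(k)})$ and times $t^{(k)}$ (linear motion with velocity $\theta^{(k)}$ between $t^{(k)}$ and $t^{(k+1)}$).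
   Formalization: As printed, prior flips occur at rate M_i^0, so the claim fails if M_i^0>m_i^0; here either M_i^0=m_i^0, or prior flips are accepted with probability m_i^0/M_i^0. Also assumed: U^0, U^• are C^1, the bounds are measurable and locally integrable in t, and attempt times do not accumulate. *)

theory Defs
  imports "HOL-Probability.Probability"
begin

definition partial :: "'p \<Rightarrow> (real^'p \<Rightarrow> real) \<Rightarrow> real^'p \<Rightarrow> real" where
  "partial i f \<xi> = deriv (\<lambda>h. f (\<xi> + h *\<^sub>R axis i 1)) 0"

definition continuously_differentiable :: "(real^'p::finite \<Rightarrow> real) \<Rightarrow> bool" where
  "continuously_differentiable f \<longleftrightarrow>
     (\<forall>\<xi>. f differentiable (at \<xi>)) \<and> (\<forall>i. continuous_on UNIV (partial i f))"

definition prior_potential :: "(real^'p \<Rightarrow> real) \<Rightarrow> real^'p \<Rightarrow> real" where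
  "prior_potential p0 \<xi> = - ln (p0 \<xi>)"

text \<open>The data are the pairs \<open>(y j, x j)\<close> for \<open>1 \<le> j \<le> n\<close>, and \<open>lik (y j) (x j) \<xi>\<close>
  is the value of the conditional density \<open>p(y j | x j, \<xi>)\<close>.\<close>

definition likelihood_potential ::
  "('y \<Rightarrow> 'x \<Rightarrow> real^'p \<Rightarrow> real) \<Rightarrow> nat \<Rightarrow> (nat \<Rightarrow> 'y) \<Rightarrow> (nat \<Rightarrow> 'x) \<Rightarrow> real^'p \<Rightarrow> real" where
  "likelihood_potential lik n y x \<xi> = (\<Sum>j=1..n. - ln (lik (y j) (x j) \<xi>))"

definition gibbs_measure :: "(real^'p::finite \<Rightarrow> real) \<Rightarrow> (real^'p) measure" where
  "gibbs_measure U =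
     density lborel (\<lambda>\<xi>. ennreal (exp (- U \<xi>) / (LINT \<zeta>|lborel. exp (- U \<zeta>))))"

definition velocities :: "(real^'p::finite) set" where
  "velocities = {\<theta>. \<forall>i. \<theta> $ i = 1 \<or> \<theta> $ i = - 1}"

definition flip :: "'p \<Rightarrow> real^'p \<Rightarrow> real^'p::finite" where
  "flip i \<theta> = (\<chi> j. if j = i then - (\<theta> $ j) else \<theta> $ j)"

definition state_space :: "((real^'p::finite) \<times> (real^'p)) measure" where
  "state_space = borel \<Otimes>\<^sub>M count_space velocities"

definition target :: "(real^'p::finite \<Rightarrow> real) \<Rightarrow> ((real^'p) \<times> (real^'p)) measure" where
  "target U = gibbs_measure U \<Otimes>\<^sub>M uniform_count_measure velocities"

text \<open>A skeleton point \<open>(t, \<xi>, \<theta>)\<close> consists of a time and the position and velocity at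
  that time.  A waiting time can be infinite with positive probability (for instance if the
  rates vanish along a half-line); the time component is then \<open>\<infinity>\<close>, and such points are absorbing.
  They do not enter the path at finite times.\<close>

type_synonym 'p skeleton_point = "ennreal \<times> (real^'p) \<times> (real^'p)"

definition skeleton_space :: "('p::finite) skeleton_point measure" where
  "skeleton_space = borel \<Otimes>\<^sub>M state_space"

text \<open>For a skeleton whose times are nondecreasing from \<open>0\<close>, the index \<open>k\<close> selected below is the one
  with \<open>T k \<le> t < T (k + 1)\<close>.\<close>

definition skeleton_path ::
  "(nat \<Rightarrow> ('p::finite) skeleton_point) \<Rightarrow> real \<Rightarrow> (real^'p) \<times> (real^'p)" where
  "skeleton_path s t =
     (let k = (LEAST k. ennreal t < fst (s (Suc k)));
          (T, \<xi>, \<theta>) = s k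
      in (\<xi> + (t - enn2real T) *\<^sub>R \<theta>, \<theta>))"

text \<open>The first arrival time of a Poisson process on \<open>[0, \<infinity>)\<close> with intensity \<open>r\<close> is infinite with
  probability \<open>exp (- \<integral>\<^sub>0\<^sup>\<infinity> r)\<close>, hence the laws on \<open>ennreal\<close>.\<close>

definition is_first_arrival_law :: "(real \<Rightarrow> real) \<Rightarrow> ennreal measure \<Rightarrow> bool" where
  "is_first_arrival_law r N \<longleftrightarrow> prob_space N \<and> sets N = sets borel \<and>
     (\<forall>t\<ge>0. emeasure N {ennreal t..} = ennreal (exp (- (LINT s:{0..t}|lborel. r s))))"

definition first_arrival_law :: "(real \<Rightarrow> real) \<Rightarrow> ennreal measure" where
  "first_arrival_law r = (THE N. is_first_arrival_law r N)"

lemma first_arrival_law_unique: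
  assumes "is_first_arrival_law r N" "is_first_arrival_law r N'"
  shows "N = N'"
proof (rule measure_eqI_generator_eq[where E="range (\<lambda>t::ennreal. {t..})" and \<Omega>=UNIV and A="\<lambda>_. UNIV"])
  have pN: "prob_space N" "prob_space N'" and sN: "sets N = sets borel" "sets N' = sets borel"
    using assms by (auto simp: is_first_arrival_law_def)
  show "Int_stable (range (\<lambda>t::ennreal. {t..}))"
    unfolding Int_stable_def
  proof safe
    fix a b :: ennreal
    have "{a..} \<inter> {b..} = {max a b..}" by auto
    then show "{a..} \<inter> {b..} \<in> range (\<lambda>t::ennreal. {t..})" by blast
  qed
  have gen: "sigma_sets UNIV (range (\<lambda>t::ennreal. {..<t})) = sigma_sets UNIV (range (\<lambda>t::ennreal. {t..}))"
  proof (rule sigma_sets_eqI)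
    fix a assume "a \<in> range (\<lambda>t::ennreal. {..<t})"
    then obtain t where "a = {..<t}" by auto
    then have "a = UNIV - {t..}" by auto
    moreover have "UNIV - {t..} \<in> sigma_sets UNIV (range (\<lambda>t::ennreal. {t..}))"
      by (rule sigma_sets.Compl, rule sigma_sets.Basic) simp
    ultimately show "a \<in> sigma_sets UNIV (range (\<lambda>t::ennreal. {t..}))" by simp
  next
    fix a assume "a \<in> range (\<lambda>t::ennreal. {t..})"
    then obtain t where "a = {t..}" by auto
    then have "a = UNIV - {..<t}" by auto
    moreover have "UNIV - {..<t} \<in> sigma_sets UNIV (range (\<lambda>t::ennreal. {..<t}))"
      by (rule sigma_sets.Compl, rule sigma_sets.Basic) simp
    ultimately show "a \<in> sigma_sets UNIV (range (\<lambda>t::ennreal. {..<t}))" by simp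
  qed
  show "range (\<lambda>t::ennreal. {t..}) \<subseteq> Pow UNIV" by simp
  show "sets N = sigma_sets UNIV (range (\<lambda>t::ennreal. {t..}))"
    "sets N' = sigma_sets UNIV (range (\<lambda>t::ennreal. {t..}))"
    using sN gen by (simp_all add: borel_Iio)
  have at_top: "emeasure M {top::ennreal..} = (INF n::nat. emeasure M {ennreal (real n)..})"
    if "prob_space M" "sets M = sets borel" for M :: "ennreal measure"
  proof -
    interpret prob_space M by fact
    have "(INF n::nat. emeasure M {ennreal (real n)..}) = emeasure M (\<Inter>n::nat. {ennreal (real n)..})"
      by (rule INF_emeasure_decseq) (auto simp: that(2) decseq_def intro: order_trans)
    also have "(\<Inter>n::nat. {ennreal (real n)..}) = {top::ennreal..}"
    proof -
      have "y = top" if "\<And>n::nat. ennreal (real n) \<le> y" for y :: ennreal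
      proof (cases y)
        case (real r)
        obtain n :: nat where "r < real n" using reals_Archimedean2 by blast
        with that[of n] real show ?thesis by (simp add: ennreal_le_iff)
      qed
      then show ?thesis by (auto simp: top_unique)
    qed
    finally show ?thesis by simp
  qed
  fix X assume "X \<in> range (\<lambda>t::ennreal. {t..})"
  then obtain t where X: "X = {t..}" by auto
  have fin: "emeasure N {ennreal s..} = emeasure N' {ennreal s..}" if "0 \<le> s" for s
    using assms that by (simp add: is_first_arrival_law_def)
  show "emeasure N X = emeasure N' X"
  proof (cases t)
    case (real s) then show ?thesis using fin X by simp
  next
    case top then show ?thesis
      using at_top[OF pN(1) sN(1)] at_top[OF pN(2) sN(2)] top fin X by simp
  qed
next
  have "UNIV = {0::ennreal..}" by auto
  then show "range (\<lambda>_. UNIV) \<subseteq> range (\<lambda>t::ennreal. {t..})" by blast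
  show "(\<Union>i::nat. UNIV) = (UNIV::ennreal set)" by simp
  fix i :: nat show "emeasure N UNIV \<noteq> \<infinity>"
    using assms prob_space.emeasure_space_1[of N] by (auto simp: is_first_arrival_law_def dest: sets_eq_imp_space_eq)
qed

lemma first_arrival_law_exists:
  assumes nonneg: "\<And>t. 0 \<le> t \<Longrightarrow> 0 \<le> r t"
    and int: "\<And>T. 0 \<le> T \<Longrightarrow> set_integrable lborel {0..T} r"
  shows "\<exists>N. is_first_arrival_law r N"
proof -
  define R where "R t = (LINT s:{0..t}|lborel. r s)" for t
  define T where "T e = Sup {ennreal t |t. 0 \<le> t \<and> R t \<le> e}" for e :: real
  define E where "E = density lborel (\<lambda>x. ennreal (exponential_density 1 x))"
  interpret E: prob_space E unfolding E_def by (rule prob_space_exponential_density) simp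
  have sE: "sets E = sets borel" "space E = UNIV" by (auto simp: E_def)
  have R_eq: "R t = integral {0..t} r" if "0 \<le> t" for t
    unfolding R_def using set_borel_integral_eq_integral[OF int[OF that]] by simp
  have R_mono: "R s \<le> R t" if "0 \<le> s" "s \<le> t" for s t
    unfolding R_def set_lebesgue_integral_def using that int[of s] int[of t] nonneg
    by (intro integral_mono) (auto simp: set_integrable_def indicator_def)
  have R_nonneg: "0 \<le> R t" if "0 \<le> t" for t
    using R_mono[of 0 t] that R_eq[of 0] by simp
  have R_cont: "continuous_on {0..t} R" if "0 \<le> t" for t
  proof -
    have "continuous_on {0..t} (\<lambda>s. integral {0..s} r)"
      by (rule indefinite_integral_continuous_1)
        (use set_borel_integral_eq_integral[OF int[OF that]] in simp)
    then show ?thesis by (rule continuous_on_eq) (auto simp: R_eq)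
  qed
  have T_ge: "ennreal t \<le> T e \<longleftrightarrow> R t \<le> e" if "0 \<le> t" "0 \<le> e" for t e
  proof
    assume "R t \<le> e" then show "ennreal t \<le> T e"
      unfolding T_def by (intro Sup_upper) (use that in auto)
  next
    assume le: "ennreal t \<le> T e"
    have lt: "R s \<le> e" if s: "0 \<le> s" "s < t" for s
    proof -
      have "ennreal s < T e" using le s by (meson ennreal_lessI less_le_trans order_le_less_trans)
      then obtain u where "ennreal s < ennreal u" "0 \<le> u" "R u \<le> e"
        unfolding T_def less_Sup_iff by auto
      then show ?thesis using R_mono[of s u] s by (simp add: ennreal_less_iff)
    qed
    show "R t \<le> e"
    proof (cases "t = 0")
      case True then show ?thesis using R_eq[of 0] that by simp
    next
      case False
      then have "0 < t" using that by simp
      have "(R \<longlongrightarrow> R t) (at t within {0..t})"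
        using R_cont[OF that(1)] that by (simp add: continuous_on_def)
      then have "(R \<longlongrightarrow> R t) (at_left t)"
        using \<open>0 < t\<close> by (simp add: at_within_Icc_at_left)
      moreover have "eventually (\<lambda>s. R s \<le> e) (at_left t)"
        using eventually_at_left_real[OF \<open>0 < t\<close>] by eventually_elim (use lt in auto)
      ultimately show ?thesis by (intro tendsto_upperbound) auto
    qed
  qed
  have mono: "T a \<le> T b" if "a \<le> b" for a b
    unfolding T_def by (rule Sup_subset_mono) (use that in auto)
  have T_meas: "T \<in> borel_measurable E"
  proof (rule borel_measurableI_ge)
    fix y
    have "is_interval {x. y \<le> T x}"
      unfolding is_interval_1 using mono order_trans by blast
    then have "{x. y \<le> T x} \<in> sets borel"
      by (rule real_interval_borel_measurable)
    then show "{x \<in> space E. y \<le> T x} \<in> sets E" by (simp add: sE)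
  qed
  have "is_first_arrival_law r (distr E borel T)"
    unfolding is_first_arrival_law_def
  proof (intro conjI allI impI)
    show "prob_space (distr E borel T)" by (rule E.prob_space_distr[OF T_meas])
    fix t :: real assume t: "0 \<le> t"
    have "AE e in E. 0 \<le> e"
      unfolding E_def by (subst AE_density) (auto simp: exponential_density_def)
    then have "emeasure (distr E borel T) {ennreal t..} = emeasure E {R t..}"
      using T_meas T_ge[OF t] measurable_sets[OF T_meas, of "{ennreal t..}"] sE
      by (subst emeasure_distr) (auto intro!: emeasure_eq_AE elim: eventually_mono)
    also have "\<dots> = emeasure E {R t<..}"
    proof (rule emeasure_eq_AE)
      have "AE e in E. e \<noteq> R t"
        unfolding E_def using AE_lborel_singleton[of "R t"]
        by (subst AE_density) auto
      then show "AE e in E. e \<in> {R t..} \<longleftrightarrow> e \<in> {R t<..}" by eventually_elim auto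
    qed (simp_all add: sE)
    also have "\<dots> = ennreal (exp (- R t))"
    proof -
      have "distributed E lborel (\<lambda>x. x) (exponential_density 1)"
        unfolding distributed_def E_def by (simp add: distr_id2)
      from E.exponential_distributedD_gt[OF this R_nonneg[OF t]] show ?thesis
        by (simp add: E.emeasure_eq_measure sE greaterThan_def)
    qed
    finally show "emeasure (distr E borel T) {ennreal t..} = ennreal (exp (- (LINT s:{0..t}|lborel. r s)))"
      by (simp add: R_def)
  qed simp
  then show ?thesis by blast
qed

lemma is_first_arrival_law_first_arrival_law:
  assumes "\<And>t. 0 \<le> t \<Longrightarrow> 0 \<le> r t" "\<And>T. 0 \<le> T \<Longrightarrow> set_integrable lborel {0..T} r"
  shows "is_first_arrival_law r (first_arrival_law r)"
  unfolding first_arrival_law_def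
  using first_arrival_law_exists[OF assms] first_arrival_law_unique by (metis theI)

definition markov_chain ::
  "'w measure \<Rightarrow> 's measure \<Rightarrow> ('s \<Rightarrow> 's measure) \<Rightarrow> (nat \<Rightarrow> 'w \<Rightarrow> 's) \<Rightarrow> bool" where
  "markov_chain \<Omega> S K Y \<longleftrightarrow>
     prob_space \<Omega> \<and> (\<forall>k. Y k \<in> measurable \<Omega> S) \<and>
     (\<forall>k. \<forall>A\<in>sets (PiM {..k} (\<lambda>_. S)). \<forall>B\<in>sets S.
        emeasure \<Omega> {\<omega>\<in>space \<Omega>. (\<lambda>i\<in>{..k}. Y i \<omega>) \<in> A \<and> Y (Suc k) \<omega> \<in> B} =
        (\<integral>\<^sup>+\<omega>. indicator A (\<lambda>i\<in>{..k}. Y i \<omega>) * emeasure (K (Y k \<omega>)) B \<partial>\<Omega>))"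

definition zigzag_step ::
  "('p \<Rightarrow> real^'p \<Rightarrow> real^'p \<Rightarrow> real) \<Rightarrow> ('p::finite) skeleton_point \<Rightarrow> 'p skeleton_point measure" where
  "zigzag_step rate = (\<lambda>(t, \<xi>, \<theta>).
     if t = \<infinity> then return skeleton_space (t, \<xi>, \<theta>)
     else do {
       \<tau> \<leftarrow> PiM UNIV (\<lambda>i. first_arrival_law (\<lambda>s. rate i (\<xi> + s *\<^sub>R \<theta>) \<theta>));
       let i0 = (ARG_MIN \<tau> i. True);
       return skeleton_space
         (if \<tau> i0 = \<infinity> then (\<infinity>, \<xi>, \<theta>)
          else (t + \<tau> i0, \<xi> + enn2real (\<tau> i0) *\<^sub>R \<theta>, flip i0 \<theta>))
     })"

text \<open>\<open>X\<close> is a zig-zag process if it is, almost surely, the path through the skeleton points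
  \<open>Z 0, Z 1, \<dots>\<close> given by its initial state and its successive bounces; the bounce times do not
  accumulate.\<close>

definition zigzag_process ::
  "'w measure \<Rightarrow> ('p \<Rightarrow> real^'p \<Rightarrow> real^'p \<Rightarrow> real) \<Rightarrow>
   (real \<Rightarrow> 'w \<Rightarrow> (real^'p::finite) \<times> (real^'p)) \<Rightarrow> bool" where
  "zigzag_process \<Omega> rate X \<longleftrightarrow>
     (\<exists>Z. markov_chain \<Omega> skeleton_space (zigzag_step rate) Z \<and>
          (AE \<omega> in \<Omega>. fst (Z 0 \<omega>) = 0 \<and> (SUP k. fst (Z k \<omega>)) = \<infinity> \<and>
             (\<forall>t\<ge>0. X t \<omega> = skeleton_path (\<lambda>k. Z k \<omega>) t)))"

text \<open>\<open>g i \<xi> a\<close> is the estimator of the \<open>i\<close>-th partial derivative of the negative log-likelihood.\<close>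

definition m_lik ::
  "('p \<Rightarrow> real^'p \<Rightarrow> 'a \<Rightarrow> real) \<Rightarrow> 'p \<Rightarrow> real^'p \<Rightarrow> real^'p \<Rightarrow> real \<Rightarrow> 'a \<Rightarrow> real" where
  "m_lik g i \<xi> \<theta> t a = max 0 (\<theta> $ i * g i (\<xi> + t *\<^sub>R \<theta>) a)"

definition m_prior ::
  "(real^'p \<Rightarrow> real) \<Rightarrow> 'p \<Rightarrow> real^'p \<Rightarrow> real^'p \<Rightarrow> real \<Rightarrow> real" where
  "m_prior U0 i \<xi> \<theta> t = max 0 (\<theta> $ i * partial i U0 (\<xi> + t *\<^sub>R \<theta>))"

text \<open>One bouncing attempt.  The bounds \<open>M0 i \<xi> \<theta> t\<close> and \<open>Ml i \<xi> \<theta> t\<close> (prior and likelihood) belong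
  to the state \<open>(\<xi>, \<theta>)\<close> at the beginning of the attempt.  The flag \<open>thin\<close> selects the
  treatment of a prior event.  If it is false, the velocity is always flipped, so prior flips
  occur at the rate \<open>M0\<close>; if it is true, a flip is accepted with probability \<open>m_prior / M0\<close>, as for
  the likelihood events, so prior flips occur at the rate \<open>m_prior\<close>.\<close>

definition attempt ::
  "bool \<Rightarrow> (real^'p \<Rightarrow> real) \<Rightarrow> ('p \<Rightarrow> real^'p \<Rightarrow> real^'p \<Rightarrow> real \<Rightarrow> real) \<Rightarrow>
   ('p \<Rightarrow> 'a measure) \<Rightarrow> ('p \<Rightarrow> real^'p \<Rightarrow> 'a \<Rightarrow> real) \<Rightarrow>
   ('p \<Rightarrow> real^'p \<Rightarrow> real^'p \<Rightarrow> real \<Rightarrow> real) \<Rightarrow>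
   ('p::finite) skeleton_point \<Rightarrow> 'p skeleton_point measure" where
  "attempt thin U0 M0 \<mu> g Ml = (\<lambda>(t, \<xi>, \<theta>).
     if t = \<infinity> then return skeleton_space (t, \<xi>, \<theta>)
     else do {
       \<tau>l \<leftarrow> PiM UNIV (\<lambda>i. first_arrival_law (Ml i \<xi> \<theta>));
       \<tau>0 \<leftarrow> PiM UNIV (\<lambda>i. first_arrival_law (M0 i \<xi> \<theta>));
       let i0 = (ARG_MIN \<tau>l i. True);
       let j0 = (ARG_MIN \<tau>0 i. True);
       let \<tau> = min (\<tau>l i0) (\<tau>0 j0);
       let s = enn2real \<tau>;
       let \<xi>' = \<xi> + s *\<^sub>R \<theta>;
       if \<tau> = \<infinity> then return skeleton_space (\<infinity>, \<xi>, \<theta>)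
       else if \<tau>0 j0 < \<tau>l i0 then do {
         u \<leftarrow> uniform_measure lborel {0<..<1::real};
         return skeleton_space
           (t + \<tau>, \<xi>', if thin \<longrightarrow> u < m_prior U0 j0 \<xi> \<theta> s / M0 j0 \<xi> \<theta> s
                       then flip j0 \<theta> else \<theta>)
       }
       else do {
         b \<leftarrow> \<mu> i0;
         u \<leftarrow> uniform_measure lborel {0<..<1::real};
         return skeleton_space
           (t + \<tau>, \<xi>', if u < m_lik g i0 \<xi> \<theta> s b / Ml i0 \<xi> \<theta> s
                       then flip i0 \<theta> else \<theta>)
       }
     })"

definition rate_prior :: "(real^'p \<Rightarrow> real) \<Rightarrow> 'p \<Rightarrow> real^'p \<Rightarrow> real^'p \<Rightarrow> real" where
  "rate_prior U0 i \<xi> \<theta> = max 0 (\<theta> $ i * partial i U0 \<xi>)"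

definition rate_lik ::
  "('p \<Rightarrow> 'a measure) \<Rightarrow> ('p \<Rightarrow> real^'p \<Rightarrow> 'a \<Rightarrow> real) \<Rightarrow> 'p \<Rightarrow> real^'p \<Rightarrow> real^'p \<Rightarrow> real" where
  "rate_lik \<mu> g i \<xi> \<theta> = (LINT a|\<mu> i. max 0 (\<theta> $ i * g i \<xi> a))"

text \<open>The domination of the rates is not part of this predicate.\<close>

definition admissible_bound :: "('p \<Rightarrow> real^'p \<Rightarrow> real^'p \<Rightarrow> real \<Rightarrow> real) \<Rightarrow> bool" where
  "admissible_bound M \<longleftrightarrow>
     (\<forall>i. \<forall>\<theta>\<in>velocities.
        (\<lambda>(\<xi>, t). M i \<xi> \<theta> t) \<in> borel_measurable (borel \<Otimes>\<^sub>M borel) \<and>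
        (\<forall>\<xi>. \<forall>T\<ge>0. set_integrable lborel {0..T} (M i \<xi> \<theta>)))"

end

theory Submission
  imports Defs
begin

text \<open>Between two flips the attempts form a thinned arrival process: the kernel of an attempt
  proposes at the rate \<open>\<Sum>i. Ml i + M0 i\<close>, and integrating the acceptance probability against \<open>\<mu> i\<close>
  turns the proposals of component \<open>i\<close> into flips at the effective rate.  The law of the next bounce
  therefore solves the renewal equation of the attempts, and a martingale built from this law shows
  that the subsequence of attempts with a flip is a Markov chain with kernel \<open>zigzag_step\<close>.

  For invariance, the expectation of \<open>f\<close> at time \<open>t\<close> is split according to the number \<open>n\<close> of bounces.
  The \<open>n\<close>-bounce transition operator is an iterated integral; reading it backwards in time with
  \<open>\<theta>\<close> replaced by \<open>- \<theta>\<close> gives its adjoint with respect to \<open>exp (- U)\<close>, because the rates of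
  \<open>\<theta>\<close> and \<open>- \<theta>\<close> differ by the derivative of \<open>U\<close> along \<open>\<theta>\<close>.  Summing the adjoints of the
  constant \<open>1\<close> over \<open>n\<close> gives the total mass of the process, hence the expectation at time \<open>0\<close>.\<close>

section \<open>First arrival times\<close>

text \<open>Two features of the algorithm shape the proof. First, the bounds belong to the state at
  the beginning of a bouncing attempt, so a rejection replaces the dominating rate by a new one, and
  thinning of one fixed Poisson process does not apply. The renewal equation avoids this: it
  compares a single attempt with the law of the remaining bounce, which depends only on the flip
  rates along the ray and restarts consistently after a rejection. Secondly, rates and bounds are
  merely measurable and locally integrable, and waiting times may be infinite with positive
  probability. Exponentials are therefore handled through the integrated rate, and each kernel is
  described by its finite events together with one point at time \<infinity> that carries the
  remaining mass. Invariance is proved without a generator: all operators act on functions with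
  values in \<open>ennreal\<close>, so that sums, integrals and adjoints can be exchanged freely.
  Nonexplosion enters twice: it makes the forecast of the next bounce settle, and it ensures that
  the terms indexed by the number of bounces exhaust the expectation.\<close>

lemma measure_eqI_atMost:
  fixes M N :: "real measure"
  assumes sets: "sets M = sets borel" "sets N = sets borel"
    and eq: "\<And>y. emeasure M {..y} = emeasure N {..y}"
    and fin: "\<And>y. emeasure M {..y} \<noteq> \<infinity>"
  shows "M = N"
proof (rule measure_eqI_generator_eq[where E="range (\<lambda>a::real. {..a})" and \<Omega>=UNIV and A="\<lambda>n. {..real n}"])
  show "Int_stable (range (\<lambda>a::real. {..a}))"
  proof (rule Int_stableI)
    fix a b assume "a \<in> range (\<lambda>a::real. {..a})" "b \<in> range (\<lambda>a::real. {..a})"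
    then obtain x y where "a = {..x}" "b = {..y}" by auto
    then have "a \<inter> b = {..min x y}" by auto
    then show "a \<inter> b \<in> range (\<lambda>a::real. {..a})" by blast
  qed
  show "sets M = sigma_sets UNIV (range (\<lambda>a::real. {..a}))" "sets N = sigma_sets UNIV (range (\<lambda>a::real. {..a}))"
    using sets by (simp_all add: borel_eq_atMost)
  show "(\<Union>n::nat. {..real n}) = UNIV"
    using real_arch_simple by auto
qed (use eq fin in auto)

text \<open>The integrated hazard; it is 0 for negative \<open>t\<close>, where the interval is
  empty.\<close>

definition cumulative :: "(real \<Rightarrow> real) \<Rightarrow> real \<Rightarrow> real" where
  "cumulative r t = (LINT s:{0..t}|lborel. r s)"

lemma cumulative_zero [simp]: "cumulative r 0 = 0"
proof -
  have "AE s in lborel. indicator {0..0} s *\<^sub>R r s = 0"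
    using AE_lborel_singleton[of "0::real"] by (auto elim!: eventually_mono)
  then show ?thesis
    unfolding cumulative_def set_lebesgue_integral_def by (rule integral_eq_zero_AE)
qed

text \<open>This is what an admissible bound provides along a ray. There is no continuity, so
  \<open>cumulative r\<close> is continuous but need not be differentiable everywhere.\<close>

locale hazard =
  fixes r :: "real \<Rightarrow> real"
  assumes measurable_rate [measurable]: "r \<in> borel_measurable borel"
    and rate_nonneg: "\<And>t. 0 \<le> t \<Longrightarrow> 0 \<le> r t"
    and rate_integrable: "\<And>T. 0 \<le> T \<Longrightarrow> set_integrable lborel {0..T} r"
begin

lemma nn_integral_rate:
  assumes "0 \<le> t"
  shows "(\<integral>\<^sup>+s. ennreal (r s) * indicator {0..t} s \<partial>lborel) = ennreal (cumulative r t)"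
proof -
  have "(\<integral>\<^sup>+s. ennreal (r s) * indicator {0..t} s \<partial>lborel) = (\<integral>\<^sup>+s. ennreal (indicator {0..t} s *\<^sub>R r s) \<partial>lborel)"
    by (intro nn_integral_cong) (auto simp: indicator_def)
  also have "\<dots> = ennreal (cumulative r t)"
    unfolding cumulative_def set_lebesgue_integral_def
    by (rule nn_integral_eq_integral)
      (use rate_integrable[OF assms] rate_nonneg in \<open>auto simp: set_integrable_def indicator_def\<close>)
  finally show ?thesis .
qed

lemma cumulative_mono:
  assumes "0 \<le> s" "s \<le> t"
  shows "cumulative r s \<le> cumulative r t"
  unfolding cumulative_def set_lebesgue_integral_def
  using assms rate_integrable[of s] rate_integrable[of t] rate_nonneg
  by (intro integral_mono) (auto simp: set_integrable_def indicator_def)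

lemma cumulative_nonneg: "0 \<le> t \<Longrightarrow> 0 \<le> cumulative r t"
  using cumulative_mono[of 0 t] by simp

lemma continuous_on_cumulative: "continuous_on {0..t} (cumulative r)"
proof (cases "0 \<le> t")
  case True
  have eq: "cumulative r s = integral {0..s} r" if "0 \<le> s" for s
    unfolding cumulative_def using set_borel_integral_eq_integral[OF rate_integrable[OF that]] by simp
  have "continuous_on {0..t} (\<lambda>s. integral {0..s} r)"
    by (rule indefinite_integral_continuous_1)
      (use set_borel_integral_eq_integral[OF rate_integrable[OF True]] in simp)
  then show ?thesis by (rule continuous_on_eq) (auto simp: eq)
qed simp

lemma measurable_cumulative [measurable]: "cumulative r \<in> borel_measurable borel"
proof -
  \<comment> \<open>With the interval written as a condition on \<open>s\<close> and
    \<open>t\<close>, the integrand is jointly measurable and the integral depends measurably on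
    \<open>t\<close>.\<close>
  have "(\<lambda>t. LINT s|lborel. (if 0 \<le> s \<and> s \<le> t then 1 else 0) *\<^sub>R r s) \<in> borel_measurable borel"
    by measurable
  then show ?thesis
    by (simp add: cumulative_def[abs_def] set_lebesgue_integral_def indicator_def)
qed

text \<open>The law \<open>r s ds\<close> on \<open>[0, q]\<close> is carried to Lebesgue measure on \<open>[0, R q]\<close> by its own
  distribution function \<open>R\<close>.  As \<open>r\<close> is only measurable, this replaces the fundamental theorem
  of calculus for \<open>exp (- R)\<close>.\<close>

lemma distr_cumulative:
  assumes q: "0 \<le> q"
  shows "distr (density lborel (\<lambda>s. ennreal (r s) * indicator {0..q} s)) borel (cumulative r) =
    density lborel (indicator {0..cumulative r q})"
proof (rule measure_eqI_atMost)
  fix y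
  have L: "emeasure (distr (density lborel (\<lambda>s. ennreal (r s) * indicator {0..q} s)) borel (cumulative r)) {..y} =
    (\<integral>\<^sup>+s. ennreal (r s) * indicator {s\<in>{0..q}. cumulative r s \<le> y} s \<partial>lborel)"
    by (subst emeasure_distr, simp, simp, subst emeasure_density, measurable)
      (auto intro!: nn_integral_cong simp: indicator_def)
  have R: "emeasure (density lborel (indicator {0..cumulative r q})) {..y} =
      emeasure lborel ({0..cumulative r q} \<inter> {..y})"
    by (subst emeasure_density, simp, simp, subst nn_integral_indicator[symmetric])
      (auto intro!: nn_integral_cong simp: indicator_def simp del: nn_integral_indicator)
  consider "y < 0" | "cumulative r q \<le> y" "0 \<le> y" | "0 \<le> y" "y < cumulative r q" by linarith
  then have "emeasure (distr (density lborel (\<lambda>s. ennreal (r s) * indicator {0..q} s)) borel (cumulative r)) {..y} =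
      emeasure (density lborel (indicator {0..cumulative r q})) {..y} \<and>
      emeasure (density lborel (indicator {0..cumulative r q})) {..y} \<noteq> \<infinity>"
  proof cases
    case 1
    have "{s\<in>{0..q}. cumulative r s \<le> y} = {}" "{0..cumulative r q} \<inter> {..y} = {}"
      using 1 cumulative_nonneg by fastforce+
    then show ?thesis using L R by simp
  next
    case 2
    have "{s\<in>{0..q}. cumulative r s \<le> y} = {0..q}"
      using 2 cumulative_mono by force
    moreover have "{0..cumulative r q} \<inter> {..y} = {0..cumulative r q}" using 2 by auto
    ultimately show ?thesis using L R nn_integral_rate[OF q] cumulative_nonneg[OF q] by simp
  next
    case 3
    \<comment> \<open>\<open>cumulative r\<close> may be flat at the height \<open>y\<close>. The
      last point \<open>s0\<close> of the compact level set is the one for which the sublevel set is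
      exactly \<open>{0..s0}\<close>.\<close>
    have "closed ({0..q} \<inter> cumulative r -` {y})"
      by (rule continuous_closed_preimage[OF continuous_on_cumulative]) auto
    then have "compact ({0..q} \<inter> cumulative r -` {y})"
      by (auto simp: compact_eq_bounded_closed intro: bounded_subset[OF bounded_closed_interval])
    moreover have "{0..q} \<inter> cumulative r -` {y} \<noteq> {}"
      using IVT'[of "cumulative r" 0 y q] 3 q continuous_on_cumulative[of q] by auto
    ultimately obtain s0 where "s0 \<in> {0..q} \<inter> cumulative r -` {y}"
      "\<forall>s\<in>{0..q} \<inter> cumulative r -` {y}. s \<le> s0"
      using compact_attains_sup by blast
    then have s0: "0 \<le> s0" "s0 \<le> q" "cumulative r s0 = y"
      and max: "\<And>s. 0 \<le> s \<Longrightarrow> s \<le> q \<Longrightarrow> cumulative r s = y \<Longrightarrow> s \<le> s0"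
      by simp_all
    have "s \<le> s0" if "0 \<le> s" "s \<le> q" "cumulative r s \<le> y" for s
      using max[of s] cumulative_mono[of s0 s] that s0 by force
    then have "{s\<in>{0..q}. cumulative r s \<le> y} = {0..s0}"
      using s0 cumulative_mono by force
    moreover have "{0..cumulative r q} \<inter> {..y} = {0..y}" using 3 by auto
    ultimately show ?thesis using L R nn_integral_rate[OF s0(1)] s0 3 by simp
  qed
  then show "emeasure (distr (density lborel (\<lambda>s. ennreal (r s) * indicator {0..q} s)) borel (cumulative r)) {..y} =
      emeasure (density lborel (indicator {0..cumulative r q})) {..y}"
    and "emeasure (distr (density lborel (\<lambda>s. ennreal (r s) * indicator {0..q} s)) borel (cumulative r)) {..y} \<noteq> \<infinity>"
    by auto
qed simp_all

text \<open>The substitution \<open>y = cumulative r s\<close> reduces this to the integral of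
  \<open>exp (- y)\<close>, a smooth function to which the fundamental theorem applies.\<close>

lemma nn_integral_rate_exp:
  assumes q: "0 \<le> q"
  shows "(\<integral>\<^sup>+s. ennreal (r s * exp (- cumulative r s)) * indicator {0..q} s \<partial>lborel) =
    ennreal (1 - exp (- cumulative r q))"
proof -
  have "(\<integral>\<^sup>+s. ennreal (r s * exp (- cumulative r s)) * indicator {0..q} s \<partial>lborel) =
    (\<integral>\<^sup>+y. ennreal (exp (- y)) \<partial>distr (density lborel (\<lambda>s. ennreal (r s) * indicator {0..q} s)) borel (cumulative r))"
    by (subst nn_integral_distr, simp, simp, subst nn_integral_density)
      (auto intro!: nn_integral_cong simp: indicator_def ennreal_mult rate_nonneg)
  also have "\<dots> = (\<integral>\<^sup>+y. ennreal (exp (- y)) * indicator {0..cumulative r q} y \<partial>lborel)"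
    unfolding distr_cumulative[OF q] by (subst nn_integral_density) (auto intro!: nn_integral_cong simp: mult.commute)
  also have "\<dots> = ennreal (- exp (- cumulative r q) - (- exp (- 0)))"
    by (rule nn_integral_FTC_Icc) (use cumulative_nonneg[OF q] in \<open>auto intro!: derivative_eq_intros\<close>)
  finally show ?thesis by simp
qed

abbreviation "arrival \<equiv> first_arrival_law r"

lemma arrival_law: "is_first_arrival_law r arrival"
  using is_first_arrival_law_first_arrival_law rate_nonneg rate_integrable by blast

lemma prob_space_arrival: "prob_space arrival"
  and sets_arrival [measurable_cong, simp]: "sets arrival = sets borel"
  using arrival_law by (auto simp: is_first_arrival_law_def)

lemma space_arrival [simp]: "space arrival = UNIV"
  using sets_eq_imp_space_eq[OF sets_arrival] by simp

lemma emeasure_arrival_atLeast: "0 \<le> t \<Longrightarrow> emeasure arrival {ennreal t..} = ennreal (exp (- cumulative r t))"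
  using arrival_law by (auto simp: is_first_arrival_law_def cumulative_def)

text \<open>The law has no atom at a finite time: by continuity of the integrated hazard, the closed
  half-lines starting at \<open>s > t\<close> already have the full mass in the limit as
  \<open>s\<close> decreases to \<open>t\<close>.\<close>

lemma emeasure_arrival_greaterThan:
  assumes t: "0 \<le> t"
  shows "emeasure arrival {ennreal t<..} = ennreal (exp (- cumulative r t))"
proof (rule antisym)
  show "emeasure arrival {ennreal t<..} \<le> ennreal (exp (- cumulative r t))"
    unfolding emeasure_arrival_atLeast[OF t, symmetric] by (rule emeasure_mono) auto
  have "(cumulative r \<longlongrightarrow> cumulative r t) (at t within {0..t+1})"
    using continuous_on_cumulative[of "t+1"] t by (simp add: continuous_on_def)
  then have "(cumulative r \<longlongrightarrow> cumulative r t) (at t within {t..t+1})"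
    by (rule tendsto_within_subset) (use t in auto)
  then have "(cumulative r \<longlongrightarrow> cumulative r t) (at_right t)"
    by (simp add: at_within_Icc_at_right)
  then have lim: "((\<lambda>s. ennreal (exp (- cumulative r s))) \<longlongrightarrow> ennreal (exp (- cumulative r t))) (at_right t)"
    by (intro tendsto_intros)
  have "eventually (\<lambda>s. ennreal (exp (- cumulative r s)) \<le> emeasure arrival {ennreal t<..}) (at_right t)"
    using eventually_at_right_less[of t]
  proof eventually_elim
    case (elim s)
    then have "ennreal t < ennreal s" using t by (simp add: ennreal_lessI)
    then have "{ennreal s..} \<subseteq> {ennreal t<..}" by auto
    then show ?case
      using emeasure_arrival_atLeast[of s] emeasure_mono[of "{ennreal s..}" "{ennreal t<..}" arrival] elim t by simp
  qed
  with lim show "ennreal (exp (- cumulative r t)) \<le> emeasure arrival {ennreal t<..}"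
    by (intro tendsto_upperbound) auto
qed

text \<open>The law has a density on the finite times and possibly an atom at \<infinity>, which
  \<open>f \<infinity> = 0\<close> makes invisible. Densities are compared through their
  distribution functions.\<close>

lemma nn_integral_arrival:
  assumes [measurable]: "f \<in> borel_measurable borel" and "f \<infinity> = 0"
  shows "(\<integral>\<^sup>+x. f x \<partial>arrival) =
    (\<integral>\<^sup>+s. ennreal (r s * exp (- cumulative r s)) * f (ennreal s) * indicator {0..} s \<partial>lborel)"
proof -
  interpret N: prob_space arrival by (rule prob_space_arrival)
  \<comment> \<open>The part of the law on finite times, carried to the real line.\<close>
  let ?D = "distr (density arrival (indicator {..<\<infinity>})) borel enn2real"
  let ?E = "density lborel (\<lambda>s. ennreal (r s * exp (- cumulative r s)) * indicator {0..} s)"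
  have eq: "?D = ?E"
  proof (rule measure_eqI_atMost)
    fix y :: real
    have D: "emeasure ?D {..y} = emeasure arrival {x. x < \<infinity> \<and> enn2real x \<le> y}"
      by (subst emeasure_distr, measurable, subst emeasure_density, measurable,
          subst nn_integral_indicator[symmetric], measurable)
        (auto intro!: nn_integral_cong simp: indicator_def simp del: nn_integral_indicator)
    have E: "emeasure ?E {..y} = (\<integral>\<^sup>+s. ennreal (r s * exp (- cumulative r s)) * indicator {0..y} s \<partial>lborel)"
      by (subst emeasure_density) (auto intro!: nn_integral_cong simp: indicator_def)
    show "emeasure ?D {..y} = emeasure ?E {..y}"
    proof (cases "0 \<le> y")
      case True
      have "{x. x < \<infinity> \<and> enn2real x \<le> y} = UNIV - {ennreal y<..}"
      proof (intro set_eqI)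
        fix x show "x \<in> {x. x < \<infinity> \<and> enn2real x \<le> y} \<longleftrightarrow> x \<in> UNIV - {ennreal y<..}"
          using True by (cases x) (auto simp: ennreal_less_iff not_less)
      qed
      then have "emeasure arrival {x. x < \<infinity> \<and> enn2real x \<le> y} = 1 - emeasure arrival {ennreal y<..}"
        using emeasure_compl[of "{ennreal y<..}" arrival] N.emeasure_space_1 by (simp add: N.emeasure_finite)
      also have "\<dots> = ennreal (1 - exp (- cumulative r y))"
        unfolding emeasure_arrival_greaterThan[OF True]
        using cumulative_nonneg[OF True] by (simp add: ennreal_minus flip: ennreal_1)
      finally show ?thesis using D E nn_integral_rate_exp[OF True] by simp
    next
      case False
      have empty: "{x. x < \<infinity> \<and> enn2real x \<le> y} = {}" "{0..y} = {}"
        using False by (auto simp: not_le intro: less_le_trans[OF _ enn2real_nonneg])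
      show ?thesis unfolding D E empty by simp
    qed
    show "emeasure ?D {..y} \<noteq> \<infinity>"
      using D by simp
  qed simp_all
  have "(\<integral>\<^sup>+x. f x \<partial>arrival) = (\<integral>\<^sup>+s. f (ennreal s) \<partial>?D)"
    by (subst nn_integral_distr, simp, simp, subst nn_integral_density)
      (use assms(2) in \<open>auto intro!: nn_integral_cong simp: indicator_def top_unique not_less\<close>)
  also have "\<dots> = (\<integral>\<^sup>+s. ennreal (r s * exp (- cumulative r s)) * f (ennreal s) * indicator {0..} s \<partial>lborel)"
    unfolding eq by (subst nn_integral_density) (auto intro!: nn_integral_cong simp: ac_simps)
  finally show ?thesis .
qed

end

section \<open>Independent competing clocks and their minimum\<close>

definition first_clock :: "('i::finite \<Rightarrow> ennreal) \<Rightarrow> 'i" where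
  "first_clock \<tau> = (ARG_MIN \<tau> i. True)"

lemma first_clock_le: "\<tau> (first_clock \<tau>) \<le> \<tau> i"
proof -
  obtain k where "is_arg_min \<tau> (\<lambda>_. True) k"
    using ex_is_arg_min_if_finite[of "UNIV :: 'a set" \<tau>] by auto
  then have "is_arg_min \<tau> (\<lambda>_. True) (first_clock \<tau>)"
    unfolding first_clock_def arg_min_def by (rule someI)
  then show ?thesis by (auto simp: is_arg_min_linorder)
qed

lemma measurable_clock: "(\<lambda>\<tau>. \<tau> i) \<in> borel_measurable (PiM UNIV (\<lambda>_::'i::finite. borel))"
  by (rule measurable_component_singleton) simp

lemma pred_clock_le [measurable]:
  "Measurable.pred (PiM UNIV (\<lambda>_. borel)) (\<lambda>\<tau>::'i::finite \<Rightarrow> ennreal. \<tau> i \<le> \<tau> j)"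
  unfolding pred_def by (rule borel_measurable_le[OF measurable_clock measurable_clock])

text \<open>The choice among minimal clocks is arbitrary, but it is a function of the set of minimal
  indices. This set takes finitely many values, each on a measurable event.\<close>

lemma measurable_first_clock [measurable]:
  "first_clock \<in> measurable (PiM UNIV (\<lambda>_. borel)) (count_space (UNIV :: 'i::finite set))"
proof -
  let ?S = "\<lambda>\<tau>::'i \<Rightarrow> ennreal. {i. \<forall>j. \<tau> i \<le> \<tau> j}"
  have "?S \<in> measurable (PiM UNIV (\<lambda>_. borel)) (count_space UNIV)"
  proof (subst measurable_count_space_eq2, simp, intro conjI ballI)
    fix A :: "'i set"
    have "?S -` {A} \<inter> space (PiM UNIV (\<lambda>_. borel)) =
      {\<tau> \<in> space (PiM UNIV (\<lambda>_. borel)). \<forall>i. i \<in> A \<longleftrightarrow> (\<forall>j. \<tau> i \<le> \<tau> j)}"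
      by auto
    also have "\<dots> \<in> sets (PiM UNIV (\<lambda>_. borel))" by measurable
    finally show "?S -` {A} \<inter> space (PiM UNIV (\<lambda>_. borel)) \<in> sets (PiM UNIV (\<lambda>_. borel))" .
  qed simp
  then have "(\<lambda>\<tau>. SOME i. i \<in> ?S \<tau>) \<in> measurable (PiM UNIV (\<lambda>_. borel)) (count_space (UNIV :: 'i set))"
    by (rule measurable_compose) simp
  moreover have "first_clock = (\<lambda>\<tau>. SOME i. i \<in> ?S \<tau>)"
    by (simp add: fun_eq_iff first_clock_def arg_min_def is_arg_min_linorder)
  ultimately show ?thesis by simp
qed

lemma measurable_first_time [measurable]:
  "(\<lambda>\<tau>. \<tau> (first_clock \<tau>)) \<in> borel_measurable (PiM UNIV (\<lambda>_::'i::finite. borel))"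
  by (rule measurable_compose_countable[OF measurable_clock measurable_first_clock])

lemma measurable_weighted_by_law:
  fixes r R :: "real \<Rightarrow> real" and f :: "ennreal \<Rightarrow> ennreal"
  assumes [measurable]: "r \<in> borel_measurable borel" "R \<in> borel_measurable borel" "f \<in> borel_measurable borel"
  shows "(\<lambda>s. ennreal (r s * exp (- R s)) * f (ennreal s) * indicator {0..} s) \<in> borel_measurable lborel"
  by measurable

locale competing_hazards =
  fixes r :: "'i::finite \<Rightarrow> real \<Rightarrow> real"
  assumes hazard: "\<And>i. hazard (r i)"
begin

definition "total_rate s = (\<Sum>i\<in>UNIV. r i s)"

lemma hazard_total: "hazard total_rate"
proof
  interpret hazard "r k" for k by (rule hazard)
  show "total_rate \<in> borel_measurable borel" unfolding total_rate_def[abs_def] by measurable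
  show "0 \<le> total_rate t" if "0 \<le> t" for t
    unfolding total_rate_def using rate_nonneg that by (auto intro: sum_nonneg)
  show "set_integrable lborel {0..T} total_rate" if "0 \<le> T" for T
    unfolding total_rate_def[abs_def]
    using rate_integrable[OF that] unfolding set_integrable_def
    by (subst scaleR_sum_right) (intro Bochner_Integration.integrable_sum)
qed

lemma cumulative_total: "0 \<le> t \<Longrightarrow> cumulative total_rate t = (\<Sum>i\<in>UNIV. cumulative (r i) t)"
proof -
  assume t: "0 \<le> t"
  interpret hazard "r k" for k by (rule hazard)
  have "cumulative total_rate t = (LINT s|lborel. (\<Sum>i\<in>UNIV. indicator {0..t} s *\<^sub>R r i s))"
    unfolding cumulative_def set_lebesgue_integral_def total_rate_def by (simp add: sum_distrib_left)
  also have "\<dots> = (\<Sum>i\<in>UNIV. cumulative (r i) t)"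
    unfolding cumulative_def set_lebesgue_integral_def
    using rate_integrable[OF t] by (intro Bochner_Integration.integral_sum) (simp add: set_integrable_def)
  finally show ?thesis .
qed

abbreviation "clocks \<equiv> PiM UNIV (\<lambda>i. first_arrival_law (r i))"

lemma sets_clocks [measurable_cong]: "sets clocks = sets (PiM UNIV (\<lambda>_. borel))"
  by (intro sets_PiM_cong) (simp_all add: hazard.sets_arrival[OF hazard])

lemma space_clocks [simp]: "space clocks = UNIV"
  using sets_eq_imp_space_eq[OF sets_clocks] by (simp add: space_PiM)

lemma prob_space_clocks: "prob_space clocks"
  by (rule prob_space_PiM) (rule hazard.prob_space_arrival[OF hazard])

lemma prod_exp_cumulative:
  "0 \<le> t \<Longrightarrow> (\<Prod>i\<in>UNIV. ennreal (exp (- cumulative (r i) t))) = ennreal (exp (- cumulative total_rate t))"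
  by (simp add: prod_ennreal cumulative_total exp_sum flip: sum_negf)

text \<open>The minimum exceeds \<open>s\<close> iff every clock does, so the event is a box and
  independence turns the product of survival probabilities into the total hazard.\<close>

lemma emeasure_clocks_greaterThan:
  assumes s: "0 \<le> s"
  shows "emeasure clocks {\<tau>. ennreal s < \<tau> (first_clock \<tau>)} = ennreal (exp (- cumulative total_rate s))"
proof -
  interpret hazard "r k" for k by (rule hazard)
  interpret P: prob_space "first_arrival_law (r k)" for k by (rule prob_space_arrival)
  interpret product_sigma_finite "\<lambda>i. first_arrival_law (r i)" by standard
  have eq: "{\<tau>. ennreal s < \<tau> (first_clock \<tau>)} = PiE UNIV (\<lambda>_. {ennreal s<..})"
    using first_clock_le less_le_trans by (fastforce simp: PiE_iff)
  show ?thesis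
    unfolding eq by (subst emeasure_PiM) (simp_all add: emeasure_arrival_greaterThan[OF s] prod_exp_cumulative[OF s])
qed

lemma emeasure_clocks_atLeast:
  assumes s: "0 \<le> s"
  shows "emeasure clocks {\<tau>. ennreal s \<le> \<tau> (first_clock \<tau>)} = ennreal (exp (- cumulative total_rate s))"
proof -
  interpret hazard "r k" for k by (rule hazard)
  interpret P: prob_space "first_arrival_law (r k)" for k by (rule prob_space_arrival)
  interpret product_sigma_finite "\<lambda>i. first_arrival_law (r i)" by standard
  have eq: "{\<tau>. ennreal s \<le> \<tau> (first_clock \<tau>)} = PiE UNIV (\<lambda>_. {ennreal s..})"
    using first_clock_le order_trans by (fastforce simp: PiE_iff)
  show ?thesis
    unfolding eq by (subst emeasure_PiM) (simp_all add: emeasure_arrival_atLeast[OF s] prod_exp_cumulative[OF s])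
qed

text \<open>\<open>S x\<close> is the set of values left to the other clocks when clock
  \<open>i\<close> rings at \<open>x\<close>. It stands for both \<open>{x..}\<close> and
  \<open>{x<..}\<close>, which have the same probability under every clock, so weak and strict
  victory are treated by one computation.\<close>

lemma nn_integral_clocks_winner:
  fixes S :: "ennreal \<Rightarrow> ennreal set" and i :: 'i
  assumes [measurable]: "f \<in> borel_measurable borel" and f: "f \<infinity> = 0"
    and S_sets: "\<And>x. S x \<in> sets borel"
    and S_emeasure: "\<And>j t. 0 \<le> t \<Longrightarrow>
      emeasure (first_arrival_law (r j)) (S (ennreal t)) = ennreal (exp (- cumulative (r j) t))"
    and S_pred [measurable]: "Measurable.pred (borel \<Otimes>\<^sub>M borel) (\<lambda>(x, y). y \<in> S x)"
  shows "(\<integral>\<^sup>+\<tau>. f (\<tau> i) * indicator {\<tau>. \<forall>j\<in>UNIV - {i}. \<tau> j \<in> S (\<tau> i)} \<tau> \<partial>clocks) =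
    (\<integral>\<^sup>+s. ennreal (r i s * exp (- cumulative total_rate s)) * f (ennreal s) * indicator {0..} s \<partial>lborel)"
proof -
  interpret hazard "r k" for k by (rule hazard)
  interpret P: prob_space "first_arrival_law (r k)" for k by (rule prob_space_arrival)
  interpret product_sigma_finite "\<lambda>i. first_arrival_law (r i)" by standard
  let ?I = "UNIV - {i}" and ?N = "\<lambda>i. first_arrival_law (r i)"
  have ins: "insert i ?I = UNIV" by auto
  have pm: "Measurable.pred (PiM UNIV (\<lambda>_. borel)) (\<lambda>\<tau>::'i \<Rightarrow> ennreal. \<tau> j \<in> S (\<tau> i))" for j
    using measurable_compose[OF measurable_Pair[OF measurable_component_singleton[of i UNIV] measurable_component_singleton[of j UNIV]] S_pred]
    by simp
  have m: "(\<lambda>\<tau>. f (\<tau> i) * indicator {\<tau>. \<forall>j\<in>?I. \<tau> j \<in> S (\<tau> i)} \<tau>) \<in> borel_measurable clocks"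
  proof -
    have "Measurable.pred (PiM UNIV (\<lambda>_. borel)) (\<lambda>\<tau>. \<forall>j\<in>?I. \<tau> j \<in> S (\<tau> i))"
      using pm by (intro pred_intros_finite) auto
    then have [measurable]: "indicator {\<tau>. \<forall>j\<in>?I. \<tau> j \<in> S (\<tau> i)} \<in> borel_measurable (PiM UNIV (\<lambda>_. borel))"
      by (intro borel_measurable_indicator) (simp add: pred_def space_PiM)
    have [measurable]: "(\<lambda>\<tau>::'i \<Rightarrow> ennreal. f (\<tau> i)) \<in> borel_measurable (PiM UNIV (\<lambda>_. borel))"
      by (rule measurable_compose[OF measurable_clock]) simp
    show ?thesis by measurable
  qed
  let ?F = "\<lambda>\<tau>. f (\<tau> i) * indicator {\<tau>. \<forall>j\<in>?I. \<tau> j \<in> S (\<tau> i)} \<tau>"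
  have "(\<integral>\<^sup>+\<tau>. ?F \<tau> \<partial>clocks) = (\<integral>\<^sup>+\<tau>. ?F \<tau> \<partial>PiM (insert i ?I) ?N)"
    by (simp only: ins)
  \<comment> \<open>Coordinate \<open>i\<close> is split off; given its value \<open>x\<close>, the
    others are restricted to a box.\<close>
  also have "\<dots> = (\<integral>\<^sup>+x. (\<integral>\<^sup>+\<tau>. ?F (\<tau>(i := x)) \<partial>PiM ?I ?N) \<partial>?N i)"
    by (rule product_nn_integral_insert_rev) (use m in \<open>simp_all only: ins finite_code\<close>, auto)
  also have "\<dots> = (\<integral>\<^sup>+x. (\<integral>\<^sup>+\<tau>. f x * indicator (PiE ?I (\<lambda>_. S x)) \<tau> \<partial>PiM ?I ?N) \<partial>?N i)"
    by (intro nn_integral_cong) (auto simp: indicator_def space_PiM PiE_iff)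
  also have "\<dots> = (\<integral>\<^sup>+x. f x * (\<Prod>j\<in>?I. emeasure (?N j) (S x)) \<partial>?N i)"
  proof (rule nn_integral_cong)
    fix x
    have "PiE ?I (\<lambda>_. S x) \<in> sets (PiM ?I ?N)" using S_sets by (intro sets_PiM_I_finite) auto
    then show "(\<integral>\<^sup>+\<tau>. f x * indicator (PiE ?I (\<lambda>_. S x)) \<tau> \<partial>PiM ?I ?N) =
        f x * (\<Prod>j\<in>?I. emeasure (?N j) (S x))"
      using S_sets by (simp add: nn_integral_cmult_indicator emeasure_PiM)
  qed
  also have "\<dots> = (\<integral>\<^sup>+s. ennreal (r i s * exp (- cumulative (r i) s)) *
      (f (ennreal s) * (\<Prod>j\<in>?I. emeasure (?N j) (S (ennreal s)))) * indicator {0..} s \<partial>lborel)"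
  proof (rule nn_integral_arrival)
    have "(\<lambda>x. emeasure (?N j) (S x)) \<in> borel_measurable borel" for j
    proof -
      have "(\<lambda>x. emeasure (?N j) (Pair x -` {p. snd p \<in> S (fst p)})) \<in> borel_measurable borel"
      proof (rule P.measurable_emeasure_Pair)
        have "{p \<in> space (borel \<Otimes>\<^sub>M borel). case p of (x, y) \<Rightarrow> y \<in> S x} \<in> sets (borel \<Otimes>\<^sub>M borel)"
          by measurable
        also have "sets (borel \<Otimes>\<^sub>M borel) = sets (borel \<Otimes>\<^sub>M ?N j)"
          by (intro sets_pair_measure_cong) simp_all
        also have "{p \<in> space (borel \<Otimes>\<^sub>M borel). case p of (x, y) \<Rightarrow> y \<in> S x} = {p. snd p \<in> S (fst p)}"
          by (auto simp: space_pair_measure)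
        finally show "{p. snd p \<in> S (fst p)} \<in> sets (borel \<Otimes>\<^sub>M ?N j)" .
      qed
      then show ?thesis by simp
    qed
    then show "(\<lambda>x. f x * (\<Prod>j\<in>?I. emeasure (?N j) (S x))) \<in> borel_measurable borel" by measurable
  qed (use f in simp)
  also have "\<dots> = (\<integral>\<^sup>+s. ennreal (r i s * exp (- cumulative total_rate s)) * f (ennreal s) * indicator {0..} s \<partial>lborel)"
  proof (rule nn_integral_cong)
    fix s :: real
    have "ennreal (r i s * exp (- cumulative (r i) s)) * (\<Prod>j\<in>?I. emeasure (?N j) (S (ennreal s))) =
        ennreal (r i s * exp (- cumulative total_rate s))" if "0 \<le> s"
    proof -
      have "(\<Prod>j\<in>?I. emeasure (?N j) (S (ennreal s))) = (\<Prod>j\<in>?I. ennreal (exp (- cumulative (r j) s)))"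
        using that by (simp add: S_emeasure)
      moreover have "ennreal (exp (- cumulative (r i) s)) * (\<Prod>j\<in>?I. ennreal (exp (- cumulative (r j) s))) =
          ennreal (exp (- cumulative total_rate s))"
        unfolding prod_exp_cumulative[OF that, symmetric] by (rule prod.remove[symmetric]) auto
      ultimately show ?thesis
        using rate_nonneg[of s i] that by (simp add: ennreal_mult mult.assoc)
    qed
    then show "ennreal (r i s * exp (- cumulative (r i) s)) *
        (f (ennreal s) * (\<Prod>j\<in>?I. emeasure (?N j) (S (ennreal s)))) * indicator {0..} s =
      ennreal (r i s * exp (- cumulative total_rate s)) * f (ennreal s) * indicator {0..} s"
      by (auto simp: indicator_def ac_simps)
  qed
  finally show ?thesis by simp
qed

text \<open>Ties occur with probability zero, because the strict and the weak comparison of the clocks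
  give the same integral.\<close>

lemma nn_integral_clocks:
  assumes f [measurable]: "\<And>i. f i \<in> borel_measurable borel" and f0: "\<And>i. f i \<infinity> = 0"
  shows "(\<integral>\<^sup>+\<tau>. f (first_clock \<tau>) (\<tau> (first_clock \<tau>)) \<partial>clocks) =
    (\<integral>\<^sup>+s. (\<Sum>i\<in>UNIV. ennreal (r i s) * f i (ennreal s)) * ennreal (exp (- cumulative total_rate s)) *
      indicator {0..} s \<partial>lborel)"
proof -
  interpret hazard "r k" for k by (rule hazard)
  interpret T: hazard total_rate by (rule hazard_total)
  have "(\<integral>\<^sup>+\<tau>. f i (\<tau> i) * indicator {\<tau>. first_clock \<tau> = i} \<tau> \<partial>clocks) =
      (\<integral>\<^sup>+s. ennreal (r i s * exp (- cumulative total_rate s)) * f i (ennreal s) * indicator {0..} s \<partial>lborel)" for i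
  proof (rule antisym)
    have "(\<integral>\<^sup>+\<tau>. f i (\<tau> i) * indicator {\<tau>. first_clock \<tau> = i} \<tau> \<partial>clocks) \<le>
      (\<integral>\<^sup>+\<tau>. f i (\<tau> i) * indicator {\<tau>. \<forall>j\<in>UNIV - {i}. \<tau> j \<in> {\<tau> i..}} \<tau> \<partial>clocks)"
      using first_clock_le by (intro nn_integral_mono) (auto simp: indicator_def)
    also have "\<dots> = (\<integral>\<^sup>+s. ennreal (r i s * exp (- cumulative total_rate s)) * f i (ennreal s) * indicator {0..} s \<partial>lborel)"
      by (rule nn_integral_clocks_winner) (use f0 in \<open>auto simp: emeasure_arrival_atLeast\<close>)
    finally show "(\<integral>\<^sup>+\<tau>. f i (\<tau> i) * indicator {\<tau>. first_clock \<tau> = i} \<tau> \<partial>clocks) \<le> \<dots>" .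
    have "(\<integral>\<^sup>+s. ennreal (r i s * exp (- cumulative total_rate s)) * f i (ennreal s) * indicator {0..} s \<partial>lborel) =
      (\<integral>\<^sup>+\<tau>. f i (\<tau> i) * indicator {\<tau>. \<forall>j\<in>UNIV - {i}. \<tau> j \<in> {\<tau> i<..}} \<tau> \<partial>clocks)"
      by (rule nn_integral_clocks_winner[symmetric]) (use f0 in \<open>auto simp: emeasure_arrival_greaterThan\<close>)
    also have "\<dots> \<le> (\<integral>\<^sup>+\<tau>. f i (\<tau> i) * indicator {\<tau>. first_clock \<tau> = i} \<tau> \<partial>clocks)"
    proof (rule nn_integral_mono)
      fix \<tau>
      have "first_clock \<tau> = i" if "\<forall>j\<in>UNIV - {i}. \<tau> j \<in> {\<tau> i<..}"
        using that first_clock_le[of \<tau> i] by (metis DiffI UNIV_I greaterThan_iff leD singletonD)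
      then show "f i (\<tau> i) * indicator {\<tau>. \<forall>j\<in>UNIV - {i}. \<tau> j \<in> {\<tau> i<..}} \<tau> \<le>
          f i (\<tau> i) * indicator {\<tau>. first_clock \<tau> = i} \<tau>"
        by (auto simp: indicator_def)
    qed
    finally show "(\<integral>\<^sup>+s. ennreal (r i s * exp (- cumulative total_rate s)) * f i (ennreal s) * indicator {0..} s \<partial>lborel) \<le>
      (\<integral>\<^sup>+\<tau>. f i (\<tau> i) * indicator {\<tau>. first_clock \<tau> = i} \<tau> \<partial>clocks)" .
  qed
  note winner = this
  have "(\<integral>\<^sup>+\<tau>. f (first_clock \<tau>) (\<tau> (first_clock \<tau>)) \<partial>clocks) =
      (\<integral>\<^sup>+\<tau>. (\<Sum>i\<in>UNIV. f i (\<tau> i) * indicator {\<tau>. first_clock \<tau> = i} \<tau>) \<partial>clocks)"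
    by (intro nn_integral_cong) (simp add: indicator_def of_bool_def if_distrib[of "\<lambda>x. _ * x"] cong: if_cong)
  also have "\<dots> = (\<Sum>i\<in>UNIV. \<integral>\<^sup>+\<tau>. f i (\<tau> i) * indicator {\<tau>. first_clock \<tau> = i} \<tau> \<partial>clocks)"
  proof (rule nn_integral_sum)
    fix i
    have "(\<lambda>\<tau>::'i \<Rightarrow> ennreal. f i (\<tau> i)) \<in> borel_measurable (PiM UNIV (\<lambda>_. borel))"
      by (rule measurable_compose[OF measurable_clock f])
    moreover have "{\<tau> \<in> space (PiM UNIV (\<lambda>_. borel)). first_clock \<tau> = i} \<in> sets (PiM UNIV (\<lambda>_::'i. borel))"
      by measurable
    then have "indicator {\<tau>. first_clock \<tau> = i} \<in> borel_measurable (PiM UNIV (\<lambda>_::'i. borel))"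
      by (intro borel_measurable_indicator) (simp add: space_PiM)
    ultimately show "(\<lambda>\<tau>. f i (\<tau> i) * indicator {\<tau>. first_clock \<tau> = i} \<tau>) \<in> borel_measurable clocks"
      unfolding measurable_cong_sets[OF sets_clocks refl] by (rule borel_measurable_times_ennreal)
  qed
  also have "\<dots> = (\<integral>\<^sup>+s. (\<Sum>i\<in>UNIV. ennreal (r i s * exp (- cumulative total_rate s)) * f i (ennreal s) * indicator {0..} s) \<partial>lborel)"
    unfolding winner
    by (intro nn_integral_sum[symmetric] measurable_weighted_by_law measurable_rate T.measurable_cumulative f)
  also have "\<dots> = (\<integral>\<^sup>+s. (\<Sum>i\<in>UNIV. ennreal (r i s) * f i (ennreal s)) * ennreal (exp (- cumulative total_rate s)) *
      indicator {0..} s \<partial>lborel)"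
    by (intro nn_integral_cong)
      (auto simp: indicator_def sum_distrib_left ennreal_mult rate_nonneg ac_simps intro!: sum.cong)
  finally show ?thesis .
qed

end

section \<open>Thinning\<close>

context hazard
begin

text \<open>After survival up to \<open>s\<close> the arrival restarts with the shifted rate; this
  is the memoryless property on which the renewal argument rests.\<close>

lemma hazard_shift:
  assumes s: "0 \<le> s"
  shows "hazard (\<lambda>v. r (s + v))"
proof
  show "set_integrable lborel {0..T} (\<lambda>v. r (s + v))" if "0 \<le> T" for T
  proof -
    have "integrable lborel (\<lambda>v. indicator {0..s + T} (s + 1 * v) *\<^sub>R r (s + 1 * v))"
      using rate_integrable[of "s + T"] s that
      by (subst lborel_integrable_real_affine_iff) (auto simp: set_integrable_def)
    moreover have "indicator {0..s + T} (s + 1 * v) = (indicator {- s..T} v :: real)" for v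
      by (auto simp: indicator_def)
    ultimately have "set_integrable lborel {- s..T} (\<lambda>v. r (s + v))"
      by (simp add: set_integrable_def)
    then show ?thesis by (rule set_integrable_subset) (use s in auto)
  qed
qed (use s rate_nonneg in auto)

lemma cumulative_shift:
  assumes s: "0 \<le> s" and u: "0 \<le> u"
  shows "cumulative (\<lambda>v. r (s + v)) u = cumulative r (s + u) - cumulative r s"
proof -
  interpret S: hazard "\<lambda>v. r (s + v)" by (rule hazard_shift[OF s])
  have "ennreal (cumulative r (s + u)) = (\<integral>\<^sup>+v. ennreal (r v) * indicator {0..s + u} v \<partial>lborel)"
    using s u by (simp add: nn_integral_rate)
  \<comment> \<open>The two intervals overlap in the single point \<open>s\<close>, a null
    set.\<close>
  also have "\<dots> = (\<integral>\<^sup>+v. ennreal (r v) * indicator {0..s} v + ennreal (r v) * indicator {s..s + u} v \<partial>lborel)"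
    by (rule nn_integral_cong_AE, use AE_lborel_singleton[of s] in eventually_elim)
      (use s u in \<open>auto simp: indicator_def\<close>)
  also have "\<dots> = ennreal (cumulative r s) + (\<integral>\<^sup>+v. ennreal (r v) * indicator {s..s + u} v \<partial>lborel)"
    using s by (simp add: nn_integral_add nn_integral_rate)
  also have "(\<integral>\<^sup>+v. ennreal (r v) * indicator {s..s + u} v \<partial>lborel) =
      (\<integral>\<^sup>+v. ennreal (r (s + v)) * indicator {0..u} v \<partial>lborel)"
    by (subst nn_integral_real_affine[where c=1 and t=s]) (auto intro!: nn_integral_cong simp: indicator_def)
  also have "\<dots> = ennreal (cumulative (\<lambda>v. r (s + v)) u)"
    using u by (rule S.nn_integral_rate)
  finally show ?thesis
    using cumulative_nonneg[OF s] cumulative_nonneg[of "s + u"] S.cumulative_nonneg[OF u] s u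
    by (simp flip: ennreal_plus)
qed

end

text \<open>The rejected proposals are an arrival process of their own, with rate
  \<open>m - r\<close>.\<close>

lemma hazard_diff:
  assumes "hazard m" "hazard r" and le: "\<And>s. 0 \<le> s \<Longrightarrow> r s \<le> m s"
  shows "hazard (\<lambda>s. m s - r s)"
    and "0 \<le> t \<Longrightarrow> cumulative (\<lambda>s. m s - r s) t = cumulative m t - cumulative r t"
proof -
  interpret m: hazard m by fact
  interpret r: hazard r by fact
  show "hazard (\<lambda>s. m s - r s)"
    by unfold_locales (use le in \<open>auto intro!: set_integral_diff(1) m.rate_integrable r.rate_integrable\<close>)
  show "0 \<le> t \<Longrightarrow> cumulative (\<lambda>s. m s - r s) t = cumulative m t - cumulative r t"
    unfolding cumulative_def by (intro set_integral_diff(2) m.rate_integrable r.rate_integrable)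
qed

text \<open>First accepted arrival: proposals at rate \<open>m\<close>, accepted with probability \<open>r / m\<close>, and
  after a rejection the accepted arrivals restart with their law given survival up to that time.\<close>

lemma thinning_identity:
  assumes "hazard m" "hazard r" and le: "\<And>s. 0 \<le> s \<Longrightarrow> r s \<le> m s"
    and [measurable]: "A \<in> borel_measurable borel"
  shows "(\<integral>\<^sup>+s. (A s + ennreal (m s - r s) *
        (\<integral>\<^sup>+u. A (s + u) * ennreal (exp (- (cumulative r (s + u) - cumulative r s))) * indicator {0..} u \<partial>lborel)) *
      ennreal (exp (- cumulative m s)) * indicator {0..} s \<partial>lborel) =
    (\<integral>\<^sup>+s. A s * ennreal (exp (- cumulative r s)) * indicator {0..} s \<partial>lborel)"
proof -
  interpret m: hazard m by fact
  interpret r: hazard r by fact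
  interpret d: hazard "\<lambda>s. m s - r s" by (rule hazard_diff(1)) fact+
  have dc: "cumulative (\<lambda>s. m s - r s) t = cumulative m t - cumulative r t" if "0 \<le> t" for t
    by (rule hazard_diff(2)) (use assms that in auto)
  have "(\<integral>\<^sup>+s. (A s + ennreal (m s - r s) *
        (\<integral>\<^sup>+u. A (s + u) * ennreal (exp (- (cumulative r (s + u) - cumulative r s))) * indicator {0..} u \<partial>lborel)) *
      ennreal (exp (- cumulative m s)) * indicator {0..} s \<partial>lborel) =
    (\<integral>\<^sup>+s. A s * ennreal (exp (- cumulative m s)) * indicator {0..} s +
      (\<integral>\<^sup>+q. A q * ennreal (exp (- cumulative r q)) *
        (ennreal ((m s - r s) * exp (- cumulative (\<lambda>s. m s - r s) s)) * indicator {0..q} s) * indicator {0..} q \<partial>lborel) \<partial>lborel)"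
  proof (rule nn_integral_cong)
    fix s :: real
    have "(\<integral>\<^sup>+u. A (s + u) * ennreal (exp (- (cumulative r (s + u) - cumulative r s))) * indicator {0..} u \<partial>lborel) =
        (\<integral>\<^sup>+q. A q * ennreal (exp (- (cumulative r q - cumulative r s))) * indicator {s..} q \<partial>lborel)"
      by (subst (2) nn_integral_real_affine[where c=1 and t=s]) (auto intro!: nn_integral_cong simp: indicator_def)
    moreover have "ennreal (m s - r s) * (\<integral>\<^sup>+q. A q * ennreal (exp (- (cumulative r q - cumulative r s))) * indicator {s..} q \<partial>lborel) *
        ennreal (exp (- cumulative m s)) =
      (\<integral>\<^sup>+q. A q * ennreal (exp (- cumulative r q)) *
        (ennreal ((m s - r s) * exp (- cumulative (\<lambda>s. m s - r s) s)) * indicator {0..q} s) * indicator {0..} q \<partial>lborel)"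
      if s: "0 \<le> s"
    proof -
      have "ennreal (m s - r s) * (\<integral>\<^sup>+q. A q * ennreal (exp (- (cumulative r q - cumulative r s))) * indicator {s..} q \<partial>lborel) *
          ennreal (exp (- cumulative m s)) =
        (\<integral>\<^sup>+q. (ennreal (m s - r s) * ennreal (exp (- cumulative m s))) *
          (A q * ennreal (exp (- (cumulative r q - cumulative r s))) * indicator {s..} q) \<partial>lborel)"
        by (subst nn_integral_cmult) (auto simp: ac_simps)
      also have "\<dots> = (\<integral>\<^sup>+q. A q * ennreal (exp (- cumulative r q)) *
        (ennreal ((m s - r s) * exp (- cumulative (\<lambda>s. m s - r s) s)) * indicator {0..q} s) * indicator {0..} q \<partial>lborel)"
      proof (rule nn_integral_cong)
        fix q
        \<comment> \<open>With M and R the integrated rates, exp (- M s) exp (- (R q - R s)) = exp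
          (- R q) exp (- (M - R) s): what depends on \<open>s\<close> is now the density of the
          first arrival at the rejection rate.\<close>
        have "ennreal (m s - r s) * ennreal (exp (- cumulative m s)) * ennreal (exp (- (cumulative r q - cumulative r s))) =
            ennreal (exp (- cumulative r q)) * ennreal ((m s - r s) * exp (- cumulative (\<lambda>s. m s - r s) s))"
          using le[OF s] by (simp add: dc[OF s] exp_diff exp_minus field_simps flip: ennreal_mult)
        then show "(ennreal (m s - r s) * ennreal (exp (- cumulative m s))) *
          (A q * ennreal (exp (- (cumulative r q - cumulative r s))) * indicator {s..} q) =
          A q * ennreal (exp (- cumulative r q)) *
        (ennreal ((m s - r s) * exp (- cumulative (\<lambda>s. m s - r s) s)) * indicator {0..q} s) * indicator {0..} q"
          using s by (auto simp: indicator_def ac_simps)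
      qed
      finally show ?thesis .
    qed
    ultimately show "(A s + ennreal (m s - r s) *
        (\<integral>\<^sup>+u. A (s + u) * ennreal (exp (- (cumulative r (s + u) - cumulative r s))) * indicator {0..} u \<partial>lborel)) *
      ennreal (exp (- cumulative m s)) * indicator {0..} s =
      A s * ennreal (exp (- cumulative m s)) * indicator {0..} s +
      (\<integral>\<^sup>+q. A q * ennreal (exp (- cumulative r q)) *
        (ennreal ((m s - r s) * exp (- cumulative (\<lambda>s. m s - r s) s)) * indicator {0..q} s) * indicator {0..} q \<partial>lborel)"
      by (cases "0 \<le> s") (auto simp: distrib_right)
  qed
  also have "\<dots> = (\<integral>\<^sup>+s. A s * ennreal (exp (- cumulative m s)) * indicator {0..} s \<partial>lborel) +
      (\<integral>\<^sup>+s. (\<integral>\<^sup>+q. A q * ennreal (exp (- cumulative r q)) *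
        (ennreal ((m s - r s) * exp (- cumulative (\<lambda>s. m s - r s) s)) * (if 0 \<le> s \<and> s \<le> q then 1 else 0)) * indicator {0..} q \<partial>lborel) \<partial>lborel)"
    by (subst nn_integral_add) (auto simp: indicator_def of_bool_def cong: if_cong)
  also have "(\<integral>\<^sup>+s. (\<integral>\<^sup>+q. A q * ennreal (exp (- cumulative r q)) *
        (ennreal ((m s - r s) * exp (- cumulative (\<lambda>s. m s - r s) s)) * (if 0 \<le> s \<and> s \<le> q then 1 else 0)) * indicator {0..} q \<partial>lborel) \<partial>lborel) =
      (\<integral>\<^sup>+q. (\<integral>\<^sup>+s. A q * ennreal (exp (- cumulative r q)) *
        (ennreal ((m s - r s) * exp (- cumulative (\<lambda>s. m s - r s) s)) * (if 0 \<le> s \<and> s \<le> q then 1 else 0)) * indicator {0..} q \<partial>lborel) \<partial>lborel)"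
    by (rule lborel_pair.Fubini') measurable
  \<comment> \<open>For a fixed acceptance time \<open>q\<close>, integrating over \<open>s\<close>
    gives the probability that the rejection clock has rung by time \<open>q\<close>.\<close>
  also have "\<dots> = (\<integral>\<^sup>+q. A q * ennreal (exp (- cumulative r q)) * ennreal (1 - exp (- cumulative (\<lambda>s. m s - r s) q)) * indicator {0..} q \<partial>lborel)"
  proof (rule nn_integral_cong)
    fix q
    have "(\<integral>\<^sup>+s. A q * ennreal (exp (- cumulative r q)) *
        (ennreal ((m s - r s) * exp (- cumulative (\<lambda>s. m s - r s) s)) * (if 0 \<le> s \<and> s \<le> q then 1 else 0)) * indicator {0..} q \<partial>lborel) =
      (\<integral>\<^sup>+s. (A q * ennreal (exp (- cumulative r q)) * indicator {0..} q) *
        (ennreal ((m s - r s) * exp (- cumulative (\<lambda>s. m s - r s) s)) * indicator {0..q} s) \<partial>lborel)"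
      by (intro nn_integral_cong) (auto simp: indicator_def)
    also have "\<dots> = (A q * ennreal (exp (- cumulative r q)) * indicator {0..} q) *
      (\<integral>\<^sup>+s. ennreal ((m s - r s) * exp (- cumulative (\<lambda>s. m s - r s) s)) * indicator {0..q} s \<partial>lborel)"
      by (rule nn_integral_cmult) measurable
    also have "\<dots> = A q * ennreal (exp (- cumulative r q)) * ennreal (1 - exp (- cumulative (\<lambda>s. m s - r s) q)) * indicator {0..} q"
      by (cases "0 \<le> q") (auto simp: d.nn_integral_rate_exp)
    finally show "(\<integral>\<^sup>+s. A q * ennreal (exp (- cumulative r q)) *
        (ennreal ((m s - r s) * exp (- cumulative (\<lambda>s. m s - r s) s)) * (if 0 \<le> s \<and> s \<le> q then 1 else 0)) * indicator {0..} q \<partial>lborel) =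
      A q * ennreal (exp (- cumulative r q)) * ennreal (1 - exp (- cumulative (\<lambda>s. m s - r s) q)) * indicator {0..} q" .
  qed
  also have "(\<integral>\<^sup>+s. A s * ennreal (exp (- cumulative m s)) * indicator {0..} s \<partial>lborel) + \<dots> =
      (\<integral>\<^sup>+s. A s * ennreal (exp (- cumulative m s)) * indicator {0..} s +
        A s * ennreal (exp (- cumulative r s)) * ennreal (1 - exp (- cumulative (\<lambda>s. m s - r s) s)) * indicator {0..} s \<partial>lborel)"
    by (rule nn_integral_add[symmetric]) measurable
  also have "\<dots> = (\<integral>\<^sup>+s. A s * ennreal (exp (- cumulative r s)) * indicator {0..} s \<partial>lborel)"
  proof (rule nn_integral_cong)
    fix s :: real
    \<comment> \<open>Acceptance at \<open>s\<close> without an earlier rejection, and acceptance at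
      \<open>s\<close> after some rejection, add up to acceptance at \<open>s\<close>.\<close>
    have "ennreal (exp (- cumulative m s)) + ennreal (exp (- cumulative r s)) * ennreal (1 - exp (- cumulative (\<lambda>s. m s - r s) s)) =
        ennreal (exp (- cumulative r s))" if "0 \<le> s"
      using d.cumulative_nonneg[OF that]
      by (simp add: dc[OF that] right_diff_distrib exp_add[symmetric] flip: ennreal_mult ennreal_plus)
    then show "A s * ennreal (exp (- cumulative m s)) * indicator {0..} s +
        A s * ennreal (exp (- cumulative r s)) * ennreal (1 - exp (- cumulative (\<lambda>s. m s - r s) s)) * indicator {0..} s =
      A s * ennreal (exp (- cumulative r s)) * indicator {0..} s"
      by (cases "0 \<le> s") (auto simp: mult.assoc distrib_left[symmetric])
  qed
  finally show ?thesis .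
qed

section \<open>Zig-zag kernels\<close>

lemma finite_velocities: "finite (velocities :: (real^'p::finite) set)"
proof -
  have "velocities \<subseteq> vec_lambda ` PiE (UNIV::'p set) (\<lambda>_. {1, -1::real})"
  proof
    fix \<theta> :: "real^'p" assume "\<theta> \<in> velocities"
    then have "(\<lambda>i. \<theta> $ i) \<in> PiE UNIV (\<lambda>_. {1, -1})"
      by (auto simp: velocities_def)
    then show "\<theta> \<in> vec_lambda ` PiE UNIV (\<lambda>_. {1, -1})"
      by (rule rev_image_eqI) simp
  qed
  then show ?thesis by (rule finite_subset) (intro finite_imageI finite_PiE, auto)
qed

lemma velocities_iff: "\<theta> \<in> velocities \<longleftrightarrow> (\<forall>i. (\<theta> $ i)\<^sup>2 = 1)"
  by (simp add: velocities_def power2_eq_1_iff)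

lemma flip_velocities [simp]: "flip i \<theta> \<in> velocities \<longleftrightarrow> \<theta> \<in> velocities"
  by (auto simp: velocities_iff flip_def)

lemma uminus_velocities [simp]: "- \<theta> \<in> velocities \<longleftrightarrow> \<theta> \<in> velocities"
  by (simp add: velocities_iff)

lemma flip_flip [simp]: "flip i (flip i \<theta>) = \<theta>"
  by (simp add: flip_def vec_eq_iff)

lemma flip_uminus: "flip i (- \<theta>) = - flip i \<theta>"
  by (simp add: flip_def vec_eq_iff)

text \<open>Every flip is visible as a change of velocity; this is what lets the bounces be
  recovered from the sequence of all skeleton points.\<close>

lemma flip_neq: "\<theta> \<in> velocities \<Longrightarrow> flip i \<theta> \<noteq> \<theta>"
proof
  assume "\<theta> \<in> velocities" "flip i \<theta> = \<theta>"
  then have "flip i \<theta> $ i = \<theta> $ i" "\<theta> $ i = 1 \<or> \<theta> $ i = - 1"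
    by (simp_all add: velocities_def)
  then show False by (auto simp: flip_def)
qed

lemma space_skeleton_space [simp]: "z \<in> space skeleton_space \<longleftrightarrow> snd (snd z) \<in> velocities"
  by (cases z) (auto simp: skeleton_space_def state_space_def space_pair_measure)

lemma measurable_skeletonI:
  assumes [measurable]: "a \<in> borel_measurable M" "b \<in> borel_measurable M"
    "c \<in> measurable M (count_space velocities)"
  shows "(\<lambda>x. (a x, b x, c x)) \<in> measurable M skeleton_space"
  unfolding skeleton_space_def state_space_def by measurable

lemma measurable_skeleton_time [measurable]: "fst \<in> borel_measurable skeleton_space"
  and measurable_skeleton_state [measurable]: "snd \<in> measurable skeleton_space state_space"
  and measurable_skeleton_position [measurable]: "(\<lambda>z. fst (snd z)) \<in> borel_measurable skeleton_space"
  and measurable_skeleton_velocity [measurable]: "(\<lambda>z. snd (snd z)) \<in> measurable skeleton_space (count_space velocities)"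
  unfolding skeleton_space_def state_space_def by measurable

lemma countable_velocities: "countable velocities"
  by (rule countable_finite[OF finite_velocities])

text \<open>There are finitely many velocities, so measurability may be checked with the velocity
  fixed. This removes the velocity as a variable from all later measurability proofs.\<close>

lemma measurable_velocity_cases:
  assumes "\<And>\<theta>. \<theta> \<in> velocities \<Longrightarrow> (\<lambda>x. f x \<theta>) \<in> measurable M N"
    and "g \<in> measurable M (count_space velocities)"
  shows "(\<lambda>x. f x (g x)) \<in> measurable M N"
  using assms by (rule measurable_compose_countable'[OF _ _ countable_velocities])

locale zigzag_rates =
  fixes rate :: "'p::finite \<Rightarrow> real^'p \<Rightarrow> real^'p \<Rightarrow> real"
  assumes measurable_rate: "\<And>i \<theta>. \<theta> \<in> velocities \<Longrightarrow> (\<lambda>\<xi>. rate i \<xi> \<theta>) \<in> borel_measurable borel"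
    and rate_nonneg: "\<And>i \<xi> \<theta>. \<theta> \<in> velocities \<Longrightarrow> 0 \<le> rate i \<xi> \<theta>"
    and rate_integrable: "\<And>i \<xi> \<theta> T. \<theta> \<in> velocities \<Longrightarrow> 0 \<le> T \<Longrightarrow>
      set_integrable lborel {0..T} (\<lambda>s. rate i (\<xi> + s *\<^sub>R \<theta>) \<theta>)"
begin

definition "bounce_rate \<xi> \<theta> = (\<Sum>i\<in>UNIV. rate i \<xi> \<theta>)"

lemma measurable_bounce_rate: "\<theta> \<in> velocities \<Longrightarrow> (\<lambda>\<xi>. bounce_rate \<xi> \<theta>) \<in> borel_measurable borel"
  unfolding bounce_rate_def by (intro borel_measurable_sum measurable_rate)

lemma bounce_rate_nonneg: "\<theta> \<in> velocities \<Longrightarrow> 0 \<le> bounce_rate \<xi> \<theta>"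
  unfolding bounce_rate_def by (intro sum_nonneg rate_nonneg)

lemma hazard_rate: "\<theta> \<in> velocities \<Longrightarrow> hazard (\<lambda>s. rate i (\<xi> + s *\<^sub>R \<theta>) \<theta>)"
  by unfold_locales (auto intro: rate_nonneg rate_integrable measurable_compose[OF _ measurable_rate])

lemma competing: "\<theta> \<in> velocities \<Longrightarrow> competing_hazards (\<lambda>i s. rate i (\<xi> + s *\<^sub>R \<theta>) \<theta>)"
  by (intro competing_hazards.intro hazard_rate)

lemma hazard_bounce_rate: "\<theta> \<in> velocities \<Longrightarrow> hazard (\<lambda>s. bounce_rate (\<xi> + s *\<^sub>R \<theta>) \<theta>)"
proof -
  assume "\<theta> \<in> velocities"
  then interpret competing_hazards "\<lambda>i s. rate i (\<xi> + s *\<^sub>R \<theta>) \<theta>" by (rule competing)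
  show ?thesis using hazard_total by (simp add: total_rate_def[abs_def] bounce_rate_def)
qed

end

text \<open>A kernel whose proposals arrive at the rate \<open>bound \<xi> \<theta>\<close> along the ray from
  \<open>(\<xi>, \<theta>)\<close>, and at which component \<open>i\<close> is flipped at the rate \<open>rate i\<close>; the
  remaining proposals leave the velocity unchanged.\<close>

locale thinned_kernel = zigzag_rates rate
  for rate :: "'p::finite \<Rightarrow> real^'p \<Rightarrow> real^'p \<Rightarrow> real" +
  fixes bound :: "real^'p \<Rightarrow> real^'p \<Rightarrow> real \<Rightarrow> real"
    and K :: "'p skeleton_point \<Rightarrow> 'p skeleton_point measure"
  assumes measurable_bound: "\<And>\<theta>. \<theta> \<in> velocities \<Longrightarrow> (\<lambda>(\<xi>, s). bound \<xi> \<theta> s) \<in> borel_measurable (borel \<Otimes>\<^sub>M borel)"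
    and hazard_bound: "\<And>\<xi> \<theta>. \<theta> \<in> velocities \<Longrightarrow> hazard (bound \<xi> \<theta>)"
    and bounce_rate_le_bound: "\<And>\<xi> \<theta> s. \<theta> \<in> velocities \<Longrightarrow> 0 \<le> s \<Longrightarrow> bounce_rate (\<xi> + s *\<^sub>R \<theta>) \<theta> \<le> bound \<xi> \<theta> s"
    and kernel: "\<And>z. z \<in> space skeleton_space \<Longrightarrow> K z \<in> space (prob_algebra skeleton_space)"
    and kernel_infinite: "\<And>\<xi> \<theta>. \<theta> \<in> velocities \<Longrightarrow> K (\<infinity>, \<xi>, \<theta>) = return skeleton_space (\<infinity>, \<xi>, \<theta>)"
    and kernel_no_event: "\<And>t \<xi> \<theta>. t \<noteq> \<infinity> \<Longrightarrow> \<theta> \<in> velocities \<Longrightarrow>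
      AE z in K (t, \<xi>, \<theta>). fst z = \<infinity> \<longrightarrow> snd z = (\<xi>, \<theta>)"
    and kernel_event: "\<And>t \<xi> \<theta> F. t \<noteq> \<infinity> \<Longrightarrow> \<theta> \<in> velocities \<Longrightarrow> F \<in> borel_measurable skeleton_space \<Longrightarrow>
      (\<And>x. F (\<infinity>, x) = 0) \<Longrightarrow>
      (\<integral>\<^sup>+z. F z \<partial>K (t, \<xi>, \<theta>)) =
      (\<integral>\<^sup>+s. ((\<Sum>i\<in>UNIV. ennreal (rate i (\<xi> + s *\<^sub>R \<theta>) \<theta>) * F (t + ennreal s, \<xi> + s *\<^sub>R \<theta>, flip i \<theta>)) +
          ennreal (bound \<xi> \<theta> s - bounce_rate (\<xi> + s *\<^sub>R \<theta>) \<theta>) * F (t + ennreal s, \<xi> + s *\<^sub>R \<theta>, \<theta>)) *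
        ennreal (exp (- cumulative (bound \<xi> \<theta>) s)) * indicator {0..} s \<partial>lborel)"

context zigzag_rates
begin

definition zigzag_next :: "ennreal \<Rightarrow> real^'p \<Rightarrow> real^'p \<Rightarrow> ('p \<Rightarrow> ennreal) \<Rightarrow> 'p skeleton_point" where
  "zigzag_next t \<xi> \<theta> \<tau> = (if \<tau> (first_clock \<tau>) = \<infinity> then (\<infinity>, \<xi>, \<theta>)
    else (t + \<tau> (first_clock \<tau>), \<xi> + enn2real (\<tau> (first_clock \<tau>)) *\<^sub>R \<theta>, flip (first_clock \<tau>) \<theta>))"

lemma measurable_zigzag_next:
  assumes \<theta>: "\<theta> \<in> velocities"
  shows "zigzag_next t \<xi> \<theta> \<in> measurable (PiM UNIV (\<lambda>_. borel)) skeleton_space"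
  unfolding zigzag_next_def[abs_def]
proof (rule measurable_If)
  show "{\<tau> \<in> space (PiM UNIV (\<lambda>_. borel)). \<tau> (first_clock \<tau>) = \<infinity>} \<in> sets (PiM UNIV (\<lambda>_::'p. borel))"
    by measurable
  show "(\<lambda>\<tau>. (\<infinity>, \<xi>, \<theta>)) \<in> measurable (PiM UNIV (\<lambda>_::'p. borel)) skeleton_space"
    using \<theta> by (intro measurable_const) simp
  have "(\<lambda>i. flip i \<theta>) \<in> measurable (count_space UNIV) (count_space velocities)"
    using \<theta> by simp
  from measurable_compose[OF measurable_first_clock this]
  have [measurable]: "(\<lambda>\<tau>. flip (first_clock \<tau>) \<theta>) \<in> measurable (PiM UNIV (\<lambda>_::'p. borel)) (count_space velocities)" .
  show "(\<lambda>\<tau>. (t + \<tau> (first_clock \<tau>), \<xi> + enn2real (\<tau> (first_clock \<tau>)) *\<^sub>R \<theta>, flip (first_clock \<tau>) \<theta>))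
      \<in> measurable (PiM UNIV (\<lambda>_::'p. borel)) skeleton_space"
    by (rule measurable_skeletonI) measurable
qed

lemma zigzag_step_eq_distr:
  assumes \<theta>: "\<theta> \<in> velocities" and t: "t \<noteq> \<infinity>"
  shows "zigzag_step rate (t, \<xi>, \<theta>) =
    distr (PiM UNIV (\<lambda>i. first_arrival_law (\<lambda>s. rate i (\<xi> + s *\<^sub>R \<theta>) \<theta>))) skeleton_space (zigzag_next t \<xi> \<theta>)"
proof -
  interpret competing_hazards "\<lambda>i s. rate i (\<xi> + s *\<^sub>R \<theta>) \<theta>" by (rule competing[OF \<theta>])
  have "zigzag_next t \<xi> \<theta> \<in> measurable clocks skeleton_space"
    unfolding measurable_cong_sets[OF sets_clocks refl] by (rule measurable_zigzag_next[OF \<theta>])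
  from bind_return_distr'[OF _ this] show ?thesis
    using t unfolding zigzag_step_def zigzag_next_def[abs_def] first_clock_def Let_def by simp
qed

text \<open>As \<open>F\<close> vanishes at time \<infinity>, the event that no clock rings
  contributes nothing, and the integral is governed by the density of the first ring.\<close>

lemma nn_integral_zigzag_step:
  assumes \<theta>: "\<theta> \<in> velocities" and t: "t \<noteq> \<infinity>"
    and F [measurable]: "F \<in> borel_measurable skeleton_space" and F0: "\<And>x. F (\<infinity>, x) = 0"
  shows "(\<integral>\<^sup>+z. F z \<partial>zigzag_step rate (t, \<xi>, \<theta>)) =
    (\<integral>\<^sup>+s. (\<Sum>i\<in>UNIV. ennreal (rate i (\<xi> + s *\<^sub>R \<theta>) \<theta>) * F (t + ennreal s, \<xi> + s *\<^sub>R \<theta>, flip i \<theta>)) *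
      ennreal (exp (- cumulative (\<lambda>s. bounce_rate (\<xi> + s *\<^sub>R \<theta>) \<theta>) s)) * indicator {0..} s \<partial>lborel)"
proof -
  interpret competing_hazards "\<lambda>i s. rate i (\<xi> + s *\<^sub>R \<theta>) \<theta>" by (rule competing[OF \<theta>])
  let ?f = "\<lambda>i x. if x = \<infinity> then 0 else F (t + x, \<xi> + enn2real x *\<^sub>R \<theta>, flip i \<theta>)"
  have "zigzag_next t \<xi> \<theta> \<in> measurable clocks skeleton_space"
    unfolding measurable_cong_sets[OF sets_clocks refl] by (rule measurable_zigzag_next[OF \<theta>])
  then have "(\<integral>\<^sup>+z. F z \<partial>zigzag_step rate (t, \<xi>, \<theta>)) = (\<integral>\<^sup>+\<tau>. F (zigzag_next t \<xi> \<theta> \<tau>) \<partial>clocks)"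
    unfolding zigzag_step_eq_distr[OF \<theta> t] by (rule nn_integral_distr) simp
  also have "\<dots> = (\<integral>\<^sup>+\<tau>. ?f (first_clock \<tau>) (\<tau> (first_clock \<tau>)) \<partial>clocks)"
    by (intro nn_integral_cong) (simp add: zigzag_next_def F0[unfolded infinity_ennreal_def])
  also have "\<dots> = (\<integral>\<^sup>+s. (\<Sum>i\<in>UNIV. ennreal (rate i (\<xi> + s *\<^sub>R \<theta>) \<theta>) * ?f i (ennreal s)) *
      ennreal (exp (- cumulative total_rate s)) * indicator {0..} s \<partial>lborel)"
  proof (rule nn_integral_clocks)
    fix i
    have "(\<lambda>x::ennreal. (t + x, \<xi> + enn2real x *\<^sub>R \<theta>, flip i \<theta>)) \<in> measurable borel skeleton_space"
      using \<theta> by (intro measurable_skeletonI) auto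
    from measurable_compose[OF this F] show "?f i \<in> borel_measurable borel"
      by measurable
  qed simp
  also have "\<dots> = (\<integral>\<^sup>+s. (\<Sum>i\<in>UNIV. ennreal (rate i (\<xi> + s *\<^sub>R \<theta>) \<theta>) * F (t + ennreal s, \<xi> + s *\<^sub>R \<theta>, flip i \<theta>)) *
      ennreal (exp (- cumulative (\<lambda>s. bounce_rate (\<xi> + s *\<^sub>R \<theta>) \<theta>) s)) * indicator {0..} s \<partial>lborel)"
    by (intro nn_integral_cong) (auto simp: indicator_def bounce_rate_def total_rate_def[abs_def])
  finally show ?thesis .
qed

text \<open>With the bounce rate itself as proposal rate nothing is rejected. Hence all facts about
  thinned kernels apply to the zig-zag step as well as to the sub-sampled attempt.\<close>

lemma thinned_kernel_zigzag_step:
  "thinned_kernel rate (\<lambda>\<xi> \<theta> s. bounce_rate (\<xi> + s *\<^sub>R \<theta>) \<theta>) (zigzag_step rate)"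
proof (intro thinned_kernel.intro thinned_kernel_axioms.intro zigzag_rates_axioms)
  fix \<theta> :: "real^'p" assume \<theta>: "\<theta> \<in> velocities"
  show "(\<lambda>(\<xi>, s). bounce_rate (\<xi> + s *\<^sub>R \<theta>) \<theta>) \<in> borel_measurable (borel \<Otimes>\<^sub>M borel)"
    unfolding case_prod_beta by (rule measurable_compose[OF _ measurable_bounce_rate[OF \<theta>]]) measurable
  show "hazard (\<lambda>s. bounce_rate (\<xi> + s *\<^sub>R \<theta>) \<theta>)" for \<xi>
    by (rule hazard_bounce_rate[OF \<theta>])
  show "zigzag_step rate (\<infinity>, \<xi>, \<theta>) = return skeleton_space (\<infinity>, \<xi>, \<theta>)" for \<xi>
    by (simp add: zigzag_step_def)
  fix t :: ennreal and \<xi> :: "real^'p"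
  assume t: "t \<noteq> \<infinity>"
  interpret competing_hazards "\<lambda>i s. rate i (\<xi> + s *\<^sub>R \<theta>) \<theta>" by (rule competing[OF \<theta>])
  have nxt [measurable]: "zigzag_next t \<xi> \<theta> \<in> measurable clocks skeleton_space"
    unfolding measurable_cong_sets[OF sets_clocks refl] by (rule measurable_zigzag_next[OF \<theta>])
  have "{z. fst z = \<infinity> \<longrightarrow> snd z = (\<xi>, \<theta>)} \<inter> space skeleton_space \<in> sets skeleton_space"
  proof -
    have "Measurable.pred skeleton_space (\<lambda>z. fst z = \<infinity> \<longrightarrow> fst (snd z) = \<xi> \<and> snd (snd z) = \<theta>)"
      using \<theta> by measurable
    then show ?thesis by (simp add: pred_def prod_eq_iff Int_def conj_commute)
  qed
  then show "AE z in zigzag_step rate (t, \<xi>, \<theta>). fst z = \<infinity> \<longrightarrow> snd z = (\<xi>, \<theta>)"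
    unfolding zigzag_step_eq_distr[OF \<theta> t]
    by (subst AE_distr_iff[OF nxt])
      (use t in \<open>auto simp: zigzag_next_def ennreal_add_eq_top Int_def conj_commute intro!: AE_I2\<close>)
next
  fix z :: "'p skeleton_point" assume "z \<in> space skeleton_space"
  moreover obtain t \<xi> \<theta> where z: "z = (t, \<xi>, \<theta>)" by (cases z)
  ultimately have \<theta>: "\<theta> \<in> velocities" by simp
  interpret competing_hazards "\<lambda>i s. rate i (\<xi> + s *\<^sub>R \<theta>) \<theta>" by (rule competing[OF \<theta>])
  interpret P: prob_space clocks by (rule prob_space_clocks)
  have nxt: "zigzag_next t \<xi> \<theta> \<in> measurable clocks skeleton_space" for t
    unfolding measurable_cong_sets[OF sets_clocks refl] by (rule measurable_zigzag_next[OF \<theta>])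
  show "zigzag_step rate z \<in> space (prob_algebra skeleton_space)"
  proof (cases "t = \<infinity>")
    case True
    then show ?thesis using \<theta> by (simp add: z zigzag_step_def space_prob_algebra prob_space_return)
  next
    case False
    then show ?thesis
      using P.prob_space_distr[OF nxt] by (simp add: z zigzag_step_eq_distr[OF \<theta>] space_prob_algebra)
  qed
qed (simp_all add: nn_integral_zigzag_step)

end

section \<open>The sub-sampled bouncing attempt\<close>

lemma prob_space_unit_uniform: "uniform_measure lborel {0<..<1::real} \<in> space (prob_algebra borel)"
  by (auto simp: space_prob_algebra intro!: prob_space_uniform_measure)

lemma nn_integral_unit_uniform:
  assumes "0 \<le> p" "p \<le> 1"
  shows "(\<integral>\<^sup>+u. (if u < p then x else y) \<partial>uniform_measure lborel {0<..<1::real}) =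
    ennreal p * x + ennreal (1 - p) * y"
proof -
  have "(\<integral>\<^sup>+u. (if u < p then x else y) \<partial>uniform_measure lborel {0<..<1::real}) =
      (\<integral>\<^sup>+u. x * indicator {0<..<p} u + y * indicator {p..<1} u \<partial>lborel)"
    by (subst nn_integral_uniform_measure, measurable, simp add: divide_ennreal_def)
      (use assms AE_lborel_singleton[of 0] in \<open>intro nn_integral_cong_AE, auto elim!: eventually_mono simp: indicator_def\<close>)
  also have "\<dots> = x * ennreal p + y * ennreal (1 - p)"
    using assms by (subst nn_integral_add) (simp_all add: nn_integral_cmult_indicator)
  finally show ?thesis by (simp add: mult.commute)
qed

text \<open>An unthinned prior event flips at the rate \<open>M0\<close>. The last assumption
  therefore asks either for thinning or for the exact bound \<open>M0 = m_prior\<close>; in both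
  cases prior flips occur at the rate \<open>m_prior\<close>.\<close>

locale subsampled_zigzag =
  fixes U0 :: "real^'p::finite \<Rightarrow> real"
    and \<mu> :: "'p \<Rightarrow> 'a measure"
    and g :: "'p \<Rightarrow> real^'p \<Rightarrow> 'a \<Rightarrow> real"
    and M0 Ml :: "'p \<Rightarrow> real^'p \<Rightarrow> real^'p \<Rightarrow> real \<Rightarrow> real"
    and thin :: bool
  assumes measurable_partial_U0: "\<And>i. partial i U0 \<in> borel_measurable borel"
    and estimator_prob: "\<And>i. prob_space (\<mu> i)"
    and estimator_measurable: "\<And>i. (\<lambda>(\<xi>, a). g i \<xi> a) \<in> borel_measurable (borel \<Otimes>\<^sub>M \<mu> i)"
    and estimator_integrable: "\<And>i \<xi>. integrable (\<mu> i) (g i \<xi>)"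
    and bound_lik: "admissible_bound Ml"
      "\<And>i \<xi> \<theta> t a. \<theta> \<in> velocities \<Longrightarrow> 0 \<le> t \<Longrightarrow> a \<in> space (\<mu> i) \<Longrightarrow> m_lik g i \<xi> \<theta> t a \<le> Ml i \<xi> \<theta> t"
    and bound_prior: "admissible_bound M0"
      "\<And>i \<xi> \<theta> t. \<theta> \<in> velocities \<Longrightarrow> 0 \<le> t \<Longrightarrow> m_prior U0 i \<xi> \<theta> t \<le> M0 i \<xi> \<theta> t"
    and prior_step: "thin \<or> (\<forall>i \<xi>. \<forall>\<theta>\<in>velocities. \<forall>t\<ge>0. M0 i \<xi> \<theta> t = m_prior U0 i \<xi> \<theta> t)"
begin

abbreviation "effective_rate \<equiv> (\<lambda>i \<xi> \<theta>. rate_prior U0 i \<xi> \<theta> + rate_lik \<mu> g i \<xi> \<theta>)"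
abbreviation "proposal_rate \<equiv> (\<lambda>\<xi> \<theta> s. \<Sum>i\<in>UNIV. Ml i \<xi> \<theta> s + M0 i \<xi> \<theta> s)"

lemma m_prior_eq: "m_prior U0 i \<xi> \<theta> s = rate_prior U0 i (\<xi> + s *\<^sub>R \<theta>) \<theta>"
  by (simp add: m_prior_def rate_prior_def)

lemma measurable_rate_prior: "(\<lambda>\<xi>. rate_prior U0 i \<xi> \<theta>) \<in> borel_measurable borel"
  unfolding rate_prior_def using measurable_partial_U0[of i] by measurable

lemma measurable_rate_lik: "(\<lambda>\<xi>. rate_lik \<mu> g i \<xi> \<theta>) \<in> borel_measurable borel"
proof -
  interpret prob_space "\<mu> i" by (rule estimator_prob)
  note [measurable] = estimator_measurable[of i]
  show ?thesis unfolding rate_lik_def by measurable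
qed

lemma measurable_Ml: "\<theta> \<in> velocities \<Longrightarrow> (\<lambda>(\<xi>, t). Ml i \<xi> \<theta> t) \<in> borel_measurable (borel \<Otimes>\<^sub>M borel)"
  and measurable_M0: "\<theta> \<in> velocities \<Longrightarrow> (\<lambda>(\<xi>, t). M0 i \<xi> \<theta> t) \<in> borel_measurable (borel \<Otimes>\<^sub>M borel)"
  using bound_lik(1) bound_prior(1) by (auto simp: admissible_bound_def)

lemma measurable_Ml': "\<theta> \<in> velocities \<Longrightarrow> Ml i \<xi> \<theta> \<in> borel_measurable borel"
  and measurable_M0': "\<theta> \<in> velocities \<Longrightarrow> M0 i \<xi> \<theta> \<in> borel_measurable borel"
  using measurable_Pair2[OF measurable_Ml, of \<theta> \<xi> i] measurable_Pair2[OF measurable_M0, of \<theta> \<xi> i] by simp_all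

lemma m_lik_nonneg: "0 \<le> m_lik g i \<xi> \<theta> t a" and m_prior_nonneg: "0 \<le> m_prior U0 i \<xi> \<theta> t"
  by (simp_all add: m_lik_def m_prior_def)

text \<open>The bound is compared with \<open>m_lik\<close> at points of
  \<open>space (\<mu> i)\<close> only; such a point exists because \<open>\<mu> i\<close> is a
  probability measure.\<close>

lemma Ml_nonneg: "\<theta> \<in> velocities \<Longrightarrow> 0 \<le> t \<Longrightarrow> 0 \<le> Ml i \<xi> \<theta> t"
  using prob_space.not_empty[OF estimator_prob[of i]] bound_lik(2)[of \<theta> t _ i \<xi>] m_lik_nonneg
  by (meson ex_in_conv order_trans)

lemma M0_nonneg: "\<theta> \<in> velocities \<Longrightarrow> 0 \<le> t \<Longrightarrow> 0 \<le> M0 i \<xi> \<theta> t"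
  using bound_prior(2) m_prior_nonneg order_trans by blast

lemma integrable_m_lik: "integrable (\<mu> i) (m_lik g i \<xi> \<theta> s)"
  unfolding m_lik_def using estimator_integrable[of i "\<xi> + s *\<^sub>R \<theta>"]
  by (auto intro!: integrable_max)

lemma rate_lik_eq: "rate_lik \<mu> g i (\<xi> + s *\<^sub>R \<theta>) \<theta> = (LINT a|\<mu> i. m_lik g i \<xi> \<theta> s a)"
  by (simp add: rate_lik_def m_lik_def)

lemma rate_lik_nonneg: "0 \<le> rate_lik \<mu> g i \<xi> \<theta>"
  by (simp add: rate_lik_def)

lemma rate_prior_nonneg: "0 \<le> rate_prior U0 i \<xi> \<theta>"
  by (simp add: rate_prior_def)

lemma rate_lik_le: "\<theta> \<in> velocities \<Longrightarrow> 0 \<le> s \<Longrightarrow> rate_lik \<mu> g i (\<xi> + s *\<^sub>R \<theta>) \<theta> \<le> Ml i \<xi> \<theta> s"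
  unfolding rate_lik_eq using bound_lik(2)
  by (intro prob_space.integral_le_const[OF estimator_prob] integrable_m_lik AE_I2) auto

lemma rate_prior_le: "\<theta> \<in> velocities \<Longrightarrow> 0 \<le> s \<Longrightarrow> rate_prior U0 i (\<xi> + s *\<^sub>R \<theta>) \<theta> \<le> M0 i \<xi> \<theta> s"
  using bound_prior(2) by (simp add: m_prior_eq)

lemma competing_Ml: "\<theta> \<in> velocities \<Longrightarrow> competing_hazards (\<lambda>i. Ml i \<xi> \<theta>)"
  and competing_M0: "\<theta> \<in> velocities \<Longrightarrow> competing_hazards (\<lambda>i. M0 i \<xi> \<theta>)"
  using bound_lik(1) bound_prior(1)
  by (auto intro!: competing_hazards.intro hazard.intro Ml_nonneg M0_nonneg measurable_Ml' measurable_M0'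
      simp: admissible_bound_def)

text \<open>Integrability along rays is inherited from the bounds, which dominate the two parts of
  the rate.\<close>

lemma zigzag_rates_effective: "zigzag_rates effective_rate"
proof
  fix i and \<xi> \<theta> :: "real^'p" and T :: real
  assume \<theta>: "\<theta> \<in> velocities"
  note [measurable] = measurable_rate_prior measurable_rate_lik
  show m: "(\<lambda>\<xi>. effective_rate i \<xi> \<theta>) \<in> borel_measurable borel" by measurable
  show "0 \<le> effective_rate i \<xi> \<theta>" using rate_prior_nonneg rate_lik_nonneg by (simp add: add_nonneg_nonneg)
  assume T: "0 \<le> T"
  show "set_integrable lborel {0..T} (\<lambda>s. effective_rate i (\<xi> + s *\<^sub>R \<theta>) \<theta>)"
  proof (rule set_integrable_bound)
    have "set_integrable lborel {0..T} (Ml i \<xi> \<theta>)" "set_integrable lborel {0..T} (M0 i \<xi> \<theta>)"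
      using bound_lik(1) bound_prior(1) \<theta> T by (auto simp: admissible_bound_def)
    then show "set_integrable lborel {0..T} (\<lambda>s. Ml i \<xi> \<theta> s + M0 i \<xi> \<theta> s)" by (rule set_integral_add)
    show "set_borel_measurable lborel {0..T} (\<lambda>s. effective_rate i (\<xi> + s *\<^sub>R \<theta>) \<theta>)"
      unfolding set_borel_measurable_def using measurable_compose[OF _ m, of "\<lambda>s. \<xi> + s *\<^sub>R \<theta>" lborel]
      by measurable
    show "AE s in lborel. s \<in> {0..T} \<longrightarrow>
        norm (effective_rate i (\<xi> + s *\<^sub>R \<theta>) \<theta>) \<le> norm (Ml i \<xi> \<theta> s + M0 i \<xi> \<theta> s)"
      using rate_prior_nonneg rate_lik_nonneg Ml_nonneg[OF \<theta>] M0_nonneg[OF \<theta>] rate_prior_le[OF \<theta>] rate_lik_le[OF \<theta>]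
      by (intro AE_I2) (auto simp: add.commute add_nonneg_nonneg intro!: add_mono)
  qed
qed

text \<open>The outcome of a prior event once its component and time are known. Keeping the time as
  an argument makes it a kernel that can be integrated against the law of the clocks;
  \<open>lik_move\<close> plays the same role for the likelihood.\<close>

definition prior_move :: "ennreal \<Rightarrow> real^'p \<Rightarrow> real^'p \<Rightarrow> 'p \<Rightarrow> ennreal \<Rightarrow> 'p skeleton_point measure" where
  "prior_move t \<xi> \<theta> j x = do {
     u \<leftarrow> uniform_measure lborel {0<..<1::real};
     return skeleton_space (t + x, \<xi> + enn2real x *\<^sub>R \<theta>,
       if thin \<longrightarrow> u < m_prior U0 j \<xi> \<theta> (enn2real x) / M0 j \<xi> \<theta> (enn2real x) then flip j \<theta> else \<theta>)
   }"

definition lik_move :: "ennreal \<Rightarrow> real^'p \<Rightarrow> real^'p \<Rightarrow> 'p \<Rightarrow> ennreal \<Rightarrow> 'p skeleton_point measure" where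
  "lik_move t \<xi> \<theta> i x = do {
     b \<leftarrow> \<mu> i;
     u \<leftarrow> uniform_measure lborel {0<..<1::real};
     return skeleton_space (t + x, \<xi> + enn2real x *\<^sub>R \<theta>,
       if u < m_lik g i \<xi> \<theta> (enn2real x) b / Ml i \<xi> \<theta> (enn2real x) then flip i \<theta> else \<theta>)
   }"

definition move :: "ennreal \<Rightarrow> real^'p \<Rightarrow> real^'p \<Rightarrow> ('p \<Rightarrow> ennreal) \<Rightarrow> ('p \<Rightarrow> ennreal) \<Rightarrow> 'p skeleton_point measure" where
  "move t \<xi> \<theta> \<tau>l \<tau>0 =
    (if \<tau>l (first_clock \<tau>l) = \<infinity> \<and> \<tau>0 (first_clock \<tau>0) = \<infinity> then return skeleton_space (\<infinity>, \<xi>, \<theta>)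
     else if \<tau>0 (first_clock \<tau>0) < \<tau>l (first_clock \<tau>l) then prior_move t \<xi> \<theta> (first_clock \<tau>0) (\<tau>0 (first_clock \<tau>0))
     else lik_move t \<xi> \<theta> (first_clock \<tau>l) (\<tau>l (first_clock \<tau>l)))"

lemma attempt_eq_move:
  assumes "t \<noteq> \<infinity>"
  shows "attempt thin U0 M0 \<mu> g Ml (t, \<xi>, \<theta>) =
    PiM UNIV (\<lambda>i. first_arrival_law (Ml i \<xi> \<theta>)) \<bind> (\<lambda>\<tau>l.
    PiM UNIV (\<lambda>i. first_arrival_law (M0 i \<xi> \<theta>)) \<bind> (\<lambda>\<tau>0. move t \<xi> \<theta> \<tau>l \<tau>0))"
proof -
  have "move t \<xi> \<theta> \<tau>l \<tau>0 =
     (let i0 = (ARG_MIN \<tau>l i. True);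
         j0 = (ARG_MIN \<tau>0 i. True);
         \<tau> = min (\<tau>l i0) (\<tau>0 j0);
         s = enn2real \<tau>;
         \<xi>' = \<xi> + s *\<^sub>R \<theta>
      in if \<tau> = \<infinity> then return skeleton_space (\<infinity>, \<xi>, \<theta>)
       else if \<tau>0 j0 < \<tau>l i0 then do {
         u \<leftarrow> uniform_measure lborel {0<..<1::real};
         return skeleton_space
           (t + \<tau>, \<xi>', if thin \<longrightarrow> u < m_prior U0 j0 \<xi> \<theta> s / M0 j0 \<xi> \<theta> s
                       then flip j0 \<theta> else \<theta>)
       }
       else do {
         b \<leftarrow> \<mu> i0;
         u \<leftarrow> uniform_measure lborel {0<..<1::real};
         return skeleton_space
           (t + \<tau>, \<xi>', if u < m_lik g i0 \<xi> \<theta> s b / Ml i0 \<xi> \<theta> s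
                       then flip i0 \<theta> else \<theta>)
       })" for \<tau>l \<tau>0
  proof (cases "\<tau>0 (first_clock \<tau>0) < \<tau>l (first_clock \<tau>l)")
    case True
    then have "min (\<tau>l (first_clock \<tau>l)) (\<tau>0 (first_clock \<tau>0)) = \<tau>0 (first_clock \<tau>0)"
      "\<tau>0 (first_clock \<tau>0) \<noteq> \<infinity>" by auto
    with True show ?thesis
      unfolding move_def prior_move_def first_clock_def[symmetric] Let_def by simp
  next
    case False
    \<comment> \<open>Ties go to the likelihood clock; if its time is infinite here, then so is the
      prior time.\<close>
    then have "min (\<tau>l (first_clock \<tau>l)) (\<tau>0 (first_clock \<tau>0)) = \<tau>l (first_clock \<tau>l)"
      "\<tau>l (first_clock \<tau>l) = \<infinity> \<Longrightarrow> \<tau>0 (first_clock \<tau>0) = \<infinity>" by (auto simp: not_less top_unique)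
    with False show ?thesis
      unfolding move_def lik_move_def first_clock_def[symmetric] Let_def by auto
  qed
  then show ?thesis
    using assms unfolding attempt_def Let_def by simp
qed

context
  fixes \<theta> :: "real^'p" assumes \<theta>: "\<theta> \<in> velocities"
begin

lemma measurable_velocity_choice:
  assumes [measurable]: "Measurable.pred M P"
  shows "(\<lambda>x. if P x then flip i \<theta> else \<theta>) \<in> measurable M (count_space velocities)"
  using \<theta> by (intro measurable_If measurable_const) auto

lemma measurable_m_prior [measurable]: "(\<lambda>s. m_prior U0 j \<xi> \<theta> s) \<in> borel_measurable borel"
  unfolding m_prior_eq by (rule measurable_compose[OF _ measurable_rate_prior]) measurable

lemma measurable_m_lik: "(\<lambda>(s, b). m_lik g i \<xi> \<theta> s b) \<in> borel_measurable (borel \<Otimes>\<^sub>M \<mu> i)"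
proof -
  have "(\<lambda>p. (\<xi> + fst p *\<^sub>R \<theta>, snd p)) \<in> measurable (borel \<Otimes>\<^sub>M \<mu> i) (borel \<Otimes>\<^sub>M \<mu> i)"
    by measurable
  from measurable_compose[OF this estimator_measurable]
  show ?thesis by (simp add: m_lik_def case_prod_beta)
qed

lemma measurable_prior_move: "prior_move t \<xi> \<theta> j \<in> measurable borel (prob_algebra skeleton_space)"
  unfolding prior_move_def[abs_def]
proof (rule measurable_bind_prob_space2)
  show "(\<lambda>x. uniform_measure lborel {0<..<1::real}) \<in> measurable borel (prob_algebra borel)"
    by (intro measurable_const prob_space_unit_uniform)
  note [measurable] = measurable_M0'[OF \<theta>, of j \<xi>]
  have *: "(\<lambda>p. (t + fst p, \<xi> + enn2real (fst p) *\<^sub>R \<theta>,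
       if thin \<longrightarrow> snd p < m_prior U0 j \<xi> \<theta> (enn2real (fst p)) / M0 j \<xi> \<theta> (enn2real (fst p)) then flip j \<theta> else \<theta>))
       \<in> measurable (borel \<Otimes>\<^sub>M borel) skeleton_space"
    by (intro measurable_skeletonI measurable_velocity_choice) measurable
  from measurable_compose[OF this measurable_return_prob_space]
  show "(\<lambda>(x, u). return skeleton_space (t + x, \<xi> + enn2real x *\<^sub>R \<theta>,
       if thin \<longrightarrow> u < m_prior U0 j \<xi> \<theta> (enn2real x) / M0 j \<xi> \<theta> (enn2real x) then flip j \<theta> else \<theta>))
       \<in> measurable (borel \<Otimes>\<^sub>M borel) (prob_algebra skeleton_space)"
    by (simp add: case_prod_beta)
qed

lemma measurable_lik_move: "lik_move t \<xi> \<theta> i \<in> measurable borel (prob_algebra skeleton_space)"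
  unfolding lik_move_def[abs_def]
proof (rule measurable_bind_prob_space2)
  show "(\<lambda>x. \<mu> i) \<in> measurable borel (prob_algebra (\<mu> i))"
    by (intro measurable_const) (simp add: space_prob_algebra estimator_prob)
  show "(\<lambda>(x, b). uniform_measure lborel {0<..<1::real} \<bind> (\<lambda>u. return skeleton_space (t + x, \<xi> + enn2real x *\<^sub>R \<theta>,
       if u < m_lik g i \<xi> \<theta> (enn2real x) b / Ml i \<xi> \<theta> (enn2real x) then flip i \<theta> else \<theta>)))
       \<in> measurable (borel \<Otimes>\<^sub>M \<mu> i) (prob_algebra skeleton_space)"
    unfolding case_prod_beta
  proof (rule measurable_bind_prob_space2)
    show "(\<lambda>x. uniform_measure lborel {0<..<1::real}) \<in> measurable (borel \<Otimes>\<^sub>M \<mu> i) (prob_algebra borel)"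
      by (intro measurable_const prob_space_unit_uniform)
    note [measurable] = measurable_Ml'[OF \<theta>, of i \<xi>] measurable_m_lik[of i \<xi>]
    have "(\<lambda>p. (t + fst (fst p), \<xi> + enn2real (fst (fst p)) *\<^sub>R \<theta>,
         if snd p < m_lik g i \<xi> \<theta> (enn2real (fst (fst p))) (snd (fst p)) / Ml i \<xi> \<theta> (enn2real (fst (fst p))) then flip i \<theta> else \<theta>))
         \<in> measurable ((borel \<Otimes>\<^sub>M \<mu> i) \<Otimes>\<^sub>M borel) skeleton_space"
      by (intro measurable_skeletonI measurable_velocity_choice) measurable
    from measurable_compose[OF this measurable_return_prob_space]
    show "(\<lambda>(p, u). return skeleton_space (t + fst p, \<xi> + enn2real (fst p) *\<^sub>R \<theta>,
         if u < m_lik g i \<xi> \<theta> (enn2real (fst p)) (snd p) / Ml i \<xi> \<theta> (enn2real (fst p)) then flip i \<theta> else \<theta>))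
         \<in> measurable ((borel \<Otimes>\<^sub>M \<mu> i) \<Otimes>\<^sub>M borel) (prob_algebra skeleton_space)"
      by (simp add: case_prod_beta)
  qed
qed

lemma measurable_move:
  "(\<lambda>(\<tau>l, \<tau>0). move t \<xi> \<theta> \<tau>l \<tau>0) \<in>
    measurable (PiM UNIV (\<lambda>_. borel) \<Otimes>\<^sub>M PiM UNIV (\<lambda>_. borel)) (prob_algebra skeleton_space)"
proof -
  let ?P = "PiM UNIV (\<lambda>_::'p. borel :: ennreal measure)"
  have l: "(\<lambda>p. fst p (first_clock (fst p))) \<in> borel_measurable (?P \<Otimes>\<^sub>M ?P)"
      "(\<lambda>p. first_clock (fst p)) \<in> measurable (?P \<Otimes>\<^sub>M ?P) (count_space UNIV)"
    by (rule measurable_compose[OF measurable_fst measurable_first_time])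
      (rule measurable_compose[OF measurable_fst measurable_first_clock])
  have 0: "(\<lambda>p. snd p (first_clock (snd p))) \<in> borel_measurable (?P \<Otimes>\<^sub>M ?P)"
      "(\<lambda>p. first_clock (snd p)) \<in> measurable (?P \<Otimes>\<^sub>M ?P) (count_space UNIV)"
    by (rule measurable_compose[OF measurable_snd measurable_first_time])
      (rule measurable_compose[OF measurable_snd measurable_first_clock])
  show ?thesis
    unfolding case_prod_beta move_def
  proof (intro measurable_If measurable_const)
    show "return skeleton_space (\<infinity>, \<xi>, \<theta>) \<in> space (prob_algebra skeleton_space)"
      using \<theta> by (simp add: space_prob_algebra prob_space_return)
    show "(\<lambda>p. prior_move t \<xi> \<theta> (first_clock (snd p)) (snd p (first_clock (snd p)))) \<in>
        measurable (?P \<Otimes>\<^sub>M ?P) (prob_algebra skeleton_space)"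
      by (rule measurable_compose_countable[OF measurable_compose[OF 0(1) measurable_prior_move] 0(2)])
    show "(\<lambda>p. lik_move t \<xi> \<theta> (first_clock (fst p)) (fst p (first_clock (fst p)))) \<in>
        measurable (?P \<Otimes>\<^sub>M ?P) (prob_algebra skeleton_space)"
      by (rule measurable_compose_countable[OF measurable_compose[OF l(1) measurable_lik_move] l(2)])
  qed (use l 0 in measurable)
qed

text \<open>Multiplication by the proposal rate cancels the denominator of the acceptance
  probability. The identity also holds where the bound vanishes, since the dominated rate then
  vanishes too.\<close>

lemma nn_integral_prior_move:
  assumes F: "F \<in> borel_measurable skeleton_space" and s: "0 \<le> s"
  shows "ennreal (M0 j \<xi> \<theta> s) * (\<integral>\<^sup>+z. F z \<partial>prior_move t \<xi> \<theta> j (ennreal s)) =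
    ennreal (rate_prior U0 j (\<xi> + s *\<^sub>R \<theta>) \<theta>) * F (t + ennreal s, \<xi> + s *\<^sub>R \<theta>, flip j \<theta>) +
    ennreal (M0 j \<xi> \<theta> s - rate_prior U0 j (\<xi> + s *\<^sub>R \<theta>) \<theta>) * F (t + ennreal s, \<xi> + s *\<^sub>R \<theta>, \<theta>)"
proof -
  let ?p = "m_prior U0 j \<xi> \<theta> s / M0 j \<xi> \<theta> s" and ?M = "M0 j \<xi> \<theta> s"
  have le: "m_prior U0 j \<xi> \<theta> s \<le> ?M" "0 \<le> m_prior U0 j \<xi> \<theta> s" using bound_prior(2)[OF \<theta> s] m_prior_nonneg by auto
  then have p: "0 \<le> ?p" "?p \<le> 1" by (auto simp: divide_le_eq_1)
  have Mp: "?M * ?p = m_prior U0 j \<xi> \<theta> s" "?M * (1 - ?p) = ?M - m_prior U0 j \<xi> \<theta> s" using le by (auto simp: field_simps)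
  have m: "(\<lambda>u. (t + ennreal s, \<xi> + s *\<^sub>R \<theta>, if thin \<longrightarrow> u < ?p then flip j \<theta> else \<theta>)) \<in>
      measurable (uniform_measure lborel {0<..<1::real}) skeleton_space"
    by (intro measurable_skeletonI measurable_velocity_choice) measurable
  have "(\<integral>\<^sup>+z. F z \<partial>prior_move t \<xi> \<theta> j (ennreal s)) =
    (\<integral>\<^sup>+u. F (t + ennreal s, \<xi> + s *\<^sub>R \<theta>, if thin \<longrightarrow> u < ?p then flip j \<theta> else \<theta>) \<partial>uniform_measure lborel {0<..<1})"
    unfolding prior_move_def using s m bind_return_distr'[OF _ m] F
    by (simp add: nn_integral_distr)
  also have "\<dots> = (if thin then ennreal ?p * F (t + ennreal s, \<xi> + s *\<^sub>R \<theta>, flip j \<theta>) +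
      ennreal (1 - ?p) * F (t + ennreal s, \<xi> + s *\<^sub>R \<theta>, \<theta>) else F (t + ennreal s, \<xi> + s *\<^sub>R \<theta>, flip j \<theta>))"
    using nn_integral_unit_uniform[OF p, of "F (t + ennreal s, \<xi> + s *\<^sub>R \<theta>, flip j \<theta>)" "F (t + ennreal s, \<xi> + s *\<^sub>R \<theta>, \<theta>)"]
      prob_space.emeasure_space_1[of "uniform_measure lborel {0<..<1::real}"] prob_space_unit_uniform
    by (auto simp: if_distrib[of "\<lambda>x. F (t + ennreal s, \<xi> + s *\<^sub>R \<theta>, x)"] space_prob_algebra cong: if_cong)
  finally have eq: "(\<integral>\<^sup>+z. F z \<partial>prior_move t \<xi> \<theta> j (ennreal s)) = \<dots>" .
  show ?thesis
  proof (cases thin)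
    case True
    then show ?thesis
      unfolding eq m_prior_eq[symmetric]
      using Mp p le by (simp add: distrib_left mult.assoc[symmetric] flip: ennreal_mult' ennreal_mult'')
  next
    case False
    \<comment> \<open>The flip is certain here, and the bound is exact by \<open>prior_step\<close>,
      so the term without a flip has weight 0.\<close>
    then have "?M = m_prior U0 j \<xi> \<theta> s" using prior_step \<theta> s by auto
    with False show ?thesis unfolding eq m_prior_eq[symmetric] by simp
  qed
qed

text \<open>The acceptance probability is linear in \<open>m_lik\<close>, so averaging it over the
  sub-sample produces the expectation of the positive part. This is the origin of
  \<open>rate_lik\<close>.\<close>

lemma nn_integral_lik_move:
  assumes F: "F \<in> borel_measurable skeleton_space" and s: "0 \<le> s"
  shows "ennreal (Ml i \<xi> \<theta> s) * (\<integral>\<^sup>+z. F z \<partial>lik_move t \<xi> \<theta> i (ennreal s)) =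
    ennreal (rate_lik \<mu> g i (\<xi> + s *\<^sub>R \<theta>) \<theta>) * F (t + ennreal s, \<xi> + s *\<^sub>R \<theta>, flip i \<theta>) +
    ennreal (Ml i \<xi> \<theta> s - rate_lik \<mu> g i (\<xi> + s *\<^sub>R \<theta>) \<theta>) * F (t + ennreal s, \<xi> + s *\<^sub>R \<theta>, \<theta>)"
proof -
  interpret prob_space "\<mu> i" by (rule estimator_prob)
  let ?p = "\<lambda>b. m_lik g i \<xi> \<theta> s b / Ml i \<xi> \<theta> s" and ?M = "Ml i \<xi> \<theta> s"
  let ?x = "F (t + ennreal s, \<xi> + s *\<^sub>R \<theta>, flip i \<theta>)" and ?y = "F (t + ennreal s, \<xi> + s *\<^sub>R \<theta>, \<theta>)"
  have le: "m_lik g i \<xi> \<theta> s b \<le> ?M" "0 \<le> m_lik g i \<xi> \<theta> s b" if "b \<in> space (\<mu> i)" for b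
    using bound_lik(2)[OF \<theta> s that] m_lik_nonneg by auto
  then have p: "0 \<le> ?p b" "?p b \<le> 1" if "b \<in> space (\<mu> i)" for b using that by (fastforce simp: divide_le_eq_1)+
  have Mp: "?M * ?p b = m_lik g i \<xi> \<theta> s b" "?M * (1 - ?p b) = ?M - m_lik g i \<xi> \<theta> s b" if "b \<in> space (\<mu> i)" for b
    using le[OF that] by (auto simp: field_simps)
  have [measurable]: "m_lik g i \<xi> \<theta> s \<in> borel_measurable (\<mu> i)"
    using measurable_compose[OF measurable_Pair1' measurable_m_lik, of s i \<xi>] by simp
  have m: "(\<lambda>u. (t + ennreal s, \<xi> + s *\<^sub>R \<theta>, if u < ?p b then flip i \<theta> else \<theta>)) \<in>
      measurable (uniform_measure lborel {0<..<1::real}) skeleton_space" for b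
    by (intro measurable_skeletonI measurable_velocity_choice) measurable
  let ?k = "\<lambda>b. distr (uniform_measure lborel {0<..<1::real}) skeleton_space
      (\<lambda>u. (t + ennreal s, \<xi> + s *\<^sub>R \<theta>, if u < ?p b then flip i \<theta> else \<theta>))"
  have move: "lik_move t \<xi> \<theta> i (ennreal s) = \<mu> i \<bind> ?k"
    unfolding lik_move_def using s bind_return_distr'[OF _ m] by simp
  have "(\<lambda>p. (t + ennreal s, \<xi> + s *\<^sub>R \<theta>, if snd p < ?p (fst p) then flip i \<theta> else \<theta>)) \<in>
      measurable (\<mu> i \<Otimes>\<^sub>M borel) skeleton_space"
    by (intro measurable_skeletonI measurable_velocity_choice) measurable
  then have k: "?k \<in> measurable (\<mu> i) (subprob_algebra skeleton_space)"
    by (intro measurable_prob_algebraD measurable_distr_prob_space2[where M=borel] measurable_const prob_space_unit_uniform)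
      (simp add: case_prod_beta)
  have "?M * (\<integral>\<^sup>+z. F z \<partial>lik_move t \<xi> \<theta> i (ennreal s)) =
      ?M * (\<integral>\<^sup>+b. (\<integral>\<^sup>+u. (if u < ?p b then ?x else ?y) \<partial>uniform_measure lborel {0<..<1}) \<partial>\<mu> i)"
    unfolding move nn_integral_bind[OF F k]
    by (subst nn_integral_distr[OF m]) (use F in simp, simp add: if_distrib[of "\<lambda>x. F (t + ennreal s, \<xi> + s *\<^sub>R \<theta>, x)"] cong: if_cong)
  also have "\<dots> = ?M * (\<integral>\<^sup>+b. ennreal (?p b) * ?x + ennreal (1 - ?p b) * ?y \<partial>\<mu> i)"
    by (intro arg_cong2[where f=times] refl nn_integral_cong nn_integral_unit_uniform p)
  also have "\<dots> = (\<integral>\<^sup>+b. ?M * (ennreal (?p b) * ?x + ennreal (1 - ?p b) * ?y) \<partial>\<mu> i)"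
    by (rule nn_integral_cmult[symmetric]) measurable
  also have "\<dots> = (\<integral>\<^sup>+b. ennreal (m_lik g i \<xi> \<theta> s b) * ?x + ennreal (?M - m_lik g i \<xi> \<theta> s b) * ?y \<partial>\<mu> i)"
    using Mp p le Ml_nonneg[OF \<theta> s]
    by (intro nn_integral_cong) (simp add: distrib_left mult.assoc[symmetric] flip: ennreal_mult)
  also have "\<dots> = (\<integral>\<^sup>+b. ennreal (m_lik g i \<xi> \<theta> s b) \<partial>\<mu> i) * ?x + (\<integral>\<^sup>+b. ennreal (?M - m_lik g i \<xi> \<theta> s b) \<partial>\<mu> i) * ?y"
    by (simp add: nn_integral_add nn_integral_multc)
  also have "(\<integral>\<^sup>+b. ennreal (m_lik g i \<xi> \<theta> s b) \<partial>\<mu> i) = ennreal (rate_lik \<mu> g i (\<xi> + s *\<^sub>R \<theta>) \<theta>)"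
    unfolding rate_lik_eq by (rule nn_integral_eq_integral) (use integrable_m_lik le in auto)
  also have "(\<integral>\<^sup>+b. ennreal (?M - m_lik g i \<xi> \<theta> s b) \<partial>\<mu> i) = ennreal (?M - rate_lik \<mu> g i (\<xi> + s *\<^sub>R \<theta>) \<theta>)"
    unfolding rate_lik_eq using integrable_m_lik le
    by (subst nn_integral_eq_integral) (auto simp: prob_space)
  finally show ?thesis .
qed

end

end

context subsampled_zigzag
begin

lemma cumulative_proposal_rate:
  assumes \<theta>: "\<theta> \<in> velocities" and s: "0 \<le> s"
  shows "cumulative (proposal_rate \<xi> \<theta>) s =
    cumulative (competing_hazards.total_rate (\<lambda>i. Ml i \<xi> \<theta>)) s +
    cumulative (competing_hazards.total_rate (\<lambda>i. M0 i \<xi> \<theta>)) s"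
proof -
  interpret L: competing_hazards "\<lambda>i. Ml i \<xi> \<theta>" by (rule competing_Ml[OF \<theta>])
  interpret O: competing_hazards "\<lambda>i. M0 i \<xi> \<theta>" by (rule competing_M0[OF \<theta>])
  have "proposal_rate \<xi> \<theta> = (\<lambda>s. L.total_rate s + O.total_rate s)"
    by (simp add: L.total_rate_def O.total_rate_def sum.distrib)
  then show ?thesis
    using set_integral_add(2)[OF hazard.rate_integrable[OF L.hazard_total s] hazard.rate_integrable[OF O.hazard_total s]]
    by (simp add: cumulative_def)
qed

lemma hazard_proposal_rate:
  assumes \<theta>: "\<theta> \<in> velocities"
  shows "hazard (proposal_rate \<xi> \<theta>)"
proof -
  interpret L: competing_hazards "\<lambda>i. Ml i \<xi> \<theta>" by (rule competing_Ml[OF \<theta>])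
  interpret O: competing_hazards "\<lambda>i. M0 i \<xi> \<theta>" by (rule competing_M0[OF \<theta>])
  interpret HL: hazard L.total_rate by (rule L.hazard_total)
  interpret HO: hazard O.total_rate by (rule O.hazard_total)
  have "hazard (\<lambda>s. L.total_rate s + O.total_rate s)"
    by unfold_locales (auto intro!: add_nonneg_nonneg HL.rate_nonneg HO.rate_nonneg
        set_integral_add(1) HL.rate_integrable HO.rate_integrable)
  then show ?thesis by (simp add: L.total_rate_def O.total_rate_def sum.distrib)
qed

text \<open>The winner of one group of clocks is integrated against the survival probability of the
  other group. The two survival factors multiply to that of the full proposal rate, and the
  contributions are then collected by component.\<close>

lemma nn_integral_attempt:
  assumes \<theta>: "\<theta> \<in> velocities" and t: "t \<noteq> \<infinity>"
    and F [measurable]: "F \<in> borel_measurable skeleton_space" and F0: "\<And>x. F (\<infinity>, x) = 0"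
  shows "(\<integral>\<^sup>+z. F z \<partial>attempt thin U0 M0 \<mu> g Ml (t, \<xi>, \<theta>)) =
      (\<integral>\<^sup>+s. ((\<Sum>i\<in>UNIV. ennreal (effective_rate i (\<xi> + s *\<^sub>R \<theta>) \<theta>) * F (t + ennreal s, \<xi> + s *\<^sub>R \<theta>, flip i \<theta>)) +
          ennreal (proposal_rate \<xi> \<theta> s - (\<Sum>i\<in>UNIV. effective_rate i (\<xi> + s *\<^sub>R \<theta>) \<theta>)) * F (t + ennreal s, \<xi> + s *\<^sub>R \<theta>, \<theta>)) *
        ennreal (exp (- cumulative (proposal_rate \<xi> \<theta>) s)) * indicator {0..} s \<partial>lborel)"
proof -
  interpret L: competing_hazards "\<lambda>i. Ml i \<xi> \<theta>" by (rule competing_Ml[OF \<theta>])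
  interpret O: competing_hazards "\<lambda>i. M0 i \<xi> \<theta>" by (rule competing_M0[OF \<theta>])
  interpret PL: prob_space L.clocks by (rule L.prob_space_clocks)
  interpret PO: prob_space O.clocks by (rule O.prob_space_clocks)
  interpret PLO: pair_sigma_finite L.clocks O.clocks by standard
  interpret HL: hazard L.total_rate by (rule L.hazard_total)
  interpret HO: hazard O.total_rate by (rule O.hazard_total)
  note [measurable_cong] = L.sets_clocks O.sets_clocks
  let ?l = "\<lambda>\<tau>::'p \<Rightarrow> ennreal. \<tau> (first_clock \<tau>)"
  \<comment> \<open>The value 0 at \<infinity> is what the integral formula for competing clocks
    requires; it agrees with \<open>F\<close> vanishing at infinite times.\<close>
  define Hp where "Hp j x = (if x = \<infinity> then 0 else \<integral>\<^sup>+z. F z \<partial>prior_move t \<xi> \<theta> j x)" for j x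
  define Hl where "Hl i x = (if x = \<infinity> then 0 else \<integral>\<^sup>+z. F z \<partial>lik_move t \<xi> \<theta> i x)" for i x
  have Hp: "Hp j \<in> borel_measurable borel" and Hl: "Hl j \<in> borel_measurable borel" for j
  proof -
    have "(\<lambda>x. \<integral>\<^sup>+z. F z \<partial>prior_move t \<xi> \<theta> j x) \<in> borel_measurable borel"
        "(\<lambda>x. \<integral>\<^sup>+z. F z \<partial>lik_move t \<xi> \<theta> j x) \<in> borel_measurable borel"
      using measurable_prior_move[OF \<theta>] measurable_lik_move[OF \<theta>]
      by (auto intro!: measurable_compose[OF _ nn_integral_measurable_subprob_algebra[OF F]] measurable_prob_algebraD)
    then show "Hp j \<in> borel_measurable borel" "Hl j \<in> borel_measurable borel"
      unfolding Hp_def Hl_def by measurable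
  qed
  have Hp': "(\<lambda>\<tau>. Hp (first_clock \<tau>) (?l \<tau>)) \<in> borel_measurable (PiM UNIV (\<lambda>_. borel))"
    and Hl': "(\<lambda>\<tau>. Hl (first_clock \<tau>) (?l \<tau>)) \<in> borel_measurable (PiM UNIV (\<lambda>_. borel))"
    by (rule measurable_compose_countable[OF measurable_compose[OF measurable_first_time Hp] measurable_first_clock])
      (rule measurable_compose_countable[OF measurable_compose[OF measurable_first_time Hl] measurable_first_clock])
  have move: "(\<lambda>(\<tau>l, \<tau>0). move t \<xi> \<theta> \<tau>l \<tau>0) \<in> measurable (L.clocks \<Otimes>\<^sub>M O.clocks) (prob_algebra skeleton_space)"
    using measurable_move[OF \<theta>] by (simp cong: measurable_cong_sets sets_pair_measure_cong add: L.sets_clocks O.sets_clocks)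
  then have move': "move t \<xi> \<theta> \<tau>l \<in> measurable O.clocks (subprob_algebra skeleton_space)" for \<tau>l
    using measurable_Pair2[OF move, of \<tau>l] by (simp add: measurable_prob_algebraD)
  have time: "(\<lambda>p. ?l (fst p)) \<in> borel_measurable (L.clocks \<Otimes>\<^sub>M O.clocks)"
      "(\<lambda>p. ?l (snd p)) \<in> borel_measurable (L.clocks \<Otimes>\<^sub>M O.clocks)"
    by measurable
  have A: "(\<lambda>(\<tau>l, \<tau>0). Hp (first_clock \<tau>0) (?l \<tau>0) * indicator {\<tau>l. ?l \<tau>0 < ?l \<tau>l} \<tau>l)
      \<in> borel_measurable (L.clocks \<Otimes>\<^sub>M O.clocks)"
  proof -
    have "(\<lambda>p. Hp (first_clock (snd p)) (?l (snd p))) \<in> borel_measurable (L.clocks \<Otimes>\<^sub>M O.clocks)"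
      by (rule measurable_compose[OF measurable_snd]) (simp add: measurable_cong_sets[OF O.sets_clocks refl] Hp')
    then have "(\<lambda>p. if ?l (snd p) < ?l (fst p) then Hp (first_clock (snd p)) (?l (snd p)) else 0)
        \<in> borel_measurable (L.clocks \<Otimes>\<^sub>M O.clocks)"
      using borel_measurable_less[OF time(2) time(1)] by (intro measurable_If) auto
    then show ?thesis by (rule measurable_cong[THEN iffD1, rotated]) (auto simp: indicator_def)
  qed
  have B: "(\<lambda>(\<tau>l, \<tau>0). Hl (first_clock \<tau>l) (?l \<tau>l) * indicator {\<tau>0. ?l \<tau>l \<le> ?l \<tau>0} \<tau>0)
      \<in> borel_measurable (L.clocks \<Otimes>\<^sub>M O.clocks)"
  proof -
    have "(\<lambda>p. Hl (first_clock (fst p)) (?l (fst p))) \<in> borel_measurable (L.clocks \<Otimes>\<^sub>M O.clocks)"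
      by (rule measurable_compose[OF measurable_fst]) (simp add: measurable_cong_sets[OF L.sets_clocks refl] Hl')
    then have "(\<lambda>p. if ?l (fst p) \<le> ?l (snd p) then Hl (first_clock (fst p)) (?l (fst p)) else 0)
        \<in> borel_measurable (L.clocks \<Otimes>\<^sub>M O.clocks)"
      using borel_measurable_le[OF time(1) time(2)] by (intro measurable_If) auto
    then show ?thesis by (rule measurable_cong[THEN iffD1, rotated]) (auto simp: indicator_def)
  qed
  have "(\<integral>\<^sup>+z. F z \<partial>attempt thin U0 M0 \<mu> g Ml (t, \<xi>, \<theta>)) =
      (\<integral>\<^sup>+\<tau>l. \<integral>\<^sup>+z. F z \<partial>(O.clocks \<bind> move t \<xi> \<theta> \<tau>l) \<partial>L.clocks)"
    unfolding attempt_eq_move[OF t]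
  proof (rule nn_integral_bind[OF F])
    show "(\<lambda>\<tau>l. O.clocks \<bind> move t \<xi> \<theta> \<tau>l) \<in> measurable L.clocks (subprob_algebra skeleton_space)"
      by (intro measurable_prob_algebraD measurable_bind_prob_space2[OF _ move] measurable_const)
        (simp add: space_prob_algebra PO.prob_space_axioms)
  qed
  also have "\<dots> = (\<integral>\<^sup>+\<tau>l. \<integral>\<^sup>+\<tau>0. \<integral>\<^sup>+z. F z \<partial>move t \<xi> \<theta> \<tau>l \<tau>0 \<partial>O.clocks \<partial>L.clocks)"
    by (simp add: nn_integral_bind[OF F move'])
  \<comment> \<open>Prior first, strictly, or likelihood first, ties included. On the event of no
    arrival at all both sides vanish.\<close>
  also have "\<dots> = (\<integral>\<^sup>+\<tau>l. \<integral>\<^sup>+\<tau>0.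
      Hp (first_clock \<tau>0) (?l \<tau>0) * indicator {\<tau>l. ?l \<tau>0 < ?l \<tau>l} \<tau>l +
      Hl (first_clock \<tau>l) (?l \<tau>l) * indicator {\<tau>0. ?l \<tau>l \<le> ?l \<tau>0} \<tau>0 \<partial>O.clocks \<partial>L.clocks)"
  proof (intro nn_integral_cong)
    fix \<tau>l \<tau>0 :: "'p \<Rightarrow> ennreal"
    have "(\<integral>\<^sup>+z. F z \<partial>return skeleton_space (\<infinity>, \<xi>, \<theta>)) = 0"
      using \<theta> by (subst nn_integral_return) (auto simp: F0[unfolded infinity_ennreal_def])
    then show "(\<integral>\<^sup>+z. F z \<partial>move t \<xi> \<theta> \<tau>l \<tau>0) =
      Hp (first_clock \<tau>0) (?l \<tau>0) * indicator {\<tau>l. ?l \<tau>0 < ?l \<tau>l} \<tau>l +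
      Hl (first_clock \<tau>l) (?l \<tau>l) * indicator {\<tau>0. ?l \<tau>l \<le> ?l \<tau>0} \<tau>0"
      by (cases "?l \<tau>0 < ?l \<tau>l") (auto simp: move_def Hp_def Hl_def not_less top_unique)
  qed
  also have "\<dots> = (\<integral>\<^sup>+\<tau>l. \<integral>\<^sup>+\<tau>0. Hp (first_clock \<tau>0) (?l \<tau>0) * indicator {\<tau>l. ?l \<tau>0 < ?l \<tau>l} \<tau>l \<partial>O.clocks \<partial>L.clocks) +
      (\<integral>\<^sup>+\<tau>l. \<integral>\<^sup>+\<tau>0. Hl (first_clock \<tau>l) (?l \<tau>l) * indicator {\<tau>0. ?l \<tau>l \<le> ?l \<tau>0} \<tau>0 \<partial>O.clocks \<partial>L.clocks)"
    using measurable_Pair2[OF A] measurable_Pair2[OF B] PO.borel_measurable_nn_integral[OF A] PO.borel_measurable_nn_integral[OF B]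
    by (simp add: nn_integral_add)
  \<comment> \<open>The integrals are exchanged so that the clocks of the losing group are
    integrated first and leave their survival probability.\<close>
  also have "(\<integral>\<^sup>+\<tau>l. \<integral>\<^sup>+\<tau>0. Hp (first_clock \<tau>0) (?l \<tau>0) * indicator {\<tau>l. ?l \<tau>0 < ?l \<tau>l} \<tau>l \<partial>O.clocks \<partial>L.clocks) =
      (\<integral>\<^sup>+\<tau>0. \<integral>\<^sup>+\<tau>l. Hp (first_clock \<tau>0) (?l \<tau>0) * indicator {\<tau>l. ?l \<tau>0 < ?l \<tau>l} \<tau>l \<partial>L.clocks \<partial>O.clocks)"
    by (rule PLO.Fubini'[OF A, symmetric])
  also have "\<dots> = (\<integral>\<^sup>+\<tau>0. (\<lambda>j x. Hp j x * ennreal (exp (- cumulative L.total_rate (enn2real x)))) (first_clock \<tau>0) (?l \<tau>0) \<partial>O.clocks)"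
  proof (intro nn_integral_cong)
    fix \<tau>0 :: "'p \<Rightarrow> ennreal"
    show "(\<integral>\<^sup>+\<tau>l. Hp (first_clock \<tau>0) (?l \<tau>0) * indicator {\<tau>l. ?l \<tau>0 < ?l \<tau>l} \<tau>l \<partial>L.clocks) =
      Hp (first_clock \<tau>0) (?l \<tau>0) * ennreal (exp (- cumulative L.total_rate (enn2real (?l \<tau>0))))"
    proof (cases "?l \<tau>0")
      case (real s)
      have "{\<tau> \<in> space L.clocks. ?l \<tau>0 < ?l \<tau>} \<in> sets L.clocks" by measurable
      then show ?thesis
        using L.emeasure_clocks_greaterThan[of s] real by (simp add: nn_integral_cmult_indicator)
    qed (simp add: Hp_def)
  qed
  also have "\<dots> = (\<integral>\<^sup>+s. (\<Sum>i\<in>UNIV. ennreal (M0 i \<xi> \<theta> s) * (Hp i (ennreal s) * ennreal (exp (- cumulative L.total_rate (enn2real (ennreal s)))))) *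
      ennreal (exp (- cumulative O.total_rate s)) * indicator {0..} s \<partial>lborel)"
  proof (rule O.nn_integral_clocks)
    show "(\<lambda>x. Hp i x * ennreal (exp (- cumulative L.total_rate (enn2real x)))) \<in> borel_measurable borel" for i
      using HL.measurable_cumulative by (intro borel_measurable_times_ennreal Hp) measurable
  qed (simp add: Hp_def)
  also have "(\<integral>\<^sup>+\<tau>l. \<integral>\<^sup>+\<tau>0. Hl (first_clock \<tau>l) (?l \<tau>l) * indicator {\<tau>0. ?l \<tau>l \<le> ?l \<tau>0} \<tau>0 \<partial>O.clocks \<partial>L.clocks) =
      (\<integral>\<^sup>+\<tau>l. (\<lambda>i x. Hl i x * ennreal (exp (- cumulative O.total_rate (enn2real x)))) (first_clock \<tau>l) (?l \<tau>l) \<partial>L.clocks)"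
  proof (intro nn_integral_cong)
    fix \<tau>l :: "'p \<Rightarrow> ennreal"
    show "(\<integral>\<^sup>+\<tau>0. Hl (first_clock \<tau>l) (?l \<tau>l) * indicator {\<tau>0. ?l \<tau>l \<le> ?l \<tau>0} \<tau>0 \<partial>O.clocks) =
      Hl (first_clock \<tau>l) (?l \<tau>l) * ennreal (exp (- cumulative O.total_rate (enn2real (?l \<tau>l))))"
    proof (cases "?l \<tau>l")
      case (real s)
      have "{\<tau> \<in> space O.clocks. ?l \<tau>l \<le> ?l \<tau>} \<in> sets O.clocks" by measurable
      then show ?thesis
        using O.emeasure_clocks_atLeast[of s] real by (simp add: nn_integral_cmult_indicator)
    qed (simp add: Hl_def)
  qed
  also have "\<dots> = (\<integral>\<^sup>+s. (\<Sum>i\<in>UNIV. ennreal (Ml i \<xi> \<theta> s) * (Hl i (ennreal s) * ennreal (exp (- cumulative O.total_rate (enn2real (ennreal s)))))) *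
      ennreal (exp (- cumulative L.total_rate s)) * indicator {0..} s \<partial>lborel)"
  proof (rule L.nn_integral_clocks)
    show "(\<lambda>x. Hl i x * ennreal (exp (- cumulative O.total_rate (enn2real x)))) \<in> borel_measurable borel" for i
      using HO.measurable_cumulative by (intro borel_measurable_times_ennreal Hl) measurable
  qed (simp add: Hl_def)
  also have "(\<integral>\<^sup>+s. (\<Sum>i\<in>UNIV. ennreal (M0 i \<xi> \<theta> s) * (Hp i (ennreal s) * ennreal (exp (- cumulative L.total_rate (enn2real (ennreal s)))))) *
      ennreal (exp (- cumulative O.total_rate s)) * indicator {0..} s \<partial>lborel) + \<dots> =
    (\<integral>\<^sup>+s. (\<Sum>i\<in>UNIV. ennreal (M0 i \<xi> \<theta> s) * (Hp i (ennreal s) * ennreal (exp (- cumulative L.total_rate (enn2real (ennreal s)))))) *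
      ennreal (exp (- cumulative O.total_rate s)) * indicator {0..} s +
      (\<Sum>i\<in>UNIV. ennreal (Ml i \<xi> \<theta> s) * (Hl i (ennreal s) * ennreal (exp (- cumulative O.total_rate (enn2real (ennreal s)))))) *
      ennreal (exp (- cumulative L.total_rate s)) * indicator {0..} s \<partial>lborel)"
  proof (rule nn_integral_add[symmetric])
    note [measurable] = HL.measurable_cumulative HO.measurable_cumulative
    have Me: "(\<lambda>s. ennreal (M0 i \<xi> \<theta> s)) \<in> borel_measurable borel" "(\<lambda>s. ennreal (Ml i \<xi> \<theta> s)) \<in> borel_measurable borel" for i
      using measurable_M0'[OF \<theta>] measurable_Ml'[OF \<theta>] by simp_all
    have He: "(\<lambda>s. Hp i (ennreal s)) \<in> borel_measurable borel" "(\<lambda>s. Hl i (ennreal s)) \<in> borel_measurable borel" for i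
      by (rule measurable_compose[OF measurable_ennreal Hp], rule measurable_compose[OF measurable_ennreal Hl])
    have "(\<lambda>s. (\<Sum>i\<in>UNIV. ennreal (M0 i \<xi> \<theta> s) * (Hp i (ennreal s) * ennreal (exp (- cumulative L.total_rate (enn2real (ennreal s)))))) *
        ennreal (exp (- cumulative O.total_rate s)) * indicator {0..} s) \<in> borel_measurable borel"
      by (intro borel_measurable_times_ennreal borel_measurable_sum Me He) measurable
    then show "(\<lambda>s. (\<Sum>i\<in>UNIV. ennreal (M0 i \<xi> \<theta> s) * (Hp i (ennreal s) * ennreal (exp (- cumulative L.total_rate (enn2real (ennreal s)))))) *
        ennreal (exp (- cumulative O.total_rate s)) * indicator {0..} s) \<in> borel_measurable lborel" by simp
    have "(\<lambda>s. (\<Sum>i\<in>UNIV. ennreal (Ml i \<xi> \<theta> s) * (Hl i (ennreal s) * ennreal (exp (- cumulative O.total_rate (enn2real (ennreal s)))))) *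
        ennreal (exp (- cumulative L.total_rate s)) * indicator {0..} s) \<in> borel_measurable borel"
      by (intro borel_measurable_times_ennreal borel_measurable_sum Me He) measurable
    then show "(\<lambda>s. (\<Sum>i\<in>UNIV. ennreal (Ml i \<xi> \<theta> s) * (Hl i (ennreal s) * ennreal (exp (- cumulative O.total_rate (enn2real (ennreal s)))))) *
        ennreal (exp (- cumulative L.total_rate s)) * indicator {0..} s) \<in> borel_measurable lborel" by simp
  qed
  also have "\<dots> = (\<integral>\<^sup>+s. ((\<Sum>i\<in>UNIV. ennreal (effective_rate i (\<xi> + s *\<^sub>R \<theta>) \<theta>) * F (t + ennreal s, \<xi> + s *\<^sub>R \<theta>, flip i \<theta>)) +
          ennreal (proposal_rate \<xi> \<theta> s - (\<Sum>i\<in>UNIV. effective_rate i (\<xi> + s *\<^sub>R \<theta>) \<theta>)) * F (t + ennreal s, \<xi> + s *\<^sub>R \<theta>, \<theta>)) *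
        ennreal (exp (- cumulative (proposal_rate \<xi> \<theta>) s)) * indicator {0..} s \<partial>lborel)"
  proof (rule nn_integral_cong)
    fix s :: real
    let ?x = "\<lambda>i. F (t + ennreal s, \<xi> + s *\<^sub>R \<theta>, flip i \<theta>)" and ?y = "F (t + ennreal s, \<xi> + s *\<^sub>R \<theta>, \<theta>)"
    let ?rp = "\<lambda>i. rate_prior U0 i (\<xi> + s *\<^sub>R \<theta>) \<theta>" and ?rl = "\<lambda>i. rate_lik \<mu> g i (\<xi> + s *\<^sub>R \<theta>) \<theta>"
    have "(\<Sum>i\<in>UNIV. ennreal (M0 i \<xi> \<theta> s) * (Hp i (ennreal s) * ennreal (exp (- cumulative L.total_rate (enn2real (ennreal s)))))) *
        ennreal (exp (- cumulative O.total_rate s)) +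
        (\<Sum>i\<in>UNIV. ennreal (Ml i \<xi> \<theta> s) * (Hl i (ennreal s) * ennreal (exp (- cumulative O.total_rate (enn2real (ennreal s)))))) *
        ennreal (exp (- cumulative L.total_rate s)) =
      ((\<Sum>i\<in>UNIV. ennreal (?rp i + ?rl i) * ?x i) +
          ennreal (proposal_rate \<xi> \<theta> s - (\<Sum>i\<in>UNIV. ?rp i + ?rl i)) * ?y) *
        ennreal (exp (- cumulative (proposal_rate \<xi> \<theta>) s))" if s: "0 \<le> s"
    proof -
      have cum: "cumulative (proposal_rate \<xi> \<theta>) s = cumulative L.total_rate s + cumulative O.total_rate s"
        by (rule cumulative_proposal_rate[OF \<theta> s])
      have e: "ennreal (exp (- cumulative (proposal_rate \<xi> \<theta>) s)) =
          ennreal (exp (- cumulative L.total_rate s)) * ennreal (exp (- cumulative O.total_rate s))" (is "?e = ?eL * ?eO")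
        unfolding cum by (simp add: exp_add[symmetric] flip: ennreal_mult)
      have "(\<Sum>i\<in>UNIV. ennreal (M0 i \<xi> \<theta> s) * (Hp i (ennreal s) * ?eL)) * ?eO +
          (\<Sum>i\<in>UNIV. ennreal (Ml i \<xi> \<theta> s) * (Hl i (ennreal s) * ?eO)) * ?eL =
        (\<Sum>i\<in>UNIV. ennreal (M0 i \<xi> \<theta> s) * Hp i (ennreal s) + ennreal (Ml i \<xi> \<theta> s) * Hl i (ennreal s)) * ?e"
        unfolding e by (simp add: sum_distrib_right sum.distrib distrib_right)
          (simp add: sum_distrib_left ac_simps)
      \<comment> \<open>Each event time splits into flips and rejections at this point; the
        acceptance probabilities have disappeared.\<close>
      also have "(\<Sum>i\<in>UNIV. ennreal (M0 i \<xi> \<theta> s) * Hp i (ennreal s) + ennreal (Ml i \<xi> \<theta> s) * Hl i (ennreal s)) =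
        (\<Sum>i\<in>UNIV. (ennreal (?rp i) * ?x i + ennreal (M0 i \<xi> \<theta> s - ?rp i) * ?y) +
          (ennreal (?rl i) * ?x i + ennreal (Ml i \<xi> \<theta> s - ?rl i) * ?y))"
        unfolding Hp_def Hl_def
        using nn_integral_prior_move[OF \<theta> F s] nn_integral_lik_move[OF \<theta> F s] by (intro sum.cong) simp_all
      also have "\<dots> = (\<Sum>i\<in>UNIV. ennreal (?rp i + ?rl i) * ?x i + ennreal ((Ml i \<xi> \<theta> s + M0 i \<xi> \<theta> s) - (?rp i + ?rl i)) * ?y)"
      proof (rule sum.cong[OF refl])
        fix i
        have "ennreal (Ml i \<xi> \<theta> s + M0 i \<xi> \<theta> s - (?rp i + ?rl i)) = ennreal (M0 i \<xi> \<theta> s - ?rp i) + ennreal (Ml i \<xi> \<theta> s - ?rl i)"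
          using rate_prior_le[OF \<theta> s] rate_lik_le[OF \<theta> s] by (subst ennreal_plus[symmetric]) (auto simp: algebra_simps)
        moreover have "ennreal (?rp i + ?rl i) = ennreal (?rp i) + ennreal (?rl i)"
          using rate_prior_nonneg rate_lik_nonneg by (rule ennreal_plus)
        ultimately show "(ennreal (?rp i) * ?x i + ennreal (M0 i \<xi> \<theta> s - ?rp i) * ?y) +
            (ennreal (?rl i) * ?x i + ennreal (Ml i \<xi> \<theta> s - ?rl i) * ?y) =
          ennreal (?rp i + ?rl i) * ?x i + ennreal ((Ml i \<xi> \<theta> s + M0 i \<xi> \<theta> s) - (?rp i + ?rl i)) * ?y"
          by (simp only: distrib_right add_ac)
      qed
      also have "\<dots> = (\<Sum>i\<in>UNIV. ennreal (?rp i + ?rl i) * ?x i) +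
          ennreal (proposal_rate \<xi> \<theta> s - (\<Sum>i\<in>UNIV. ?rp i + ?rl i)) * ?y"
      proof -
        have "0 \<le> (Ml i \<xi> \<theta> s + M0 i \<xi> \<theta> s) - (?rp i + ?rl i)" for i
          using rate_prior_le[OF \<theta> s, of i \<xi>] rate_lik_le[OF \<theta> s, of i \<xi>] by simp
        then have "ennreal (proposal_rate \<xi> \<theta> s - (\<Sum>i\<in>UNIV. ?rp i + ?rl i)) =
            (\<Sum>i\<in>UNIV. ennreal ((Ml i \<xi> \<theta> s + M0 i \<xi> \<theta> s) - (?rp i + ?rl i)))"
          unfolding sum_subtractf[symmetric] by (intro sum_ennreal[symmetric]) auto
        then show ?thesis by (simp only: sum.distrib sum_distrib_right)
      qed
      finally show ?thesis using s by simp
    qed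
    then show "(\<Sum>i\<in>UNIV. ennreal (M0 i \<xi> \<theta> s) * (Hp i (ennreal s) * ennreal (exp (- cumulative L.total_rate (enn2real (ennreal s)))))) *
        ennreal (exp (- cumulative O.total_rate s)) * indicator {0..} s +
        (\<Sum>i\<in>UNIV. ennreal (Ml i \<xi> \<theta> s) * (Hl i (ennreal s) * ennreal (exp (- cumulative O.total_rate (enn2real (ennreal s)))))) *
        ennreal (exp (- cumulative L.total_rate s)) * indicator {0..} s =
      ((\<Sum>i\<in>UNIV. ennreal (?rp i + ?rl i) * ?x i) +
          ennreal (proposal_rate \<xi> \<theta> s - (\<Sum>i\<in>UNIV. ?rp i + ?rl i)) * ?y) *
        ennreal (exp (- cumulative (proposal_rate \<xi> \<theta>) s)) * indicator {0..} s"
      by (simp split: split_indicator)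
  qed
  finally show ?thesis .
qed

text \<open>Only the branch in which no clock rings leads to an infinite time, and it keeps position
  and velocity; every other branch adds a finite waiting time to the finite
  \<open>t\<close>.\<close>

lemma attempt_in_prob_algebra:
  assumes \<theta>: "\<theta> \<in> velocities" and t: "t \<noteq> \<infinity>"
  shows "attempt thin U0 M0 \<mu> g Ml (t, \<xi>, \<theta>) \<in> space (prob_algebra skeleton_space)"
    and "AE z in attempt thin U0 M0 \<mu> g Ml (t, \<xi>, \<theta>). fst z = \<infinity> \<longrightarrow> snd z = (\<xi>, \<theta>)"
proof -
  interpret L: competing_hazards "\<lambda>i. Ml i \<xi> \<theta>" by (rule competing_Ml[OF \<theta>])
  interpret O: competing_hazards "\<lambda>i. M0 i \<xi> \<theta>" by (rule competing_M0[OF \<theta>])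
  interpret PL: prob_space L.clocks by (rule L.prob_space_clocks)
  interpret PO: prob_space O.clocks by (rule O.prob_space_clocks)
  have move: "(\<lambda>(\<tau>l, \<tau>0). move t \<xi> \<theta> \<tau>l \<tau>0) \<in> measurable (L.clocks \<Otimes>\<^sub>M O.clocks) (prob_algebra skeleton_space)"
    using measurable_move[OF \<theta>] by (simp cong: measurable_cong_sets sets_pair_measure_cong add: L.sets_clocks O.sets_clocks)
  then have move': "move t \<xi> \<theta> \<tau>l \<in> measurable O.clocks (subprob_algebra skeleton_space)" for \<tau>l
    using measurable_Pair2[OF move, of \<tau>l] by (simp add: measurable_prob_algebraD)
  have bind: "(\<lambda>\<tau>l. O.clocks \<bind> move t \<xi> \<theta> \<tau>l) \<in> measurable L.clocks (prob_algebra skeleton_space)"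
    by (intro measurable_bind_prob_space2[OF _ move] measurable_const)
      (simp add: space_prob_algebra PO.prob_space_axioms)
  have L: "L.clocks \<in> space (prob_algebra L.clocks)"
    by (simp add: space_prob_algebra PL.prob_space_axioms)
  show "attempt thin U0 M0 \<mu> g Ml (t, \<xi>, \<theta>) \<in> space (prob_algebra skeleton_space)"
    unfolding attempt_eq_move[OF t] space_prob_algebra
    using prob_space_bind'[OF L bind] sets_bind'[OF L bind] by simp
  let ?P = "\<lambda>z::'p skeleton_point. fst z = \<infinity> \<longrightarrow> snd z = (\<xi>, \<theta>)"
  have P [measurable]: "Measurable.pred skeleton_space ?P"
  proof -
    have "Measurable.pred skeleton_space (\<lambda>z::'p skeleton_point. fst z = \<infinity> \<longrightarrow> fst (snd z) = \<xi> \<and> snd (snd z) = \<theta>)"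
      using \<theta> by measurable
    then show ?thesis by (simp add: prod_eq_iff)
  qed
  note [measurable] = measurable_m_prior[OF \<theta>] measurable_velocity_choice[OF \<theta>]
  have prior: "AE z in prior_move t \<xi> \<theta> j x. ?P z" if x: "x \<noteq> \<infinity>" for j x
  proof -
    let ?f = "\<lambda>u. (t + x, \<xi> + enn2real x *\<^sub>R \<theta>,
       if thin \<longrightarrow> u < m_prior U0 j \<xi> \<theta> (enn2real x) / M0 j \<xi> \<theta> (enn2real x) then flip j \<theta> else \<theta>)"
    have f: "?f \<in> measurable (uniform_measure lborel {0<..<1::real}) skeleton_space"
      by (intro measurable_skeletonI measurable_velocity_choice[OF \<theta>]) measurable
    show ?thesis
      unfolding prior_move_def bind_return_distr'[OF _ f, simplified]
      using t x by (subst AE_distr_iff[OF f]) (use P in \<open>auto simp: pred_def ennreal_add_eq_top\<close>)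
  qed
  have lik: "AE z in lik_move t \<xi> \<theta> i x. ?P z" if x: "x \<noteq> \<infinity>" for i x
  proof -
    interpret prob_space "\<mu> i" by (rule estimator_prob)
    let ?U = "uniform_measure lborel {0<..<1::real}"
    let ?f = "\<lambda>b u. (t + x, \<xi> + enn2real x *\<^sub>R \<theta>,
       if u < m_lik g i \<xi> \<theta> (enn2real x) b / Ml i \<xi> \<theta> (enn2real x) then flip i \<theta> else \<theta>)"
    have [measurable]: "m_lik g i \<xi> \<theta> s \<in> borel_measurable (\<mu> i)" for s
      using measurable_Pair2[OF measurable_m_lik[OF \<theta>, of i \<xi>], of s] by simp
    have f: "?f b \<in> measurable ?U skeleton_space" for b
      by (intro measurable_skeletonI measurable_velocity_choice[OF \<theta>]) measurable
    have "(\<lambda>p. ?f (fst p) (snd p)) \<in> measurable (\<mu> i \<Otimes>\<^sub>M borel) skeleton_space"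
      by (intro measurable_skeletonI measurable_velocity_choice[OF \<theta>]) measurable
    then have k: "(\<lambda>b. distr ?U skeleton_space (?f b)) \<in> measurable (\<mu> i) (subprob_algebra skeleton_space)"
      by (intro measurable_prob_algebraD measurable_distr_prob_space2[where M=borel] measurable_const prob_space_unit_uniform)
        (simp add: case_prod_beta)
    have "AE z in distr ?U skeleton_space (?f b). ?P z" for b
      using t x by (subst AE_distr_iff[OF f]) (use P in \<open>auto simp: pred_def ennreal_add_eq_top\<close>)
    then show ?thesis
      unfolding lik_move_def bind_return_distr'[OF _ f, simplified] by (subst AE_bind[OF k P]) simp
  qed
  have "AE z in move t \<xi> \<theta> \<tau>l \<tau>0. ?P z" for \<tau>l \<tau>0
  proof -
    have "AE z in return skeleton_space (\<infinity>, \<xi>, \<theta>). ?P z"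
      using \<theta> by (subst AE_return[OF _ P]) auto
    moreover have "\<tau>0 (first_clock \<tau>0) < \<tau>l (first_clock \<tau>l) \<Longrightarrow> \<tau>0 (first_clock \<tau>0) \<noteq> \<infinity>"
      by auto
    ultimately show ?thesis
      using prior[of "\<tau>0 (first_clock \<tau>0)" "first_clock \<tau>0"] lik[of "\<tau>l (first_clock \<tau>l)" "first_clock \<tau>l"]
      unfolding move_def
      by (cases "\<tau>0 (first_clock \<tau>0) < \<tau>l (first_clock \<tau>l)"; cases "\<tau>l (first_clock \<tau>l) = \<infinity>")
        (auto simp: not_less top_unique)
  qed
  then have "AE z in O.clocks \<bind> move t \<xi> \<theta> \<tau>l. ?P z" for \<tau>l
    by (rule AE_bind[OF move' P, THEN iffD2, OF AE_I2])
  then show "AE z in attempt thin U0 M0 \<mu> g Ml (t, \<xi>, \<theta>). ?P z"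
    unfolding attempt_eq_move[OF t]
    by (rule AE_bind[OF measurable_prob_algebraD[OF bind] P, THEN iffD2, OF AE_I2])
qed

text \<open>From here on an attempt is known only through its proposal rate and its flip rates; the
  estimator returns when the balance of the rates is verified.\<close>

lemma thinned_kernel_attempt: "thinned_kernel effective_rate proposal_rate (attempt thin U0 M0 \<mu> g Ml)"
proof (intro thinned_kernel.intro thinned_kernel_axioms.intro zigzag_rates_effective)
  interpret zigzag_rates effective_rate by (rule zigzag_rates_effective)
  fix \<theta> :: "real^'p" assume \<theta>: "\<theta> \<in> velocities"
  show "(\<lambda>(\<xi>, s). proposal_rate \<xi> \<theta> s) \<in> borel_measurable (borel \<Otimes>\<^sub>M borel)"
    using measurable_Ml[OF \<theta>] measurable_M0[OF \<theta>]
    unfolding case_prod_beta by (intro borel_measurable_sum borel_measurable_add)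
  show "hazard (proposal_rate \<xi> \<theta>)" for \<xi>
    by (rule hazard_proposal_rate[OF \<theta>])
  show "bounce_rate (\<xi> + s *\<^sub>R \<theta>) \<theta> \<le> proposal_rate \<xi> \<theta> s" if "0 \<le> s" for \<xi> s
    unfolding bounce_rate_def using rate_prior_le[OF \<theta> that] rate_lik_le[OF \<theta> that]
    by (intro sum_mono) (simp add: add.commute add_mono)
  show "attempt thin U0 M0 \<mu> g Ml (\<infinity>, \<xi>, \<theta>) = return skeleton_space (\<infinity>, \<xi>, \<theta>)" for \<xi>
    by (simp add: attempt_def)
  show "AE z in attempt thin U0 M0 \<mu> g Ml (t, \<xi>, \<theta>). fst z = \<infinity> \<longrightarrow> snd z = (\<xi>, \<theta>)" if "t \<noteq> \<infinity>" for t \<xi>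
    by (rule attempt_in_prob_algebra(2)[OF \<theta> that])
next
  fix z :: "'p skeleton_point" assume "z \<in> space skeleton_space"
  moreover obtain t \<xi> \<theta> where z: "z = (t, \<xi>, \<theta>)" by (cases z)
  ultimately have \<theta>: "\<theta> \<in> velocities" by simp
  show "attempt thin U0 M0 \<mu> g Ml z \<in> space (prob_algebra skeleton_space)"
  proof (cases "t = \<infinity>")
    case True
    then show ?thesis using \<theta> by (simp add: z attempt_def space_prob_algebra prob_space_return)
  next
    case False
    then show ?thesis unfolding z by (rule attempt_in_prob_algebra(1)[OF \<theta>])
  qed
next
  interpret zigzag_rates effective_rate by (rule zigzag_rates_effective)
  fix t :: ennreal and \<xi> \<theta> :: "real^'p" and F :: "'p skeleton_point \<Rightarrow> ennreal"
  assume "t \<noteq> \<infinity>" "\<theta> \<in> velocities" "F \<in> borel_measurable skeleton_space" "\<And>x. F (\<infinity>, x) = 0"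
  then show "(\<integral>\<^sup>+z. F z \<partial>attempt thin U0 M0 \<mu> g Ml (t, \<xi>, \<theta>)) =
      (\<integral>\<^sup>+s. ((\<Sum>i\<in>UNIV. ennreal (effective_rate i (\<xi> + s *\<^sub>R \<theta>) \<theta>) * F (t + ennreal s, \<xi> + s *\<^sub>R \<theta>, flip i \<theta>)) +
          ennreal (proposal_rate \<xi> \<theta> s - bounce_rate (\<xi> + s *\<^sub>R \<theta>) \<theta>) * F (t + ennreal s, \<xi> + s *\<^sub>R \<theta>, \<theta>)) *
        ennreal (exp (- cumulative (proposal_rate \<xi> \<theta>) s)) * indicator {0..} s \<partial>lborel)"
    unfolding bounce_rate_def by (intro nn_integral_attempt)
qed

end

section \<open>Renewal at the next bounce\<close>

declare space_skeleton_space [simp del]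

text \<open>The definition of a chain tests rectangles only. They form an intersection-stable
  generator, so the joint law of the history and the next point is determined, and integrals of
  arbitrary nonnegative functions of both follow.\<close>

lemma markov_chain_nn_integral:
  assumes chain: "markov_chain \<Omega> S K Y"
    and K: "K \<in> measurable S (prob_algebra S)"
    and F [measurable]: "F \<in> borel_measurable (PiM {..k} (\<lambda>_. S) \<Otimes>\<^sub>M S)"
  shows "(\<integral>\<^sup>+\<omega>. F (\<lambda>i\<in>{..k}. Y i \<omega>, Y (Suc k) \<omega>) \<partial>\<Omega>) =
    (\<integral>\<^sup>+\<omega>. \<integral>\<^sup>+z. F (\<lambda>i\<in>{..k}. Y i \<omega>, z) \<partial>K (Y k \<omega>) \<partial>\<Omega>)"
proof -
  interpret P: prob_space \<Omega> using chain by (simp add: markov_chain_def)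
  have Y [measurable]: "Y k \<in> measurable \<Omega> S" for k using chain by (simp add: markov_chain_def)
  let ?H = "PiM {..k} (\<lambda>_. S)"
  let ?h = "\<lambda>\<omega>. \<lambda>i\<in>{..k}. Y i \<omega>"
  have h [measurable]: "?h \<in> measurable \<Omega> ?H" by (intro measurable_restrict) measurable
  have Kk: "(\<lambda>\<omega>. K (Y k \<omega>)) \<in> measurable \<Omega> (prob_algebra S)"
    by (rule measurable_compose[OF Y K])
  have sK: "sets (K (Y k \<omega>)) = sets S" "prob_space (K (Y k \<omega>))" if "\<omega> \<in> space \<Omega>" for \<omega>
    using measurable_space[OF Kk that] by (auto simp: space_prob_algebra)
  let ?k = "\<lambda>\<omega>. distr (K (Y k \<omega>)) (?H \<Otimes>\<^sub>M S) (\<lambda>z. (?h \<omega>, z))"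
  have k: "?k \<in> measurable \<Omega> (subprob_algebra (?H \<Otimes>\<^sub>M S))"
    by (intro measurable_prob_algebraD measurable_distr_prob_space2[OF Kk]) measurable
  have eq: "distr \<Omega> (?H \<Otimes>\<^sub>M S) (\<lambda>\<omega>. (?h \<omega>, Y (Suc k) \<omega>)) = \<Omega> \<bind> ?k"
  proof (rule measure_eqI_generator_eq[OF Int_stable_pair_measure_generator pair_measure_closed])
    show "sets (distr \<Omega> (?H \<Otimes>\<^sub>M S) (\<lambda>\<omega>. (?h \<omega>, Y (Suc k) \<omega>))) =
        sigma_sets (space ?H \<times> space S) {a \<times> b |a b. a \<in> sets ?H \<and> b \<in> sets S}"
      by (simp add: sets_pair_measure)
    show "sets (\<Omega> \<bind> ?k) = sigma_sets (space ?H \<times> space S) {a \<times> b |a b. a \<in> sets ?H \<and> b \<in> sets S}"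
      unfolding sets_pair_measure[symmetric] by (rule sets_bind) (simp_all add: P.not_empty)
    show "range (\<lambda>_::nat. space ?H \<times> space S) \<subseteq> {a \<times> b |a b. a \<in> sets ?H \<and> b \<in> sets S}" by auto
    show "(\<Union>i::nat. space ?H \<times> space S) = space ?H \<times> space S" by simp
    have "prob_space (distr \<Omega> (?H \<Otimes>\<^sub>M S) (\<lambda>\<omega>. (?h \<omega>, Y (Suc k) \<omega>)))"
      by (rule P.prob_space_distr) measurable
    then show "emeasure (distr \<Omega> (?H \<Otimes>\<^sub>M S) (\<lambda>\<omega>. (?h \<omega>, Y (Suc k) \<omega>))) (space ?H \<times> space S) \<noteq> \<infinity>"
      by (simp add: prob_space_def finite_measure.emeasure_finite)
  next
    fix X assume "X \<in> {a \<times> b |a b. a \<in> sets ?H \<and> b \<in> sets S}"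
    then obtain a b where X: "X = a \<times> b" and [measurable]: "a \<in> sets ?H" "b \<in> sets S" by auto
    have "emeasure (distr \<Omega> (?H \<Otimes>\<^sub>M S) (\<lambda>\<omega>. (?h \<omega>, Y (Suc k) \<omega>))) X =
        emeasure \<Omega> {\<omega>\<in>space \<Omega>. ?h \<omega> \<in> a \<and> Y (Suc k) \<omega> \<in> b}"
      by (subst emeasure_distr) (auto simp: X intro!: arg_cong[where f="emeasure \<Omega>"])
    also have "\<dots> = (\<integral>\<^sup>+\<omega>. indicator a (?h \<omega>) * emeasure (K (Y k \<omega>)) b \<partial>\<Omega>)"
      using chain by (simp add: markov_chain_def)
    also have "\<dots> = (\<integral>\<^sup>+\<omega>. emeasure (?k \<omega>) X \<partial>\<Omega>)"
    proof (rule nn_integral_cong)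
      fix \<omega> assume \<omega>: "\<omega> \<in> space \<Omega>"
      have [measurable_cong]: "sets (K (Y k \<omega>)) = sets S" by (rule sK[OF \<omega>])
      have [measurable]: "?h \<omega> \<in> space ?H" using measurable_space[OF h \<omega>] .
      have "emeasure (?k \<omega>) X = emeasure (K (Y k \<omega>)) ((\<lambda>z. (?h \<omega>, z)) -` X \<inter> space (K (Y k \<omega>)))"
        by (rule emeasure_distr) (auto simp: X)
      also have "(\<lambda>z. (?h \<omega>, z)) -` X \<inter> space (K (Y k \<omega>)) = (if ?h \<omega> \<in> a then b else {})"
        using sets.sets_into_space[OF \<open>b \<in> sets S\<close>] sets_eq_imp_space_eq[OF sK(1)[OF \<omega>]] by (auto simp: X)
      finally have e: "emeasure (?k \<omega>) X = emeasure (K (Y k \<omega>)) (if ?h \<omega> \<in> a then b else {})" .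
      show "indicator a (?h \<omega>) * emeasure (K (Y k \<omega>)) b = emeasure (?k \<omega>) X"
        unfolding e by (cases "?h \<omega> \<in> a") simp_all
    qed
    also have "\<dots> = emeasure (\<Omega> \<bind> ?k) X"
      by (rule emeasure_bind[OF P.not_empty k, symmetric]) (simp add: X)
    finally show "emeasure (distr \<Omega> (?H \<Otimes>\<^sub>M S) (\<lambda>\<omega>. (?h \<omega>, Y (Suc k) \<omega>))) X = emeasure (\<Omega> \<bind> ?k) X" .
  qed
  have "(\<integral>\<^sup>+\<omega>. F (?h \<omega>, Y (Suc k) \<omega>) \<partial>\<Omega>) = (\<integral>\<^sup>+p. F p \<partial>(\<Omega> \<bind> ?k))"
    unfolding eq[symmetric] by (rule nn_integral_distr[symmetric]) measurable
  also have "\<dots> = (\<integral>\<^sup>+\<omega>. \<integral>\<^sup>+p. F p \<partial>?k \<omega> \<partial>\<Omega>)"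
    by (rule nn_integral_bind[OF F k])
  also have "\<dots> = (\<integral>\<^sup>+\<omega>. \<integral>\<^sup>+z. F (?h \<omega>, z) \<partial>K (Y k \<omega>) \<partial>\<Omega>)"
  proof (rule nn_integral_cong)
    fix \<omega> assume \<omega>: "\<omega> \<in> space \<Omega>"
    have [measurable_cong]: "sets (K (Y k \<omega>)) = sets S" by (rule sK[OF \<omega>])
    have [measurable]: "?h \<omega> \<in> space ?H" using measurable_space[OF h \<omega>] .
    show "(\<integral>\<^sup>+p. F p \<partial>?k \<omega>) = (\<integral>\<^sup>+z. F (?h \<omega>, z) \<partial>K (Y k \<omega>))"
      by (rule nn_integral_distr) measurable
  qed
  finally show ?thesis .
qed

lemma sets_skeleton_time [measurable]:
  "{z \<in> space skeleton_space. fst z = \<infinity>} \<in> sets skeleton_space"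
  "{z \<in> space skeleton_space. fst z \<noteq> \<infinity>} \<in> sets skeleton_space"
proof -
  show *: "{z \<in> space skeleton_space. fst z = \<infinity>} \<in> sets skeleton_space"
    using measurable_sets[OF measurable_skeleton_time, of "{\<infinity>}"] by (simp add: vimage_def Int_def conj_commute)
  have "{z \<in> space skeleton_space. fst z \<noteq> \<infinity>} = space skeleton_space - {z \<in> space skeleton_space. fst z = \<infinity>}"
    by auto
  with * show "{z \<in> space skeleton_space. fst z \<noteq> \<infinity>} \<in> sets skeleton_space" by simp
qed

context thinned_kernel
begin

lemma prob_space_kernel: "z \<in> space skeleton_space \<Longrightarrow> prob_space (K z)"
  and sets_kernel: "z \<in> space skeleton_space \<Longrightarrow> sets (K z) = sets skeleton_space"
  using kernel by (auto simp: space_prob_algebra)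

text \<open>A thinned kernel is assumed to be a probability measure at each point, with no
  measurability in the starting point. That is recovered from the explicit formula for its finite
  events, whose integrand is treated here.\<close>

lemma measurable_event_integrand:
  assumes [measurable]: "F \<in> borel_measurable (M \<Otimes>\<^sub>M skeleton_space)" and \<theta>: "\<theta> \<in> velocities"
  shows "(\<lambda>((x, t, \<xi>), s). ((\<Sum>i\<in>UNIV. ennreal (rate i (\<xi> + s *\<^sub>R \<theta>) \<theta>) * F (x, t + ennreal s, \<xi> + s *\<^sub>R \<theta>, flip i \<theta>)) +
          ennreal (bound \<xi> \<theta> s - bounce_rate (\<xi> + s *\<^sub>R \<theta>) \<theta>) * F (x, t + ennreal s, \<xi> + s *\<^sub>R \<theta>, \<theta>)) *
        ennreal (exp (- cumulative (bound \<xi> \<theta>) s)) * indicator {0..} s)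
      \<in> borel_measurable ((M \<Otimes>\<^sub>M borel \<Otimes>\<^sub>M borel) \<Otimes>\<^sub>M lborel)"
proof -
  let ?N = "(M \<Otimes>\<^sub>M (borel :: ennreal measure) \<Otimes>\<^sub>M (borel :: (real^'p) measure)) \<Otimes>\<^sub>M (lborel :: real measure)"
  have pos: "(\<lambda>p. snd (snd (fst p)) + snd p *\<^sub>R \<theta>) \<in> borel_measurable ?N" by measurable
  have F': "(\<lambda>p. F (fst (fst p), fst (snd (fst p)) + ennreal (snd p), snd (snd (fst p)) + snd p *\<^sub>R \<theta>, \<theta>')) \<in> borel_measurable ?N"
    if "\<theta>' \<in> velocities" for \<theta>'
  proof -
    have "(\<lambda>p. (fst (fst p), fst (snd (fst p)) + ennreal (snd p), snd (snd (fst p)) + snd p *\<^sub>R \<theta>, \<theta>')) \<in>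
        measurable ?N (M \<Otimes>\<^sub>M skeleton_space)"
      by (intro measurable_Pair measurable_skeletonI) (use that in \<open>measurable, simp\<close>)
    from measurable_compose[OF this assms(1)] show ?thesis .
  qed
  have bnd: "(\<lambda>p. bound (snd (snd (fst p))) \<theta> (snd p)) \<in> borel_measurable ?N"
  proof -
    have "(\<lambda>p. (snd (snd (fst p)), snd p)) \<in> measurable ?N (borel \<Otimes>\<^sub>M borel)" by measurable
    from measurable_compose[OF this measurable_bound[OF \<theta>]] show ?thesis by simp
  qed
  have cum: "(\<lambda>p. cumulative (bound (snd (snd (fst p))) \<theta>) (snd p)) \<in> borel_measurable ?N"
  proof -
    have "(\<lambda>q. (snd (snd (fst (fst q))), snd q)) \<in> measurable (?N \<Otimes>\<^sub>M lborel) (borel \<Otimes>\<^sub>M borel)" by measurable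
    from measurable_compose[OF this measurable_bound[OF \<theta>]]
    have [measurable]: "(\<lambda>q. bound (snd (snd (fst (fst q)))) \<theta> (snd q)) \<in> borel_measurable (?N \<Otimes>\<^sub>M lborel)" by simp
    have "(\<lambda>p. LINT r|lborel. (if 0 \<le> r \<and> r \<le> snd p then 1 else 0) *\<^sub>R bound (snd (snd (fst p))) \<theta> r) \<in> borel_measurable ?N"
      by (rule lborel.borel_measurable_lebesgue_integral) measurable
    then show ?thesis by (simp add: cumulative_def set_lebesgue_integral_def indicator_def of_bool_def cong: if_cong)
  qed
  note [measurable] = measurable_compose[OF pos measurable_rate[OF \<theta>]] measurable_compose[OF pos measurable_bounce_rate[OF \<theta>]]
    F'[OF \<theta>] bnd cum
  have "(\<lambda>p. \<Sum>i\<in>UNIV. ennreal (rate i (snd (snd (fst p)) + snd p *\<^sub>R \<theta>) \<theta>) *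
      F (fst (fst p), fst (snd (fst p)) + ennreal (snd p), snd (snd (fst p)) + snd p *\<^sub>R \<theta>, flip i \<theta>)) \<in> borel_measurable ?N"
    by (intro borel_measurable_sum borel_measurable_times_ennreal F' measurable_compose[OF _ measurable_ennreal]
        measurable_compose[OF pos measurable_rate[OF \<theta>]]) (use \<theta> in simp)
  then show ?thesis unfolding case_prod_beta by measurable
qed

lemma measurable_event_integral:
  assumes F [measurable]: "F \<in> borel_measurable (M \<Otimes>\<^sub>M skeleton_space)"
  shows "(\<lambda>(x, t, \<xi>, \<theta>). \<integral>\<^sup>+s. ((\<Sum>i\<in>UNIV. ennreal (rate i (\<xi> + s *\<^sub>R \<theta>) \<theta>) * F (x, t + ennreal s, \<xi> + s *\<^sub>R \<theta>, flip i \<theta>)) +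
          ennreal (bound \<xi> \<theta> s - bounce_rate (\<xi> + s *\<^sub>R \<theta>) \<theta>) * F (x, t + ennreal s, \<xi> + s *\<^sub>R \<theta>, \<theta>)) *
        ennreal (exp (- cumulative (bound \<xi> \<theta>) s)) * indicator {0..} s \<partial>lborel)
      \<in> borel_measurable (M \<Otimes>\<^sub>M skeleton_space)"
proof -
  let ?G = "\<lambda>(x, t, \<xi>) \<theta>. \<integral>\<^sup>+s. ((\<Sum>i\<in>UNIV. ennreal (rate i (\<xi> + s *\<^sub>R \<theta>) \<theta>) * F (x, t + ennreal s, \<xi> + s *\<^sub>R \<theta>, flip i \<theta>)) +
          ennreal (bound \<xi> \<theta> s - bounce_rate (\<xi> + s *\<^sub>R \<theta>) \<theta>) * F (x, t + ennreal s, \<xi> + s *\<^sub>R \<theta>, \<theta>)) *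
        ennreal (exp (- cumulative (bound \<xi> \<theta>) s)) * indicator {0..} s \<partial>lborel"
  have "(\<lambda>p. ?G (fst p, fst (snd p), fst (snd (snd p))) (snd (snd (snd p)))) \<in> borel_measurable (M \<Otimes>\<^sub>M skeleton_space)"
  proof (rule measurable_velocity_cases)
    show "(\<lambda>p. snd (snd (snd p))) \<in> measurable (M \<Otimes>\<^sub>M skeleton_space) (count_space velocities)"
      by (rule measurable_compose[OF measurable_snd measurable_skeleton_velocity])
    fix \<theta> :: "real^'p" assume \<theta>: "\<theta> \<in> velocities"
    have m: "(\<lambda>p. (fst p, fst (snd p), fst (snd (snd p)))) \<in> measurable (M \<Otimes>\<^sub>M skeleton_space) (M \<Otimes>\<^sub>M borel \<Otimes>\<^sub>M borel)"
      by (intro measurable_Pair measurable_compose[OF measurable_snd measurable_skeleton_position]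
          measurable_compose[OF measurable_snd measurable_skeleton_time] measurable_fst)
    have "(\<lambda>y. ?G y \<theta>) \<in> borel_measurable (M \<Otimes>\<^sub>M borel \<Otimes>\<^sub>M borel)"
      using lborel.borel_measurable_nn_integral_fst[OF measurable_event_integrand[OF F \<theta>]]
      by (simp add: case_prod_beta)
    from measurable_compose[OF m this]
    show "(\<lambda>p. ?G (fst p, fst (snd p), fst (snd (snd p))) \<theta>) \<in> borel_measurable (M \<Otimes>\<^sub>M skeleton_space)" .
  qed
  then show ?thesis by (simp add: case_prod_beta)
qed

text \<open>The mass at time \<infinity> sits at the single point
  \<open>(\<infinity>, snd z)\<close>, so it is the deficit of the mass of the finite
  events.\<close>

lemma emeasure_kernel:
  assumes z: "z \<in> space skeleton_space" and t: "fst z \<noteq> \<infinity>" and A [measurable]: "A \<in> sets skeleton_space"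
  shows "emeasure (K z) A = emeasure (K z) {z' \<in> A. fst z' \<noteq> \<infinity>} +
    indicator A (\<infinity>, snd z) * (1 - emeasure (K z) {z' \<in> space skeleton_space. fst z' \<noteq> \<infinity>})"
proof -
  interpret prob_space "K z" by (rule prob_space_kernel[OF z])
  have [measurable_cong, simp]: "sets (K z) = sets skeleton_space" by (rule sets_kernel[OF z])
  have sp [simp]: "space (K z) = space skeleton_space" by (rule sets_eq_imp_space_eq) simp
  obtain t \<xi> \<theta> where z_eq: "z = (t, \<xi>, \<theta>)" by (cases z)
  have eqs: "{z' \<in> A. fst z' \<noteq> \<infinity>} = A \<inter> {z' \<in> space skeleton_space. fst z' \<noteq> \<infinity>}"
    using sets.sets_into_space[OF A] by auto
  have "emeasure (K z) A = emeasure (K z) {z' \<in> A. fst z' \<noteq> \<infinity>} + emeasure (K z) (A \<inter> {z' \<in> space skeleton_space. fst z' = \<infinity>})"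
    unfolding eqs by (subst plus_emeasure) (use sets.sets_into_space[OF A] in \<open>auto intro!: arg_cong[where f="emeasure (K z)"]\<close>)
  also have "emeasure (K z) (A \<inter> {z' \<in> space skeleton_space. fst z' = \<infinity>}) =
      emeasure (K z) (if (\<infinity>, snd z) \<in> A then {z' \<in> space skeleton_space. fst z' = \<infinity>} else {})"
  proof (rule emeasure_eq_AE)
    have "AE z' in K z. fst z' = \<infinity> \<longrightarrow> snd z' = snd z"
      using kernel_no_event[of t \<theta> \<xi>] z t unfolding z_eq by (simp add: space_skeleton_space)
    then show "AE z' in K z. z' \<in> A \<inter> {z' \<in> space skeleton_space. fst z' = \<infinity>} \<longleftrightarrow>
        z' \<in> (if (\<infinity>, snd z) \<in> A then {z' \<in> space skeleton_space. fst z' = \<infinity>} else {})"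
      using AE_space by eventually_elim (auto simp: prod_eq_iff)
  qed auto
  also have "emeasure (K z) (if (\<infinity>, snd z) \<in> A then {z' \<in> space skeleton_space. fst z' = \<infinity>} else {}) =
      indicator A (\<infinity>, snd z) * emeasure (K z) (space (K z) - {z' \<in> space skeleton_space. fst z' \<noteq> \<infinity>})"
    by (auto simp: indicator_def intro!: arg_cong[where f="emeasure (K z)"])
  also have "emeasure (K z) (space (K z) - {z' \<in> space skeleton_space. fst z' \<noteq> \<infinity>}) =
      1 - emeasure (K z) {z' \<in> space skeleton_space. fst z' \<noteq> \<infinity>}"
    by (subst emeasure_compl) (simp_all add: emeasure_space_1[unfolded sp])
  finally show ?thesis .
qed

lemma measurable_emeasure_kernel_finite:
  assumes A [measurable]: "A \<in> sets skeleton_space"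
  shows "(\<lambda>z. if fst z = \<infinity> then 0 else emeasure (K z) {z' \<in> A. fst z' \<noteq> \<infinity>}) \<in> borel_measurable skeleton_space"
proof -
  have "{z' \<in> A. fst z' \<noteq> \<infinity>} = A \<inter> {z' \<in> space skeleton_space. fst z' \<noteq> \<infinity>}"
    using sets.sets_into_space[OF A] by auto
  then have B [measurable]: "{z' \<in> A. fst z' \<noteq> \<infinity>} \<in> sets skeleton_space" by simp
  let ?F = "\<lambda>p::unit \<times> 'p skeleton_point. indicator {z' \<in> A. fst z' \<noteq> \<infinity>} (snd p) :: ennreal"
  have "?F \<in> borel_measurable (count_space UNIV \<Otimes>\<^sub>M skeleton_space)" by measurable
  note m = measurable_Pair2[OF measurable_event_integral[OF this], of "()"]
  have "(\<lambda>z. if fst z = \<infinity> then 0 else (\<lambda>(x, t, \<xi>, \<theta>). \<integral>\<^sup>+s. ((\<Sum>i\<in>UNIV. ennreal (rate i (\<xi> + s *\<^sub>R \<theta>) \<theta>) * ?F (x, t + ennreal s, \<xi> + s *\<^sub>R \<theta>, flip i \<theta>)) +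
          ennreal (bound \<xi> \<theta> s - bounce_rate (\<xi> + s *\<^sub>R \<theta>) \<theta>) * ?F (x, t + ennreal s, \<xi> + s *\<^sub>R \<theta>, \<theta>)) *
        ennreal (exp (- cumulative (bound \<xi> \<theta>) s)) * indicator {0..} s \<partial>lborel) ((), z)) \<in> borel_measurable skeleton_space"
    by (rule measurable_If[OF measurable_const m sets_skeleton_time(1)]) simp_all
  then show ?thesis
  proof (rule measurable_cong[THEN iffD1, rotated])
    fix z :: "'p skeleton_point" assume z: "z \<in> space skeleton_space"
    obtain t \<xi> \<theta> where z_eq: "z = (t, \<xi>, \<theta>)" by (cases z)
    have "emeasure (K z) {z' \<in> A. fst z' \<noteq> \<infinity>} = (\<integral>\<^sup>+z'. indicator {z' \<in> A. fst z' \<noteq> \<infinity>} z' \<partial>K z)"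
      using B sets_kernel[OF z] by (subst nn_integral_indicator) auto
    also have "\<dots> = (\<integral>\<^sup>+s. ((\<Sum>i\<in>UNIV. ennreal (rate i (\<xi> + s *\<^sub>R \<theta>) \<theta>) * ?F ((), t + ennreal s, \<xi> + s *\<^sub>R \<theta>, flip i \<theta>)) +
          ennreal (bound \<xi> \<theta> s - bounce_rate (\<xi> + s *\<^sub>R \<theta>) \<theta>) * ?F ((), t + ennreal s, \<xi> + s *\<^sub>R \<theta>, \<theta>)) *
        ennreal (exp (- cumulative (bound \<xi> \<theta>) s)) * indicator {0..} s \<partial>lborel)" if "t \<noteq> \<infinity>"
      unfolding z_eq snd_conv using z that by (intro kernel_event) (auto simp: z_eq B space_skeleton_space)
    finally show "(if fst z = \<infinity> then 0 else (\<lambda>(x, t, \<xi>, \<theta>). \<integral>\<^sup>+s. ((\<Sum>i\<in>UNIV. ennreal (rate i (\<xi> + s *\<^sub>R \<theta>) \<theta>) * ?F (x, t + ennreal s, \<xi> + s *\<^sub>R \<theta>, flip i \<theta>)) +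
          ennreal (bound \<xi> \<theta> s - bounce_rate (\<xi> + s *\<^sub>R \<theta>) \<theta>) * ?F (x, t + ennreal s, \<xi> + s *\<^sub>R \<theta>, \<theta>)) *
        ennreal (exp (- cumulative (bound \<xi> \<theta>) s)) * indicator {0..} s \<partial>lborel) ((), z)) =
      (if fst z = \<infinity> then 0 else emeasure (K z) {z' \<in> A. fst z' \<noteq> \<infinity>})"
      by (simp add: z_eq)
  qed
qed

lemma kernel_infinite': "z \<in> space skeleton_space \<Longrightarrow> fst z = \<infinity> \<Longrightarrow> K z = return skeleton_space z"
  using kernel_infinite[of "snd (snd z)" "fst (snd z)"] by (cases z) (auto simp: space_skeleton_space)

lemma measurable_kernel: "K \<in> measurable skeleton_space (prob_algebra skeleton_space)"
proof (intro measurable_prob_algebraI measurable_subprob_algebra)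
  fix A :: "'p skeleton_point set" assume A [measurable]: "A \<in> sets skeleton_space"
  have "(\<lambda>z::'p skeleton_point. (\<infinity> :: ennreal, fst (snd z), snd (snd z))) \<in> measurable skeleton_space skeleton_space"
    by (intro measurable_skeletonI) measurable
  then have [measurable]: "(\<lambda>z::'p skeleton_point. (\<infinity> :: ennreal, snd z)) \<in> measurable skeleton_space skeleton_space"
    by simp
  have i: "(\<lambda>z. indicator A (\<infinity>, snd z) :: ennreal) \<in> borel_measurable skeleton_space" by measurable
  have "(\<lambda>z. if fst z = \<infinity> then indicator A z
      else (if fst z = \<infinity> then 0 else emeasure (K z) {z' \<in> A. fst z' \<noteq> \<infinity>}) + indicator A (\<infinity>, snd z) *
        (1 - (if fst z = \<infinity> then 0 else emeasure (K z) {z' \<in> space skeleton_space. fst z' \<noteq> \<infinity>})))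
    \<in> borel_measurable skeleton_space"
    by (intro measurable_If[OF _ _ sets_skeleton_time(1)] borel_measurable_add borel_measurable_times_ennreal
        borel_measurable_minus_ennreal borel_measurable_const borel_measurable_indicator i A
        measurable_emeasure_kernel_finite[OF A] measurable_emeasure_kernel_finite[OF sets.top])
  then show "(\<lambda>z. emeasure (K z) A) \<in> borel_measurable skeleton_space"
  proof (rule measurable_cong[THEN iffD1, rotated])
    fix z :: "'p skeleton_point" assume z: "z \<in> space skeleton_space"
    show "(if fst z = \<infinity> then indicator A z
      else (if fst z = \<infinity> then 0 else emeasure (K z) {z' \<in> A. fst z' \<noteq> \<infinity>}) + indicator A (\<infinity>, snd z) *
        (1 - (if fst z = \<infinity> then 0 else emeasure (K z) {z' \<in> space skeleton_space. fst z' \<noteq> \<infinity>}))) =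
      emeasure (K z) A"
      using emeasure_kernel[OF z _ A] by (cases "fst z = \<infinity>") (simp_all add: kernel_infinite'[OF z] A)
  qed
qed (auto intro: prob_space_kernel prob_space_imp_subprob_space simp: sets_kernel)

end

context thinned_kernel
begin

lemma zigzag_kernel: "thinned_kernel rate (\<lambda>\<xi> \<theta> s. bounce_rate (\<xi> + s *\<^sub>R \<theta>) \<theta>) (zigzag_step rate)"
  by (rule thinned_kernel_zigzag_step)

text \<open>If the first attempt flips, its endpoint is the bounce; otherwise the bounce law starts
  afresh from the endpoint. Along the ray the restarted law is the law given survival up to the
  rejection, which is the setting of \<open>thinning_identity\<close>.\<close>

lemma next_bounce_renewal:
  assumes z: "z \<in> space skeleton_space" and B [measurable]: "B \<in> sets skeleton_space"
    and B_finite: "\<And>z'. z' \<in> B \<Longrightarrow> fst z' \<noteq> \<infinity>"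
  shows "emeasure (zigzag_step rate z) B =
    (\<integral>\<^sup>+z'. (if snd (snd z') \<noteq> snd (snd z) then indicator B z' else emeasure (zigzag_step rate z') B) \<partial>K z)"
proof -
  interpret Z: thinned_kernel rate "\<lambda>\<xi> \<theta> s. bounce_rate (\<xi> + s *\<^sub>R \<theta>) \<theta>" "zigzag_step rate"
    by (rule zigzag_kernel)
  have h [measurable]: "(\<lambda>z'. emeasure (zigzag_step rate z') B) \<in> borel_measurable skeleton_space"
    using measurable_emeasure_kernel[OF measurable_prob_algebraD[OF Z.measurable_kernel] B] .
  have h_inf: "emeasure (zigzag_step rate z') B = 0" if "z' \<in> space skeleton_space" "fst z' = \<infinity>" for z'
    using that B_finite[of z'] by (auto simp: Z.kernel_infinite' indicator_def)
  obtain t \<xi> \<theta> where z_eq: "z = (t, \<xi>, \<theta>)" by (cases z)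
  with z have \<theta>: "\<theta> \<in> velocities" by (simp add: space_skeleton_space)
  \<comment> \<open>The value 0 off the state space makes \<open>F\<close> vanish at every point of
    infinite time, as \<open>kernel_event\<close> demands, and not only at those with an admissible
    velocity.\<close>
  define F where "F z' = (if snd (snd z') \<notin> velocities then 0 else
    if snd (snd z') \<noteq> \<theta> then indicator B z' else emeasure (zigzag_step rate z') B)" for z' :: "'p skeleton_point"
  have F [measurable]: "F \<in> borel_measurable skeleton_space"
  proof -
    have [measurable]: "Measurable.pred skeleton_space (\<lambda>z'. snd (snd z') = \<theta>)"
      using \<theta> by measurable
    have "(\<lambda>z'. if snd (snd z') \<noteq> \<theta> then indicator B z' else emeasure (zigzag_step rate z') B) \<in> borel_measurable skeleton_space"
      by measurable
    then show ?thesis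
      by (rule measurable_cong[THEN iffD1, rotated]) (simp add: F_def space_skeleton_space)
  qed
  have F_inf: "F (\<infinity>, x) = 0" for x
    using h_inf[of "(\<infinity>, x)"] B_finite[of "(\<infinity>, x)"] by (auto simp: F_def space_skeleton_space indicator_def)
  have K_eq: "(\<integral>\<^sup>+z'. (if snd (snd z') \<noteq> snd (snd z) then indicator B z' else emeasure (zigzag_step rate z') B) \<partial>K z) =
      (\<integral>\<^sup>+z'. F z' \<partial>K z)"
    using sets_eq_imp_space_eq[OF sets_kernel[OF z]]
    by (intro nn_integral_cong) (auto simp: F_def z_eq space_skeleton_space)
  show ?thesis
  proof (cases "t = \<infinity>")
    case True
    then show ?thesis
      using z \<theta> F F_inf by (simp add: K_eq kernel_infinite' h_inf z_eq nn_integral_return)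
  next
    case False
    interpret r: hazard "\<lambda>s. bounce_rate (\<xi> + s *\<^sub>R \<theta>) \<theta>" by (rule hazard_bounce_rate[OF \<theta>])
    define A where "A s = (\<Sum>i\<in>UNIV. ennreal (rate i (\<xi> + s *\<^sub>R \<theta>) \<theta>) * indicator B (t + ennreal s, \<xi> + s *\<^sub>R \<theta>, flip i \<theta>))" for s
    have A: "A \<in> borel_measurable borel"
      unfolding A_def
    proof (intro borel_measurable_sum borel_measurable_times_ennreal)
      fix i
      show "(\<lambda>s. ennreal (rate i (\<xi> + s *\<^sub>R \<theta>) \<theta>)) \<in> borel_measurable borel"
        using hazard.measurable_rate[OF hazard_rate[OF \<theta>, of i \<xi>]] by simp
      have "(\<lambda>s. (t + ennreal s, \<xi> + s *\<^sub>R \<theta>, flip i \<theta>)) \<in> measurable borel skeleton_space"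
        by (intro measurable_skeletonI) (use \<theta> in simp_all)
      from measurable_compose[OF this borel_measurable_indicator[OF B]]
      show "(\<lambda>s. indicator B (t + ennreal s, \<xi> + s *\<^sub>R \<theta>, flip i \<theta>) :: ennreal) \<in> borel_measurable borel" .
    qed
    \<comment> \<open>A rejection at \<open>s\<close> leaves the point on the same ray, so the
      restarted hazard is the old one shifted by \<open>s\<close>.\<close>
    have h_eq: "emeasure (zigzag_step rate (t + ennreal s, \<xi> + s *\<^sub>R \<theta>, \<theta>)) B =
        (\<integral>\<^sup>+u. A (s + u) * ennreal (exp (- (cumulative (\<lambda>s. bounce_rate (\<xi> + s *\<^sub>R \<theta>) \<theta>) (s + u) -
          cumulative (\<lambda>s. bounce_rate (\<xi> + s *\<^sub>R \<theta>) \<theta>) s))) * indicator {0..} u \<partial>lborel)" if s: "0 \<le> s" for s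
    proof -
      have "emeasure (zigzag_step rate (t + ennreal s, \<xi> + s *\<^sub>R \<theta>, \<theta>)) B =
          (\<integral>\<^sup>+z'. indicator B z' \<partial>zigzag_step rate (t + ennreal s, \<xi> + s *\<^sub>R \<theta>, \<theta>))"
        using B Z.sets_kernel[of "(t + ennreal s, \<xi> + s *\<^sub>R \<theta>, \<theta>)"] \<theta>
        by (subst nn_integral_indicator) (auto simp: space_skeleton_space)
      also have "\<dots> = (\<integral>\<^sup>+u. (\<Sum>i\<in>UNIV. ennreal (rate i (\<xi> + s *\<^sub>R \<theta> + u *\<^sub>R \<theta>) \<theta>) *
          indicator B (t + ennreal s + ennreal u, \<xi> + s *\<^sub>R \<theta> + u *\<^sub>R \<theta>, flip i \<theta>)) *
        ennreal (exp (- cumulative (\<lambda>u. bounce_rate (\<xi> + s *\<^sub>R \<theta> + u *\<^sub>R \<theta>) \<theta>) u)) * indicator {0..} u \<partial>lborel)"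
      proof (rule nn_integral_zigzag_step)
        show "indicator B (\<infinity>, x) = (0 :: ennreal)" for x
          using B_finite[of "(\<infinity>, x)"] by (auto simp: indicator_def)
      qed (use \<theta> False in auto)
      also have "\<dots> = (\<integral>\<^sup>+u. A (s + u) * ennreal (exp (- (cumulative (\<lambda>s. bounce_rate (\<xi> + s *\<^sub>R \<theta>) \<theta>) (s + u) -
          cumulative (\<lambda>s. bounce_rate (\<xi> + s *\<^sub>R \<theta>) \<theta>) s))) * indicator {0..} u \<partial>lborel)"
      proof (rule nn_integral_cong)
        fix u :: real
        have "cumulative (\<lambda>u. bounce_rate (\<xi> + s *\<^sub>R \<theta> + u *\<^sub>R \<theta>) \<theta>) u =
            cumulative (\<lambda>s. bounce_rate (\<xi> + s *\<^sub>R \<theta>) \<theta>) (s + u) - cumulative (\<lambda>s. bounce_rate (\<xi> + s *\<^sub>R \<theta>) \<theta>) s"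
          if "0 \<le> u"
          using r.cumulative_shift[OF s that] by (simp add: scaleR_left_distrib add.assoc)
        then show "(\<Sum>i\<in>UNIV. ennreal (rate i (\<xi> + s *\<^sub>R \<theta> + u *\<^sub>R \<theta>) \<theta>) *
            indicator B (t + ennreal s + ennreal u, \<xi> + s *\<^sub>R \<theta> + u *\<^sub>R \<theta>, flip i \<theta>)) *
          ennreal (exp (- cumulative (\<lambda>u. bounce_rate (\<xi> + s *\<^sub>R \<theta> + u *\<^sub>R \<theta>) \<theta>) u)) * indicator {0..} u =
          A (s + u) * ennreal (exp (- (cumulative (\<lambda>s. bounce_rate (\<xi> + s *\<^sub>R \<theta>) \<theta>) (s + u) -
          cumulative (\<lambda>s. bounce_rate (\<xi> + s *\<^sub>R \<theta>) \<theta>) s))) * indicator {0..} u"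
          using s by (cases "0 \<le> u") (simp_all add: A_def scaleR_left_distrib add.assoc)
      qed
      finally show ?thesis .
    qed
    have "(\<integral>\<^sup>+z'. F z' \<partial>K z) =
      (\<integral>\<^sup>+s. ((\<Sum>i\<in>UNIV. ennreal (rate i (\<xi> + s *\<^sub>R \<theta>) \<theta>) * F (t + ennreal s, \<xi> + s *\<^sub>R \<theta>, flip i \<theta>)) +
          ennreal (bound \<xi> \<theta> s - bounce_rate (\<xi> + s *\<^sub>R \<theta>) \<theta>) * F (t + ennreal s, \<xi> + s *\<^sub>R \<theta>, \<theta>)) *
        ennreal (exp (- cumulative (bound \<xi> \<theta>) s)) * indicator {0..} s \<partial>lborel)"
      unfolding z_eq by (rule kernel_event[OF False \<theta> F F_inf])
    also have "\<dots> = (\<integral>\<^sup>+s. (A s + ennreal (bound \<xi> \<theta> s - bounce_rate (\<xi> + s *\<^sub>R \<theta>) \<theta>) *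
        (\<integral>\<^sup>+u. A (s + u) * ennreal (exp (- (cumulative (\<lambda>s. bounce_rate (\<xi> + s *\<^sub>R \<theta>) \<theta>) (s + u) -
          cumulative (\<lambda>s. bounce_rate (\<xi> + s *\<^sub>R \<theta>) \<theta>) s))) * indicator {0..} u \<partial>lborel)) *
        ennreal (exp (- cumulative (bound \<xi> \<theta>) s)) * indicator {0..} s \<partial>lborel)"
    proof (rule nn_integral_cong)
      fix s :: real
      have "F (t + ennreal s, \<xi> + s *\<^sub>R \<theta>, flip i \<theta>) = indicator B (t + ennreal s, \<xi> + s *\<^sub>R \<theta>, flip i \<theta>)" for i
        using \<theta> flip_neq[OF \<theta>] by (simp add: F_def)
      moreover have "F (t + ennreal s, \<xi> + s *\<^sub>R \<theta>, \<theta>) = emeasure (zigzag_step rate (t + ennreal s, \<xi> + s *\<^sub>R \<theta>, \<theta>)) B"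
        using \<theta> by (simp add: F_def)
      ultimately show "((\<Sum>i\<in>UNIV. ennreal (rate i (\<xi> + s *\<^sub>R \<theta>) \<theta>) * F (t + ennreal s, \<xi> + s *\<^sub>R \<theta>, flip i \<theta>)) +
          ennreal (bound \<xi> \<theta> s - bounce_rate (\<xi> + s *\<^sub>R \<theta>) \<theta>) * F (t + ennreal s, \<xi> + s *\<^sub>R \<theta>, \<theta>)) *
        ennreal (exp (- cumulative (bound \<xi> \<theta>) s)) * indicator {0..} s =
        (A s + ennreal (bound \<xi> \<theta> s - bounce_rate (\<xi> + s *\<^sub>R \<theta>) \<theta>) *
        (\<integral>\<^sup>+u. A (s + u) * ennreal (exp (- (cumulative (\<lambda>s. bounce_rate (\<xi> + s *\<^sub>R \<theta>) \<theta>) (s + u) -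
          cumulative (\<lambda>s. bounce_rate (\<xi> + s *\<^sub>R \<theta>) \<theta>) s))) * indicator {0..} u \<partial>lborel)) *
        ennreal (exp (- cumulative (bound \<xi> \<theta>) s)) * indicator {0..} s"
        by (cases "0 \<le> s") (simp_all add: A_def[of s] h_eq)
    qed
    also have "\<dots> = (\<integral>\<^sup>+s. A s * ennreal (exp (- cumulative (\<lambda>s. bounce_rate (\<xi> + s *\<^sub>R \<theta>) \<theta>) s)) * indicator {0..} s \<partial>lborel)"
      by (rule thinning_identity[OF hazard_bound[OF \<theta>] r.hazard_axioms bounce_rate_le_bound[OF \<theta>] A])
    also have "\<dots> = emeasure (zigzag_step rate z) B"
      using h_eq[of 0] by (simp add: z_eq)
    finally show ?thesis by (simp add: K_eq)
  qed
qed

end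

section \<open>The skeleton of bounces\<close>

text \<open>Almost sure features of one step of a thinned kernel, turned into a property of single
  paths. The bookkeeping of bounces can then be done without probability.\<close>

definition regular_step :: "('p::finite) skeleton_point \<Rightarrow> 'p skeleton_point \<Rightarrow> bool" where
  "regular_step z z' \<longleftrightarrow> fst z \<le> fst z' \<and>
    (if fst z' = \<infinity> then snd z' = snd z
     else fst (snd z') = fst (snd z) + enn2real (fst z' - fst z) *\<^sub>R snd (snd z))"

definition bounces_at :: "(nat \<Rightarrow> ('p::finite) skeleton_point) \<Rightarrow> nat \<Rightarrow> bool" where
  "bounces_at y m \<longleftrightarrow> snd (snd (y (Suc m))) \<noteq> snd (snd (y m))"

primrec bounces :: "(nat \<Rightarrow> ('p::finite) skeleton_point) \<Rightarrow> nat \<Rightarrow> nat" where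
  "bounces y 0 = 0"
| "bounces y (Suc m) = (if bounces_at y m then Suc (bounces y m) else bounces y m)"

text \<open>The points at which the velocity has changed among the first \<open>m\<close> steps; as long as the next
  bounce has not been seen, its time is \<open>\<infinity>\<close>.\<close>

primrec bounce_skeleton :: "(nat \<Rightarrow> ('p::finite) skeleton_point) \<Rightarrow> nat \<Rightarrow> nat \<Rightarrow> 'p skeleton_point" where
  "bounce_skeleton y 0 = (\<lambda>i. if i = 0 then y 0 else (\<infinity>, snd (y 0)))"
| "bounce_skeleton y (Suc m) = (if bounces_at y m
    then (\<lambda>i. if i \<le> bounces y m then bounce_skeleton y m i
      else (if i = Suc (bounces y m) then fst (y (Suc m)) else \<infinity>, snd (y (Suc m))))
    else bounce_skeleton y m)"

text \<open>Entry \<open>i\<close> is overwritten only while fewer than \<open>i\<close> bounces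
  have been seen, hence finitely often. If bounce \<open>i\<close> never comes, the limit keeps the
  time \<infinity> and the state at the last bounce.\<close>

definition bounce_limit :: "(nat \<Rightarrow> ('p::finite) skeleton_point) \<Rightarrow> nat \<Rightarrow> 'p skeleton_point" where
  "bounce_limit y i = bounce_skeleton y (LEAST m. \<forall>m'\<ge>m. bounce_skeleton y m' i = bounce_skeleton y m i) i"

lemma bounces_mono: "m \<le> m' \<Longrightarrow> bounces y m \<le> bounces y m'"
  by (rule lift_Suc_mono_le[of "bounces y"]) auto

lemma bounces_le: "bounces y m \<le> m"
  by (induction m) auto

lemma bounce_skeleton_stable:
  assumes "i \<le> bounces y m" "m \<le> m'"
  shows "bounce_skeleton y m' i = bounce_skeleton y m i"
  using assms(2,1)
proof (induction rule: dec_induct)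
  case (step n)
  then show ?case using bounces_mono[of m n y] by auto
qed simp

lemma bounce_skeleton_no_bounce:
  assumes "bounces y m' = bounces y m" "m \<le> m'"
  shows "bounce_skeleton y m' = bounce_skeleton y m"
  using assms(2,1)
proof (induction rule: dec_induct)
  case (step n)
  then have "bounces y m \<le> bounces y n" by (intro bounces_mono)
  with step show ?case by (auto split: if_splits)
qed simp

text \<open>Either bounce \<open>i\<close> occurs and fixes the entry, or the number of bounces is
  bounded, hence eventually constant, and then nothing is overwritten any more.\<close>

lemma bounce_skeleton_eventually_constant:
  "\<exists>m\<ge>m0. \<forall>m'\<ge>m. bounce_skeleton y m' i = bounce_skeleton y m i"
proof (cases "\<exists>m. i \<le> bounces y m")
  case True
  then obtain m where "i \<le> bounces y m" by blast
  then have "i \<le> bounces y (max m0 m)" using bounces_mono[of m "max m0 m" y] by simp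
  then have "\<forall>m'\<ge>max m0 m. bounce_skeleton y m' i = bounce_skeleton y (max m0 m) i"
    by (blast intro: bounce_skeleton_stable)
  then show ?thesis by (blast intro: max.cobounded1)
next
  case False
  then have "\<And>m. bounces y m \<le> i" by (meson linear)
  then have "\<exists>m. \<forall>m'. bounces y m' \<le> bounces y m"
    using ex_has_greatest_nat[of "\<lambda>_. True" 0 "bounces y" "Suc i"] by (auto simp: less_Suc_eq_le)
  then obtain m where m: "\<And>m'. bounces y m' \<le> bounces y m" by blast
  have "bounces y m' = bounces y (max m0 m)" if "max m0 m \<le> m'" for m'
    using m[of m'] bounces_mono[OF that, of y] bounces_mono[of m "max m0 m" y] by simp
  then have "bounce_skeleton y m' = bounce_skeleton y (max m0 m)" if "max m0 m \<le> m'" for m'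
    using that by (blast intro: bounce_skeleton_no_bounce)
  then have "\<forall>m'\<ge>max m0 m. bounce_skeleton y m' i = bounce_skeleton y (max m0 m) i" by metis
  then show ?thesis by (blast intro: max.cobounded1)
qed

lemma bounce_limit_eq:
  assumes "\<forall>m'\<ge>m. bounce_skeleton y m' i = bounce_skeleton y m i"
  shows "bounce_limit y i = bounce_skeleton y m i"
proof -
  define m1 where "m1 = (LEAST m. \<forall>m'\<ge>m. bounce_skeleton y m' i = bounce_skeleton y m i)"
  have "\<forall>m'\<ge>m1. bounce_skeleton y m' i = bounce_skeleton y m1 i"
    unfolding m1_def by (rule LeastI) (rule assms)
  moreover have "m1 \<le> m"
    unfolding m1_def by (rule Least_le) (rule assms)
  ultimately have "bounce_skeleton y m i = bounce_skeleton y m1 i" by blast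
  then show ?thesis unfolding bounce_limit_def m1_def[symmetric] by (rule sym)
qed

text \<open>The lower bound \<open>m0\<close> allows several entries to be read off at a common
  stage.\<close>

lemma bounce_limit_obtain:
  obtains m where "m0 \<le> m" "\<And>m'. m \<le> m' \<Longrightarrow> bounce_skeleton y m' i = bounce_limit y i"
proof -
  obtain m where m: "m0 \<le> m" "\<forall>m'\<ge>m. bounce_skeleton y m' i = bounce_skeleton y m i"
    using bounce_skeleton_eventually_constant by blast
  show thesis
  proof (rule that[OF m(1)])
    fix m' assume "m \<le> m'"
    with m(2) have "bounce_skeleton y m' i = bounce_skeleton y m i" by blast
    then show "bounce_skeleton y m' i = bounce_limit y i"
      using bounce_limit_eq[OF m(2)] by (rule trans[OF _ sym])
  qed
qed

lemma bounce_limit_eq_skeleton: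
  "i \<le> bounces y m \<Longrightarrow> bounce_limit y i = bounce_skeleton y m i"
  by (rule bounce_limit_eq) (auto intro: bounce_skeleton_stable)

lemma bounce_skeleton_0 [simp]: "bounce_skeleton y m 0 = y 0"
  by (induction m) auto

lemma bounce_limit_0 [simp]: "bounce_limit y 0 = y 0"
  using bounce_limit_eq_skeleton[of 0 y 0] by simp

lemma bounce_skeleton_pending:
  "bounces y m < i \<Longrightarrow> bounce_skeleton y m i = (\<infinity>, snd (bounce_skeleton y m (bounces y m)))"
proof (induction m)
  case (Suc m)
  show ?case
  proof (cases "bounces_at y m")
    case True
    with Suc.prems show ?thesis by simp
  next
    case False
    then have "bounces y m < i" using Suc.prems by simp
    from Suc.IH[OF this] False show ?thesis by (simp only: bounce_skeleton.simps bounces.simps if_False)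
  qed
qed simp

lemma bounce_skeleton_velocity: "snd (snd (bounce_skeleton y m (bounces y m))) = snd (snd (y m))"
  by (induction m) (auto simp: bounces_at_def)

text \<open>The count after \<open>m\<close> steps depends on the points up to \<open>m\<close>
  only, so it is a function of the history to which the Markov property applies.\<close>

lemma bounces_cong: "(\<And>j. j \<le> m \<Longrightarrow> y j = y' j) \<Longrightarrow> bounces y m = bounces y' m"
proof (induction m)
  case (Suc m)
  have "bounces y m = bounces y' m" by (rule Suc.IH) (rule Suc.prems, simp)
  with Suc.prems[of m] Suc.prems[of "Suc m"] show ?case by (simp add: bounces_at_def)
qed simp

lemma bounce_skeleton_cong: "(\<And>j. j \<le> m \<Longrightarrow> y j = y' j) \<Longrightarrow> bounce_skeleton y m = bounce_skeleton y' m"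
proof (induction m)
  case (Suc m)
  have "bounce_skeleton y m = bounce_skeleton y' m" by (rule Suc.IH) (rule Suc.prems, simp)
  moreover have "bounces y m = bounces y' m" by (rule bounces_cong) (rule Suc.prems, simp)
  ultimately show ?case
    using Suc.prems[of m] Suc.prems[of "Suc m"] by (simp add: bounces_at_def cong: if_cong)
qed (simp cong: if_cong)

section \<open>Pathwise comparison of a path with its skeleton of bounces\<close>

locale regular_skeleton =
  fixes y :: "nat \<Rightarrow> ('p::finite) skeleton_point"
  assumes regular: "\<And>m. regular_step (y m) (y (Suc m))"
begin

lemma time_mono: "m \<le> m' \<Longrightarrow> fst (y m) \<le> fst (y m')"
proof -
  have "fst (y n) \<le> fst (y (Suc n))" for n using regular[of n] by (simp add: regular_step_def)
  then show "m \<le> m' \<Longrightarrow> fst (y m) \<le> fst (y m')" by (rule lift_Suc_mono_le[of "\<lambda>m. fst (y m)"])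
qed

lemma bounce_finite: "bounces_at y m \<Longrightarrow> fst (y (Suc m)) \<noteq> \<infinity>"
  using regular[of m] by (auto simp: bounces_at_def regular_step_def)

lemma bounce_skeleton_time_le: "i \<le> bounces y m \<Longrightarrow> fst (bounce_skeleton y m i) \<le> fst (y m)"
proof (induction m)
  case (Suc m)
  have mono: "fst (y m) \<le> fst (y (Suc m))" by (rule time_mono) simp
  show ?case
  proof (cases "i \<le> bounces y m")
    case True
    then have "fst (bounce_skeleton y (Suc m) i) \<le> fst (y m)" using Suc.IH by simp
    with mono show ?thesis by (rule order_trans[rotated])
  next
    case False
    with Suc.prems show ?thesis by (auto split: if_splits)
  qed
qed simp

text \<open>A bounce not seen in the first \<open>m0\<close> steps is located at the point
  \<open>Suc m0\<close> or later, or its time is still \<infinity>.\<close>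

lemma bounce_skeleton_time_ge:
  assumes "bounces y m0 < i" "m0 \<le> m"
  shows "fst (y (Suc m0)) \<le> fst (bounce_skeleton y m i)"
  using assms(2,1)
proof (induction rule: dec_induct)
  case base
  then show ?case by (simp add: bounce_skeleton_pending)
next
  case (step n)
  then show ?case using time_mono[of "Suc m0" "Suc n"] by auto
qed

text \<open>Bounce \<open>i\<close> needs at least \<open>i\<close> steps. This carries nonexplosion
  over from the attempts to the bounces.\<close>

lemma bounce_skeleton_time_ge': "fst (y i) \<le> fst (bounce_skeleton y m i)"
proof (induction m)
  case (Suc m)
  then show ?case using bounces_le[of y m] time_mono[of "Suc (bounces y m)" "Suc m"] by auto
qed simp

lemma bounce_skeleton_finite: "0 < i \<Longrightarrow> i \<le> bounces y m \<Longrightarrow> fst (bounce_skeleton y m i) \<noteq> \<infinity>"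
proof (induction m)
  case (Suc m)
  then show ?case using bounce_finite[of m] by (auto split: if_splits simp: le_Suc_eq)
qed simp

text \<open>Rejections keep the velocity, so the segments since the last bounce join to one straight
  line.\<close>

lemma bounce_skeleton_position:
  "fst (y m) \<noteq> \<infinity> \<Longrightarrow> fst (snd (y m)) = fst (snd (bounce_skeleton y m (bounces y m))) +
    enn2real (fst (y m) - fst (bounce_skeleton y m (bounces y m))) *\<^sub>R snd (snd (y m))"
proof (induction m)
  case 0
  then show ?case by (simp add: diff_eq_0_ennreal less_top)
next
  case (Suc m)
  have mono: "fst (y m) \<le> fst (y (Suc m))" using time_mono by simp
  with Suc.prems have fin: "fst (y m) \<noteq> \<infinity>" by (auto simp: top_unique)
  note IH = Suc.IH[OF fin]
  show ?case
  proof (cases "bounces_at y m")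
    case True
    then show ?thesis using Suc.prems by (simp add: diff_eq_0_ennreal less_top)
  next
    case False
    let ?b = "bounce_skeleton y m (bounces y m)"
    have le: "fst ?b \<le> fst (y m)" by (rule bounce_skeleton_time_le) simp
    \<comment> \<open>All three times are finite; as real numbers their differences add up, whereas
      subtraction in \<open>ennreal\<close> is truncated.\<close>
    obtain a b c where abc: "fst ?b = ennreal a" "fst (y m) = ennreal b" "fst (y (Suc m)) = ennreal c" "0 \<le> a" "a \<le> b" "b \<le> c"
      using le mono fin Suc.prems
      by (cases "fst ?b"; cases "fst (y m)"; cases "fst (y (Suc m))") (auto simp: top_unique)
    have "fst (snd (y (Suc m))) = fst (snd (y m)) + (c - b) *\<^sub>R snd (snd (y m))"
      using regular[of m] Suc.prems abc by (simp add: regular_step_def ennreal_minus)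
    also have "fst (snd (y m)) = fst (snd ?b) + (b - a) *\<^sub>R snd (snd (y m))"
      using IH abc by (simp add: ennreal_minus)
    finally show ?thesis
      using False abc by (simp add: bounces_at_def ennreal_minus algebra_simps flip: scaleR_left_distrib)
  qed
qed

lemma bounce_limit_time_ge: "fst (y i) \<le> fst (bounce_limit y i)"
proof -
  obtain m where "\<And>m'. m \<le> m' \<Longrightarrow> bounce_skeleton y m' i = bounce_limit y i"
    using bounce_limit_obtain[of 0 y i] by blast
  then show ?thesis using bounce_skeleton_time_ge'[of i m] by (simp only: order_refl)
qed

text \<open>An infinite entry means that this bounce never comes. At a common late stage both
  entries carry the state of the last bounce that did.\<close>

lemma bounce_limit_infinite:
  assumes "fst (bounce_limit y (Suc k)) = \<infinity>"
  shows "snd (bounce_limit y (Suc k)) = snd (bounce_limit y k)"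
proof -
  obtain m1 where m1: "\<And>m'. m1 \<le> m' \<Longrightarrow> bounce_skeleton y m' k = bounce_limit y k"
    using bounce_limit_obtain[of 0 y k] by blast
  obtain m where m: "m1 \<le> m" "\<And>m'. m \<le> m' \<Longrightarrow> bounce_skeleton y m' (Suc k) = bounce_limit y (Suc k)"
    using bounce_limit_obtain[of m1 y "Suc k"] by blast
  have "\<not> Suc k \<le> bounces y m"
    using bounce_skeleton_finite[of "Suc k" m] assms m(2)[of m] by auto
  then have lt: "bounces y m < Suc k" by simp
  then have "k = bounces y m \<or> bounces y m < k" by auto
  then have "bounce_skeleton y m (Suc k) = (\<infinity>, snd (bounce_skeleton y m (bounces y m)))"
    "k = bounces y m \<or> bounce_skeleton y m k = (\<infinity>, snd (bounce_skeleton y m (bounces y m)))"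
    using bounce_skeleton_pending[OF lt] bounce_skeleton_pending[of y m k] by blast+
  then show ?thesis using m1[of m] m by auto
qed

text \<open>If \<open>t\<close> lies between the points \<open>k\<close> and \<open>Suc k\<close> of
  the path, then it lies in the segment of bounces with index \<open>bounces y k\<close>; both
  skeletons describe the same line there.\<close>

lemma skeleton_path_bounce_limit:
  assumes start: "fst (y 0) = 0" and total: "(SUP k. fst (y k)) = \<infinity>" and t: "0 \<le> t"
  shows "skeleton_path (bounce_limit y) t = skeleton_path y t"
proof -
  define k where "k = (LEAST k. ennreal t < fst (y (Suc k)))"
  have "\<exists>k. ennreal t < fst (y k)"
  proof -
    have "ennreal t < (SUP k. fst (y k))" unfolding total by simp
    then show ?thesis by (simp add: less_SUP_iff)
  qed
  then have "\<exists>k. ennreal t < fst (y (Suc k))"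
    using time_mono[of _ "Suc _"] by (meson le_SucI less_le_trans order_refl)
  then have k: "ennreal t < fst (y (Suc k))" unfolding k_def by (rule LeastI_ex)
  have le: "fst (y k) \<le> ennreal t"
  proof (cases k)
    case (Suc j)
    then have "\<not> ennreal t < fst (y (Suc j))" using not_less_Least[of j "\<lambda>k. ennreal t < fst (y (Suc k))"] by (simp add: k_def)
    then show ?thesis using Suc by simp
  qed (simp add: start)
  then have fin: "fst (y k) \<noteq> \<infinity>" by (auto simp: top_unique)
  define j where "j = bounces y k"
  \<comment> \<open>The next bounce is not before the point \<open>Suc k\<close>, hence after
    \<open>t\<close>; all bounces counted so far are at or before the point \<open>k\<close>, hence
    not after \<open>t\<close>.\<close>
  have "(LEAST i. ennreal t < fst (bounce_limit y (Suc i))) = j"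
  proof (rule Least_equality)
    obtain m where m: "k \<le> m" "bounce_skeleton y m (Suc j) = bounce_limit y (Suc j)"
      using bounce_limit_obtain[of k y "Suc j"] by blast
    have "fst (y (Suc k)) \<le> fst (bounce_limit y (Suc j))"
      unfolding m(2)[symmetric] by (rule bounce_skeleton_time_ge) (use m in \<open>auto simp: j_def\<close>)
    then show "ennreal t < fst (bounce_limit y (Suc j))" using k by (rule less_le_trans[rotated])
  next
    fix i assume i: "ennreal t < fst (bounce_limit y (Suc i))"
    show "j \<le> i"
    proof (rule ccontr)
      assume "\<not> j \<le> i"
      then have "Suc i \<le> bounces y k" by (simp add: j_def)
      then have "fst (bounce_limit y (Suc i)) \<le> fst (y k)"
        using bounce_skeleton_time_le by (simp only: bounce_limit_eq_skeleton)
      with i le show False by (meson leD order_trans)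
    qed
  qed
  moreover have lim: "bounce_limit y j = bounce_skeleton y k (bounces y k)"
    unfolding j_def by (rule bounce_limit_eq_skeleton) simp
  obtain T \<xi> \<theta> where b: "bounce_skeleton y k (bounces y k) = (T, \<xi>, \<theta>)" by (cases "bounce_skeleton y k (bounces y k)")
  obtain T' \<xi>' \<theta>' where yk: "y k = (T', \<xi>', \<theta>')" by (cases "y k")
  have "\<theta>' = \<theta>" using bounce_skeleton_velocity[of y k] b yk by simp
  moreover have "\<xi>' = \<xi> + enn2real (T' - T) *\<^sub>R \<theta>'"
    using bounce_skeleton_position[OF fin] b yk by simp
  moreover have "T \<le> T'" using bounce_skeleton_time_le[of "bounces y k" k] b yk by simp
  then have "enn2real (T' - T) = enn2real T' - enn2real T"
    using fin yk by (cases T; cases T') (auto simp: ennreal_minus top_unique)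
  ultimately show ?thesis
    unfolding skeleton_path_def k_def[symmetric] Let_def
    using lim b yk by (simp add: algebra_simps)
qed

end

lemma measurable_skeleton_velocity_borel [measurable]: "(\<lambda>z. snd (snd z)) \<in> borel_measurable skeleton_space"
  by (rule measurable_compose[OF measurable_skeleton_velocity]) simp

lemma pred_velocity_eq:
  assumes "f \<in> measurable M skeleton_space" "g \<in> measurable M skeleton_space"
  shows "{x \<in> space M. snd (snd (f x)) = snd (snd (g x))} \<in> sets M"
proof -
  have [measurable]: "(\<lambda>x. snd (snd (f x))) \<in> borel_measurable M" "(\<lambda>x. snd (snd (g x))) \<in> borel_measurable M"
    by (rule measurable_compose[OF assms(1) measurable_skeleton_velocity_borel])
      (rule measurable_compose[OF assms(2) measurable_skeleton_velocity_borel])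
  show ?thesis by measurable
qed

lemma measurable_bounces:
  "m \<le> M \<Longrightarrow> (\<lambda>x. bounces x m) \<in>
    measurable (PiM {..M} (\<lambda>_. skeleton_space :: 'p::finite skeleton_point measure)) (count_space UNIV)"
proof (induction m)
  case (Suc m)
  let ?M = "PiM {..M} (\<lambda>_. skeleton_space :: 'p skeleton_point measure)"
  have n: "(\<lambda>x. bounces x m) \<in> measurable ?M (count_space UNIV)" using Suc by simp
  have "(\<lambda>x. Suc (bounces x m)) \<in> measurable ?M (count_space UNIV)"
    by (rule measurable_compose[OF n]) simp
  moreover have "(\<lambda>x. x j) \<in> measurable ?M skeleton_space" if "j \<le> Suc m" for j
    using that Suc.prems by (intro measurable_component_singleton) simp
  then have "{x \<in> space ?M. snd (snd (x (Suc m))) = snd (snd (x m))} \<in> sets ?M"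
    by (intro pred_velocity_eq) simp_all
  moreover have "bounces x (Suc m) = (if snd (snd (x (Suc m))) = snd (snd (x m)) then bounces x m else Suc (bounces x m))"
    for x :: "nat \<Rightarrow> 'p skeleton_point"
    by (simp add: bounces_at_def)
  ultimately show ?case
    using n by (simp only:) (rule measurable_If)
qed simp

lemma measurable_bounce_skeleton:
  "m \<le> M \<Longrightarrow> (\<lambda>x. bounce_skeleton x m i) \<in>
    measurable (PiM {..M} (\<lambda>_. skeleton_space :: 'p::finite skeleton_point measure)) skeleton_space"
proof (induction m arbitrary: i)
  case 0
  let ?M = "PiM {..M} (\<lambda>_. skeleton_space :: 'p skeleton_point measure)"
  have 0: "(\<lambda>x. x 0) \<in> measurable ?M skeleton_space"
    by (rule measurable_component_singleton) simp
  have "(\<lambda>x. (\<infinity>, fst (snd (x 0)), snd (snd (x 0)))) \<in> measurable ?M skeleton_space"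
    by (intro measurable_skeletonI measurable_compose[OF 0] measurable_skeleton_position measurable_skeleton_velocity) simp
  with 0 show ?case by (cases "i = 0") simp_all
next
  case (Suc m)
  let ?M = "PiM {..M} (\<lambda>_. skeleton_space :: 'p skeleton_point measure)"
  have y: "(\<lambda>x. x j) \<in> measurable ?M skeleton_space" if "j \<le> Suc m" for j
    using that Suc.prems by (intro measurable_component_singleton) simp
  have inf: "(\<lambda>x. (\<infinity>, fst (snd (x (Suc m))), snd (snd (x (Suc m))))) \<in> measurable ?M skeleton_space"
    by (intro measurable_skeletonI measurable_compose[OF y] measurable_skeleton_position measurable_skeleton_velocity) simp_all
  \<comment> \<open>The random number of bounces is replaced by a countable parameter
    \<open>n\<close>, for which the case distinction is fixed.\<close>
  have "(\<lambda>x. (\<lambda>n x. if i \<le> n then bounce_skeleton x m i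
      else if i = Suc n then x (Suc m) else (\<infinity>, snd (x (Suc m)))) (bounces x m) x) \<in> measurable ?M skeleton_space"
  proof (rule measurable_compose_countable[where g="\<lambda>x. bounces x m" and f="\<lambda>n x. if i \<le> n then bounce_skeleton x m i
      else if i = Suc n then x (Suc m) else (\<infinity>, snd (x (Suc m)))"])
    show "(\<lambda>x. bounces x m) \<in> measurable ?M (count_space UNIV)"
      using Suc.prems by (intro measurable_bounces) simp
    fix n
    show "(\<lambda>x. if i \<le> n then bounce_skeleton x m i
        else if i = Suc n then x (Suc m) else (\<infinity>, snd (x (Suc m)))) \<in> measurable ?M skeleton_space"
      using Suc y[of "Suc m"] inf by (cases "i \<le> n"; cases "i = Suc n") simp_all
  qed
  moreover have "bounce_skeleton x (Suc m) i = (if snd (snd (x (Suc m))) = snd (snd (x m)) then bounce_skeleton x m i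
     else (\<lambda>n x. if i \<le> n then bounce_skeleton x m i
      else if i = Suc n then x (Suc m) else (\<infinity>, snd (x (Suc m)))) (bounces x m) x)" for x :: "nat \<Rightarrow> 'p skeleton_point"
    by (auto simp: bounces_at_def)
  moreover have "{x \<in> space ?M. snd (snd (x (Suc m))) = snd (snd (x m))} \<in> sets ?M"
    by (intro pred_velocity_eq y) simp_all
  moreover have "(\<lambda>x. bounce_skeleton x m i) \<in> measurable ?M skeleton_space"
    using Suc by simp
  ultimately show ?case
    by (simp only:) (rule measurable_If)
qed

context thinned_kernel
begin

lemma sets_regular_step:
  "{p \<in> space (skeleton_space \<Otimes>\<^sub>M skeleton_space). regular_step (fst p) (snd p :: 'p skeleton_point)} \<in>
    sets (skeleton_space \<Otimes>\<^sub>M skeleton_space)"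
proof -
  let ?M = "skeleton_space \<Otimes>\<^sub>M skeleton_space :: ('p skeleton_point \<times> 'p skeleton_point) measure"
  have [measurable]: "(\<lambda>p. fst (fst p)) \<in> borel_measurable ?M" "(\<lambda>p. fst (snd p)) \<in> borel_measurable ?M"
    "(\<lambda>p. fst (snd (fst p))) \<in> borel_measurable ?M" "(\<lambda>p. fst (snd (snd p))) \<in> borel_measurable ?M"
    "(\<lambda>p. snd (snd (fst p))) \<in> borel_measurable ?M" "(\<lambda>p. snd (snd (snd p))) \<in> borel_measurable ?M"
    by (intro measurable_compose[OF measurable_fst] measurable_compose[OF measurable_snd] measurable_skeleton_time
      measurable_skeleton_position measurable_skeleton_velocity_borel)+
  have "{p \<in> space ?M. fst (fst p) \<le> fst (snd p) \<and>
    (if fst (snd p) = \<infinity> then fst (snd (snd p)) = fst (snd (fst p)) \<and> snd (snd (snd p)) = snd (snd (fst p))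
     else fst (snd (snd p)) = fst (snd (fst p)) + enn2real (fst (snd p) - fst (fst p)) *\<^sub>R snd (snd (fst p)))} \<in> sets ?M"
    by measurable
  then show ?thesis unfolding regular_step_def prod_eq_iff .
qed

text \<open>Every outcome charged by the explicit event formula is regular, and the outcomes of
  infinite time are covered by \<open>kernel_no_event\<close>.\<close>

lemma regular_step_kernel:
  assumes z: "z \<in> space skeleton_space"
  shows "AE z' in K z. regular_step z z'"
proof -
  have R: "{z' \<in> space skeleton_space. regular_step z z'} \<in> sets skeleton_space"
    using measurable_sets[OF measurable_Pair1'[OF z, of skeleton_space] sets_regular_step] z
    by (simp add: vimage_def Int_def space_pair_measure conj_commute cong: conj_cong)
  have sp: "space (K z) = space skeleton_space" by (rule sets_eq_imp_space_eq[OF sets_kernel[OF z]])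
  obtain t \<xi> \<theta> where z_eq: "z = (t, \<xi>, \<theta>)" by (cases z)
  with z have \<theta>: "\<theta> \<in> velocities" by (simp add: space_skeleton_space)
  show ?thesis
  proof (cases "t = \<infinity>")
    case True
    have "AE z' in return skeleton_space z. regular_step z z'"
      by (subst AE_return[OF z]) (use R True in \<open>simp_all add: pred_def z_eq regular_step_def\<close>)
    moreover have "K z = return skeleton_space z" using True by (intro kernel_infinite'[OF z]) (simp add: z_eq)
    ultimately show ?thesis by (simp only:)
  next
    case False
    \<comment> \<open>The irregular outcomes of finite time; as points of infinite time are removed,
      the event formula applies to the indicator.\<close>
    define E where "E = space skeleton_space - ({z' \<in> space skeleton_space. regular_step z z'} \<union> {z' \<in> space skeleton_space. fst z' = \<infinity>})"
    have E: "E \<in> sets skeleton_space" unfolding E_def using R sets_skeleton_time(1) by blast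
    have reg: "regular_step z (t + ennreal s, \<xi> + s *\<^sub>R \<theta>, \<theta>')" if "0 \<le> s" for s \<theta>'
      using that False by (auto simp: z_eq regular_step_def ennreal_add_diff_cancel_left)
    have "emeasure (K z) E = (\<integral>\<^sup>+z'. indicator E z' \<partial>K z)"
      using E sets_kernel[OF z] by simp
    also have "\<dots> = 0"
      unfolding z_eq
      by (subst kernel_event[OF False \<theta>])
        (use E reg in \<open>auto simp: E_def indicator_def z_eq intro!: nn_integral_zero' AE_I2\<close>)
    finally have "AE z' in K z. z' \<notin> E"
      using E sets_kernel[OF z] by (intro AE_not_in) (simp add: null_sets_def)
    moreover have "AE z' in K z. fst z' = \<infinity> \<longrightarrow> snd z' = (\<xi>, \<theta>)"
      unfolding z_eq by (rule kernel_no_event[OF False \<theta>])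
    ultimately show ?thesis
      using AE_space by eventually_elim (auto simp: E_def sp[unfolded z_eq] z_eq regular_step_def)
  qed
qed

end

section \<open>The bounces form a Markov chain with the zig-zag kernel\<close>

locale thinned_chain = thinned_kernel rate bound K
  for rate :: "'p::finite \<Rightarrow> real^'p \<Rightarrow> real^'p \<Rightarrow> real" and bound K +
  fixes \<Omega> :: "'w measure" and Y :: "nat \<Rightarrow> 'w \<Rightarrow> 'p skeleton_point"
  assumes chain: "markov_chain \<Omega> skeleton_space K Y"
    and start: "AE \<omega> in \<Omega>. fst (Y 0 \<omega>) = 0"
    and total: "AE \<omega> in \<Omega>. (SUP k. fst (Y k \<omega>)) = \<infinity>"
begin

sublocale P: prob_space \<Omega> using chain by (simp add: markov_chain_def)

lemma measurable_Y: "Y k \<in> measurable \<Omega> skeleton_space"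
  using chain by (simp add: markov_chain_def)

lemma Y_space: "\<omega> \<in> space \<Omega> \<Longrightarrow> Y k \<omega> \<in> space skeleton_space"
  by (rule measurable_space[OF measurable_Y])

abbreviation "history m \<omega> \<equiv> (\<lambda>i\<in>{..m}. Y i \<omega>)"

lemma measurable_history: "history m \<in> measurable \<Omega> (PiM {..m} (\<lambda>_. skeleton_space))"
  by (intro measurable_restrict measurable_Y)

lemma bounces_history: "bounces (history m \<omega>) m = bounces (\<lambda>j. Y j \<omega>) m"
  and bounce_skeleton_history: "bounce_skeleton (history m \<omega>) m = bounce_skeleton (\<lambda>j. Y j \<omega>) m"
  by (rule bounces_cong, simp) (rule bounce_skeleton_cong, simp)

lemma measurable_bounces_Y [measurable]: "(\<lambda>\<omega>. bounces (\<lambda>j. Y j \<omega>) m) \<in> measurable \<Omega> (count_space UNIV)"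
  using measurable_compose[OF measurable_history measurable_bounces[OF order_refl]] by (simp add: bounces_history)

lemma measurable_bounce_skeleton_Y: "(\<lambda>\<omega>. bounce_skeleton (\<lambda>j. Y j \<omega>) m i) \<in> measurable \<Omega> skeleton_space"
  using measurable_compose[OF measurable_history measurable_bounce_skeleton[OF order_refl]] by (simp add: bounce_skeleton_history)

lemma AE_regular: "AE \<omega> in \<Omega>. regular_skeleton (\<lambda>j. Y j \<omega>)"
proof -
  have "AE \<omega> in \<Omega>. regular_step (Y m \<omega>) (Y (Suc m) \<omega>)" for m
  proof -
    define E where "E = space (skeleton_space \<Otimes>\<^sub>M skeleton_space) -
      {p \<in> space (skeleton_space \<Otimes>\<^sub>M skeleton_space). regular_step (fst p) (snd p :: 'p skeleton_point)}"
    have E: "E \<in> sets (skeleton_space \<Otimes>\<^sub>M skeleton_space)" unfolding E_def using sets_regular_step by blast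
    have pair: "(\<lambda>p. (fst p m, snd p)) \<in> measurable (PiM {..m} (\<lambda>_. skeleton_space) \<Otimes>\<^sub>M skeleton_space)
        (skeleton_space \<Otimes>\<^sub>M skeleton_space :: ('p skeleton_point \<times> 'p skeleton_point) measure)"
      by (intro measurable_Pair measurable_compose[OF measurable_fst] measurable_component_singleton measurable_snd) simp
    have "(\<lambda>p. indicator E (fst p m, snd p) :: ennreal) \<in> borel_measurable (PiM {..m} (\<lambda>_. skeleton_space) \<Otimes>\<^sub>M skeleton_space)"
      by (rule measurable_compose[OF pair borel_measurable_indicator[OF E]])
    from markov_chain_nn_integral[OF chain measurable_kernel this]
    have "(\<integral>\<^sup>+\<omega>. indicator E (Y m \<omega>, Y (Suc m) \<omega>) \<partial>\<Omega>) = (\<integral>\<^sup>+\<omega>. \<integral>\<^sup>+z. indicator E (Y m \<omega>, z) \<partial>K (Y m \<omega>) \<partial>\<Omega>)"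
      by simp
    also have "\<dots> = (\<integral>\<^sup>+\<omega>. 0 \<partial>\<Omega>)"
    proof (rule nn_integral_cong)
      fix \<omega> assume \<omega>: "\<omega> \<in> space \<Omega>"
      have "AE z in K (Y m \<omega>). indicator E (Y m \<omega>, z) = (0 :: ennreal)"
        using regular_step_kernel[OF Y_space[OF \<omega>], of m] by eventually_elim (auto simp: E_def)
      then have "(\<integral>\<^sup>+z. indicator E (Y m \<omega>, z) \<partial>K (Y m \<omega>)) = (\<integral>\<^sup>+z. 0 \<partial>K (Y m \<omega>))"
        by (rule nn_integral_cong_AE)
      then show "(\<integral>\<^sup>+z. indicator E (Y m \<omega>, z) \<partial>K (Y m \<omega>)) = 0" by simp
    qed
    finally have "(\<integral>\<^sup>+\<omega>. indicator E (Y m \<omega>, Y (Suc m) \<omega>) \<partial>\<Omega>) = 0" by simp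
    moreover have "(\<lambda>\<omega>. (Y m \<omega>, Y (Suc m) \<omega>)) \<in> measurable \<Omega> (skeleton_space \<Otimes>\<^sub>M skeleton_space)"
      by (intro measurable_Pair measurable_Y)
    ultimately have "AE \<omega> in \<Omega>. indicator E (Y m \<omega>, Y (Suc m) \<omega>) = (0::ennreal)"
      by (subst (asm) nn_integral_0_iff_AE) (auto intro: measurable_compose[OF _ borel_measurable_indicator[OF E]])
    then show ?thesis
      using AE_space by eventually_elim (auto simp: E_def space_pair_measure Y_space indicator_def split: if_splits)
  qed
  then have "AE \<omega> in \<Omega>. \<forall>m. regular_step (Y m \<omega>) (Y (Suc m) \<omega>)" by (simp add: AE_all_countable)
  then show ?thesis by eventually_elim (auto intro: regular_skeleton.intro)
qed

definition Z :: "nat \<Rightarrow> 'w \<Rightarrow> 'p skeleton_point" where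
  "Z k \<omega> = bounce_limit (\<lambda>j. Y j \<omega>) k"

text \<open>The stages are eventually constant at each point, so membership of the limit is
  membership of all late stages.\<close>

lemma measurable_Z: "Z k \<in> measurable \<Omega> skeleton_space"
proof (rule measurableI)
  fix \<omega> assume "\<omega> \<in> space \<Omega>"
  moreover obtain m where "bounce_skeleton (\<lambda>j. Y j \<omega>) m k = Z k \<omega>"
    using bounce_limit_obtain[of 0 "\<lambda>j. Y j \<omega>" k] unfolding Z_def by blast
  ultimately show "Z k \<omega> \<in> space skeleton_space"
    using measurable_space[OF measurable_bounce_skeleton_Y, of \<omega> m k] by simp
next
  fix A :: "'p skeleton_point set" assume A: "A \<in> sets skeleton_space"
  have eq: "Z k \<omega> \<in> A \<longleftrightarrow> (\<exists>m. \<forall>m'. m \<le> m' \<longrightarrow> bounce_skeleton (\<lambda>j. Y j \<omega>) m' k \<in> A)" for \<omega>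
  proof -
    obtain m where m: "\<And>m'. m \<le> m' \<Longrightarrow> bounce_skeleton (\<lambda>j. Y j \<omega>) m' k = Z k \<omega>"
      using bounce_limit_obtain[of 0 "\<lambda>j. Y j \<omega>" k] unfolding Z_def by blast
    show ?thesis
    proof
      assume "Z k \<omega> \<in> A"
      with m show "\<exists>m. \<forall>m'. m \<le> m' \<longrightarrow> bounce_skeleton (\<lambda>j. Y j \<omega>) m' k \<in> A" by (intro exI[of _ m]) simp
    next
      assume "\<exists>m. \<forall>m'. m \<le> m' \<longrightarrow> bounce_skeleton (\<lambda>j. Y j \<omega>) m' k \<in> A"
      then obtain n where "\<forall>m'. n \<le> m' \<longrightarrow> bounce_skeleton (\<lambda>j. Y j \<omega>) m' k \<in> A" by blast
      then have "bounce_skeleton (\<lambda>j. Y j \<omega>) (max m n) k \<in> A" by simp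
      with m[of "max m n"] show "Z k \<omega> \<in> A" by simp
    qed
  qed
  have "Z k -` A \<inter> space \<Omega> = (\<Union>m. \<Inter>m'\<in>{m..}. (\<lambda>\<omega>. bounce_skeleton (\<lambda>j. Y j \<omega>) m' k) -` A \<inter> space \<Omega>)"
    by (simp add: set_eq_iff eq Ball_def) blast
  also have "\<dots> \<in> sets \<Omega>"
    by (intro sets.countable_UN sets.countable_INT' image_subsetI measurable_sets[OF measurable_bounce_skeleton_Y A]) auto
  finally show "Z k -` A \<inter> space \<Omega> \<in> sets \<Omega>" .
qed

end

context thinned_kernel
begin

lemma emeasure_kernel':
  assumes z: "z \<in> space skeleton_space" and A: "A \<in> sets skeleton_space"
  shows "emeasure (K z) A = emeasure (K z) {z' \<in> A. fst z' \<noteq> \<infinity>} +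
    indicator A (\<infinity>, snd z) * (1 - emeasure (K z) {z' \<in> space skeleton_space. fst z' \<noteq> \<infinity>})"
proof (cases "fst z = \<infinity>")
  case True
  then have K: "K z = return skeleton_space z" by (rule kernel_infinite'[OF z])
  have "{z' \<in> A. fst z' \<noteq> \<infinity>} = A \<inter> {z' \<in> space skeleton_space. fst z' \<noteq> \<infinity>}"
    using sets.sets_into_space[OF A] by auto
  then have "{z' \<in> A. fst z' \<noteq> \<infinity>} \<in> sets skeleton_space" using A sets_skeleton_time(2) by auto
  moreover have "z = (\<infinity>, snd z)" using True by (simp add: prod_eq_iff)
  ultimately show ?thesis
    using True A sets_skeleton_time(2) unfolding K by (auto simp: indicator_def)
qed (rule emeasure_kernel[OF z _ A])

end

context thinned_chain
begin

sublocale Z: thinned_kernel rate "\<lambda>\<xi> \<theta> s. bounce_rate (\<xi> + s *\<^sub>R \<theta>) \<theta>" "zigzag_step rate"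
  by (rule zigzag_kernel)

lemma measurable_zigzag_emeasure:
  "B \<in> sets skeleton_space \<Longrightarrow> (\<lambda>z. emeasure (zigzag_step rate z) B) \<in> borel_measurable skeleton_space"
  using measurable_emeasure_kernel[OF measurable_prob_algebraD[OF Z.measurable_kernel]] .

abbreviation "stages k m \<omega> \<equiv> (\<lambda>i\<in>{..k}. bounce_skeleton (\<lambda>j. Y j \<omega>) m i)"

lemma measurable_stages: "stages k m \<in> measurable \<Omega> (PiM {..k} (\<lambda>_. skeleton_space))"
  by (intro measurable_restrict measurable_bounce_skeleton_Y)

lemma measurable_Z_tuple: "(\<lambda>\<omega>. \<lambda>i\<in>{..k}. Z i \<omega>) \<in> measurable \<Omega> (PiM {..k} (\<lambda>_. skeleton_space))"
  by (intro measurable_restrict measurable_Z)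

context
  fixes A :: "(nat \<Rightarrow> 'p skeleton_point) set" and B :: "'p skeleton_point set" and k :: nat and T :: real
  assumes A: "A \<in> sets (PiM {..k} (\<lambda>_. skeleton_space))" and B: "B \<in> sets skeleton_space"
    and B_bounded: "\<And>z. z \<in> B \<Longrightarrow> fst z \<le> ennreal T"
begin

abbreviation "h z \<equiv> emeasure (zigzag_step rate z) B"

text \<open>A forecast, started at bounce \<open>k\<close>, of the event that the bounces up to
  \<open>k\<close> satisfy \<open>A\<close> and the next one lies in \<open>B\<close>. While bounce
  \<open>k\<close> is the last one seen, the chance is \<open>h\<close> at the present point, even
  though this point need not be a bounce; afterwards the outcome is known.\<close>

definition "V m \<omega> = (if bounces (\<lambda>j. Y j \<omega>) m < k then 0 else indicator A (stages k m \<omega>) *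
  (if bounces (\<lambda>j. Y j \<omega>) m = k then h (Y m \<omega>) else indicator B (bounce_skeleton (\<lambda>j. Y j \<omega>) m (Suc k))))"

text \<open>The same forecast frozen at the moment of bounce \<open>k\<close>. Its limit is the
  right-hand side of the Markov property, that of \<open>V\<close> the left-hand side.\<close>

definition "V' m \<omega> = (if bounces (\<lambda>j. Y j \<omega>) m < k then 0 else
  indicator A (stages k m \<omega>) * h (bounce_skeleton (\<lambda>j. Y j \<omega>) m k))"

lemma B_finite: "z \<in> B \<Longrightarrow> fst z \<noteq> \<infinity>"
  using B_bounded[of z] by (auto simp: top_unique)

lemma h_measurable: "h \<in> borel_measurable skeleton_space"
  by (rule measurable_zigzag_emeasure[OF B])

lemma indicator_A: "(\<lambda>\<omega>. indicator A (stages k m \<omega>) :: ennreal) \<in> borel_measurable \<Omega>"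
  by (rule measurable_compose[OF measurable_stages borel_measurable_indicator[OF A]])

lemma bounces_sets: "{\<omega> \<in> space \<Omega>. P (bounces (\<lambda>j. Y j \<omega>) m)} \<in> sets \<Omega>"
  by measurable

lemma measurable_V: "V m \<in> borel_measurable \<Omega>"
  unfolding V_def
  by (intro measurable_If bounces_sets borel_measurable_times_ennreal indicator_A borel_measurable_const
      measurable_compose[OF measurable_Y h_measurable] measurable_compose[OF measurable_bounce_skeleton_Y borel_measurable_indicator[OF B]])

lemma measurable_V': "V' m \<in> borel_measurable \<Omega>"
  unfolding V'_def
  by (intro measurable_If bounces_sets borel_measurable_times_ennreal indicator_A borel_measurable_const
      measurable_compose[OF measurable_bounce_skeleton_Y h_measurable])

text \<open>Having seen exactly \<open>k\<close> bounces with stages in \<open>A\<close> is an event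
  of the history up to \<open>m\<close>. The Markov property of the attempts therefore permits the
  renewal equation to be applied inside the integral.\<close>

lemma nn_integral_renewal:
  "(\<integral>\<^sup>+\<omega>. (if bounces (\<lambda>j. Y j \<omega>) m = k then indicator A (stages k m \<omega>) else 0) *
      (if snd (snd (Y (Suc m) \<omega>)) \<noteq> snd (snd (Y m \<omega>)) then indicator B (Y (Suc m) \<omega>) else h (Y (Suc m) \<omega>)) \<partial>\<Omega>) =
   (\<integral>\<^sup>+\<omega>. (if bounces (\<lambda>j. Y j \<omega>) m = k then indicator A (stages k m \<omega>) else 0) * h (Y m \<omega>) \<partial>\<Omega>)"
proof -
  let ?H = "PiM {..m} (\<lambda>_. skeleton_space :: 'p skeleton_point measure)"
  define F where "F p = (if bounces (fst p) m = k then indicator A (\<lambda>i\<in>{..k}. bounce_skeleton (fst p) m i) else 0) *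
      (if snd (snd (snd p)) = snd (snd (fst p m)) then h (snd p) else indicator B (snd p) :: ennreal)"
    for p :: "(nat \<Rightarrow> 'p skeleton_point) \<times> 'p skeleton_point"
  have last: "history m \<omega> m = Y m \<omega>" for \<omega> by simp
  have F: "F \<in> borel_measurable (?H \<Otimes>\<^sub>M skeleton_space)"
    unfolding F_def
  proof (intro borel_measurable_times_ennreal measurable_If borel_measurable_const pred_velocity_eq measurable_snd)
    have "(\<lambda>p. bounces (fst p) m) \<in> measurable (?H \<Otimes>\<^sub>M skeleton_space) (count_space UNIV)"
      by (rule measurable_compose[OF measurable_fst measurable_bounces[OF order_refl]])
    then show "{x \<in> space (?H \<Otimes>\<^sub>M skeleton_space). bounces (fst x) m = k} \<in> sets (?H \<Otimes>\<^sub>M skeleton_space)"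
      by measurable
    have "(\<lambda>p. \<lambda>i\<in>{..k}. bounce_skeleton (fst p) m i) \<in> measurable (?H \<Otimes>\<^sub>M skeleton_space) (PiM {..k} (\<lambda>_. skeleton_space))"
      by (intro measurable_restrict measurable_compose[OF measurable_fst measurable_bounce_skeleton[OF order_refl]])
    then show "(\<lambda>p. indicator A (\<lambda>i\<in>{..k}. bounce_skeleton (fst p) m i) :: ennreal) \<in> borel_measurable (?H \<Otimes>\<^sub>M skeleton_space)"
      by (rule measurable_compose[OF _ borel_measurable_indicator[OF A]])
    show "(\<lambda>p. fst p m) \<in> measurable (?H \<Otimes>\<^sub>M skeleton_space) skeleton_space"
      by (intro measurable_compose[OF measurable_fst] measurable_component_singleton) simp
    show "(\<lambda>p. h (snd p)) \<in> borel_measurable (?H \<Otimes>\<^sub>M skeleton_space)"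
      by (rule measurable_compose[OF measurable_snd h_measurable])
    show "(\<lambda>p. indicator B (snd p) :: ennreal) \<in> borel_measurable (?H \<Otimes>\<^sub>M skeleton_space)"
      by (rule measurable_compose[OF measurable_snd borel_measurable_indicator[OF B]])
  qed
  have "(\<integral>\<^sup>+\<omega>. (if bounces (\<lambda>j. Y j \<omega>) m = k then indicator A (stages k m \<omega>) else 0) *
      (if snd (snd (Y (Suc m) \<omega>)) \<noteq> snd (snd (Y m \<omega>)) then indicator B (Y (Suc m) \<omega>) else h (Y (Suc m) \<omega>)) \<partial>\<Omega>) =
    (\<integral>\<^sup>+\<omega>. F (history m \<omega>, Y (Suc m) \<omega>) \<partial>\<Omega>)"
    by (intro nn_integral_cong) (auto simp: F_def bounces_history bounce_skeleton_history last simp del: restrict_apply)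
  also have "\<dots> = (\<integral>\<^sup>+\<omega>. \<integral>\<^sup>+z. F (history m \<omega>, z) \<partial>K (Y m \<omega>) \<partial>\<Omega>)"
    by (rule markov_chain_nn_integral[OF chain measurable_kernel F])
  also have "\<dots> = (\<integral>\<^sup>+\<omega>. (if bounces (\<lambda>j. Y j \<omega>) m = k then indicator A (stages k m \<omega>) else 0) * h (Y m \<omega>) \<partial>\<Omega>)"
  proof (rule nn_integral_cong)
    fix \<omega> assume \<omega>: "\<omega> \<in> space \<Omega>"
    let ?G = "\<lambda>z. if snd (snd z) \<noteq> snd (snd (Y m \<omega>)) then indicator B z else h z"
    have G: "?G \<in> borel_measurable (K (Y m \<omega>))"
    proof -
      have "{z \<in> space skeleton_space. snd (snd z) = snd (snd (Y m \<omega>))} \<in> sets skeleton_space"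
        using Y_space[OF \<omega>] by (intro pred_velocity_eq measurable_const measurable_ident_sets) simp_all
      then have "(\<lambda>z. if snd (snd z) = snd (snd (Y m \<omega>)) then h z else indicator B z) \<in> borel_measurable skeleton_space"
        by (intro measurable_If h_measurable borel_measurable_indicator B)
      then show ?thesis
        unfolding measurable_cong_sets[OF sets_kernel[OF Y_space[OF \<omega>]] refl]
        by (rule measurable_cong[THEN iffD1, rotated]) auto
    qed
    have "(\<integral>\<^sup>+z. F (history m \<omega>, z) \<partial>K (Y m \<omega>)) =
        (\<integral>\<^sup>+z. (if bounces (\<lambda>j. Y j \<omega>) m = k then indicator A (stages k m \<omega>) else 0) * ?G z \<partial>K (Y m \<omega>))"
      by (intro nn_integral_cong) (auto simp: F_def bounces_history bounce_skeleton_history last simp del: restrict_apply)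
    also have "\<dots> = (if bounces (\<lambda>j. Y j \<omega>) m = k then indicator A (stages k m \<omega>) else 0) * (\<integral>\<^sup>+z. ?G z \<partial>K (Y m \<omega>))"
      by (rule nn_integral_cmult[OF G])
    also have "(\<integral>\<^sup>+z. ?G z \<partial>K (Y m \<omega>)) = h (Y m \<omega>)"
      by (rule next_bounce_renewal[OF Y_space[OF \<omega>] B, symmetric]) (rule B_finite)
    finally show "(\<integral>\<^sup>+z. F (history m \<omega>, z) \<partial>K (Y m \<omega>)) =
        (if bounces (\<lambda>j. Y j \<omega>) m = k then indicator A (stages k m \<omega>) else 0) * h (Y m \<omega>)" .
  qed
  finally show ?thesis .
qed

text \<open>\<open>V\<close> and \<open>V'\<close> differ by a martingale: before the bounce with number \<open>k\<close> they change together,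
  after it \<open>V'\<close> is constant and \<open>V\<close> has mean increments \<open>0\<close> by the renewal equation.\<close>

lemma nn_integral_V_eq_V': "(\<integral>\<^sup>+\<omega>. V m \<omega> \<partial>\<Omega>) = (\<integral>\<^sup>+\<omega>. V' m \<omega> \<partial>\<Omega>)"
proof (induction m)
  case 0
  show ?case by (intro nn_integral_cong) (simp add: V_def V'_def)
next
  case (Suc m)
  let ?N = "\<lambda>\<omega>. bounces (\<lambda>j. Y j \<omega>) m"
  \<comment> \<open>The parts of the sample space during step \<open>m\<close>: bounce
    \<open>k\<close> not yet seen before it (\<open>?a\<close>), bounce \<open>Suc k\<close> already
    seen (\<open>?b\<close>), and waiting for bounce \<open>Suc k\<close>, after (\<open>?c\<close>)
    and before (\<open>?d\<close>) the step.\<close>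
  let ?a = "\<lambda>\<omega>. if ?N \<omega> < k then V' (Suc m) \<omega> else 0"
  let ?b = "\<lambda>\<omega>. if k < ?N \<omega> then V m \<omega> else 0"
  let ?i = "\<lambda>\<omega>. if ?N \<omega> = k then indicator A (stages k m \<omega>) else 0 :: ennreal"
  let ?c = "\<lambda>\<omega>. ?i \<omega> * (if snd (snd (Y (Suc m) \<omega>)) \<noteq> snd (snd (Y m \<omega>)) then indicator B (Y (Suc m) \<omega>) else h (Y (Suc m) \<omega>))"
  let ?d = "\<lambda>\<omega>. ?i \<omega> * h (Y m \<omega>)"
  have ma: "?a \<in> borel_measurable \<Omega>" by (intro measurable_If bounces_sets measurable_V' borel_measurable_const)
  have mb: "?b \<in> borel_measurable \<Omega>" by (intro measurable_If bounces_sets measurable_V borel_measurable_const)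
  have mi: "?i \<in> borel_measurable \<Omega>" by (intro measurable_If bounces_sets indicator_A borel_measurable_const)
  have mc: "?c \<in> borel_measurable \<Omega>"
    unfolding if_not_P not_not
    by (intro borel_measurable_times_ennreal mi measurable_If sets.sets_Collect_neg pred_velocity_eq measurable_Y
       measurable_compose[OF measurable_Y h_measurable] measurable_compose[OF measurable_Y borel_measurable_indicator[OF B]])
  have md: "?d \<in> borel_measurable \<Omega>"
    by (intro borel_measurable_times_ennreal mi measurable_compose[OF measurable_Y h_measurable])
  have V_Suc: "V (Suc m) \<omega> = ?a \<omega> + (?b \<omega> + ?c \<omega>)" for \<omega>
  proof (cases "bounces_at (\<lambda>j. Y j \<omega>) m")
    case True
    have stages: "stages k (Suc m) \<omega> = stages k m \<omega>" if "k \<le> ?N \<omega>"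
      using that by (intro restrict_ext) auto
    consider "?N \<omega> < k" "Suc (?N \<omega>) \<noteq> k" | "Suc (?N \<omega>) = k" | "?N \<omega> = k" | "k < ?N \<omega>" by linarith
    then show ?thesis
    proof cases
      case 1 then show ?thesis using True by (simp add: V_def V'_def)
    next
      case 2
      \<comment> \<open>The new point is bounce \<open>k\<close> itself, so current and frozen
        forecast agree.\<close>
      then have "bounce_skeleton (\<lambda>j. Y j \<omega>) (Suc m) k = Y (Suc m) \<omega>" using True by auto
      with 2 True show ?thesis by (simp add: V_def V'_def del: bounce_skeleton.simps)
    next
      case 3
      then have "bounce_skeleton (\<lambda>j. Y j \<omega>) (Suc m) (Suc k) = Y (Suc m) \<omega>" using True by simp
      with 3 True stages show ?thesis by (simp add: V_def bounces_at_def[symmetric] del: bounce_skeleton.simps) (simp add: bounces_at_def)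
    next
      case 4
      then have "bounce_skeleton (\<lambda>j. Y j \<omega>) (Suc m) (Suc k) = bounce_skeleton (\<lambda>j. Y j \<omega>) m (Suc k)" using True by simp
      with 4 True stages show ?thesis by (simp add: V_def del: bounce_skeleton.simps)
    qed
  next
    case False
    then have "snd (snd (Y (Suc m) \<omega>)) = snd (snd (Y m \<omega>))" by (simp add: bounces_at_def)
    with False show ?thesis
      by (cases "?N \<omega> < k"; cases "?N \<omega> = k") (simp_all add: V_def V'_def)
  qed
  have V_m: "V m \<omega> = ?b \<omega> + ?d \<omega>" for \<omega>
    by (auto simp: V_def)
  have V'_Suc: "V' (Suc m) \<omega> = ?a \<omega> + V' m \<omega>" for \<omega>
  proof (cases "?N \<omega> < k")
    case False
    have "stages k (Suc m) \<omega> = stages k m \<omega>"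
      using False by (intro restrict_ext) auto
    moreover have "bounce_skeleton (\<lambda>j. Y j \<omega>) (Suc m) k = bounce_skeleton (\<lambda>j. Y j \<omega>) m k"
      using False by simp
    ultimately show ?thesis using False by (simp add: V'_def del: bounce_skeleton.simps)
  qed (simp add: V'_def)
  have "(\<integral>\<^sup>+\<omega>. V (Suc m) \<omega> \<partial>\<Omega>) = (\<integral>\<^sup>+\<omega>. ?a \<omega> \<partial>\<Omega>) + ((\<integral>\<^sup>+\<omega>. ?b \<omega> \<partial>\<Omega>) + (\<integral>\<^sup>+\<omega>. ?c \<omega> \<partial>\<Omega>))"
    unfolding V_Suc nn_integral_add[OF ma borel_measurable_add[OF mb mc]] nn_integral_add[OF mb mc] ..
  also have "(\<integral>\<^sup>+\<omega>. ?c \<omega> \<partial>\<Omega>) = (\<integral>\<^sup>+\<omega>. ?d \<omega> \<partial>\<Omega>)"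
    by (rule nn_integral_renewal)
  also have "(\<integral>\<^sup>+\<omega>. ?b \<omega> \<partial>\<Omega>) + (\<integral>\<^sup>+\<omega>. ?d \<omega> \<partial>\<Omega>) = (\<integral>\<^sup>+\<omega>. V m \<omega> \<partial>\<Omega>)"
    unfolding nn_integral_add[OF mb md, symmetric] by (intro nn_integral_cong V_m[symmetric])
  also have "\<dots> = (\<integral>\<^sup>+\<omega>. V' m \<omega> \<partial>\<Omega>)" by (rule Suc.IH)
  also have "(\<integral>\<^sup>+\<omega>. ?a \<omega> \<partial>\<Omega>) + \<dots> = (\<integral>\<^sup>+\<omega>. V' (Suc m) \<omega> \<partial>\<Omega>)"
    unfolding nn_integral_add[OF ma measurable_V', symmetric] by (intro nn_integral_cong V'_Suc[symmetric])
  finally show ?case .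
qed

text \<open>Time does not decrease, and \<open>B\<close> contains no point later than
  \<open>T\<close>.\<close>

lemma h_late:
  assumes z: "z \<in> space skeleton_space" and late: "ennreal T < fst z"
  shows "h z = 0"
proof -
  have "AE z' in zigzag_step rate z. z' \<notin> B"
    using Z.regular_step_kernel[OF z]
  proof eventually_elim
    case (elim z')
    then have "fst z \<le> fst z'" by (simp add: regular_step_def)
    with late have "ennreal T < fst z'" by (rule less_le_trans)
    with B_bounded[of z'] show ?case by (auto simp: not_le[symmetric])
  qed
  then show ?thesis
    using B Z.sets_kernel[OF z] by (simp add: AE_iff_null_sets[symmetric] null_sets_def)
qed

text \<open>The delicate case is that bounce \<open>k\<close> occurs but no later one does: then
  \<open>Z (Suc k)\<close> has infinite time and misses \<open>B\<close>, and \<open>V\<close> must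
  tend to 0. It does because the times of the attempts pass \<open>T\<close>, after which
  \<open>h\<close> vanishes; this is why \<open>B\<close> is bounded in time.\<close>

lemma V_limit:
  assumes \<omega>: "\<omega> \<in> space \<Omega>" and reg: "regular_skeleton (\<lambda>j. Y j \<omega>)" and tot: "(SUP k. fst (Y k \<omega>)) = \<infinity>"
  shows "eventually (\<lambda>m. V m \<omega> = indicator A (\<lambda>i\<in>{..k}. Z i \<omega>) * indicator B (Z (Suc k) \<omega>)) sequentially"
    and "eventually (\<lambda>m. V' m \<omega> = indicator A (\<lambda>i\<in>{..k}. Z i \<omega>) * h (Z k \<omega>)) sequentially"
proof -
  interpret regular_skeleton "\<lambda>j. Y j \<omega>" by (rule reg)
  let ?y = "\<lambda>j. Y j \<omega>"
  have tuple: "stages k m \<omega> = (\<lambda>i\<in>{..k}. Z i \<omega>)" if "k \<le> bounces ?y m" for m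
    using that by (intro restrict_ext) (simp add: Z_def bounce_limit_eq_skeleton[of _ ?y m])
  have pending: "fst (Z i \<omega>) = \<infinity>" if "\<And>m. bounces ?y m < i" for i
  proof -
    obtain m where "bounce_skeleton ?y m i = Z i \<omega>"
      using bounce_limit_obtain[of 0 ?y i] unfolding Z_def by blast
    moreover have "fst (bounce_skeleton ?y m i) = \<infinity>" using bounce_skeleton_pending[OF that, of m] by simp
    ultimately show ?thesis by simp
  qed
  have Z_sp: "Z i \<omega> \<in> space skeleton_space" for i by (rule measurable_space[OF measurable_Z \<omega>])
  have "ennreal T < (SUP k. fst (Y k \<omega>))" unfolding tot by simp
  then obtain m0 where m0: "ennreal T < fst (Y m0 \<omega>)" by (auto simp: less_SUP_iff)
  have late: "h (Y m \<omega>) = 0" if "m0 \<le> m" for m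
    using h_late[OF Y_space[OF \<omega>]] less_le_trans[OF m0 time_mono[OF that]] by simp
  consider (more) m1 where "k < bounces ?y m1" | (exact) m1 where "bounces ?y m1 = k" "\<And>m. bounces ?y m \<le> k"
    | (less) "\<And>m. bounces ?y m < k"
    by (meson linorder_not_less order_le_less)
  then have "eventually (\<lambda>m. V m \<omega> = indicator A (\<lambda>i\<in>{..k}. Z i \<omega>) * indicator B (Z (Suc k) \<omega>)) sequentially \<and>
    eventually (\<lambda>m. V' m \<omega> = indicator A (\<lambda>i\<in>{..k}. Z i \<omega>) * h (Z k \<omega>)) sequentially"
  proof cases
    case more
    have "V m \<omega> = indicator A (\<lambda>i\<in>{..k}. Z i \<omega>) * indicator B (Z (Suc k) \<omega>) \<and>
        V' m \<omega> = indicator A (\<lambda>i\<in>{..k}. Z i \<omega>) * h (Z k \<omega>)" if "m1 \<le> m" for m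
    proof -
      have k: "k < bounces ?y m" using more bounces_mono[OF that, of ?y] by simp
      then have "Z (Suc k) \<omega> = bounce_skeleton ?y m (Suc k)" "Z k \<omega> = bounce_skeleton ?y m k"
        unfolding Z_def by (auto intro!: bounce_limit_eq_skeleton)
      with k tuple[of m] show ?thesis by (simp add: V_def V'_def)
    qed
    then show ?thesis unfolding eventually_sequentially by blast
  next
    case exact
    have inf: "fst (Z (Suc k) \<omega>) = \<infinity>" by (rule pending) (use exact(2) in \<open>simp add: less_Suc_eq_le\<close>)
    have "V m \<omega> = indicator A (\<lambda>i\<in>{..k}. Z i \<omega>) * indicator B (Z (Suc k) \<omega>) \<and>
        V' m \<omega> = indicator A (\<lambda>i\<in>{..k}. Z i \<omega>) * h (Z k \<omega>)" if "max m0 m1 \<le> m" for m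
    proof -
      have k: "bounces ?y m = k" using exact bounces_mono[of m1 m ?y] that by (simp add: antisym)
      then have "Z k \<omega> = bounce_skeleton ?y m k"
        unfolding Z_def by (auto intro!: bounce_limit_eq_skeleton)
      moreover have "Z (Suc k) \<omega> \<notin> B" using inf B_finite by blast
      ultimately show ?thesis using k tuple[of m] late[of m] that by (simp add: V_def V'_def)
    qed
    then show ?thesis unfolding eventually_sequentially by blast
  next
    case less
    have "fst (Z (Suc k) \<omega>) = \<infinity>" by (rule pending) (use less in \<open>simp add: less_SucI\<close>)
    then have "Z (Suc k) \<omega> \<notin> B" using B_finite by blast
    moreover have "h (Z k \<omega>) = 0"
      by (rule h_late[OF Z_sp]) (simp add: pending[OF less])
    ultimately show ?thesis using less by (simp add: V_def V'_def)
  qed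
  then show "eventually (\<lambda>m. V m \<omega> = indicator A (\<lambda>i\<in>{..k}. Z i \<omega>) * indicator B (Z (Suc k) \<omega>)) sequentially"
    and "eventually (\<lambda>m. V' m \<omega> = indicator A (\<lambda>i\<in>{..k}. Z i \<omega>) * h (Z k \<omega>)) sequentially" by auto
qed

text \<open>The equality of the integrals at every stage passes to the limit by dominated
  convergence, both forecasts being at most 1.\<close>

lemma markov_bounded:
  "(\<integral>\<^sup>+\<omega>. indicator A (\<lambda>i\<in>{..k}. Z i \<omega>) * indicator B (Z (Suc k) \<omega>) \<partial>\<Omega>) =
    (\<integral>\<^sup>+\<omega>. indicator A (\<lambda>i\<in>{..k}. Z i \<omega>) * h (Z k \<omega>) \<partial>\<Omega>)"
proof -
  have h_le: "h z \<le> 1" if "z \<in> space skeleton_space" for z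
    by (rule subprob_space.subprob_emeasure_le_1[OF prob_space_imp_subprob_space[OF Z.prob_space_kernel[OF that]]])
  have mA: "(\<lambda>\<omega>. indicator A (\<lambda>i\<in>{..k}. Z i \<omega>) :: ennreal) \<in> borel_measurable \<Omega>"
    by (rule measurable_compose[OF measurable_Z_tuple borel_measurable_indicator[OF A]])
  have 1: "(\<lambda>m. \<integral>\<^sup>+\<omega>. V m \<omega> \<partial>\<Omega>) \<longlonglongrightarrow> (\<integral>\<^sup>+\<omega>. indicator A (\<lambda>i\<in>{..k}. Z i \<omega>) * indicator B (Z (Suc k) \<omega>) \<partial>\<Omega>)"
  proof (rule nn_integral_dominated_convergence[where w="\<lambda>_. 1"])
    show "AE \<omega> in \<Omega>. V m \<omega> \<le> 1" for m
      using h_le[OF Y_space] by (intro AE_I2) (auto simp: V_def indicator_def)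
    show "AE \<omega> in \<Omega>. (\<lambda>m. V m \<omega>) \<longlonglongrightarrow> indicator A (\<lambda>i\<in>{..k}. Z i \<omega>) * indicator B (Z (Suc k) \<omega>)"
      using AE_space AE_regular total by eventually_elim (rule tendsto_eventually[OF V_limit(1)])
  qed (auto simp: P.emeasure_space_1 intro!: measurable_V borel_measurable_times_ennreal mA
      measurable_compose[OF measurable_Z borel_measurable_indicator[OF B]])
  have 2: "(\<lambda>m. \<integral>\<^sup>+\<omega>. V' m \<omega> \<partial>\<Omega>) \<longlonglongrightarrow> (\<integral>\<^sup>+\<omega>. indicator A (\<lambda>i\<in>{..k}. Z i \<omega>) * h (Z k \<omega>) \<partial>\<Omega>)"
  proof (rule nn_integral_dominated_convergence[where w="\<lambda>_. 1"])
    show "AE \<omega> in \<Omega>. V' m \<omega> \<le> 1" for m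
      using h_le[OF measurable_space[OF measurable_bounce_skeleton_Y]] by (intro AE_I2) (auto simp: V'_def indicator_def)
    show "AE \<omega> in \<Omega>. (\<lambda>m. V' m \<omega>) \<longlonglongrightarrow> indicator A (\<lambda>i\<in>{..k}. Z i \<omega>) * h (Z k \<omega>)"
      using AE_space AE_regular total by eventually_elim (rule tendsto_eventually[OF V_limit(2)])
  qed (auto simp: P.emeasure_space_1 intro!: measurable_V' borel_measurable_times_ennreal mA
      measurable_compose[OF measurable_Z h_measurable])
  show ?thesis
    using 1 2 unfolding nn_integral_V_eq_V' by (rule LIMSEQ_unique)
qed

end

text \<open>The time bound on \<open>B\<close> is removed by exhausting \<open>B\<close> with its
  parts up to time \<open>n\<close> and using monotone convergence on both sides.\<close>

lemma markov_finite:
  assumes A: "A \<in> sets (PiM {..k} (\<lambda>_. skeleton_space))" and B: "B \<in> sets skeleton_space"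
    and B_finite: "\<And>z. z \<in> B \<Longrightarrow> fst z \<noteq> \<infinity>"
  shows "(\<integral>\<^sup>+\<omega>. indicator A (\<lambda>i\<in>{..k}. Z i \<omega>) * indicator B (Z (Suc k) \<omega>) \<partial>\<Omega>) =
    (\<integral>\<^sup>+\<omega>. indicator A (\<lambda>i\<in>{..k}. Z i \<omega>) * emeasure (zigzag_step rate (Z k \<omega>)) B \<partial>\<Omega>)"
proof -
  define Bn where "Bn n = {z \<in> B. fst z \<le> ennreal (real n)}" for n :: nat
  have Bn: "Bn n \<in> sets skeleton_space" for n
  proof -
    have "{z \<in> space skeleton_space. fst z \<le> ennreal (real n)} \<in> sets skeleton_space"
      using measurable_sets[OF measurable_skeleton_time, of "{..ennreal (real n)}"]
      by (simp add: vimage_def Int_def conj_commute)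
    then have "B \<inter> {z \<in> space skeleton_space. fst z \<le> ennreal (real n)} \<in> sets skeleton_space" using B by simp
    moreover have "Bn n = B \<inter> {z \<in> space skeleton_space. fst z \<le> ennreal (real n)}"
      using sets.sets_into_space[OF B] by (auto simp: Bn_def)
    ultimately show ?thesis by simp
  qed
  have inc: "incseq Bn"
    by (auto simp: incseq_def Bn_def elim!: order_trans intro!: ennreal_leI)
  have un: "(\<Union>n. Bn n) = B"
  proof -
    have "\<exists>n. fst z \<le> ennreal (real n)" if "z \<in> B" for z
      using B_finite[OF that] real_arch_simple by (cases "fst z") (auto intro: ennreal_leI)
    then show ?thesis by (auto simp: Bn_def)
  qed
  have mA: "(\<lambda>\<omega>. indicator A (\<lambda>i\<in>{..k}. Z i \<omega>) :: ennreal) \<in> borel_measurable \<Omega>"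
    by (rule measurable_compose[OF measurable_Z_tuple borel_measurable_indicator[OF A]])
  have iB: "(SUP n. indicator (Bn n) z) = (indicator B z :: ennreal)" for z
  proof (cases "z \<in> B")
    case True
    then obtain n where "z \<in> Bn n" using un by blast
    then have "(1::ennreal) \<le> (SUP n. indicator (Bn n) z)" by (intro SUP_upper2[of n]) simp_all
    moreover have "(SUP n. indicator (Bn n) z) \<le> (1::ennreal)" by (intro SUP_least) (simp add: indicator_def)
    ultimately show ?thesis using True by simp
  next
    case False
    then have "z \<notin> Bn n" for n using un by blast
    with False show ?thesis by simp
  qed
  have hB: "(SUP n. emeasure (zigzag_step rate z) (Bn n)) = emeasure (zigzag_step rate z) B" if "z \<in> space skeleton_space" for z
    using SUP_emeasure_incseq[of Bn "zigzag_step rate z"] inc Bn Z.sets_kernel[OF that] un by auto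
  have "(\<integral>\<^sup>+\<omega>. indicator A (\<lambda>i\<in>{..k}. Z i \<omega>) * indicator B (Z (Suc k) \<omega>) \<partial>\<Omega>) =
      (\<integral>\<^sup>+\<omega>. (SUP n. indicator A (\<lambda>i\<in>{..k}. Z i \<omega>) * indicator (Bn n) (Z (Suc k) \<omega>)) \<partial>\<Omega>)"
    by (simp add: iB SUP_mult_left_ennreal[symmetric])
  also have "\<dots> = (SUP n. \<integral>\<^sup>+\<omega>. indicator A (\<lambda>i\<in>{..k}. Z i \<omega>) * indicator (Bn n) (Z (Suc k) \<omega>) \<partial>\<Omega>)"
    using inc by (intro nn_integral_monotone_convergence_SUP borel_measurable_times_ennreal mA
      measurable_compose[OF measurable_Z borel_measurable_indicator[OF Bn]])
     (auto simp: incseq_def le_fun_def indicator_def)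
  also have "\<dots> = (SUP n. \<integral>\<^sup>+\<omega>. indicator A (\<lambda>i\<in>{..k}. Z i \<omega>) * emeasure (zigzag_step rate (Z k \<omega>)) (Bn n) \<partial>\<Omega>)"
    by (intro SUP_cong refl markov_bounded[OF A Bn, where T="real _"]) (auto simp: Bn_def)
  also have "\<dots> = (\<integral>\<^sup>+\<omega>. (SUP n. indicator A (\<lambda>i\<in>{..k}. Z i \<omega>) * emeasure (zigzag_step rate (Z k \<omega>)) (Bn n)) \<partial>\<Omega>)"
  proof (rule nn_integral_monotone_convergence_SUP_AE[symmetric])
    show "AE \<omega> in \<Omega>. indicator A (\<lambda>i\<in>{..k}. Z i \<omega>) * emeasure (zigzag_step rate (Z k \<omega>)) (Bn n) \<le>
        indicator A (\<lambda>i\<in>{..k}. Z i \<omega>) * emeasure (zigzag_step rate (Z k \<omega>)) (Bn (Suc n))" for n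
      using inc Bn Z.sets_kernel[OF measurable_space[OF measurable_Z]]
      by (intro AE_I2 mult_left_mono emeasure_mono) (auto simp: incseq_Suc_iff)
  qed (intro borel_measurable_times_ennreal mA measurable_compose[OF measurable_Z measurable_zigzag_emeasure[OF Bn]])
  also have "\<dots> = (\<integral>\<^sup>+\<omega>. indicator A (\<lambda>i\<in>{..k}. Z i \<omega>) * emeasure (zigzag_step rate (Z k \<omega>)) B \<partial>\<Omega>)"
    by (intro nn_integral_cong) (simp add: SUP_mult_left_ennreal[symmetric] hB[OF measurable_space[OF measurable_Z]])
  finally show ?thesis .
qed

end

context thinned_chain
begin

lemma AE_Z_infinite: "AE \<omega> in \<Omega>. \<forall>k. fst (Z (Suc k) \<omega>) = \<infinity> \<longrightarrow> snd (Z (Suc k) \<omega>) = snd (Z k \<omega>)"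
  using AE_regular
proof eventually_elim
  case (elim \<omega>)
  then interpret regular_skeleton "\<lambda>j. Y j \<omega>" .
  show ?case unfolding Z_def using bounce_limit_infinite by blast
qed

text \<open>What remains is the part of \<open>B\<close> at time \<infinity>. There the next point
  is determined by the present one, and its probability is the complement of the finite part already
  treated.\<close>

lemma markov_Z:
  assumes A: "A \<in> sets (PiM {..k} (\<lambda>_. skeleton_space))" and B: "B \<in> sets skeleton_space"
  shows "(\<integral>\<^sup>+\<omega>. indicator A (\<lambda>i\<in>{..k}. Z i \<omega>) * indicator B (Z (Suc k) \<omega>) \<partial>\<Omega>) =
    (\<integral>\<^sup>+\<omega>. indicator A (\<lambda>i\<in>{..k}. Z i \<omega>) * emeasure (zigzag_step rate (Z k \<omega>)) B \<partial>\<Omega>)"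
proof -
  let ?fin = "{z \<in> space skeleton_space. fst z \<noteq> \<infinity>} :: 'p skeleton_point set"
  let ?inf = "{z \<in> space skeleton_space. fst z = \<infinity>} :: 'p skeleton_point set"
  let ?S = "PiM {..k} (\<lambda>_. skeleton_space :: 'p skeleton_point measure)"
  let ?Bf = "{z \<in> B. fst z \<noteq> \<infinity>}"
  have Bf: "?Bf \<in> sets skeleton_space"
  proof -
    have "?Bf = B \<inter> ?fin" using sets.sets_into_space[OF B] by auto
    then show ?thesis using B sets_skeleton_time(2) by auto
  qed
  \<comment> \<open>Whether the only possible infinite successor lies in \<open>B\<close> is a
    property of entry \<open>k\<close>, so it is moved into the condition on the past.\<close>
  define A' where "A' = {x \<in> A. (\<infinity>, snd (x k)) \<in> B}"
  have A': "A' \<in> sets ?S"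
  proof -
    have x: "(\<lambda>x. x k) \<in> measurable ?S skeleton_space" by (rule measurable_component_singleton) simp
    have "(\<lambda>x. (\<infinity>, fst (snd (x k)), snd (snd (x k)))) \<in> measurable ?S skeleton_space"
      by (intro measurable_skeletonI measurable_compose[OF x] measurable_skeleton_position measurable_skeleton_velocity) simp
    from measurable_sets[OF this B] have "{x \<in> space ?S. (\<infinity>, snd (x k)) \<in> B} \<in> sets ?S"
      by (simp add: vimage_def Int_def conj_commute)
    then have "A \<inter> {x \<in> space ?S. (\<infinity>, snd (x k)) \<in> B} \<in> sets ?S" using A by blast
    moreover have "A' = A \<inter> {x \<in> space ?S. (\<infinity>, snd (x k)) \<in> B}"
      using sets.sets_into_space[OF A] by (auto simp: A'_def)
    ultimately show ?thesis by simp
  qed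
  let ?A = "\<lambda>\<omega>. indicator A (\<lambda>i\<in>{..k}. Z i \<omega>) :: ennreal" and ?A' = "\<lambda>\<omega>. indicator A' (\<lambda>i\<in>{..k}. Z i \<omega>) :: ennreal"
  let ?p = "\<lambda>\<omega>. emeasure (zigzag_step rate (Z k \<omega>)) ?fin"
  have mA: "?A \<in> borel_measurable \<Omega>" "?A' \<in> borel_measurable \<Omega>"
    by (rule measurable_compose[OF measurable_Z_tuple borel_measurable_indicator[OF A]])
      (rule measurable_compose[OF measurable_Z_tuple borel_measurable_indicator[OF A']])
  have mI: "(\<lambda>\<omega>. indicator C (Z j \<omega>) :: ennreal) \<in> borel_measurable \<Omega>" if "C \<in> sets skeleton_space" for C j
    by (rule measurable_compose[OF measurable_Z borel_measurable_indicator[OF that]])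
  have mK: "(\<lambda>\<omega>. emeasure (zigzag_step rate (Z k \<omega>)) C) \<in> borel_measurable \<Omega>" if "C \<in> sets skeleton_space" for C
    by (rule measurable_compose[OF measurable_Z measurable_zigzag_emeasure[OF that]])
  have A'_eq: "?A' \<omega> = ?A \<omega> * indicator B (\<infinity>, snd (Z k \<omega>))" for \<omega>
    by (auto simp: A'_def indicator_def)
  have p_le: "?p \<omega> \<le> 1" if "\<omega> \<in> space \<Omega>" for \<omega>
    by (rule subprob_space.subprob_emeasure_le_1[OF prob_space_imp_subprob_space[OF Z.prob_space_kernel[OF measurable_space[OF measurable_Z that]]]])
  have inf_part: "(\<integral>\<^sup>+\<omega>. ?A' \<omega> * indicator ?inf (Z (Suc k) \<omega>) \<partial>\<Omega>) = (\<integral>\<^sup>+\<omega>. ?A' \<omega> * (1 - ?p \<omega>) \<partial>\<Omega>)"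
  proof -
    have fin: "(\<integral>\<^sup>+\<omega>. ?A' \<omega> * indicator ?fin (Z (Suc k) \<omega>) \<partial>\<Omega>) = (\<integral>\<^sup>+\<omega>. ?A' \<omega> * ?p \<omega> \<partial>\<Omega>)"
      by (rule markov_finite[OF A' sets_skeleton_time(2)]) simp
    have "(\<integral>\<^sup>+\<omega>. ?A' \<omega> * ?p \<omega> \<partial>\<Omega>) \<le> (\<integral>\<^sup>+\<omega>. 1 \<partial>\<Omega>)"
      using p_le by (intro nn_integral_mono) (auto simp: indicator_def)
    \<comment> \<open>Finiteness permits the finite-time contribution to be cancelled from the two
      decompositions of the total mass.\<close>
    then have finite: "(\<integral>\<^sup>+\<omega>. ?A' \<omega> * ?p \<omega> \<partial>\<Omega>) \<noteq> \<infinity>"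
      by (auto simp: P.emeasure_space_1 top_unique)
    have "(\<integral>\<^sup>+\<omega>. ?A' \<omega> * ?p \<omega> \<partial>\<Omega>) + (\<integral>\<^sup>+\<omega>. ?A' \<omega> * indicator ?inf (Z (Suc k) \<omega>) \<partial>\<Omega>) =
        (\<integral>\<^sup>+\<omega>. ?A' \<omega> * indicator ?fin (Z (Suc k) \<omega>) + ?A' \<omega> * indicator ?inf (Z (Suc k) \<omega>) \<partial>\<Omega>)"
      unfolding fin[symmetric]
      by (intro nn_integral_add[symmetric] borel_measurable_times_ennreal mA mI sets_skeleton_time)
    also have "\<dots> = (\<integral>\<^sup>+\<omega>. ?A' \<omega> \<partial>\<Omega>)"
      using measurable_space[OF measurable_Z] by (intro nn_integral_cong) (auto simp: indicator_def)
    also have "\<dots> = (\<integral>\<^sup>+\<omega>. ?A' \<omega> * ?p \<omega> + ?A' \<omega> * (1 - ?p \<omega>) \<partial>\<Omega>)"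
      using p_le by (intro nn_integral_cong) (simp add: distrib_left[symmetric] add_diff_inverse_ennreal)
    also have "\<dots> = (\<integral>\<^sup>+\<omega>. ?A' \<omega> * ?p \<omega> \<partial>\<Omega>) + (\<integral>\<^sup>+\<omega>. ?A' \<omega> * (1 - ?p \<omega>) \<partial>\<Omega>)"
      by (intro nn_integral_add borel_measurable_times_ennreal borel_measurable_minus_ennreal mA mK sets_skeleton_time borel_measurable_const)
    finally show ?thesis using finite by (simp add: ennreal_add_left_cancel)
  qed
  have "(\<integral>\<^sup>+\<omega>. ?A \<omega> * indicator B (Z (Suc k) \<omega>) \<partial>\<Omega>) =
      (\<integral>\<^sup>+\<omega>. ?A \<omega> * indicator ?Bf (Z (Suc k) \<omega>) + ?A' \<omega> * indicator ?inf (Z (Suc k) \<omega>) \<partial>\<Omega>)"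
  proof (rule nn_integral_cong_AE)
    show "AE \<omega> in \<Omega>. ?A \<omega> * indicator B (Z (Suc k) \<omega>) =
        ?A \<omega> * indicator ?Bf (Z (Suc k) \<omega>) + ?A' \<omega> * indicator ?inf (Z (Suc k) \<omega>)"
      using AE_Z_infinite AE_space
    proof eventually_elim
      case (elim \<omega>)
      have sp: "Z (Suc k) \<omega> \<in> space skeleton_space" by (rule measurable_space[OF measurable_Z elim(2)])
      show ?case
      proof (cases "fst (Z (Suc k) \<omega>) = \<infinity>")
        case True
        then have "Z (Suc k) \<omega> = (\<infinity>, snd (Z k \<omega>))" using elim(1) by (simp add: prod_eq_iff)
        then show ?thesis using True sp unfolding A'_eq by (simp add: indicator_def)
      qed (simp add: indicator_def)
    qed
  qed
  also have "\<dots> = (\<integral>\<^sup>+\<omega>. ?A \<omega> * indicator ?Bf (Z (Suc k) \<omega>) \<partial>\<Omega>) + (\<integral>\<^sup>+\<omega>. ?A' \<omega> * indicator ?inf (Z (Suc k) \<omega>) \<partial>\<Omega>)"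
    by (intro nn_integral_add borel_measurable_times_ennreal mA mI sets_skeleton_time Bf)
  also have "\<dots> = (\<integral>\<^sup>+\<omega>. ?A \<omega> * emeasure (zigzag_step rate (Z k \<omega>)) ?Bf \<partial>\<Omega>) + (\<integral>\<^sup>+\<omega>. ?A' \<omega> * (1 - ?p \<omega>) \<partial>\<Omega>)"
    unfolding inf_part by (subst markov_finite[OF A Bf]) simp_all
  also have "\<dots> = (\<integral>\<^sup>+\<omega>. ?A \<omega> * emeasure (zigzag_step rate (Z k \<omega>)) ?Bf + ?A' \<omega> * (1 - ?p \<omega>) \<partial>\<Omega>)"
    by (intro nn_integral_add[symmetric] borel_measurable_times_ennreal borel_measurable_minus_ennreal mA mK Bf sets_skeleton_time borel_measurable_const)
  also have "\<dots> = (\<integral>\<^sup>+\<omega>. ?A \<omega> * emeasure (zigzag_step rate (Z k \<omega>)) B \<partial>\<Omega>)"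
  proof (rule nn_integral_cong)
    fix \<omega> assume "\<omega> \<in> space \<Omega>"
    note Z.emeasure_kernel'[OF measurable_space[OF measurable_Z this] B]
    then show "?A \<omega> * emeasure (zigzag_step rate (Z k \<omega>)) ?Bf + ?A' \<omega> * (1 - ?p \<omega>) =
        ?A \<omega> * emeasure (zigzag_step rate (Z k \<omega>)) B"
      unfolding A'_eq by (simp add: distrib_left mult.assoc)
  qed
  finally show ?thesis .
qed

lemma markov_chain_Z: "markov_chain \<Omega> skeleton_space (zigzag_step rate) Z"
  unfolding markov_chain_def
proof (intro conjI allI ballI)
  fix k and A :: "(nat \<Rightarrow> 'p skeleton_point) set" and B :: "'p skeleton_point set"
  assume A: "A \<in> sets (PiM {..k} (\<lambda>_. skeleton_space))" and B: "B \<in> sets skeleton_space"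
  have "{\<omega> \<in> space \<Omega>. (\<lambda>i\<in>{..k}. Z i \<omega>) \<in> A} \<inter> {\<omega> \<in> space \<Omega>. Z (Suc k) \<omega> \<in> B} \<in> sets \<Omega>"
    using measurable_sets[OF measurable_Z_tuple A] measurable_sets[OF measurable_Z B]
    by (intro sets.Int) (simp_all add: vimage_def Int_def conj_commute del: restrict_apply)
  also have "{\<omega> \<in> space \<Omega>. (\<lambda>i\<in>{..k}. Z i \<omega>) \<in> A} \<inter> {\<omega> \<in> space \<Omega>. Z (Suc k) \<omega> \<in> B} =
      {\<omega> \<in> space \<Omega>. (\<lambda>i\<in>{..k}. Z i \<omega>) \<in> A \<and> Z (Suc k) \<omega> \<in> B}" by auto
  finally have "emeasure \<Omega> {\<omega> \<in> space \<Omega>. (\<lambda>i\<in>{..k}. Z i \<omega>) \<in> A \<and> Z (Suc k) \<omega> \<in> B} =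
      (\<integral>\<^sup>+\<omega>. indicator {\<omega> \<in> space \<Omega>. (\<lambda>i\<in>{..k}. Z i \<omega>) \<in> A \<and> Z (Suc k) \<omega> \<in> B} \<omega> \<partial>\<Omega>)"
    by (rule nn_integral_indicator[symmetric])
  also have "\<dots> = (\<integral>\<^sup>+\<omega>. indicator A (\<lambda>i\<in>{..k}. Z i \<omega>) * indicator B (Z (Suc k) \<omega>) \<partial>\<Omega>)"
    by (intro nn_integral_cong) (auto simp: indicator_def simp del: restrict_apply)
  also have "\<dots> = (\<integral>\<^sup>+\<omega>. indicator A (\<lambda>i\<in>{..k}. Z i \<omega>) * emeasure (zigzag_step rate (Z k \<omega>)) B \<partial>\<Omega>)"
    by (rule markov_Z[OF A B])
  finally show "emeasure \<Omega> {\<omega> \<in> space \<Omega>. (\<lambda>i\<in>{..k}. Z i \<omega>) \<in> A \<and> Z (Suc k) \<omega> \<in> B} = \<dots>" .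
qed (auto intro: P.prob_space_axioms measurable_Z)

lemma AE_Z_path:
  "AE \<omega> in \<Omega>. fst (Z 0 \<omega>) = 0 \<and> (SUP k. fst (Z k \<omega>)) = \<infinity> \<and>
     (\<forall>t\<ge>0. skeleton_path (\<lambda>k. Y k \<omega>) t = skeleton_path (\<lambda>k. Z k \<omega>) t)"
  using AE_regular start total
proof eventually_elim
  case (elim \<omega>)
  interpret regular_skeleton "\<lambda>j. Y j \<omega>" by (rule elim)
  have "(SUP k. fst (Y k \<omega>)) \<le> (SUP k. fst (Z k \<omega>))"
    unfolding Z_def by (intro SUP_mono) (use bounce_limit_time_ge in blast)
  then have "(SUP k. fst (Z k \<omega>)) = \<infinity>" using elim(3) by (simp add: top_unique)
  moreover have "(\<lambda>k. Z k \<omega>) = bounce_limit (\<lambda>j. Y j \<omega>)" by (simp add: Z_def fun_eq_iff)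
  ultimately show ?case
    using skeleton_path_bounce_limit elim(2,3) by (simp add: Z_def)
qed

lemma zigzag_process_path: "zigzag_process \<Omega> rate (\<lambda>t \<omega>. skeleton_path (\<lambda>k. Y k \<omega>) t)"
  unfolding zigzag_process_def using markov_chain_Z AE_Z_path by blast

end

section \<open>Skew reversibility\<close>

context zigzag_rates
begin

text \<open>Joint measurability in a parameter and the position, for each fixed velocity. Times and
  durations become parameters \<open>c\<close>, as needed to integrate over bounce times.\<close>

definition family :: "'c measure \<Rightarrow> ('c \<Rightarrow> real^'p \<Rightarrow> real^'p \<Rightarrow> ennreal) \<Rightarrow> bool" where
  "family C f \<longleftrightarrow> (\<forall>\<theta>\<in>velocities. (\<lambda>(c, \<xi>). f c \<xi> \<theta>) \<in> borel_measurable (C \<Otimes>\<^sub>M borel))"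

definition state_function :: "(real^'p \<Rightarrow> real^'p \<Rightarrow> ennreal) \<Rightarrow> bool" where
  "state_function f \<longleftrightarrow> (\<forall>\<theta>\<in>velocities. (\<lambda>\<xi>. f \<xi> \<theta>) \<in> borel_measurable borel)"

definition survival :: "real \<Rightarrow> real^'p \<Rightarrow> real^'p \<Rightarrow> ennreal" where
  "survival t \<xi> \<theta> = ennreal (exp (- cumulative (\<lambda>s. bounce_rate (\<xi> + s *\<^sub>R \<theta>) \<theta>) t))"

text \<open>\<open>drift\<close> is the semigroup of the motion killed at its first bounce, and
  \<open>jump\<close> the unnormalised jump operator; \<open>transition n\<close> is then the term
  of order \<open>n\<close> in the Dyson expansion of the zig-zag semigroup.\<close>

definition drift :: "real \<Rightarrow> (real^'p \<Rightarrow> real^'p \<Rightarrow> ennreal) \<Rightarrow> real^'p \<Rightarrow> real^'p \<Rightarrow> ennreal" where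
  "drift t f \<xi> \<theta> = survival t \<xi> \<theta> * f (\<xi> + t *\<^sub>R \<theta>) \<theta>"

definition jump :: "(real^'p \<Rightarrow> real^'p \<Rightarrow> ennreal) \<Rightarrow> real^'p \<Rightarrow> real^'p \<Rightarrow> ennreal" where
  "jump f \<xi> \<theta> = (\<Sum>i\<in>UNIV. ennreal (rate i \<xi> \<theta>) * f \<xi> (flip i \<theta>))"

text \<open>The expectation of \<open>f\<close> at time \<open>t\<close> on the event that exactly \<open>n\<close> bounces have occurred.\<close>

primrec transition :: "nat \<Rightarrow> (real^'p \<Rightarrow> real^'p \<Rightarrow> ennreal) \<Rightarrow> real \<Rightarrow> real^'p \<Rightarrow> real^'p \<Rightarrow> ennreal" where
  "transition 0 f = (\<lambda>t. drift t f)"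
| "transition (Suc n) f = (\<lambda>t \<xi> \<theta>. \<integral>\<^sup>+s. drift s (jump (transition n f (t - s))) \<xi> \<theta> * indicator {0..t} s \<partial>lborel)"

lemma familyD: "family C f \<Longrightarrow> \<theta> \<in> velocities \<Longrightarrow> (\<lambda>p. f (fst p) (snd p) \<theta>) \<in> borel_measurable (C \<Otimes>\<^sub>M borel)"
  by (simp add: family_def case_prod_unfold)

lemma familyI: "(\<And>\<theta>. \<theta> \<in> velocities \<Longrightarrow> (\<lambda>p. f (fst p) (snd p) \<theta>) \<in> borel_measurable (C \<Otimes>\<^sub>M borel)) \<Longrightarrow> family C f"
  by (simp add: family_def case_prod_unfold)

lemma family_member: "family C f \<Longrightarrow> c \<in> space C \<Longrightarrow> state_function (f c)"
  using measurable_Pair2[of "\<lambda>p. f (fst p) (snd p) _"] by (auto simp: state_function_def dest!: familyD)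

lemma family_const: "state_function f \<Longrightarrow> family C (\<lambda>_. f)"
  by (intro familyI measurable_compose[OF measurable_snd]) (simp add: state_function_def)

lemma family_reindex:
  assumes "family C f" and \<phi>: "\<phi> \<in> measurable D C"
  shows "family D (\<lambda>d. f (\<phi> d))"
proof (rule familyI)
  fix \<theta> :: "real^'p" assume "\<theta> \<in> velocities"
  have "(\<lambda>p. (\<phi> (fst p), snd p)) \<in> measurable (D \<Otimes>\<^sub>M borel) (C \<Otimes>\<^sub>M borel)"
    by (intro measurable_Pair measurable_compose[OF measurable_fst \<phi>] measurable_snd)
  from measurable_compose[OF this familyD[OF assms(1) \<open>\<theta> \<in> velocities\<close>]]
  show "(\<lambda>p. f (\<phi> (fst p)) (snd p) \<theta>) \<in> borel_measurable (D \<Otimes>\<^sub>M borel)" by simp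
qed

lemma measurable_survival:
  assumes \<theta>: "\<theta> \<in> velocities" and a: "a \<in> borel_measurable M" and x: "x \<in> borel_measurable M"
  shows "(\<lambda>p. survival (a p) (x p) \<theta>) \<in> borel_measurable M"
proof -
  have "(\<lambda>q. x (fst q) + snd q *\<^sub>R \<theta>) \<in> borel_measurable (M \<Otimes>\<^sub>M lborel)"
    using measurable_compose[OF measurable_fst x] by measurable
  from measurable_compose[OF this measurable_bounce_rate[OF \<theta>]]
  have [measurable]: "(\<lambda>q. bounce_rate (x (fst q) + snd q *\<^sub>R \<theta>) \<theta>) \<in> borel_measurable (M \<Otimes>\<^sub>M lborel)" .
  have [measurable]: "(\<lambda>q. a (fst q)) \<in> borel_measurable (M \<Otimes>\<^sub>M lborel)"
    by (rule measurable_compose[OF measurable_fst a])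
  have "(\<lambda>p. LINT r|lborel. (if 0 \<le> r \<and> r \<le> a p then 1 else 0) *\<^sub>R bounce_rate (x p + r *\<^sub>R \<theta>) \<theta>) \<in> borel_measurable M"
    by (rule lborel.borel_measurable_lebesgue_integral) measurable
  then have "(\<lambda>p. cumulative (\<lambda>s. bounce_rate (x p + s *\<^sub>R \<theta>) \<theta>) (a p)) \<in> borel_measurable M"
    by (simp add: cumulative_def set_lebesgue_integral_def indicator_def of_bool_def cong: if_cong)
  then show ?thesis unfolding survival_def by measurable
qed

lemma family_drift:
  assumes f: "family C f" and a: "a \<in> borel_measurable C"
  shows "family C (\<lambda>c. drift (a c) (f c))"
proof (rule familyI)
  fix \<theta> :: "real^'p" assume \<theta>: "\<theta> \<in> velocities"
  have a': "(\<lambda>p. a (fst p)) \<in> borel_measurable (C \<Otimes>\<^sub>M borel)"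
    by (rule measurable_compose[OF measurable_fst a])
  have "(\<lambda>p. (fst p, snd p + a (fst p) *\<^sub>R \<theta>)) \<in> measurable (C \<Otimes>\<^sub>M borel) (C \<Otimes>\<^sub>M borel)"
    using a' by measurable
  from measurable_compose[OF this familyD[OF f \<theta>]] measurable_survival[OF \<theta> a' measurable_snd]
  show "(\<lambda>p. drift (a (fst p)) (f (fst p)) (snd p) \<theta>) \<in> borel_measurable (C \<Otimes>\<^sub>M borel)"
    unfolding drift_def by simp
qed

lemma family_jump:
  assumes f: "family C f"
  shows "family C (\<lambda>c. jump (f c))"
  unfolding jump_def
  by (intro familyI borel_measurable_sum borel_measurable_times_ennreal familyD[OF f]
      measurable_compose[OF _ measurable_ennreal] measurable_compose[OF measurable_snd measurable_rate]) simp_all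

lemma family_integral:
  fixes a :: "'c \<Rightarrow> real"
  assumes f: "family (C \<Otimes>\<^sub>M borel) (\<lambda>(c, s). f c s)" and a: "a \<in> borel_measurable C"
  shows "family C (\<lambda>c \<xi> \<theta>. \<integral>\<^sup>+s. f c s \<xi> \<theta> * indicator {0..a c} s \<partial>lborel)"
proof (rule familyI)
  fix \<theta> :: "real^'p" assume \<theta>: "\<theta> \<in> velocities"
  have "(\<lambda>q. ((fst (fst q), snd q), snd (fst q))) \<in>
      measurable ((C \<Otimes>\<^sub>M borel) \<Otimes>\<^sub>M lborel) ((C \<Otimes>\<^sub>M borel) \<Otimes>\<^sub>M (borel :: (real^'p) measure))"
    by measurable
  from measurable_compose[OF this familyD[OF f \<theta>]]
  have fm: "(\<lambda>q. f (fst (fst q)) (snd q) (snd (fst q)) \<theta>) \<in> borel_measurable ((C \<Otimes>\<^sub>M borel) \<Otimes>\<^sub>M lborel)"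
    by simp
  have sm: "snd \<in> borel_measurable ((C \<Otimes>\<^sub>M (borel :: (real^'p) measure)) \<Otimes>\<^sub>M (lborel :: real measure))"
    by measurable
  have am: "(\<lambda>q. a (fst (fst q))) \<in> borel_measurable ((C \<Otimes>\<^sub>M (borel :: (real^'p) measure)) \<Otimes>\<^sub>M (lborel :: real measure))"
    by (rule measurable_compose[OF _ a]) measurable
  have "(\<lambda>p. \<integral>\<^sup>+s. f (fst p) s (snd p) \<theta> * (if 0 \<le> s \<and> s \<le> a (fst p) then 1 else 0) \<partial>lborel) \<in> borel_measurable (C \<Otimes>\<^sub>M borel)"
  proof (rule lborel.borel_measurable_nn_integral, unfold case_prod_unfold, rule borel_measurable_times_ennreal[OF fm])
    have "{q \<in> space ((C \<Otimes>\<^sub>M (borel :: (real^'p) measure)) \<Otimes>\<^sub>M lborel). 0 \<le> snd q \<and> snd q \<le> a (fst (fst q))}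
        \<in> sets ((C \<Otimes>\<^sub>M borel) \<Otimes>\<^sub>M lborel)"
      by (intro sets.sets_Collect_conj borel_measurable_le[OF borel_measurable_const sm] borel_measurable_le[OF sm am])
    then show "(\<lambda>q. if 0 \<le> snd q \<and> snd q \<le> a (fst (fst q)) then 1 else 0 :: ennreal)
        \<in> borel_measurable ((C \<Otimes>\<^sub>M (borel :: (real^'p) measure)) \<Otimes>\<^sub>M lborel)"
      by (intro measurable_If measurable_const) simp_all
  qed
  then show "(\<lambda>p. \<integral>\<^sup>+s. f (fst p) s (snd p) \<theta> * indicator {0..a (fst p)} s \<partial>lborel) \<in> borel_measurable (C \<Otimes>\<^sub>M borel)"
    by (simp add: indicator_def of_bool_def cong: if_cong)
qed

lemma family_transition':
  assumes f: "family C f"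
  shows "family (C \<Otimes>\<^sub>M borel) (\<lambda>(c, t). transition n (f c) t)"
proof (induction n)
  case 0
  have "family (C \<Otimes>\<^sub>M borel) (\<lambda>p. drift (snd p) (f (fst p)))"
    by (intro family_drift family_reindex[OF f]) simp_all
  then show ?case by (simp add: case_prod_unfold)
next
  case (Suc n)
  have "family ((C \<Otimes>\<^sub>M borel) \<Otimes>\<^sub>M borel) (\<lambda>q. drift (snd q) (jump (transition n (f (fst (fst q))) (snd (fst q) - snd q))))"
  proof (intro family_drift family_jump)
    have "(\<lambda>q. (fst (fst q), snd (fst q) - snd q)) \<in> measurable ((C \<Otimes>\<^sub>M borel) \<Otimes>\<^sub>M borel) (C \<Otimes>\<^sub>M (borel :: real measure))"
      by measurable
    from family_reindex[OF Suc this]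
    show "family ((C \<Otimes>\<^sub>M borel) \<Otimes>\<^sub>M borel) (\<lambda>q. transition n (f (fst (fst q))) (snd (fst q) - snd q))" by simp
  qed simp
  then have "family (C \<Otimes>\<^sub>M borel) (\<lambda>p \<xi> \<theta>. \<integral>\<^sup>+s. drift s (jump (transition n (f (fst p)) (snd p - s))) \<xi> \<theta> * indicator {0..snd p} s \<partial>lborel)"
    by (intro family_integral) (simp_all add: case_prod_unfold)
  then show ?case by (simp add: case_prod_unfold)
qed

lemma family_transition:
  assumes f: "family C f" and a: "a \<in> borel_measurable C"
  shows "family C (\<lambda>c. transition n (f c) (a c))"
proof -
  have "(\<lambda>c. (c, a c)) \<in> measurable C (C \<Otimes>\<^sub>M borel)" using a by measurable
  from family_reindex[OF family_transition'[OF f] this] show ?thesis by simp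
qed

lemma state_function_transition:
  assumes "state_function f" shows "state_function (transition n f t)"
  using family_member[OF family_transition[OF family_const[OF assms], of "\<lambda>_. t" borel], of "0::real"] by simp

lemma drift_cong: "f (\<xi> + t *\<^sub>R \<theta>) \<theta> = f' (\<xi> + t *\<^sub>R \<theta>) \<theta> \<Longrightarrow> drift t f \<xi> \<theta> = drift t f' \<xi> \<theta>"
  by (simp add: drift_def)

lemma drift_jump_integral:
  fixes f :: "real \<Rightarrow> real^'p \<Rightarrow> real^'p \<Rightarrow> ennreal"
  assumes f: "family borel f" and \<theta>: "\<theta> \<in> velocities"
  shows "drift s (jump (\<lambda>\<xi> \<theta>. \<integral>\<^sup>+r. f r \<xi> \<theta> * indicator {0..t} r \<partial>lborel)) \<xi> \<theta> =
    (\<integral>\<^sup>+r. drift s (jump (f r)) \<xi> \<theta> * indicator {0..t} r \<partial>lborel)"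
proof -
  have m: "(\<lambda>r. f r \<eta> (flip i \<theta>)) \<in> borel_measurable lborel" for \<eta> i
    using measurable_Pair1[OF familyD[OF f, of "flip i \<theta>"], of \<eta>] \<theta> by simp
  have m': "(\<lambda>r. f r \<eta> (flip i \<theta>) * indicator {0..t} r) \<in> borel_measurable lborel" for \<eta> i
    by (intro borel_measurable_times_ennreal m borel_measurable_indicator) simp
  have "jump (\<lambda>\<xi> \<theta>. \<integral>\<^sup>+r. f r \<xi> \<theta> * indicator {0..t} r \<partial>lborel) \<eta> \<theta> = (\<integral>\<^sup>+r. jump (f r) \<eta> \<theta> * indicator {0..t} r \<partial>lborel)" for \<eta>
  proof -
    have "jump (\<lambda>\<xi> \<theta>. \<integral>\<^sup>+r. f r \<xi> \<theta> * indicator {0..t} r \<partial>lborel) \<eta> \<theta> =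
        (\<Sum>i\<in>UNIV. \<integral>\<^sup>+r. ennreal (rate i \<eta> \<theta>) * (f r \<eta> (flip i \<theta>) * indicator {0..t} r) \<partial>lborel)"
      unfolding jump_def by (intro sum.cong refl nn_integral_cmult[symmetric] m')
    also have "\<dots> = (\<integral>\<^sup>+r. (\<Sum>i\<in>UNIV. ennreal (rate i \<eta> \<theta>) * (f r \<eta> (flip i \<theta>) * indicator {0..t} r)) \<partial>lborel)"
      by (intro nn_integral_sum[symmetric] borel_measurable_times_ennreal borel_measurable_const m')
    finally show ?thesis by (simp add: jump_def sum_distrib_right mult.assoc)
  qed
  note J = this
  have mj: "(\<lambda>r. jump (f r) \<eta> \<theta> * indicator {0..t} r) \<in> borel_measurable lborel" for \<eta>
    using measurable_Pair1[OF familyD[OF family_jump[OF f] \<theta>], of \<eta>] by (intro borel_measurable_times_ennreal) simp_all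
  show ?thesis
    unfolding drift_def J using nn_integral_cmult[OF mj, of "survival s \<xi> \<theta>"] by (simp add: mult.assoc)
qed

lemma jump_cong: "(\<And>i. f \<xi> (flip i \<theta>) = f' \<xi> (flip i \<theta>)) \<Longrightarrow> jump f \<xi> \<theta> = jump f' \<xi> \<theta>"
  by (simp add: jump_def)

text \<open>The recursion may also be unfolded at the last bounce instead of the first one.\<close>

lemma transition_last:
  assumes f: "state_function f" and \<theta>: "\<theta> \<in> velocities"
  shows "transition (Suc n) f t \<xi> \<theta> =
    (\<integral>\<^sup>+s. transition n (jump (drift s f)) (t - s) \<xi> \<theta> * indicator {0..t} s \<partial>lborel)"
  using \<theta>
proof (induction n arbitrary: t \<xi> \<theta>)
  case 0
  have "family borel (\<lambda>s. drift s (jump (drift (t - s) f)))"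
    by (intro family_drift family_jump family_const f) measurable
  from measurable_Pair1[OF familyD[OF this 0], of \<xi>]
  have [measurable]: "(\<lambda>s. drift s (jump (drift (t - s) f)) \<xi> \<theta>) \<in> borel_measurable borel" by simp
  have "transition (Suc 0) f t \<xi> \<theta> = (\<integral>\<^sup>+s. drift s (jump (drift (t - s) f)) \<xi> \<theta> * indicator {0..t} s \<partial>lborel)"
    by simp
  also have "\<dots> = (\<integral>\<^sup>+s. drift (t - s) (jump (drift s f)) \<xi> \<theta> * indicator {0..t} s \<partial>lborel)"
    by (subst nn_integral_real_affine[where c="-1" and t=t]) (auto intro!: nn_integral_cong simp: indicator_def)
  finally show ?case by simp
next
  case (Suc n)
  \<comment> \<open>Here \<open>s\<close> is the time of the first bounce and \<open>r\<close> the
    duration after the last one.\<close>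
  let ?G = "\<lambda>r s. transition n (jump (drift r f)) (t - s - r)"
  have G: "family (borel \<Otimes>\<^sub>M borel) (\<lambda>(s, r). ?G r s)"
  proof -
    have "family (borel \<Otimes>\<^sub>M borel) (\<lambda>p. transition n (jump (drift (snd p) f)) (t - fst p - snd p))"
      by (intro family_transition family_jump family_drift family_const f) measurable
    then show ?thesis by (simp add: case_prod_unfold)
  qed
  have G1: "family borel (\<lambda>r. ?G r s)" for s
    by (intro family_transition family_jump family_drift family_const f) measurable
  have D: "(\<lambda>(s, r). drift s (jump (?G r s)) \<xi> \<theta> * (if 0 \<le> s \<and> 0 \<le> r \<and> s + r \<le> t then 1 else 0)) \<in> borel_measurable (lborel \<Otimes>\<^sub>M lborel)"
  proof -
    have "family (borel \<Otimes>\<^sub>M borel) (\<lambda>p. drift (fst p) (jump (?G (snd p) (fst p))))"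
      using G by (intro family_drift family_jump) (simp_all add: case_prod_unfold)
    from measurable_Pair1[OF familyD[OF this Suc.prems], of \<xi>]
    have [measurable]: "(\<lambda>p. drift (fst p) (jump (?G (snd p) (fst p))) \<xi> \<theta>) \<in> borel_measurable (borel \<Otimes>\<^sub>M borel)" by simp
    have "(\<lambda>p. drift (fst p) (jump (?G (snd p) (fst p))) \<xi> \<theta> * (if 0 \<le> fst p \<and> 0 \<le> snd p \<and> fst p + snd p \<le> t then 1 else 0))
        \<in> borel_measurable (borel \<Otimes>\<^sub>M borel)" by measurable
    then show ?thesis by (simp add: case_prod_unfold cong: measurable_cong_sets sets_pair_measure_cong)
  qed
  have "transition (Suc (Suc n)) f t \<xi> \<theta> =
      (\<integral>\<^sup>+s. drift s (jump (transition (Suc n) f (t - s))) \<xi> \<theta> * indicator {0..t} s \<partial>lborel)" by simp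
  also have "\<dots> = (\<integral>\<^sup>+s. drift s (jump (\<lambda>\<xi> \<theta>. \<integral>\<^sup>+r. ?G r s \<xi> \<theta> * indicator {0..t - s} r \<partial>lborel)) \<xi> \<theta> * indicator {0..t} s \<partial>lborel)"
    using Suc.prems by (intro nn_integral_cong arg_cong2[where f=times] refl drift_cong jump_cong Suc.IH) simp
  also have "\<dots> = (\<integral>\<^sup>+s. (\<integral>\<^sup>+r. drift s (jump (?G r s)) \<xi> \<theta> * indicator {0..t - s} r \<partial>lborel) * indicator {0..t} s \<partial>lborel)"
    by (simp only: drift_jump_integral[OF G1 Suc.prems])
  \<comment> \<open>The domain becomes the simplex of \<open>s\<close> and \<open>r\<close>, a
    condition symmetric in both, so that the order of integration can be exchanged.\<close>
  also have "\<dots> = (\<integral>\<^sup>+s. \<integral>\<^sup>+r. drift s (jump (?G r s)) \<xi> \<theta> * (if 0 \<le> s \<and> 0 \<le> r \<and> s + r \<le> t then 1 else 0) \<partial>lborel \<partial>lborel)"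
  proof (rule nn_integral_cong)
    fix s
    show "(\<integral>\<^sup>+r. drift s (jump (?G r s)) \<xi> \<theta> * indicator {0..t - s} r \<partial>lborel) * indicator {0..t} s =
        (\<integral>\<^sup>+r. drift s (jump (?G r s)) \<xi> \<theta> * (if 0 \<le> s \<and> 0 \<le> r \<and> s + r \<le> t then 1 else 0) \<partial>lborel)"
    proof (cases "s \<in> {0..t}")
      case True
      then show ?thesis by (auto intro!: nn_integral_cong simp: indicator_def)
    next
      case False
      then have "(if 0 \<le> s \<and> 0 \<le> r \<and> s + r \<le> t then 1 else 0) = (0 :: ennreal)" for r by auto
      with False show ?thesis by (simp only: mult_zero_right nn_integral_const mult_zero_left indicator_simps not_False_eq_True)
    qed
  qed
  also have "\<dots> = (\<integral>\<^sup>+r. \<integral>\<^sup>+s. drift s (jump (?G r s)) \<xi> \<theta> * (if 0 \<le> s \<and> 0 \<le> r \<and> s + r \<le> t then 1 else 0) \<partial>lborel \<partial>lborel)"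
    by (rule lborel_pair.Fubini'[OF D, symmetric])
  also have "\<dots> = (\<integral>\<^sup>+r. transition (Suc n) (jump (drift r f)) (t - r) \<xi> \<theta> * indicator {0..t} r \<partial>lborel)"
  proof (rule nn_integral_cong)
    fix r
    have tr: "t - s - r = t - r - s" for s by simp
    show "(\<integral>\<^sup>+s. drift s (jump (?G r s)) \<xi> \<theta> * (if 0 \<le> s \<and> 0 \<le> r \<and> s + r \<le> t then 1 else 0) \<partial>lborel) =
        transition (Suc n) (jump (drift r f)) (t - r) \<xi> \<theta> * indicator {0..t} r"
    proof (cases "r \<in> {0..t}")
      case True
      then show ?thesis unfolding tr by (auto intro!: nn_integral_cong simp: indicator_def)
    next
      case False
      then have "(if 0 \<le> s \<and> 0 \<le> r \<and> s + r \<le> t then 1 else 0) = (0 :: ennreal)" for s by auto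
      with False show ?thesis by (simp only: mult_zero_right nn_integral_const mult_zero_left indicator_simps not_False_eq_True)
    qed
  qed
  finally show ?case .
qed

end

section \<open>Adjoints with respect to the unnormalised target\<close>

lemma nn_integral_translation:
  fixes f :: "'a::euclidean_space \<Rightarrow> ennreal"
  assumes [measurable]: "f \<in> borel_measurable borel"
  shows "(\<integral>\<^sup>+x. f (x + c) \<partial>lborel) = (\<integral>\<^sup>+x. f x \<partial>lborel)"
proof -
  have "(\<integral>\<^sup>+x. f x \<partial>lborel) = (\<integral>\<^sup>+x. f x \<partial>distr lborel borel ((+) c))" by (simp add: lborel_distr_plus)
  also have "\<dots> = (\<integral>\<^sup>+x. f (x + c) \<partial>lborel)"
    by (subst nn_integral_distr) (simp_all add: add.commute)
  finally show ?thesis by simp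
qed

text \<open>\<open>balance\<close> integrates the identity that the bounce rates of
  \<open>\<theta>\<close> and \<open>- \<theta>\<close> differ by the derivative of \<open>U\<close>
  along \<open>\<theta>\<close>. The integrated form asks for no pointwise regularity of the rates.
  \<open>rate_local\<close> ensures that reversing all components other than \<open>i\<close> does
  not affect rate \<open>i\<close>.\<close>

locale balanced_zigzag_rates = zigzag_rates rate
  for rate :: "'p::finite \<Rightarrow> real^'p \<Rightarrow> real^'p \<Rightarrow> real" +
  fixes U :: "real^'p \<Rightarrow> real"
  assumes measurable_U: "U \<in> borel_measurable borel"
    and rate_local: "\<And>i \<xi> \<theta> \<theta>'. \<theta> \<in> velocities \<Longrightarrow> \<theta>' \<in> velocities \<Longrightarrow> \<theta> $ i = \<theta>' $ i \<Longrightarrow> rate i \<xi> \<theta> = rate i \<xi> \<theta>'"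
    and balance: "\<And>\<xi> \<theta> t. \<theta> \<in> velocities \<Longrightarrow> 0 \<le> t \<Longrightarrow>
      U (\<xi> + t *\<^sub>R \<theta>) + cumulative (\<lambda>s. bounce_rate (\<xi> + t *\<^sub>R \<theta> + s *\<^sub>R (- \<theta>)) (- \<theta>)) t =
      U \<xi> + cumulative (\<lambda>s. bounce_rate (\<xi> + s *\<^sub>R \<theta>) \<theta>) t"
begin

definition reversed :: "(real^'p \<Rightarrow> real^'p \<Rightarrow> ennreal) \<Rightarrow> real^'p \<Rightarrow> real^'p \<Rightarrow> ennreal" where
  "reversed f = (\<lambda>\<xi> \<theta>. f \<xi> (- \<theta>))"

text \<open>Unnormalised and with values in \<open>ennreal\<close>, so it is defined for all
  nonnegative functions; constants are restored only by the factor \<open>c\<close> at the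
  end.\<close>

definition pairing :: "(real^'p \<Rightarrow> real^'p \<Rightarrow> ennreal) \<Rightarrow> (real^'p \<Rightarrow> real^'p \<Rightarrow> ennreal) \<Rightarrow> ennreal" where
  "pairing h f = (\<Sum>\<theta>\<in>velocities. \<integral>\<^sup>+\<xi>. ennreal (exp (- U \<xi>)) * (h \<xi> \<theta> * f \<xi> \<theta>) \<partial>lborel)"

lemma reversed_reversed [simp]: "reversed (reversed f) = f"
  by (simp add: reversed_def)

lemma state_function_reversed: "state_function f \<Longrightarrow> state_function (reversed f)"
  by (simp add: state_function_def reversed_def)

lemma state_functionD: "state_function f \<Longrightarrow> \<theta> \<in> velocities \<Longrightarrow> (\<lambda>\<xi>. f \<xi> \<theta>) \<in> borel_measurable borel"
  by (simp add: state_function_def)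

lemma pairing_commute: "pairing h f = pairing f h"
  by (simp add: pairing_def mult.commute)

lemma pairing_cong: "(\<And>\<xi> \<theta>. \<theta> \<in> velocities \<Longrightarrow> f \<xi> \<theta> = f' \<xi> \<theta>) \<Longrightarrow> pairing h f = pairing h f'"
  by (simp add: pairing_def)

lemma pairing_reversed: "pairing (reversed h) f = pairing h (reversed f)"
  unfolding pairing_def reversed_def
  by (rule sum.reindex_bij_witness[of _ uminus uminus]) simp_all

lemma measurable_weight: "(\<lambda>\<xi>. ennreal (exp (- U \<xi>))) \<in> borel_measurable borel"
  using measurable_U by measurable

lemma state_function_drift: "state_function f \<Longrightarrow> state_function (drift t f)"
  using family_member[OF family_drift[OF family_const, of f "\<lambda>_. t" borel], of "0::real"] by simp

lemma state_function_jump: "state_function f \<Longrightarrow> state_function (jump f)"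
  using family_member[OF family_jump[OF family_const, of f borel], of "0::real"] by simp

text \<open>Lebesgue measure is invariant under the shift by \<open>t\<close> along
  \<open>\<theta>\<close>; the change of the weight \<open>exp (- U)\<close> is compensated by
  exchanging the forward survival factor for the one of the reversed motion.\<close>

lemma pairing_drift:
  assumes h: "state_function h" and f: "state_function f" and t: "0 \<le> t"
  shows "pairing h (drift t f) = pairing (reversed (drift t (reversed h))) f"
  unfolding pairing_def
proof (rule sum.cong[OF refl])
  fix \<theta> :: "real^'p" assume \<theta>: "\<theta> \<in> velocities"
  note [measurable] = state_functionD[OF h \<theta>] state_functionD[OF f \<theta>] measurable_U
  have [measurable]: "(\<lambda>\<xi>. survival t \<xi> (- \<theta>)) \<in> borel_measurable borel"
    using \<theta> by (intro measurable_survival) simp_all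
  have "(\<integral>\<^sup>+\<xi>. ennreal (exp (- U \<xi>)) * (h \<xi> \<theta> * drift t f \<xi> \<theta>) \<partial>lborel) =
      (\<integral>\<^sup>+\<xi>. (\<lambda>\<eta>. ennreal (exp (- U \<eta>)) * (survival t \<eta> (- \<theta>) * h (\<eta> - t *\<^sub>R \<theta>) \<theta> * f \<eta> \<theta>)) (\<xi> + t *\<^sub>R \<theta>) \<partial>lborel)"
  proof (rule nn_integral_cong)
    fix \<xi>
    \<comment> \<open>This is \<open>balance\<close> in exponential form.\<close>
    have "ennreal (exp (- U \<xi>)) * survival t \<xi> \<theta> = ennreal (exp (- U (\<xi> + t *\<^sub>R \<theta>))) * survival t (\<xi> + t *\<^sub>R \<theta>) (- \<theta>)"
      using balance[OF \<theta> t, of \<xi>] by (simp add: survival_def exp_add[symmetric] flip: ennreal_mult)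
    then show "ennreal (exp (- U \<xi>)) * (h \<xi> \<theta> * drift t f \<xi> \<theta>) =
        (\<lambda>\<eta>. ennreal (exp (- U \<eta>)) * (survival t \<eta> (- \<theta>) * h (\<eta> - t *\<^sub>R \<theta>) \<theta> * f \<eta> \<theta>)) (\<xi> + t *\<^sub>R \<theta>)"
      by (simp add: drift_def mult.assoc mult.left_commute[of _ "h \<xi> \<theta>"]) (simp flip: mult.assoc)
  qed
  also have "\<dots> = (\<integral>\<^sup>+\<eta>. ennreal (exp (- U \<eta>)) * (survival t \<eta> (- \<theta>) * h (\<eta> - t *\<^sub>R \<theta>) \<theta> * f \<eta> \<theta>) \<partial>lborel)"
  proof (rule nn_integral_translation)
    have "(\<lambda>\<eta>. h (\<eta> - t *\<^sub>R \<theta>) \<theta>) \<in> borel_measurable borel"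
      by (rule measurable_compose[OF _ state_functionD[OF h \<theta>]]) measurable
    then show "(\<lambda>\<eta>. ennreal (exp (- U \<eta>)) * (survival t \<eta> (- \<theta>) * h (\<eta> - t *\<^sub>R \<theta>) \<theta> * f \<eta> \<theta>)) \<in> borel_measurable borel"
      by measurable
  qed
  finally show "(\<integral>\<^sup>+\<xi>. ennreal (exp (- U \<xi>)) * (h \<xi> \<theta> * drift t f \<xi> \<theta>) \<partial>lborel) =
      (\<integral>\<^sup>+\<xi>. ennreal (exp (- U \<xi>)) * (reversed (drift t (reversed h)) \<xi> \<theta> * f \<xi> \<theta>) \<partial>lborel)"
    by (simp add: reversed_def drift_def)
qed

text \<open>A flip moves no position, so the sum over velocities is merely reindexed by the
  involution \<open>flip i\<close>; the rate keeps its value once the velocity is reversed.\<close>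

lemma pairing_jump:
  assumes h: "state_function h" and f: "state_function f"
  shows "pairing h (jump f) = pairing (reversed (jump (reversed h))) f"
proof -
  let ?w = "\<lambda>\<xi>. ennreal (exp (- U \<xi>))"
  have m: "(\<lambda>\<xi>. ?w \<xi> * (h \<xi> \<theta> * (ennreal (rate i \<xi> \<theta>') * f \<xi> \<theta>''))) \<in> borel_measurable lborel"
    if "\<theta> \<in> velocities" "\<theta>' \<in> velocities" "\<theta>'' \<in> velocities" for \<theta> \<theta>' \<theta>'' i
  proof -
    have "(\<lambda>\<xi>. ?w \<xi> * (h \<xi> \<theta> * (ennreal (rate i \<xi> \<theta>') * f \<xi> \<theta>''))) \<in> borel_measurable borel"
      by (intro borel_measurable_times_ennreal measurable_weight state_functionD h f that
          measurable_compose[OF measurable_rate measurable_ennreal])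
    then show ?thesis by simp
  qed
  have "pairing h (jump f) = (\<Sum>\<theta>\<in>velocities. \<Sum>i\<in>UNIV. \<integral>\<^sup>+\<xi>. ?w \<xi> * (h \<xi> \<theta> * (ennreal (rate i \<xi> \<theta>) * f \<xi> (flip i \<theta>))) \<partial>lborel)"
    unfolding pairing_def jump_def sum_distrib_left
    by (intro sum.cong refl nn_integral_sum m) simp_all
  also have "\<dots> = (\<Sum>i\<in>UNIV. \<Sum>\<theta>\<in>velocities. \<integral>\<^sup>+\<xi>. ?w \<xi> * (h \<xi> \<theta> * (ennreal (rate i \<xi> \<theta>) * f \<xi> (flip i \<theta>))) \<partial>lborel)"
    by (rule sum.swap)
  also have "\<dots> = (\<Sum>i\<in>UNIV. \<Sum>\<theta>\<in>velocities. \<integral>\<^sup>+\<xi>. ?w \<xi> * (h \<xi> (flip i \<theta>) * (ennreal (rate i \<xi> (- \<theta>)) * f \<xi> \<theta>)) \<partial>lborel)"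
  proof (rule sum.cong[OF refl])
    fix i
    \<comment> \<open>The velocities \<open>- flip i \<theta>\<close> and \<open>\<theta>\<close>
      agree in component \<open>i\<close>, the only one on which rate \<open>i\<close>
      depends.\<close>
    have "rate i \<xi> (- flip i \<theta>) = rate i \<xi> \<theta>" if "\<theta> \<in> velocities" for \<xi> \<theta>
      using that by (intro rate_local) (simp, simp, simp add: flip_def)
    then show "(\<Sum>\<theta>\<in>velocities. \<integral>\<^sup>+\<xi>. ?w \<xi> * (h \<xi> \<theta> * (ennreal (rate i \<xi> \<theta>) * f \<xi> (flip i \<theta>))) \<partial>lborel) =
        (\<Sum>\<theta>\<in>velocities. \<integral>\<^sup>+\<xi>. ?w \<xi> * (h \<xi> (flip i \<theta>) * (ennreal (rate i \<xi> (- \<theta>)) * f \<xi> \<theta>)) \<partial>lborel)"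
      by (intro sum.reindex_bij_witness[of _ "flip i" "flip i"]) simp_all
  qed
  also have "\<dots> = (\<Sum>\<theta>\<in>velocities. \<Sum>i\<in>UNIV. \<integral>\<^sup>+\<xi>. ?w \<xi> * (h \<xi> (flip i \<theta>) * (ennreal (rate i \<xi> (- \<theta>)) * f \<xi> \<theta>)) \<partial>lborel)"
    by (rule sum.swap)
  also have "\<dots> = (\<Sum>\<theta>\<in>velocities. \<integral>\<^sup>+\<xi>. (\<Sum>i\<in>UNIV. ?w \<xi> * (h \<xi> (flip i \<theta>) * (ennreal (rate i \<xi> (- \<theta>)) * f \<xi> \<theta>))) \<partial>lborel)"
    by (intro sum.cong refl nn_integral_sum[symmetric] m) simp_all
  also have "\<dots> = pairing (reversed (jump (reversed h))) f"
    unfolding pairing_def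
    by (intro sum.cong refl nn_integral_cong)
      (simp add: reversed_def jump_def flip_uminus sum_distrib_left sum_distrib_right ac_simps)
  finally show ?thesis .
qed

lemma pairing_integral:
  fixes f :: "real \<Rightarrow> real^'p \<Rightarrow> real^'p \<Rightarrow> ennreal"
  assumes h: "state_function h" and f: "family borel f"
  shows "pairing h (\<lambda>\<xi> \<theta>. \<integral>\<^sup>+s. f s \<xi> \<theta> * indicator {0..t} s \<partial>lborel) = (\<integral>\<^sup>+s. pairing h (f s) * indicator {0..t} s \<partial>lborel)"
proof -
  let ?w = "\<lambda>\<xi>. ennreal (exp (- U \<xi>))"
  let ?g = "\<lambda>\<theta> \<xi> s. ?w \<xi> * (h \<xi> \<theta> * f s \<xi> \<theta>) * indicator {0..t} s"
  have fm: "(\<lambda>s. f s \<xi> \<theta>) \<in> borel_measurable lborel" if "\<theta> \<in> velocities" for \<xi> \<theta>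
    using measurable_Pair1[OF familyD[OF f that], of \<xi>] by simp
  have g: "(\<lambda>(\<xi>, s). ?g \<theta> \<xi> s) \<in> borel_measurable (lborel \<Otimes>\<^sub>M lborel)" if \<theta>: "\<theta> \<in> velocities" for \<theta>
  proof -
    have "(\<lambda>p. (snd p, fst p)) \<in> measurable ((borel :: (real^'p) measure) \<Otimes>\<^sub>M (borel :: real measure)) (borel \<Otimes>\<^sub>M borel)" by measurable
    from measurable_compose[OF this familyD[OF f \<theta>]]
    have 1: "(\<lambda>p. f (snd p) (fst p) \<theta>) \<in> borel_measurable (borel \<Otimes>\<^sub>M borel)" by simp
    have 2: "(\<lambda>p. ?w (fst p)) \<in> borel_measurable ((borel :: (real^'p) measure) \<Otimes>\<^sub>M (borel :: real measure))"
      "(\<lambda>p. h (fst p) \<theta>) \<in> borel_measurable ((borel :: (real^'p) measure) \<Otimes>\<^sub>M (borel :: real measure))"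
      by (rule measurable_compose[OF measurable_fst measurable_weight], rule measurable_compose[OF measurable_fst state_functionD[OF h \<theta>]])
    have 3: "(\<lambda>p. indicator {0..t} (snd p) :: ennreal) \<in> borel_measurable ((borel :: (real^'p) measure) \<Otimes>\<^sub>M (borel :: real measure))"
      by measurable
    have "(\<lambda>p. ?g \<theta> (fst p) (snd p)) \<in> borel_measurable ((borel :: (real^'p) measure) \<Otimes>\<^sub>M (borel :: real measure))"
      by (intro borel_measurable_times_ennreal 1 2 3)
    then show ?thesis by (simp add: case_prod_unfold cong: measurable_cong_sets sets_pair_measure_cong)
  qed
  have "pairing h (\<lambda>\<xi> \<theta>. \<integral>\<^sup>+s. f s \<xi> \<theta> * indicator {0..t} s \<partial>lborel) = (\<Sum>\<theta>\<in>velocities. \<integral>\<^sup>+\<xi>. \<integral>\<^sup>+s. ?g \<theta> \<xi> s \<partial>lborel \<partial>lborel)"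
    unfolding pairing_def
  proof (intro sum.cong refl nn_integral_cong)
    fix \<theta> \<xi> :: "real^'p" assume \<theta>: "\<theta> \<in> velocities"
    have "(\<lambda>s. f s \<xi> \<theta> * indicator {0..t} s) \<in> borel_measurable lborel"
      by (intro borel_measurable_times_ennreal fm \<theta> borel_measurable_indicator) simp
    from nn_integral_cmult[OF this, of "?w \<xi> * h \<xi> \<theta>"]
    show "?w \<xi> * (h \<xi> \<theta> * (\<integral>\<^sup>+s. f s \<xi> \<theta> * indicator {0..t} s \<partial>lborel)) = (\<integral>\<^sup>+s. ?g \<theta> \<xi> s \<partial>lborel)"
      by (simp add: mult.assoc)
  qed
  also have "\<dots> = (\<Sum>\<theta>\<in>velocities. \<integral>\<^sup>+s. \<integral>\<^sup>+\<xi>. ?g \<theta> \<xi> s \<partial>lborel \<partial>lborel)"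
    by (intro sum.cong refl lborel_pair.Fubini'[symmetric] g)
  also have "\<dots> = (\<integral>\<^sup>+s. (\<Sum>\<theta>\<in>velocities. \<integral>\<^sup>+\<xi>. ?g \<theta> \<xi> s \<partial>lborel) \<partial>lborel)"
  proof (rule nn_integral_sum[symmetric])
    fix \<theta> :: "real^'p" assume \<theta>: "\<theta> \<in> velocities"
    have "(\<lambda>(s, \<xi>). ?g \<theta> \<xi> s) \<in> borel_measurable (lborel \<Otimes>\<^sub>M lborel)"
      using measurable_compose[OF measurable_pair_swap' g[OF \<theta>]] by (simp add: case_prod_unfold)
    from lborel.borel_measurable_nn_integral[OF this]
    show "(\<lambda>s. \<integral>\<^sup>+\<xi>. ?g \<theta> \<xi> s \<partial>lborel) \<in> borel_measurable lborel" .
  qed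
  also have "\<dots> = (\<integral>\<^sup>+s. pairing h (f s) * indicator {0..t} s \<partial>lborel)"
  proof (rule nn_integral_cong)
    fix s
    show "(\<Sum>\<theta>\<in>velocities. \<integral>\<^sup>+\<xi>. ?g \<theta> \<xi> s \<partial>lborel) = pairing h (f s) * indicator {0..t} s"
      by (cases "s \<in> {0..t}") (simp_all add: pairing_def)
  qed
  finally show ?thesis .
qed

text \<open>Skew reversibility: time reversal, combined with a change of sign of the velocity, is
  the adjoint with respect to \<open>exp (- U)\<close>.\<close>

lemma pairing_transition:
  assumes h: "state_function h" and f: "state_function f" and t: "0 \<le> t"
  shows "pairing h (transition n f t) = pairing (reversed (transition n (reversed h) t)) f"
  using h t
proof (induction n arbitrary: h t)
  case 0
  then show ?case using pairing_drift[OF _ f] by simp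
next
  case (Suc n)
  \<comment> \<open>The weight after the first drift and the first flip have been moved over to
    it.\<close>
  let ?h = "\<lambda>s. reversed (jump (drift s (reversed h)))"
  have fam: "family borel (\<lambda>s. drift s (jump (transition n f (t - s))))"
    by (intro family_drift family_jump family_transition family_const f) measurable
  have rh: "state_function (reversed h)" by (rule state_function_reversed[OF Suc.prems(1)])
  have sf: "state_function (?h s)" for s
    by (intro state_function_reversed state_function_jump state_function_drift rh)
  have fam': "family borel (\<lambda>s. transition n (jump (drift s (reversed h))) (t - s))"
    by (intro family_transition family_jump family_drift family_const rh) measurable
  have "pairing h (transition (Suc n) f t) = (\<integral>\<^sup>+s. pairing h (drift s (jump (transition n f (t - s)))) * indicator {0..t} s \<partial>lborel)"
    by (simp add: pairing_integral[OF Suc.prems(1) fam])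
  also have "\<dots> = (\<integral>\<^sup>+s. pairing (reversed f) (transition n (jump (drift s (reversed h))) (t - s)) * indicator {0..t} s \<partial>lborel)"
  proof (rule nn_integral_cong)
    fix s
    have "pairing h (drift s (jump (transition n f (t - s)))) =
        pairing (reversed f) (transition n (jump (drift s (reversed h))) (t - s))" if s: "0 \<le> s" "s \<le> t"
    proof -
      have "pairing h (drift s (jump (transition n f (t - s)))) =
          pairing (reversed (drift s (reversed h))) (jump (transition n f (t - s)))"
        by (intro pairing_drift Suc.prems state_function_jump state_function_transition f s)
      also have "\<dots> = pairing (?h s) (transition n f (t - s))"
        by (subst pairing_jump) (simp_all add: state_function_reversed state_function_drift state_function_transition rh f)
      also have "\<dots> = pairing (reversed (transition n (reversed (?h s)) (t - s))) f"
        by (rule Suc.IH[OF sf]) (use s in simp)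
      also have "\<dots> = pairing (reversed f) (transition n (jump (drift s (reversed h))) (t - s))"
        by (simp add: pairing_reversed pairing_commute)
      finally show ?thesis .
    qed
    then show "pairing h (drift s (jump (transition n f (t - s)))) * indicator {0..t} s =
        pairing (reversed f) (transition n (jump (drift s (reversed h))) (t - s)) * indicator {0..t} s"
      by (simp split: split_indicator)
  qed
  also have "\<dots> = pairing (reversed f) (\<lambda>\<xi> \<theta>. \<integral>\<^sup>+s. transition n (jump (drift s (reversed h))) (t - s) \<xi> \<theta> * indicator {0..t} s \<partial>lborel)"
    by (rule pairing_integral[OF state_function_reversed[OF f] fam', symmetric])
  \<comment> \<open>Taking adjoints reverses the order of the factors: unfolding at the first bounce
    has become unfolding at the last one, so \<open>transition_last\<close> closes the
    recursion.\<close>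
  also have "\<dots> = pairing (reversed f) (transition (Suc n) (reversed h) t)"
    by (intro pairing_cong transition_last[OF rh, symmetric])
  also have "\<dots> = pairing (reversed (transition (Suc n) (reversed h) t)) f"
    by (simp only: pairing_reversed pairing_commute)
  finally show ?case .
qed

end

section \<open>Expectations along the path as sums over the number of bounces\<close>

context thinned_chain
begin

lemma chain_step:
  assumes w: "w \<in> borel_measurable skeleton_space" and a: "a \<in> borel_measurable skeleton_space"
    and b: "b \<in> borel_measurable skeleton_space"
  shows "(\<integral>\<^sup>+\<omega>. w (Y 0 \<omega>) * a (Y n \<omega>) * b (Y (Suc n) \<omega>) \<partial>\<Omega>) =
    (\<integral>\<^sup>+\<omega>. w (Y 0 \<omega>) * a (Y n \<omega>) * (\<integral>\<^sup>+z. b z \<partial>K (Y n \<omega>)) \<partial>\<Omega>)"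
proof -
  let ?H = "PiM {..n} (\<lambda>_. skeleton_space :: 'p skeleton_point measure)"
  have x: "(\<lambda>p. fst p j) \<in> measurable (?H \<Otimes>\<^sub>M skeleton_space) skeleton_space" if "j \<le> n" for j
    by (intro measurable_compose[OF measurable_fst] measurable_component_singleton) (use that in simp)
  have F: "(\<lambda>p. w (fst p 0) * a (fst p n) * b (snd p)) \<in> borel_measurable (?H \<Otimes>\<^sub>M skeleton_space)"
    by (intro borel_measurable_times_ennreal measurable_compose[OF x w] measurable_compose[OF x a]
        measurable_compose[OF measurable_snd b]) simp_all
  have "(\<integral>\<^sup>+\<omega>. w (Y 0 \<omega>) * a (Y n \<omega>) * b (Y (Suc n) \<omega>) \<partial>\<Omega>) =
      (\<integral>\<^sup>+\<omega>. \<integral>\<^sup>+z. w (Y 0 \<omega>) * a (Y n \<omega>) * b z \<partial>K (Y n \<omega>) \<partial>\<Omega>)"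
    using markov_chain_nn_integral[OF chain measurable_kernel F] by simp
  also have "\<dots> = (\<integral>\<^sup>+\<omega>. w (Y 0 \<omega>) * a (Y n \<omega>) * (\<integral>\<^sup>+z. b z \<partial>K (Y n \<omega>)) \<partial>\<Omega>)"
    by (intro nn_integral_cong nn_integral_cmult)
      (use b in \<open>simp add: measurable_cong_sets[OF sets_kernel[OF Y_space] refl]\<close>)
  finally show ?thesis .
qed

end

context zigzag_rates
begin

lemma state_function_measurable:
  assumes "state_function f"
  shows "(\<lambda>x. f (fst x) (snd x)) \<in> borel_measurable state_space"
  unfolding state_space_def
proof (rule measurable_velocity_cases)
  fix \<theta> :: "real^'p" assume "\<theta> \<in> velocities"
  with assms show "(\<lambda>x. f (fst x) \<theta>) \<in> borel_measurable (borel \<Otimes>\<^sub>M count_space velocities)"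
    by (intro measurable_compose[OF measurable_fst]) (simp add: state_function_def)
qed simp

text \<open>The contribution to the expectation at time \<open>t\<close> of the paths with exactly
  \<open>n\<close> bounces between the skeleton point and \<open>t\<close>.\<close>

definition visit :: "nat \<Rightarrow> real \<Rightarrow> (real^'p \<Rightarrow> real^'p \<Rightarrow> ennreal) \<Rightarrow> 'p skeleton_point \<Rightarrow> ennreal" where
  "visit n t f z = (if fst z \<le> ennreal t
    then transition n f (t - enn2real (fst z)) (fst (snd z)) (snd (snd z)) else 0)"

definition extrapolation :: "real \<Rightarrow> (real^'p \<Rightarrow> real^'p \<Rightarrow> ennreal) \<Rightarrow> 'p skeleton_point \<Rightarrow> ennreal" where
  "extrapolation t f z = (if fst z \<le> ennreal t
    then f (fst (snd z) + (t - enn2real (fst z)) *\<^sub>R snd (snd z)) (snd (snd z)) else 0)"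

lemma sets_skeleton_time_le:
  "{z \<in> space skeleton_space. fst z \<le> c} \<in> sets skeleton_space"
  using measurable_sets[OF measurable_skeleton_time, of "{..c}"] by (simp add: vimage_def Int_def conj_commute)

lemma sets_skeleton_time_gt:
  "{z \<in> space skeleton_space. c < fst z} \<in> sets skeleton_space"
  using measurable_sets[OF measurable_skeleton_time, of "{c<..}"] by (simp add: vimage_def Int_def conj_commute)

lemma measurable_visit:
  assumes f: "state_function f"
  shows "visit n t f \<in> borel_measurable skeleton_space"
proof -
  have "(\<lambda>z. transition n f (t - enn2real (fst z)) (fst (snd z)) (snd (snd z))) \<in> borel_measurable skeleton_space"
  proof (rule measurable_velocity_cases[OF _ measurable_skeleton_velocity])
    fix \<theta> :: "real^'p" assume \<theta>: "\<theta> \<in> velocities"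
    have "family borel (\<lambda>s. transition n f (t - s))"
      by (intro family_transition family_const f) measurable
    note fam = familyD[OF this \<theta>]
    have "(\<lambda>z::'p skeleton_point. enn2real (fst z)) \<in> borel_measurable skeleton_space"
      by (rule measurable_compose[OF measurable_skeleton_time]) simp
    then have "(\<lambda>z::'p skeleton_point. (enn2real (fst z), fst (snd z))) \<in> measurable skeleton_space (borel \<Otimes>\<^sub>M borel)"
      by (intro measurable_Pair measurable_skeleton_position)
    from measurable_compose[OF this fam]
    show "(\<lambda>z. transition n f (t - enn2real (fst z)) (fst (snd z)) \<theta>) \<in> borel_measurable skeleton_space" by simp
  qed
  then show ?thesis
    unfolding visit_def[abs_def] by (intro measurable_If measurable_const sets_skeleton_time_le) simp_all
qed

lemma measurable_extrapolation:
  assumes f: "state_function f"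
  shows "extrapolation t f \<in> borel_measurable skeleton_space"
proof -
  have "(\<lambda>z. f (fst (snd z) + (t - enn2real (fst z)) *\<^sub>R snd (snd z)) (snd (snd z))) \<in> borel_measurable skeleton_space"
  proof (rule measurable_velocity_cases[OF _ measurable_skeleton_velocity])
    fix \<theta> :: "real^'p" assume \<theta>: "\<theta> \<in> velocities"
    have e: "(\<lambda>z::'p skeleton_point. enn2real (fst z)) \<in> borel_measurable skeleton_space"
      by (rule measurable_compose[OF measurable_skeleton_time]) simp
    have pos: "(\<lambda>z::'p skeleton_point. fst (snd z) + (t - enn2real (fst z)) *\<^sub>R \<theta>) \<in> borel_measurable skeleton_space"
      by (intro borel_measurable_add borel_measurable_scaleR borel_measurable_diff borel_measurable_const e
          measurable_skeleton_position)
    have "(\<lambda>\<xi>. f \<xi> \<theta>) \<in> borel_measurable borel" using f \<theta> by (simp add: state_function_def)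
    from measurable_compose[OF pos this]
    show "(\<lambda>z. f (fst (snd z) + (t - enn2real (fst z)) *\<^sub>R \<theta>) \<theta>) \<in> borel_measurable skeleton_space" .
  qed
  then show ?thesis
    unfolding extrapolation_def[abs_def] by (intro measurable_If measurable_const sets_skeleton_time_le) simp_all
qed

interpretation ZK: thinned_kernel rate "\<lambda>\<xi> \<theta> s. bounce_rate (\<xi> + s *\<^sub>R \<theta>) \<theta>" "zigzag_step rate"
  by (rule thinned_kernel_zigzag_step)

text \<open>The backward equation: one step of the kernel accounts for the first of
  \<open>Suc n\<close> bounces. A bounce after \<open>t\<close> contributes 0 on both sides.\<close>

lemma nn_integral_visit:
  assumes z: "z \<in> space skeleton_space" and f: "state_function f" and t: "0 \<le> t"
  shows "(\<integral>\<^sup>+z'. visit n t f z' \<partial>zigzag_step rate z) = visit (Suc n) t f z"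
proof -
  obtain a \<xi> \<theta> where z_eq: "z = (a, \<xi>, \<theta>)" by (cases z)
  with z have \<theta>: "\<theta> \<in> velocities" by (simp add: space_skeleton_space)
  show ?thesis
  proof (cases a)
    case top
    then show ?thesis
      using z measurable_visit[OF f]
      by (simp add: ZK.kernel_infinite' z_eq nn_integral_return) (simp add: visit_def top_unique)
  next
    case (real r)
    have "(\<integral>\<^sup>+z'. visit n t f z' \<partial>zigzag_step rate z) =
      (\<integral>\<^sup>+s. (\<Sum>i\<in>UNIV. ennreal (rate i (\<xi> + s *\<^sub>R \<theta>) \<theta>) * visit n t f (a + ennreal s, \<xi> + s *\<^sub>R \<theta>, flip i \<theta>)) *
        survival s \<xi> \<theta> * indicator {0..} s \<partial>lborel)"
      unfolding z_eq survival_def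
      by (rule nn_integral_zigzag_step)
        (use real \<theta> measurable_visit[OF f] in simp_all, simp add: visit_def top_unique)
    also have "\<dots> = visit (Suc n) t f z"
    proof (cases "r \<le> t")
      case True
      have "visit (Suc n) t f z = (\<integral>\<^sup>+s. drift s (jump (transition n f (t - r - s))) \<xi> \<theta> * indicator {0..t - r} s \<partial>lborel)"
        using True real t by (simp add: visit_def z_eq)
      also have "\<dots> = (\<integral>\<^sup>+s. (\<Sum>i\<in>UNIV. ennreal (rate i (\<xi> + s *\<^sub>R \<theta>) \<theta>) * visit n t f (a + ennreal s, \<xi> + s *\<^sub>R \<theta>, flip i \<theta>)) *
        survival s \<xi> \<theta> * indicator {0..} s \<partial>lborel)"
      proof (rule nn_integral_cong)
        fix s
        have v: "visit n t f (a + ennreal s, \<eta>) = (if s \<le> t - r then transition n f (t - r - s) (fst \<eta>) (snd \<eta>) else 0)"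
          if "0 \<le> s" for \<eta>
        proof -
          have e: "a + ennreal s = ennreal (r + s)" using real that by simp
          show ?thesis using real(1) that t by (auto simp: visit_def e algebra_simps simp del: ennreal_plus)
        qed
        show "drift s (jump (transition n f (t - r - s))) \<xi> \<theta> * indicator {0..t - r} s =
          (\<Sum>i\<in>UNIV. ennreal (rate i (\<xi> + s *\<^sub>R \<theta>) \<theta>) * visit n t f (a + ennreal s, \<xi> + s *\<^sub>R \<theta>, flip i \<theta>)) *
          survival s \<xi> \<theta> * indicator {0..} s"
          by (cases "0 \<le> s"; cases "s \<le> t - r") (simp_all add: v drift_def jump_def mult.commute)
      qed
      finally show ?thesis by simp
    next
      case False
      have "visit n t f (a + ennreal s, \<eta>) = 0" if "0 \<le> s" for s \<eta>
      proof -
        have e: "a + ennreal s = ennreal (r + s)" using real that by simp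
        show ?thesis using real(1) that t False by (simp add: visit_def e del: ennreal_plus)
      qed
      then have "(\<integral>\<^sup>+s. (\<Sum>i\<in>UNIV. ennreal (rate i (\<xi> + s *\<^sub>R \<theta>) \<theta>) * visit n t f (a + ennreal s, \<xi> + s *\<^sub>R \<theta>, flip i \<theta>)) *
        survival s \<xi> \<theta> * indicator {0..} s \<partial>lborel) = (\<integral>\<^sup>+s. 0 \<partial>(lborel :: real measure))"
        by (intro nn_integral_cong) (simp split: split_indicator)
      then show ?thesis using False real t by (simp add: visit_def z_eq)
    qed
    finally show ?thesis .
  qed
qed

text \<open>If the next bounce comes after \<open>t\<close>, the state at \<open>t\<close> lies on
  the line through the present point; the probability of this event is the survival factor of
  \<open>drift\<close>.\<close>

lemma extrapolation_survival:
  assumes z: "z \<in> space skeleton_space" and t: "0 \<le> t"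
  shows "extrapolation t f z * emeasure (zigzag_step rate z) {z' \<in> space skeleton_space. ennreal t < fst z'} = visit 0 t f z"
proof (cases "fst z \<le> ennreal t")
  case False
  then show ?thesis by (simp add: extrapolation_def visit_def)
next
  case True
  obtain a \<xi> \<theta> where z_eq: "z = (a, \<xi>, \<theta>)" by (cases z)
  with z have \<theta>: "\<theta> \<in> velocities" by (simp add: space_skeleton_space)
  from True obtain r where r: "a = ennreal r" "0 \<le> r" "r \<le> t"
    using t by (cases a) (auto simp: z_eq top_unique)
  interpret r: hazard "\<lambda>s. bounce_rate (\<xi> + s *\<^sub>R \<theta>) \<theta>" by (rule hazard_bounce_rate[OF \<theta>])
  interpret prob_space "zigzag_step rate z" by (rule ZK.prob_space_kernel[OF z])
  have sp: "space (zigzag_step rate z) = space skeleton_space" by (rule sets_eq_imp_space_eq[OF ZK.sets_kernel[OF z]])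
  let ?L = "{z' \<in> space skeleton_space. fst z' \<le> ennreal t} :: 'p skeleton_point set"
  \<comment> \<open>The event of a late bounce contains the infinite times, which the event formula
    does not see; hence its complement is computed.\<close>
  have "emeasure (zigzag_step rate z) ?L = (\<integral>\<^sup>+z'. indicator ?L z' \<partial>zigzag_step rate z)"
    using sets_skeleton_time_le ZK.sets_kernel[OF z] by simp
  also have "\<dots> = (\<integral>\<^sup>+s. (\<Sum>i\<in>UNIV. ennreal (rate i (\<xi> + s *\<^sub>R \<theta>) \<theta>) * indicator ?L (a + ennreal s, \<xi> + s *\<^sub>R \<theta>, flip i \<theta>)) *
      ennreal (exp (- cumulative (\<lambda>s. bounce_rate (\<xi> + s *\<^sub>R \<theta>) \<theta>) s)) * indicator {0..} s \<partial>lborel)"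
    unfolding z_eq
    by (rule nn_integral_zigzag_step)
      (use r \<theta> in \<open>auto intro!: borel_measurable_indicator sets_skeleton_time_le simp: indicator_def top_unique\<close>)
  also have "\<dots> = (\<integral>\<^sup>+s. ennreal (bounce_rate (\<xi> + s *\<^sub>R \<theta>) \<theta> * exp (- cumulative (\<lambda>s. bounce_rate (\<xi> + s *\<^sub>R \<theta>) \<theta>) s)) *
      indicator {0..t - r} s \<partial>lborel)"
  proof (rule nn_integral_cong)
    fix s
    have L: "indicator ?L (a + ennreal s, \<xi> + s *\<^sub>R \<theta>, flip i \<theta>) = (if s \<le> t - r then 1 else 0 :: ennreal)" if "0 \<le> s" for i
    proof -
      have "a + ennreal s = ennreal (r + s)" using r that by simp
      then show ?thesis using r that t \<theta> by (simp add: indicator_def space_skeleton_space algebra_simps flip: ennreal_plus)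
    qed
    have "(\<Sum>i\<in>UNIV. ennreal (rate i (\<xi> + s *\<^sub>R \<theta>) \<theta>)) = ennreal (bounce_rate (\<xi> + s *\<^sub>R \<theta>) \<theta>)"
      unfolding bounce_rate_def using rate_nonneg[OF \<theta>] by (intro sum_ennreal) auto
    then show "(\<Sum>i\<in>UNIV. ennreal (rate i (\<xi> + s *\<^sub>R \<theta>) \<theta>) * indicator ?L (a + ennreal s, \<xi> + s *\<^sub>R \<theta>, flip i \<theta>)) *
      ennreal (exp (- cumulative (\<lambda>s. bounce_rate (\<xi> + s *\<^sub>R \<theta>) \<theta>) s)) * indicator {0..} s =
      ennreal (bounce_rate (\<xi> + s *\<^sub>R \<theta>) \<theta> * exp (- cumulative (\<lambda>s. bounce_rate (\<xi> + s *\<^sub>R \<theta>) \<theta>) s)) * indicator {0..t - r} s"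
      using bounce_rate_nonneg[OF \<theta>]
      by (cases "0 \<le> s"; cases "s \<le> t - r") (simp_all add: L ennreal_mult)
  qed
  also have "\<dots> = ennreal (1 - exp (- cumulative (\<lambda>s. bounce_rate (\<xi> + s *\<^sub>R \<theta>) \<theta>) (t - r)))"
    using r by (intro r.nn_integral_rate_exp) simp
  finally have L: "emeasure (zigzag_step rate z) ?L = \<dots>" .
  have "{z' \<in> space skeleton_space. ennreal t < fst z'} = space (zigzag_step rate z) - ?L" by (auto simp: sp)
  then have "emeasure (zigzag_step rate z) {z' \<in> space skeleton_space. ennreal t < fst z'} = 1 - emeasure (zigzag_step rate z) ?L"
    using emeasure_compl[of ?L "zigzag_step rate z"] sets_skeleton_time_le ZK.sets_kernel[OF z] emeasure_space_1 by simp
  also have "\<dots> = survival (t - r) \<xi> \<theta>"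
    unfolding L survival_def using r.cumulative_nonneg[of "t - r"] r
    by (simp add: ennreal_minus flip: ennreal_1)
  finally show ?thesis
    using r t by (simp add: extrapolation_def visit_def z_eq drift_def mult.commute)
qed

end

lemma measurable_skeleton_path:
  assumes X: "\<And>k. X k \<in> measurable M skeleton_space"
  shows "(\<lambda>\<omega>. skeleton_path (\<lambda>k. X k \<omega>) t) \<in> measurable M state_space"
proof -
  have "{\<omega> \<in> space M. ennreal t < fst (X (Suc k) \<omega>)} \<in> sets M" for k
    by (intro borel_measurable_less borel_measurable_const measurable_compose[OF X measurable_skeleton_time])
  then have least: "(\<lambda>\<omega>. LEAST k. ennreal t < fst (X (Suc k) \<omega>)) \<in> measurable M (count_space UNIV)"
    by (intro measurable_Least) (simp add: pred_def)
  have state_at: "(\<lambda>\<omega>. (fst (snd (X k \<omega>)) + (t - enn2real (fst (X k \<omega>))) *\<^sub>R snd (snd (X k \<omega>)), snd (snd (X k \<omega>)))) \<in> measurable M state_space" for k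
  proof -
    have time: "(\<lambda>\<omega>. enn2real (fst (X k \<omega>))) \<in> borel_measurable M"
      by (rule measurable_compose[OF measurable_compose[OF X measurable_skeleton_time]]) simp
    note state = measurable_compose[OF X measurable_skeleton_position] measurable_compose[OF X measurable_skeleton_velocity_borel]
      measurable_compose[OF X measurable_skeleton_velocity]
    have "(\<lambda>\<omega>. fst (snd (X k \<omega>)) + (t - enn2real (fst (X k \<omega>))) *\<^sub>R snd (snd (X k \<omega>))) \<in> borel_measurable M"
      by (rule borel_measurable_add[OF state(1) borel_measurable_scaleR[OF borel_measurable_diff[OF borel_measurable_const time] state(2)]])
    from measurable_Pair[OF this state(3)] show ?thesis unfolding state_space_def .
  qed
  from measurable_compose_countable[OF state_at least]
  show ?thesis by (simp add: skeleton_path_def Let_def case_prod_beta)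
qed

context regular_skeleton
begin

text \<open>Exactly one index has its point at or before \<open>t\<close> and the next point after
  \<open>t\<close>; earlier terms vanish through the indicator and later ones through
  \<open>F\<close>.\<close>

lemma suminf_at_time:
  fixes F :: "'p skeleton_point \<Rightarrow> ennreal"
  assumes start: "fst (y 0) = 0" and total: "(SUP k. fst (y k)) = \<infinity>" and t: "0 \<le> t"
    and F: "\<And>z. ennreal t < fst z \<Longrightarrow> F z = 0"
  shows "(\<Sum>n. F (y n) * indicator {z. ennreal t < fst z} (y (Suc n))) = F (y (LEAST k. ennreal t < fst (y (Suc k))))"
    and "fst (y (LEAST k. ennreal t < fst (y (Suc k)))) \<le> ennreal t"
proof -
  define k where "k = (LEAST k. ennreal t < fst (y (Suc k)))"
  have "ennreal t < (SUP k. fst (y k))" unfolding total by simp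
  then obtain j where "ennreal t < fst (y j)" by (auto simp: less_SUP_iff)
  then have "ennreal t < fst (y (Suc j))" using time_mono[of j "Suc j"] by (simp add: less_le_trans)
  then have k: "ennreal t < fst (y (Suc k))" unfolding k_def by (rule LeastI)
  have before: "\<not> ennreal t < fst (y (Suc n))" if "n < k" for n
    using not_less_Least[OF that[unfolded k_def]] .
  show le: "fst (y (LEAST k. ennreal t < fst (y (Suc k)))) \<le> ennreal t"
    unfolding k_def[symmetric] using before[of "k - 1"] start by (cases k) (auto simp: not_less)
  have "(\<Sum>n. F (y n) * indicator {z. ennreal t < fst z} (y (Suc n))) =
      (\<Sum>n\<in>{k}. F (y n) * indicator {z. ennreal t < fst z} (y (Suc n)))"
  proof (rule suminf_finite)
    fix n assume "n \<notin> {k}"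
    then consider "n < k" | "Suc k \<le> n" by force
    then show "F (y n) * indicator {z. ennreal t < fst z} (y (Suc n)) = 0"
    proof cases
      case 1 then show ?thesis using before by simp
    next
      case 2
      have "ennreal t < fst (y n)" by (rule less_le_trans[OF k time_mono[OF 2]])
      then show ?thesis using F by simp
    qed
  qed simp
  with k show "(\<Sum>n. F (y n) * indicator {z. ennreal t < fst z} (y (Suc n))) = F (y (LEAST k. ennreal t < fst (y (Suc k))))"
    by (simp add: k_def[symmetric])
qed

end

context balanced_zigzag_rates
begin

context
  fixes \<Omega> :: "'w measure" and X :: "nat \<Rightarrow> 'w \<Rightarrow> 'p skeleton_point" and c :: ennreal
  assumes tc: "thinned_chain rate (\<lambda>\<xi> \<theta> s. bounce_rate (\<xi> + s *\<^sub>R \<theta>) \<theta>) (zigzag_step rate) \<Omega> X"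
    and init: "\<And>f. state_function f \<Longrightarrow> (\<integral>\<^sup>+\<omega>. f (fst (snd (X 0 \<omega>))) (snd (snd (X 0 \<omega>))) \<partial>\<Omega>) = c * pairing (\<lambda>_ _. 1) f"
begin

interpretation T: thinned_chain rate "\<lambda>\<xi> \<theta> s. bounce_rate (\<xi> + s *\<^sub>R \<theta>) \<theta>" "zigzag_step rate" \<Omega> X
  by (rule tc)

text \<open>Each use of the Markov property trades one step of the chain for one more bounce in the
  operator, until only the initial point is left.\<close>

lemma nn_integral_visit_chain:
  assumes W: "W \<in> borel_measurable skeleton_space" and f: "state_function f" and t: "0 \<le> t"
  shows "(\<integral>\<^sup>+\<omega>. W (X 0 \<omega>) * visit n t f (X m \<omega>) \<partial>\<Omega>) = (\<integral>\<^sup>+\<omega>. W (X 0 \<omega>) * visit (n + m) t f (X 0 \<omega>) \<partial>\<Omega>)"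
proof (induction m arbitrary: n)
  case (Suc m)
  have "(\<integral>\<^sup>+\<omega>. W (X 0 \<omega>) * visit n t f (X (Suc m) \<omega>) \<partial>\<Omega>) =
      (\<integral>\<^sup>+\<omega>. W (X 0 \<omega>) * (\<integral>\<^sup>+z. visit n t f z \<partial>zigzag_step rate (X m \<omega>)) \<partial>\<Omega>)"
    using T.chain_step[OF W _ measurable_visit[OF f], of "\<lambda>_. 1" m n t] by simp
  also have "\<dots> = (\<integral>\<^sup>+\<omega>. W (X 0 \<omega>) * visit (Suc n) t f (X m \<omega>) \<partial>\<Omega>)"
    by (intro nn_integral_cong) (simp add: nn_integral_visit[OF T.Y_space f t])
  finally show ?case using Suc.IH[of "Suc n"] by simp
qed simp

text \<open>The path at time \<open>t\<close> is split according to the segment containing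
  \<open>t\<close>. The weight \<open>w\<close> of the initial state is kept general because the
  formula is needed for \<open>w = 1\<close> and again, with the roles exchanged, for
  \<open>f = 1\<close>.\<close>

lemma nn_integral_path:
  assumes w: "state_function w" and f: "state_function f" and t: "0 \<le> t"
  shows "(\<integral>\<^sup>+\<omega>. w (fst (snd (X 0 \<omega>))) (snd (snd (X 0 \<omega>))) *
      (\<lambda>x. f (fst x) (snd x)) (skeleton_path (\<lambda>k. X k \<omega>) t) \<partial>\<Omega>) =
    (\<Sum>n. c * pairing w (transition n f t))"
proof -
  define W where "W z = w (fst (snd z)) (snd (snd z))" for z :: "'p skeleton_point"
  let ?G = "{z \<in> space skeleton_space. ennreal t < fst z} :: 'p skeleton_point set"
  have W: "W \<in> borel_measurable skeleton_space"
    unfolding W_def by (rule measurable_compose[OF measurable_skeleton_state state_function_measurable[OF w]])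
  have m: "(\<lambda>\<omega>. W (X 0 \<omega>) * extrapolation t f (X n \<omega>) * indicator ?G (X (Suc n) \<omega>)) \<in> borel_measurable \<Omega>" for n
    by (intro borel_measurable_times_ennreal measurable_compose[OF T.measurable_Y W]
        measurable_compose[OF T.measurable_Y measurable_extrapolation[OF f]]
        measurable_compose[OF T.measurable_Y borel_measurable_indicator[OF sets_skeleton_time_gt]])
  have "(\<integral>\<^sup>+\<omega>. w (fst (snd (X 0 \<omega>))) (snd (snd (X 0 \<omega>))) *
      (\<lambda>x. f (fst x) (snd x)) (skeleton_path (\<lambda>k. X k \<omega>) t) \<partial>\<Omega>) =
    (\<integral>\<^sup>+\<omega>. (\<Sum>n. W (X 0 \<omega>) * extrapolation t f (X n \<omega>) * indicator ?G (X (Suc n) \<omega>)) \<partial>\<Omega>)"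
  proof (rule nn_integral_cong_AE)
    show "AE \<omega> in \<Omega>. w (fst (snd (X 0 \<omega>))) (snd (snd (X 0 \<omega>))) *
        (\<lambda>x. f (fst x) (snd x)) (skeleton_path (\<lambda>k. X k \<omega>) t) =
      (\<Sum>n. W (X 0 \<omega>) * extrapolation t f (X n \<omega>) * indicator ?G (X (Suc n) \<omega>))"
      using T.AE_regular T.start T.total AE_space
    proof eventually_elim
      case (elim \<omega>)
      interpret regular_skeleton "\<lambda>k. X k \<omega>" by (rule elim(1))
      let ?k = "LEAST k. ennreal t < fst (X (Suc k) \<omega>)"
      have late: "W (X 0 \<omega>) * extrapolation t f z = 0" if "ennreal t < fst z" for z
        using that by (simp add: extrapolation_def)
      have "(\<Sum>n. W (X 0 \<omega>) * extrapolation t f (X n \<omega>) * indicator ?G (X (Suc n) \<omega>)) =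
          (\<Sum>n. W (X 0 \<omega>) * extrapolation t f (X n \<omega>) * indicator {z. ennreal t < fst z} (X (Suc n) \<omega>))"
        using T.Y_space[OF elim(4)] by (simp add: indicator_def)
      also have "\<dots> = W (X 0 \<omega>) * extrapolation t f (X ?k \<omega>)"
        by (rule suminf_at_time(1)[OF elim(2,3) t late])
      also have "\<dots> = w (fst (snd (X 0 \<omega>))) (snd (snd (X 0 \<omega>))) * (\<lambda>x. f (fst x) (snd x)) (skeleton_path (\<lambda>k. X k \<omega>) t)"
        using suminf_at_time(2)[OF elim(2,3) t late]
        by (simp add: W_def extrapolation_def skeleton_path_def Let_def case_prod_beta)
      finally show ?case by simp
    qed
  qed
  also have "\<dots> = (\<Sum>n. \<integral>\<^sup>+\<omega>. W (X 0 \<omega>) * extrapolation t f (X n \<omega>) * indicator ?G (X (Suc n) \<omega>) \<partial>\<Omega>)"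
    by (rule nn_integral_suminf[OF m])
  also have "\<dots> = (\<Sum>n. c * pairing w (transition n f t))"
  proof (rule suminf_cong)
    fix n
    have "(\<integral>\<^sup>+\<omega>. W (X 0 \<omega>) * extrapolation t f (X n \<omega>) * indicator ?G (X (Suc n) \<omega>) \<partial>\<Omega>) =
        (\<integral>\<^sup>+\<omega>. W (X 0 \<omega>) * extrapolation t f (X n \<omega>) * (\<integral>\<^sup>+z. indicator ?G z \<partial>zigzag_step rate (X n \<omega>)) \<partial>\<Omega>)"
      by (rule T.chain_step[OF W measurable_extrapolation[OF f] borel_measurable_indicator[OF sets_skeleton_time_gt]])
    also have "\<dots> = (\<integral>\<^sup>+\<omega>. W (X 0 \<omega>) * visit 0 t f (X n \<omega>) \<partial>\<Omega>)"
    proof (rule nn_integral_cong)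
      fix \<omega> assume "\<omega> \<in> space \<Omega>"
      note sp = T.Y_space[OF this, of n]
      have "(\<integral>\<^sup>+z. indicator ?G z \<partial>zigzag_step rate (X n \<omega>)) = emeasure (zigzag_step rate (X n \<omega>)) ?G"
        using sets_skeleton_time_gt T.sets_kernel[OF sp] by simp
      then show "W (X 0 \<omega>) * extrapolation t f (X n \<omega>) * (\<integral>\<^sup>+z. indicator ?G z \<partial>zigzag_step rate (X n \<omega>)) =
          W (X 0 \<omega>) * visit 0 t f (X n \<omega>)"
        using extrapolation_survival[OF sp t, of f] by (simp add: mult.assoc)
    qed
    also have "\<dots> = (\<integral>\<^sup>+\<omega>. W (X 0 \<omega>) * visit n t f (X 0 \<omega>) \<partial>\<Omega>)"
      using nn_integral_visit_chain[OF W f t, of 0 n] by simp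
    \<comment> \<open>The chain starts at time 0 almost surely, so \<open>visit\<close> becomes the
      transition over the full duration \<open>t\<close>.\<close>
    also have "\<dots> = (\<integral>\<^sup>+\<omega>. (\<lambda>\<xi> \<theta>. w \<xi> \<theta> * transition n f t \<xi> \<theta>) (fst (snd (X 0 \<omega>))) (snd (snd (X 0 \<omega>))) \<partial>\<Omega>)"
      using T.start by (intro nn_integral_cong_AE) (auto elim!: eventually_mono simp: visit_def W_def)
    also have "\<dots> = c * pairing (\<lambda>_ _. 1) (\<lambda>\<xi> \<theta>. w \<xi> \<theta> * transition n f t \<xi> \<theta>)"
      using w state_function_transition[OF f, of n t]
      by (intro init) (auto simp: state_function_def intro!: borel_measurable_times_ennreal)
    also have "pairing (\<lambda>_ _. 1) (\<lambda>\<xi> \<theta>. w \<xi> \<theta> * transition n f t \<xi> \<theta>) = pairing w (transition n f t)"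
      by (simp add: pairing_def)
    finally show "(\<integral>\<^sup>+\<omega>. W (X 0 \<omega>) * extrapolation t f (X n \<omega>) * indicator ?G (X (Suc n) \<omega>) \<partial>\<Omega>) =
        c * pairing w (transition n f t)" .
  qed
  finally show ?thesis .
qed

text \<open>After passing to adjoints, the series is the path formula for the constant function 1
  with the initial weight \<open>reversed f\<close>. A constant does not notice where the path is,
  so the value is that at time 0; the reversal then drops out because the target is symmetric under
  \<open>\<theta> \<mapsto> - \<theta>\<close>.\<close>

lemma nn_integral_path_invariant:
  assumes f: "state_function f" and t: "0 \<le> t"
  shows "(\<integral>\<^sup>+\<omega>. (\<lambda>x. f (fst x) (snd x)) (skeleton_path (\<lambda>k. X k \<omega>) t) \<partial>\<Omega>) = c * pairing (\<lambda>_ _. 1) f"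
proof -
  have one: "state_function (\<lambda>_ _. 1)" by (simp add: state_function_def)
  have adj: "pairing (\<lambda>_ _. 1) (transition n f t) = pairing (reversed f) (transition n (\<lambda>_ _. 1) t)" for n
  proof -
    have "pairing (\<lambda>_ _. 1) (transition n f t) = pairing (reversed (transition n (reversed (\<lambda>_ _. 1)) t)) f"
      by (rule pairing_transition[OF one f t])
    also have "reversed (\<lambda>_ _. 1) = (\<lambda>_ _. 1)" by (simp add: reversed_def)
    also have "pairing (reversed (transition n (\<lambda>_ _. 1) t)) f = pairing (transition n (\<lambda>_ _. 1) t) (reversed f)"
      by (rule pairing_reversed)
    finally show ?thesis by (simp only: pairing_commute)
  qed
  have "(\<integral>\<^sup>+\<omega>. (\<lambda>x. f (fst x) (snd x)) (skeleton_path (\<lambda>k. X k \<omega>) t) \<partial>\<Omega>) = (\<Sum>n. c * pairing (\<lambda>_ _. 1) (transition n f t))"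
    using nn_integral_path[OF one f t] by simp
  also have "\<dots> = (\<Sum>n. c * pairing (reversed f) (transition n (\<lambda>_ _. 1) t))" by (simp only: adj)
  also have "\<dots> = (\<integral>\<^sup>+\<omega>. reversed f (fst (snd (X 0 \<omega>))) (snd (snd (X 0 \<omega>))) \<partial>\<Omega>)"
    using nn_integral_path[OF state_function_reversed[OF f] one t] by simp
  also have "\<dots> = c * pairing (\<lambda>_ _. 1) (reversed f)"
    by (rule init[OF state_function_reversed[OF f]])
  also have "pairing (\<lambda>_ _. 1) (reversed f) = pairing (reversed (\<lambda>_ _. 1)) f" by (simp only: pairing_reversed)
  also have "reversed (\<lambda>_ _. 1) = (\<lambda>_ _. 1)" by (simp add: reversed_def)
  finally show ?thesis .
qed

end

end

section \<open>The balance of the effective rates\<close>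

lemma continuously_differentiable_ray:
  fixes f :: "real^'p::finite \<Rightarrow> real"
  assumes "continuously_differentiable f"
  shows "((\<lambda>s. f (\<xi> + s *\<^sub>R \<theta>)) has_vector_derivative (\<Sum>i\<in>UNIV. \<theta> $ i * partial i f (\<xi> + t *\<^sub>R \<theta>))) (at t within S)"
proof -
  let ?x = "\<xi> + t *\<^sub>R \<theta>"
  from assms have "f differentiable (at ?x)" by (simp add: continuously_differentiable_def)
  then obtain D where D: "(f has_derivative D) (at ?x)" by (auto simp: differentiable_def)
  interpret D: bounded_linear D using D by (rule has_derivative_bounded_linear)
  have ray: "((\<lambda>s. f (\<eta> + s *\<^sub>R v)) has_vector_derivative D v) (at u within T)"
    if "\<eta> + u *\<^sub>R v = ?x" for \<eta> v u T
  proof -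
    have 1: "((\<lambda>s. \<eta> + s *\<^sub>R v) has_derivative (\<lambda>h. h *\<^sub>R v)) (at u within T)"
      by (auto intro!: derivative_eq_intros)
    have "(f has_derivative D) (at (\<eta> + u *\<^sub>R v))" using D that by simp
    from has_derivative_compose[OF 1 this]
    show ?thesis unfolding has_vector_derivative_def by (simp add: D.scaleR)
  qed
  have "partial i f ?x = D (axis i 1)" for i
    unfolding partial_def using ray[of ?x 0 "axis i 1" UNIV]
    by (intro DERIV_imp_deriv) (simp add: has_real_derivative_iff_has_vector_derivative)
  moreover have "D \<theta> = (\<Sum>i\<in>UNIV. \<theta> $ i * D (axis i 1))"
  proof -
    have "D \<theta> = D (\<Sum>i\<in>UNIV. \<theta> $ i *\<^sub>R axis i 1)"
      using basis_expansion[of \<theta>] by (simp add: scalar_mult_eq_scaleR)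
    then show ?thesis by (simp add: D.sum D.scaleR)
  qed
  ultimately show ?thesis using ray[of \<xi> t \<theta> S] by simp
qed

lemma continuously_differentiable_continuous:
  "continuously_differentiable f \<Longrightarrow> continuous_on UNIV f"
  by (simp add: continuously_differentiable_def continuous_at_imp_continuous_on differentiable_imp_continuous_within)

lemma continuous_on_partial_ray:
  assumes "continuously_differentiable f"
  shows "continuous_on S (\<lambda>s. partial i f (\<xi> + s *\<^sub>R \<theta>))"
proof (rule continuous_on_compose2[of UNIV "partial i f"])
  show "continuous_on UNIV (partial i f)" using assms by (simp add: continuously_differentiable_def)
qed (auto intro!: continuous_intros)

lemma sets_target: "sets (target U) = sets state_space"
  unfolding target_def state_space_def gibbs_measure_def
  by (intro sets_pair_measure_cong) (simp_all add: sets_uniform_count_measure)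

context subsampled_zigzag
begin

text \<open>Since the positive parts of \<open>x\<close> and \<open>- x\<close> differ by
  \<open>x\<close>, the difference of the rates for \<open>\<theta>\<close> and
  \<open>- \<theta>\<close> is the directional derivative, whose integral along the ray is the
  increment of the potential.\<close>

lemma balanced_zigzag_rates_effective:
  assumes smooth: "continuously_differentiable U0" "continuously_differentiable Ul"
    and unbiased: "\<And>i \<xi>. (LINT a|\<mu> i. g i \<xi> a) = partial i Ul \<xi>"
  shows "balanced_zigzag_rates effective_rate (\<lambda>\<xi>. U0 \<xi> + Ul \<xi>)"
proof (intro balanced_zigzag_rates.intro balanced_zigzag_rates_axioms.intro zigzag_rates_effective)
  interpret R: zigzag_rates effective_rate by (rule zigzag_rates_effective)
  show "(\<lambda>\<xi>. U0 \<xi> + Ul \<xi>) \<in> borel_measurable borel"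
    using smooth by (intro borel_measurable_add borel_measurable_continuous_onI continuously_differentiable_continuous)
  show "effective_rate i \<xi> \<theta> = effective_rate i \<xi> \<theta>'" if "\<theta> $ i = \<theta>' $ i" for i \<xi> \<theta> \<theta>'
    using that by (simp add: rate_prior_def rate_lik_def)
  fix \<xi> \<theta> :: "real^'p" and t :: real assume \<theta>: "\<theta> \<in> velocities" and t: "0 \<le> t"
  let ?d = "\<lambda>s. (\<Sum>i\<in>UNIV. \<theta> $ i * partial i U0 (\<xi> + s *\<^sub>R \<theta>)) + (\<Sum>i\<in>UNIV. \<theta> $ i * partial i Ul (\<xi> + s *\<^sub>R \<theta>))"
  let ?forward = "\<lambda>s. R.bounce_rate (\<xi> + s *\<^sub>R \<theta>) \<theta>" and ?backward = "\<lambda>s. R.bounce_rate (\<xi> + s *\<^sub>R \<theta>) (- \<theta>)"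
  have prior: "rate_prior U0 k \<eta> \<theta> - rate_prior U0 k \<eta> (- \<theta>) = \<theta> $ k * partial k U0 \<eta>" for k \<eta>
    by (simp add: rate_prior_def max_def)
  \<comment> \<open>The expected positive parts are nonlinear in the estimator, but their difference
    is linear, and so unbiasedness is exactly what determines it.\<close>
  have lik: "rate_lik \<mu> g k \<eta> \<theta> - rate_lik \<mu> g k \<eta> (- \<theta>) = \<theta> $ k * partial k Ul \<eta>" for k \<eta>
  proof -
    have "rate_lik \<mu> g k \<eta> \<theta> - rate_lik \<mu> g k \<eta> (- \<theta>) =
        (LINT a|\<mu> k. max 0 (\<theta> $ k * g k \<eta> a) - max 0 ((- \<theta>) $ k * g k \<eta> a))"
      unfolding rate_lik_def using estimator_integrable[of k \<eta>]
      by (intro Bochner_Integration.integral_diff[symmetric]) simp_all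
    also have "\<dots> = (LINT a|\<mu> k. \<theta> $ k * g k \<eta> a)"
      by (intro Bochner_Integration.integral_cong) (auto simp: max_def)
    finally show ?thesis by (simp add: unbiased)
  qed
  have net: "?backward s = ?forward s - ?d s" for s
  proof -
    have "?forward s - ?backward s = ?d s"
      unfolding R.bounce_rate_def sum_subtractf[symmetric] sum.distrib[symmetric]
      using prior lik by (intro sum.cong) (simp_all add: algebra_simps flip: prior lik)
    then show ?thesis by simp
  qed
  have continuous: "continuous_on {0..t} ?d"
    using smooth by (intro continuous_intros continuous_on_partial_ray)
  note integrable = hazard.rate_integrable[OF R.hazard_bounce_rate[OF \<theta>, of \<xi>] t] borel_integrable_atLeastAtMost'[OF continuous]
  \<comment> \<open>The reflection \<open>s \<mapsto> t - s\<close> turns the backward ray from the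
    endpoint into the forward ray, traversed with the opposite velocity.\<close>
  have "cumulative (\<lambda>s. R.bounce_rate (\<xi> + t *\<^sub>R \<theta> + s *\<^sub>R (- \<theta>)) (- \<theta>)) t = cumulative ?backward t"
  proof -
    have "cumulative ?backward t = (LINT s|lborel. indicator {0..t} (t + (- 1) * s) *\<^sub>R ?backward (t + (- 1) * s))"
      unfolding cumulative_def set_lebesgue_integral_def
      by (subst lborel_integral_real_affine[where c="- 1" and t=t]) simp_all
    also have "\<dots> = cumulative (\<lambda>s. R.bounce_rate (\<xi> + t *\<^sub>R \<theta> + s *\<^sub>R (- \<theta>)) (- \<theta>)) t"
      unfolding cumulative_def set_lebesgue_integral_def
    proof (intro Bochner_Integration.integral_cong refl)
      fix s
      have "indicator {0..t} (t + (- 1) * s) = (indicator {0..t} s :: real)" by (auto simp: indicator_def)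
      moreover have "\<xi> + (t + (- 1) * s) *\<^sub>R \<theta> = \<xi> + t *\<^sub>R \<theta> + s *\<^sub>R (- \<theta>)" by (simp add: algebra_simps)
      ultimately show "indicator {0..t} (t + (- 1) * s) *\<^sub>R ?backward (t + (- 1) * s) =
          indicator {0..t} s *\<^sub>R R.bounce_rate (\<xi> + t *\<^sub>R \<theta> + s *\<^sub>R (- \<theta>)) (- \<theta>)"
        by (simp only:)
    qed
    finally show ?thesis by simp
  qed
  also have "\<dots> = cumulative ?forward t - (LINT s:{0..t}|lborel. ?d s)"
    unfolding cumulative_def net by (rule set_integral_diff(2)[OF integrable])
  also have "(LINT s:{0..t}|lborel. ?d s) = (U0 (\<xi> + t *\<^sub>R \<theta>) + Ul (\<xi> + t *\<^sub>R \<theta>)) - (U0 (\<xi> + 0 *\<^sub>R \<theta>) + Ul (\<xi> + 0 *\<^sub>R \<theta>))"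
    unfolding set_lebesgue_integral_def using t continuous
    by (intro integral_FTC_Icc has_vector_derivative_add continuously_differentiable_ray smooth)
  finally show "U0 (\<xi> + t *\<^sub>R \<theta>) + Ul (\<xi> + t *\<^sub>R \<theta>) + cumulative (\<lambda>s. R.bounce_rate (\<xi> + t *\<^sub>R \<theta> + s *\<^sub>R (- \<theta>)) (- \<theta>)) t =
      U0 \<xi> + Ul \<xi> + cumulative ?forward t"
    by simp
qed

end

context balanced_zigzag_rates
begin

text \<open>One constant, independent of \<open>f\<close>, collects the posterior normalisation and
  the number of velocities. Only its independence of \<open>f\<close> matters for
  invariance.\<close>

lemma nn_integral_target:
  "\<exists>c. \<forall>f. state_function f \<longrightarrow> (\<integral>\<^sup>+x. f (fst x) (snd x) \<partial>target U) = c * pairing (\<lambda>_ _. 1) f"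
proof (intro exI allI impI)
  fix f :: "real^'p \<Rightarrow> real^'p \<Rightarrow> ennreal" assume f: "state_function f"
  let ?V = "velocities :: (real^'p) set"
  let ?Z = "LINT \<zeta>|lborel. exp (- U \<zeta>)"
  let ?n = "ennreal (1 / card ?V)"
  have "(\<chi> i. 1) \<in> ?V" by (simp add: velocities_def)
  then interpret V: prob_space "uniform_count_measure ?V"
    by (intro prob_space_uniform_count_measure finite_velocities) auto
  have Z: "0 \<le> ?Z" by (intro Bochner_Integration.integral_nonneg) simp
  have "(\<lambda>x. f (fst x) (snd x)) \<in> borel_measurable (target U)"
    using state_function_measurable[OF f] by (simp add: measurable_cong_sets[OF sets_target refl])
  then have "(\<integral>\<^sup>+x. f (fst x) (snd x) \<partial>target U) = (\<integral>\<^sup>+\<xi>. \<integral>\<^sup>+\<theta>. f \<xi> \<theta> \<partial>uniform_count_measure ?V \<partial>gibbs_measure U)"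
    unfolding target_def by (subst V.nn_integral_fst[symmetric]) simp_all
  also have "\<dots> = (\<integral>\<^sup>+\<xi>. (\<Sum>\<theta>\<in>?V. ?n * f \<xi> \<theta>) \<partial>gibbs_measure U)"
    by (simp add: uniform_count_measure_def nn_integral_point_measure_finite finite_velocities)
  also have "\<dots> = (\<integral>\<^sup>+\<xi>. ennreal (exp (- U \<xi>) / ?Z) * (\<Sum>\<theta>\<in>?V. ?n * f \<xi> \<theta>) \<partial>lborel)"
    unfolding gibbs_measure_def using f measurable_U
    by (intro nn_integral_density) (auto simp: state_function_def intro!: borel_measurable_sum)
  also have "\<dots> = (\<integral>\<^sup>+\<xi>. (\<Sum>\<theta>\<in>?V. ennreal (1 / ?Z) * ?n * (ennreal (exp (- U \<xi>)) * f \<xi> \<theta>)) \<partial>lborel)"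
    using Z
    by (intro nn_integral_cong)
      (simp add: sum_distrib_left divide_inverse mult_ac ennreal_mult)
  also have "\<dots> = (\<Sum>\<theta>\<in>?V. \<integral>\<^sup>+\<xi>. ennreal (1 / ?Z) * ?n * (ennreal (exp (- U \<xi>)) * f \<xi> \<theta>) \<partial>lborel)"
    using f measurable_weight
    by (intro nn_integral_sum) (auto simp: state_function_def)
  also have "\<dots> = ennreal (1 / ?Z) * ?n * pairing (\<lambda>_ _. 1) f"
    unfolding pairing_def sum_distrib_left using f measurable_weight
    by (intro sum.cong refl, subst nn_integral_cmult) (auto simp: state_function_def)
  \<comment> \<open>The existential witness, left schematic so far, is instantiated here.\<close>
  finally show "(\<integral>\<^sup>+x. f (fst x) (snd x) \<partial>target U) = ennreal (1 / ?Z) * ?n * pairing (\<lambda>_ _. 1) f" .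
qed

end

theorem proposition2:
  fixes p0 :: "real^'p::finite \<Rightarrow> real"
    and lik :: "'y \<Rightarrow> 'x \<Rightarrow> real^'p \<Rightarrow> real"
    and n :: nat and y :: "nat \<Rightarrow> 'y" and x :: "nat \<Rightarrow> 'x"
    and U0 Ul U :: "real^'p \<Rightarrow> real"
    and \<mu> :: "'p \<Rightarrow> 'a measure"
    and g :: "'p \<Rightarrow> real^'p \<Rightarrow> 'a \<Rightarrow> real"
    and M0 Ml :: "'p \<Rightarrow> real^'p \<Rightarrow> real^'p \<Rightarrow> real \<Rightarrow> real"
    and thin :: bool
    and \<Omega> :: "'w measure"
    and Y :: "nat \<Rightarrow> 'w \<Rightarrow> 'p skeleton_point"
  defines "U0 \<equiv> prior_potential p0"
    and "Ul \<equiv> likelihood_potential lik n y x"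
    and "U \<equiv> (\<lambda>\<xi>. U0 \<xi> + Ul \<xi>)"
  assumes prior_density: "\<And>\<xi>. p0 \<xi> > 0" "(\<integral>\<^sup>+\<xi>. ennreal (p0 \<xi>) \<partial>lborel) = 1"
    and likelihood_pos: "\<And>j \<xi>. j \<in> {1..n} \<Longrightarrow> lik (y j) (x j) \<xi> > 0"
    and smooth: "continuously_differentiable U0" "continuously_differentiable Ul"
    and proper_posterior: "integrable lborel (\<lambda>\<xi>. exp (- U \<xi>))"
    and estimator_prob: "\<And>i. prob_space (\<mu> i)"
    and estimator_measurable:
      "\<And>i. (\<lambda>(\<xi>, a). g i \<xi> a) \<in> borel_measurable (borel \<Otimes>\<^sub>M \<mu> i)"
    and estimator_unbiased:
      "\<And>i \<xi>. integrable (\<mu> i) (g i \<xi>)"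
      "\<And>i \<xi>. (LINT a|\<mu> i. g i \<xi> a) = partial i Ul \<xi>"
    and bound_lik: "admissible_bound Ml"
      "\<And>i \<xi> \<theta> t a. \<theta> \<in> velocities \<Longrightarrow> 0 \<le> t \<Longrightarrow> a \<in> space (\<mu> i) \<Longrightarrow>
         m_lik g i \<xi> \<theta> t a \<le> Ml i \<xi> \<theta> t"
    and bound_prior: "admissible_bound M0"
      "\<And>i \<xi> \<theta> t. \<theta> \<in> velocities \<Longrightarrow> 0 \<le> t \<Longrightarrow> m_prior U0 i \<xi> \<theta> t \<le> M0 i \<xi> \<theta> t"
    and prior_step: "thin \<or>
      (\<forall>i \<xi>. \<forall>\<theta>\<in>velocities. \<forall>t\<ge>0. M0 i \<xi> \<theta> t = m_prior U0 i \<xi> \<theta> t)"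
    and run: "markov_chain \<Omega> skeleton_space (attempt thin U0 M0 \<mu> g Ml) Y"
      "AE \<omega> in \<Omega>. fst (Y 0 \<omega>) = 0"
    and nonexplosive: "AE \<omega> in \<Omega>. (SUP k. fst (Y k \<omega>)) = \<infinity>"
  shows "zigzag_process \<Omega> (\<lambda>i \<xi> \<theta>. rate_prior U0 i \<xi> \<theta> + rate_lik \<mu> g i \<xi> \<theta>)
           (\<lambda>t \<omega>. skeleton_path (\<lambda>k. Y k \<omega>) t)
    \<and> (distr \<Omega> state_space (\<lambda>\<omega>. snd (Y 0 \<omega>)) = target U \<longrightarrow>
        (\<forall>t\<ge>0. distr \<Omega> state_space (\<lambda>\<omega>. skeleton_path (\<lambda>k. Y k \<omega>) t) = target U))"
proof -
  let ?rate = "\<lambda>i \<xi> \<theta>. rate_prior U0 i \<xi> \<theta> + rate_lik \<mu> g i \<xi> \<theta>"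
  have "subsampled_zigzag U0 \<mu> g M0 Ml thin"
    using smooth(1)
    by (intro subsampled_zigzag.intro estimator_prob estimator_measurable estimator_unbiased(1) bound_lik bound_prior prior_step)
      (simp_all add: continuously_differentiable_def borel_measurable_continuous_onI)
  then interpret S: subsampled_zigzag U0 \<mu> g M0 Ml thin .
  interpret R: balanced_zigzag_rates ?rate U
    unfolding U_def by (rule S.balanced_zigzag_rates_effective[OF smooth estimator_unbiased(2)])
  interpret C: thinned_chain ?rate "\<lambda>\<xi> \<theta> s. \<Sum>i\<in>UNIV. Ml i \<xi> \<theta> s + M0 i \<xi> \<theta> s" "attempt thin U0 M0 \<mu> g Ml" \<Omega> Y
    by (intro thinned_chain.intro thinned_chain_axioms.intro S.thinned_kernel_attempt run nonexplosive)
  \<comment> \<open>The invariance argument is applied to the chain of bounces, whose kernel is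
    explicit in the effective rates, and not to the attempts; both trace the same path.\<close>
  have bounces: "thinned_chain ?rate (\<lambda>\<xi> \<theta> s. R.bounce_rate (\<xi> + s *\<^sub>R \<theta>) \<theta>) (zigzag_step ?rate) \<Omega> C.Z"
    using C.AE_Z_path
    by (intro thinned_chain.intro thinned_chain_axioms.intro R.thinned_kernel_zigzag_step C.markov_chain_Z)
      (auto elim: eventually_mono)
  have path: "(\<lambda>\<omega>. skeleton_path (\<lambda>k. Y k \<omega>) t) \<in> measurable \<Omega> state_space" for t
    by (rule measurable_skeleton_path[OF C.measurable_Y])
  show ?thesis
  proof (intro conjI impI allI C.zigzag_process_path)
    fix t :: real
    assume law: "distr \<Omega> state_space (\<lambda>\<omega>. snd (Y 0 \<omega>)) = target U" and t: "0 \<le> t"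
    obtain c where c: "\<And>f. R.state_function f \<Longrightarrow> (\<integral>\<^sup>+x. f (fst x) (snd x) \<partial>target U) = c * R.pairing (\<lambda>_ _. 1) f"
      using R.nn_integral_target by blast
    \<comment> \<open>The chain of bounces starts at the initial point of the run, as
      \<open>Z 0 = Y 0\<close>.\<close>
    have init: "(\<integral>\<^sup>+\<omega>. f (fst (snd (C.Z 0 \<omega>))) (snd (snd (C.Z 0 \<omega>))) \<partial>\<Omega>) = c * R.pairing (\<lambda>_ _. 1) f"
      if f: "R.state_function f" for f
    proof -
      have "(\<integral>\<^sup>+\<omega>. f (fst (snd (C.Z 0 \<omega>))) (snd (snd (C.Z 0 \<omega>))) \<partial>\<Omega>) =
          (\<integral>\<^sup>+x. f (fst x) (snd x) \<partial>distr \<Omega> state_space (\<lambda>\<omega>. snd (Y 0 \<omega>)))"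
        using measurable_compose[OF C.measurable_Y measurable_skeleton_state] R.state_function_measurable[OF f]
        by (subst nn_integral_distr) (simp_all add: C.Z_def)
      then show ?thesis unfolding law by (simp only: c[OF f])
    qed
    show "distr \<Omega> state_space (\<lambda>\<omega>. skeleton_path (\<lambda>k. Y k \<omega>) t) = target U"
    proof (rule measure_eqI)
      show "sets (distr \<Omega> state_space (\<lambda>\<omega>. skeleton_path (\<lambda>k. Y k \<omega>) t)) = sets (target U)"
        by (simp add: sets_target)
      fix A assume "A \<in> sets (distr \<Omega> state_space (\<lambda>\<omega>. skeleton_path (\<lambda>k. Y k \<omega>) t))"
      then have A: "A \<in> sets state_space" by simp
      define f where "f \<xi> \<theta> = (indicator A (\<xi>, \<theta>) :: ennreal)" for \<xi> \<theta>
      have f: "R.state_function f"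
        unfolding R.state_function_def f_def
      proof
        fix \<theta> :: "real^'p" assume "\<theta> \<in> velocities"
        then have "(\<lambda>\<xi>. (\<xi>, \<theta>)) \<in> measurable borel state_space"
          unfolding state_space_def by (intro measurable_Pair2') simp
        from measurable_compose[OF this borel_measurable_indicator[OF A]]
        show "(\<lambda>\<xi>. indicator A (\<xi>, \<theta>) :: ennreal) \<in> borel_measurable borel" .
      qed
      have "emeasure (distr \<Omega> state_space (\<lambda>\<omega>. skeleton_path (\<lambda>k. Y k \<omega>) t)) A =
          (\<integral>\<^sup>+x. indicator A x \<partial>distr \<Omega> state_space (\<lambda>\<omega>. skeleton_path (\<lambda>k. Y k \<omega>) t))"
        using A by simp
      also have "\<dots> = (\<integral>\<^sup>+\<omega>. indicator A (skeleton_path (\<lambda>k. Y k \<omega>) t) \<partial>\<Omega>)"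
        by (rule nn_integral_distr[OF path]) (simp add: A borel_measurable_indicator)
      also have "\<dots> = (\<integral>\<^sup>+\<omega>. (\<lambda>x. f (fst x) (snd x)) (skeleton_path (\<lambda>k. C.Z k \<omega>) t) \<partial>\<Omega>)"
        by (rule nn_integral_cong_AE) (use C.AE_Z_path t in \<open>auto simp: f_def elim: eventually_mono\<close>)
      also have "\<dots> = c * R.pairing (\<lambda>_ _. 1) f"
        by (rule R.nn_integral_path_invariant[OF bounces init f t])
      also have "\<dots> = (\<integral>\<^sup>+x. f (fst x) (snd x) \<partial>target U)" by (rule c[OF f, symmetric])
      also have "\<dots> = emeasure (target U) A" using A by (simp add: f_def sets_target)
      finally show "emeasure (distr \<Omega> state_space (\<lambda>\<omega>. skeleton_path (\<lambda>k. Y k \<omega>) t)) A = emeasure (target U) A" .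
    qed
  qed
qed

end
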